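(* Let $n$ be a positive integer, $w=\mathrm{polylog}(n)$, $d$ a constant, and let $S$ be a set of $n$ points in $[2^{w}]^d$. For any choice of a constant $0<\alpha<1$, one can construct in $\tilde{O}(n^d)$ time with high probability a data structure using $\tilde{O}(n^{d-\alpha/4})$ words of space which answers the following queries in $\tilde{O}(n^{\alpha})$ time: given an integer $k$ and $d$ boxes $B_1,\dots,B_d$, return the hyperplane with the $k$th largest distance to the origin among all hyperplanes spanned by $d$ points of $S$ lying in $B_1\times B_2\times\cdots\times B_d$.
   Context: $[M]$ denotes $\{0,1,\dots,M-1\}$. The notation $\tilde{O}(\cdot)$ omits factors polylogarithmic in $n$. A "box" is an axis-aligned $d$-dimensional box. Space is measured in machine words (word RAM model).
   Formalization: For d = 1 the stated space bound is impossible, since queries recover all n points of S; there, and only there, n further words (holding the points) are allowed beyond the Õ(n^{d-α/4}) words of space. For d ≥ 2 the bound is as stated. *)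

theory Defs
  imports
    "HOL-Probability.Probability"
    "HOL-Library.Landau_Symbols"
    "HOL-Library.Log_Nat"
begin

definition polylog :: "(nat \<Rightarrow> nat) \<Rightarrow> bool" where
  "polylog f \<longleftrightarrow> (\<exists>a::nat. (\<lambda>n. real (f n)) \<in> O(\<lambda>n. ln (real n) ^ a))"

definition soft_O :: "(nat \<Rightarrow> real) \<Rightarrow> (nat \<Rightarrow> nat) set" where
  "soft_O g = {f. \<exists>a::nat. (\<lambda>n. real (f n)) \<in> O(\<lambda>n. g n * ln (real n) ^ a)}"

text \<open>
  A program is a finite list of instructions. It works on finitely many registers (those named in
  the program) and on a memory of words addressed by words. A word is a number below \<open>2 ^ W\<close>,
  where \<open>W\<close> is the word size in bits; each instruction takes unit time.
\<close>

datatype binop = Add | Sub | Mul | Div | Mod | And | Or | Xor | Shl | Shr | Less | Eq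

datatype instr =
    Const nat nat             \<comment> \<open>target register, value\<close>
  | Bin binop nat nat nat     \<comment> \<open>target register, operand registers\<close>
  | Load nat nat              \<comment> \<open>target register, register holding the address\<close>
  | Store nat nat             \<comment> \<open>register holding the address, source register\<close>
  | Rand nat                  \<comment> \<open>target register, receives a uniformly random word\<close>
  | JumpIfZero nat nat        \<comment> \<open>tested register, position in the program\<close>

record config =
  pc :: nat
  reg :: "nat \<Rightarrow> nat"
  mem :: "nat \<Rightarrow> nat"

text \<open>\<open>x div 0 = 0\<close> and \<open>x mod 0 = x\<close>; truth values are the words 0 and 1.\<close>

fun binop_val :: "nat \<Rightarrow> binop \<Rightarrow> nat \<Rightarrow> nat \<Rightarrow> nat" where
  "binop_val W Add x y = (x + y) mod 2 ^ W"
| "binop_val W Sub x y = (x + 2 ^ W - y) mod 2 ^ W"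
| "binop_val W Mul x y = (x * y) mod 2 ^ W"
| "binop_val W Div x y = x div y"
| "binop_val W Mod x y = x mod y"
| "binop_val W And x y = semiring_bit_operations_class.and x y"
| "binop_val W Or x y = semiring_bit_operations_class.or x y"
| "binop_val W Xor x y = semiring_bit_operations_class.xor x y"
| "binop_val W Shl x y = push_bit y x mod 2 ^ W"
| "binop_val W Shr x y = drop_bit y x"
| "binop_val W Less x y = of_bool (x < y)"
| "binop_val W Eq x y = of_bool (x = y)"

definition set_reg :: "nat \<Rightarrow> nat \<Rightarrow> config \<Rightarrow> config" where
  "set_reg r v c = c\<lparr>pc := Suc (pc c), reg := (reg c)(r := v)\<rparr>"

fun exec :: "nat \<Rightarrow> instr \<Rightarrow> config \<Rightarrow> config pmf" where
  "exec W (Const r v) c = return_pmf (set_reg r (v mod 2 ^ W) c)"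
| "exec W (Bin f r s t) c = return_pmf (set_reg r (binop_val W f (reg c s) (reg c t)) c)"
| "exec W (Load r s) c = return_pmf (set_reg r (mem c (reg c s)) c)"
| "exec W (Store r s) c =
     return_pmf (c\<lparr>pc := Suc (pc c), mem := (mem c)(reg c r := reg c s)\<rparr>)"
| "exec W (Rand r) c = map_pmf (\<lambda>v. set_reg r v c) (pmf_of_set {..<2 ^ W})"
| "exec W (JumpIfZero r l) c =
     return_pmf (c\<lparr>pc := (if reg c r = 0 then l else Suc (pc c))\<rparr>)"

text \<open>A computation halts when the program counter leaves the program.\<close>

definition halted :: "instr list \<Rightarrow> config \<Rightarrow> bool" where
  "halted P c \<longleftrightarrow> length P \<le> pc c"

definition step :: "nat \<Rightarrow> instr list \<Rightarrow> config \<Rightarrow> config pmf" where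
  "step W P c = (if halted P c then return_pmf c else exec W (P ! pc c) c)"

text \<open>The distribution of the configuration after \<open>t\<close> steps (halted configurations persist).\<close>

fun run :: "nat \<Rightarrow> instr list \<Rightarrow> nat \<Rightarrow> config \<Rightarrow> config pmf" where
  "run W P 0 c = return_pmf c"
| "run W P (Suc t) c = bind_pmf (step W P c) (run W P t)"

definition init :: "nat list \<Rightarrow> config" where
  "init xs = \<lparr>pc = 0, reg = (\<lambda>_. 0), mem = (\<lambda>a. if a < length xs then xs ! a else 0)\<rparr>"

definition mem_block :: "nat \<Rightarrow> config \<Rightarrow> nat list" where
  "mem_block s c = map (mem c) [0..<s]"

text \<open>
  The dimension is \<open>d = CARD('d)\<close>. The type \<open>'d\<close> indexes coordinates, and also the members of a
  \<open>d\<close>-tuple of points or boxes; its linear order only serves to lay out vectors in memory.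
\<close>

definition grid :: "nat \<Rightarrow> (nat ^ 'd) set" where
  "grid M = {p. \<forall>i. p $ i \<in> {..<M}}"

definition real_point :: "nat ^ 'd \<Rightarrow> real ^ 'd" where
  "real_point p = (\<chi> i. real (p $ i))"

text \<open>
  A box is given by its two extreme corners, which may be taken on the grid as only the grid points
  inside matter. If the corners are in the wrong order in some coordinate, the box is empty.
\<close>

type_synonym 'd boxes = "'d \<Rightarrow> (nat ^ 'd) \<times> (nat ^ 'd)"

definition box_set :: "(nat ^ 'd) \<times> (nat ^ 'd) \<Rightarrow> (real ^ 'd::finite) set" where
  "box_set b = cbox (real_point (fst b)) (real_point (snd b))"

definition flat :: "('d \<Rightarrow> nat ^ 'd) \<Rightarrow> (real ^ 'd::finite) set" where
  "flat p = affine hull (range (\<lambda>i. real_point (p i)))"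

definition spans_hyperplane :: "('d \<Rightarrow> nat ^ 'd::finite) \<Rightarrow> bool" where
  "spans_hyperplane p \<longleftrightarrow> aff_dim (flat p) = int CARD('d) - 1"

definition spanning_tuples ::
    "(nat ^ 'd::finite) set \<Rightarrow> 'd boxes \<Rightarrow> ('d \<Rightarrow> nat ^ 'd) set" where
  "spanning_tuples S B =
     {p. (\<forall>i. p i \<in> S \<and> real_point (p i) \<in> box_set (B i)) \<and> spans_hyperplane p}"

definition origin_dist :: "('d \<Rightarrow> nat ^ 'd::finite) \<Rightarrow> real" where
  "origin_dist p = infdist 0 (flat p)"

text \<open>
  \<open>x\<close> is at position \<open>k\<close> (counting from 1) in some ordering of the finite set \<open>A\<close> by
  non-increasing \<open>f\<close>: ties may be broken arbitrarily.
\<close>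

definition kth_largest :: "('a \<Rightarrow> real) \<Rightarrow> 'a set \<Rightarrow> nat \<Rightarrow> 'a \<Rightarrow> bool" where
  "kth_largest f A k x \<longleftrightarrow>
     x \<in> A \<and> card {y \<in> A. f y > f x} < k \<and> k \<le> card {y \<in> A. f y \<ge> f x}"

text \<open>
  Hyperplanes are counted once for each tuple in \<open>B\<^sub>1 \<times> \<dots> \<times> B\<^sub>d\<close> that spans them.
\<close>

definition kth_hyperplane ::
    "(nat ^ 'd::finite) set \<Rightarrow> 'd boxes \<Rightarrow> nat \<Rightarrow> (real ^ 'd) set \<Rightarrow> bool" where
  "kth_hyperplane S B k H \<longleftrightarrow>
     (\<exists>p. kth_largest origin_dist (spanning_tuples S B) k p \<and> H = flat p)"

definition indices :: "'d::{finite,linorder} list" where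
  "indices = sorted_list_of_set UNIV"

definition enc_point :: "nat ^ 'd::{finite,linorder} \<Rightarrow> nat list" where
  "enc_point p = map (\<lambda>i. p $ i) indices"

text \<open>A hyperplane is represented by any \<open>d\<close> grid points that span it.\<close>

definition enc_tuple :: "('d \<Rightarrow> nat ^ 'd::{finite,linorder}) \<Rightarrow> nat list" where
  "enc_tuple p = concat (map (\<lambda>i. enc_point (p i)) indices)"

definition enc_query :: "nat \<Rightarrow> 'd::{finite,linorder} boxes \<Rightarrow> nat list" where
  "enc_query k B =
     k # concat (map (\<lambda>i. enc_point (fst (B i)) @ enc_point (snd (B i))) indices)"

text \<open>
  The construction gets \<open>n\<close>, the coordinate length \<open>w\<close> and the points, in arbitrary order. The
  trade-off parameter \<open>\<alpha>\<close> is an arbitrary real, possibly not computable, so the algorithm receives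
  it through the word \<open>\<lfloor>n powr \<alpha>\<rfloor>\<close>.
\<close>

definition enc_input :: "real \<Rightarrow> nat \<Rightarrow> (nat ^ 'd::{finite,linorder}) list \<Rightarrow> nat list" where
  "enc_input \<alpha> w ps =
     [length ps, w, nat \<lfloor>real (length ps) powr \<alpha>\<rfloor>] @ concat (map enc_point ps)"

text \<open>
  \<open>ds\<close> is the data structure. The memory of the query program initially holds only the query and
  \<open>ds\<close>. The quantification over \<open>set_pmf\<close> means that query time and correctness never depend on
  chance. If there are fewer than \<open>k\<close> hyperplanes, or \<open>k = 0\<close>, the program only has to halt in time.
\<close>

definition answers_queries ::
    "nat \<Rightarrow> instr list \<Rightarrow> nat \<Rightarrow> nat \<Rightarrow> (nat ^ 'd::{finite,linorder}) set \<Rightarrow> nat list \<Rightarrow> bool" where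
  "answers_queries W query t w S ds \<longleftrightarrow>
     (\<forall>k < 2 ^ W. \<forall>B :: 'd boxes. (\<forall>i. fst (B i) \<in> grid (2 ^ w) \<and> snd (B i) \<in> grid (2 ^ w)) \<longrightarrow>
       (\<forall>c \<in> set_pmf (run W query t (init (enc_query k B @ ds))).
          halted query c \<and>
          (k \<in> {1..card (spanning_tuples S B)} \<longrightarrow>
            (\<exists>q :: 'd \<Rightarrow> nat ^ 'd::{finite,linorder}. mem_block (CARD('d) * CARD('d)) c = enc_tuple q \<and>
               kth_hyperplane S B k (flat q)))))"

text \<open>
  In dimension 1 a space bound of \<open>n powr (1 - \<alpha> / 4)\<close> is below what is needed to store the points
  themselves, which can be recovered from the queries. There, and only there, the words holding
  the points are not charged.
\<close>

definition free_words :: "nat \<Rightarrow> nat \<Rightarrow> nat" where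
  "free_words d n = (if d = 1 then n else 0)"

end

(*
  Every interval of grid coordinates is a disjoint union of few dyadic nodes. Give each d-tuple of
  points one key for every choice of a dyadic level in each of its d * d coordinates: the nodes at
  these levels, followed by the rank of the distance between the origin and the spanned hyperplane.
  Boxes then correspond to polylogarithmically many intervals of the sorted sequence of keys, and a
  query is a binary search over ranks that counts keys in these intervals.

  The sorted sequence, of length N = n^d up to polylogarithmic factors, is not stored. With
  t = n^(alpha/4) it is cut into N / t buckets of t consecutive keys, of which only the first keys
  are kept. Elements of a bucket are recovered by inverting the function from tuples to bucket
  numbers with rainbow tables: chains of t steps that alternate this function with random
  multiply-shift hash functions, N / (4 t^2) chains per table, of which only the ends are stored.
  By a second moment bound, one table covers a given tuple with probability at least 1 / (8 t), so
  about t log n tables cover all tuples with high probability. One inversion step tries about t^2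
  columns with chains of t steps, and an access enumerates up to t keys of a bucket in increasing
  order, which makes t^4 = n^alpha up to polylogarithmic factors.
*)
theory Submission
  imports Defs
begin

section \<open>A loop language on top of the machine\<close>

text \<open>The function to be inverted is not injective: a bucket has t preimages and an access
  needs all of them. Hence coverage is demanded of every tuple code, not of every bucket. The fibre
  bound t also fixes the number M of chains: a table meets a given code with probability about M t /
  N, a chain merges with another one with probability at most M t t / N, and
  \<open>4 * M * t * t = N\<close> keeps the losses below half of the gain. A failed lookup does no
  harm, because every candidate is tested against the bucket asked for.

  Chance enters only through the seeds of the hash functions. A union bound over all codes shows
  that usually everything is covered, and then a deterministic program answers every query
  correctly.

  Distances may be irrational, so they are replaced by integer ranks; this works because squared
  distances are fractions with small denominators. The code of the tuple is appended to the rank,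
  which breaks ties and lets the answer be read off the key.

  All sizes are powers of two, as multiply-shift hashing requires; the rounding costs constant
  factors.\<close>

abbreviation cfg :: "nat \<Rightarrow> (nat \<Rightarrow> nat) \<Rightarrow> (nat \<Rightarrow> nat) \<Rightarrow> config" where
  "cfg k r m \<equiv> \<lparr>pc = k, reg = r, mem = m\<rparr>"

datatype exp =
    Num nat
  | Par nat
  | Var nat
  | Op binop exp exp
  | Read exp
  | Bind nat exp exp
  | Cond exp exp exp
  | Iter nat nat nat exp exp

primrec itr :: "nat \<Rightarrow> (nat \<Rightarrow> 'a \<Rightarrow> 'a) \<Rightarrow> 'a \<Rightarrow> 'a" where
  "itr 0 f a = a"
| "itr (Suc n) f a = f n (itr n f a)"

text \<open>
  \<open>Iter k x i a b\<close> is a bounded loop: starting from the value of \<open>a\<close>, the accumulator \<open>x\<close> is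
  replaced by the value of \<open>b\<close> while the index \<open>i\<close> runs from 0 up to the value of the parameter
  \<open>k\<close>. As loop bounds are parameters and both branches of a conditional are executed, the running
  time is an explicit function of the parameters alone.
\<close>

primrec eval :: "nat \<Rightarrow> (nat \<Rightarrow> nat) \<Rightarrow> (nat \<Rightarrow> nat) \<Rightarrow> exp \<Rightarrow> (nat \<Rightarrow> nat) \<Rightarrow> nat" where
  "eval W p m (Num c) v = c mod 2 ^ W"
| "eval W p m (Par k) v = p k"
| "eval W p m (Var x) v = v x"
| "eval W p m (Op f a b) v = binop_val W f (eval W p m a v) (eval W p m b v)"
| "eval W p m (Read a) v = m (eval W p m a v)"
| "eval W p m (Bind x a b) v = eval W p m b (v(x := eval W p m a v))"
| "eval W p m (Cond c a b) v =
     (if eval W p m c v \<noteq> 0 then eval W p m a v else eval W p m b v) mod 2 ^ W"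
| "eval W p m (Iter k x i a b) v =
     itr (p k) (\<lambda>j y. eval W p m b (v(x := y, i := j))) (eval W p m a v)"

datatype com =
    Write exp exp
  | Seq com com
  | Local nat exp com
  | For nat nat com

primrec sem :: "nat \<Rightarrow> (nat \<Rightarrow> nat) \<Rightarrow> com \<Rightarrow> (nat \<Rightarrow> nat) \<Rightarrow> (nat \<Rightarrow> nat) \<Rightarrow> (nat \<Rightarrow> nat)" where
  "sem W p (Write a b) v m = m(eval W p m a v := eval W p m b v)"
| "sem W p (Seq c1 c2) v m = sem W p c2 v (sem W p c1 v m)"
| "sem W p (Local x a c) v m = sem W p c (v(x := eval W p m a v)) m"
| "sem W p (For k i c) v m = itr (p k) (\<lambda>j. sem W p c (v(i := j))) m"

text \<open>
  The parameters live in the registers below 40, register 40 always holds 0, and the registers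
  above serve as an evaluation stack.
\<close>

abbreviation (input) mov :: "nat \<Rightarrow> nat \<Rightarrow> instr" where
  "mov s r \<equiv> Bin And s r r"

text \<open>The code is placed at position \<open>k\<close>, which the absolute jump targets
  require, and leaves its value in register \<open>f\<close>; \<open>\<rho>\<close> tells which
  register below \<open>f\<close> holds a variable. \<open>min j 40\<close> sends parameters out of
  range to the zero register. A conditional is computed arithmetically as a * (1 - z) + b * z with z
  = [c = 0], so that the time is independent of the data; this is also why its value is reduced
  modulo \<open>2 ^ W\<close> in \<open>eval\<close>. Jumps on a register that has just been set to
  0 are unconditional.\<close>

primrec cexp :: "nat \<Rightarrow> (nat \<Rightarrow> nat) \<Rightarrow> nat \<Rightarrow> exp \<Rightarrow> instr list" where
  "cexp k \<rho> f (Num c) = [Const f c]"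
| "cexp k \<rho> f (Par j) = [mov f (min j 40)]"
| "cexp k \<rho> f (Var x) = [mov f (\<rho> x)]"
| "cexp k \<rho> f (Op g a b) =
     (let A = cexp k \<rho> f a; B = cexp (k + length A) \<rho> (f + 1) b in A @ B @ [Bin g f f (f + 1)])"
| "cexp k \<rho> f (Read a) = cexp k \<rho> f a @ [Load f f]"
| "cexp k \<rho> f (Bind x a b) =
     (let A = cexp k \<rho> f a; B = cexp (k + length A) (\<rho>(x := f)) (f + 1) b
      in A @ B @ [mov f (f + 1)])"
| "cexp k \<rho> f (Cond c a b) =
     (let C = cexp k \<rho> f c; A = cexp (k + length C) \<rho> (f + 1) a;
          B = cexp (k + length C + length A) \<rho> (f + 2) b
      in C @ A @ B @ [Const (f + 3) 0, Bin Eq f f (f + 3), Bin Mul (f + 2) (f + 2) f,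
           Const (f + 3) 1, Bin Sub f (f + 3) f, Bin Mul (f + 1) (f + 1) f,
           Bin Add f (f + 1) (f + 2)])"
| "cexp k \<rho> f (Iter j x i a b) =
     (let A = cexp k \<rho> f a; s = k + length A + 1;
          B = cexp (s + 2) (\<rho>(x := f, i := f + 1)) (f + 2) b; e = s + 2 + length B + 5
      in A @ [Const (f + 1) 0, Bin Less (f + 2) (f + 1) (min j 40), JumpIfZero (f + 2) e] @ B @
         [mov f (f + 2), Const (f + 2) 1, Bin Add (f + 1) (f + 1) (f + 2), Const (f + 2) 0,
          JumpIfZero (f + 2) s])"

text \<open>These are exact numbers of instructions. A loop pass costs 7 beyond its body, 2 for the
  test and 5 to store the accumulator, count and jump back; the failing last test costs 2.\<close>

primrec texp :: "(nat \<Rightarrow> nat) \<Rightarrow> exp \<Rightarrow> nat" where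
  "texp p (Num c) = 1"
| "texp p (Par j) = 1"
| "texp p (Var x) = 1"
| "texp p (Op g a b) = texp p a + texp p b + 1"
| "texp p (Read a) = texp p a + 1"
| "texp p (Bind x a b) = texp p a + texp p b + 1"
| "texp p (Cond c a b) = texp p c + texp p a + texp p b + 7"
| "texp p (Iter j x i a b) = texp p a + 1 + p j * (texp p b + 7) + 2"

primrec ccom :: "nat \<Rightarrow> (nat \<Rightarrow> nat) \<Rightarrow> nat \<Rightarrow> com \<Rightarrow> instr list" where
  "ccom k \<rho> f (Write a b) =
     (let A = cexp k \<rho> f a; B = cexp (k + length A) \<rho> (f + 1) b in A @ B @ [Store f (f + 1)])"
| "ccom k \<rho> f (Seq c1 c2) = (let A = ccom k \<rho> f c1 in A @ ccom (k + length A) \<rho> f c2)"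
| "ccom k \<rho> f (Local x a c) =
     (let A = cexp k \<rho> f a in A @ ccom (k + length A) (\<rho>(x := f)) (f + 1) c)"
| "ccom k \<rho> f (For j i c) =
     (let s = k + 1; B = ccom (s + 2) (\<rho>(i := f)) (f + 1) c; e = s + 2 + length B + 4
      in [Const f 0, Bin Less (f + 1) f (min j 40), JumpIfZero (f + 1) e] @ B @
         [Const (f + 1) 1, Bin Add f f (f + 1), Const (f + 1) 0, JumpIfZero (f + 1) s])"

primrec tcom :: "(nat \<Rightarrow> nat) \<Rightarrow> com \<Rightarrow> nat" where
  "tcom p (Write a b) = texp p a + texp p b + 1"
| "tcom p (Seq c1 c2) = tcom p c1 + tcom p c2"
| "tcom p (Local x a c) = texp p a + tcom p c"
| "tcom p (For j i c) = 1 + p j * (tcom p c + 6) + 2"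

section \<open>Runs of compiled code\<close>

definition code_at :: "instr list \<Rightarrow> nat \<Rightarrow> instr list \<Rightarrow> bool" where
  "code_at P k is \<longleftrightarrow> k + length is \<le> length P \<and> (\<forall>i < length is. P ! (k + i) = is ! i)"

lemma code_at_Nil [simp]: "code_at P k [] \<longleftrightarrow> k \<le> length P"
  by (simp add: code_at_def)

lemma code_at_Cons [simp]:
  "code_at P k (i # is) \<longleftrightarrow> k < length P \<and> P ! k = i \<and> code_at P (Suc k) is"
proof -
  have "(\<forall>j < length (i # is). P ! (k + j) = (i # is) ! j) \<longleftrightarrow>
      P ! k = i \<and> (\<forall>j < length is. P ! (Suc k + j) = is ! j)"
    by (simp add: All_less_Suc2)
  then show ?thesis
    unfolding code_at_def by auto
qed

lemma code_at_append [simp]: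
  "code_at P k (xs @ ys) \<longleftrightarrow> code_at P k xs \<and> code_at P (k + length xs) ys"
proof (induction xs arbitrary: k)
  case Nil
  then show ?case by (auto simp: code_at_def)
qed simp

definition steps :: "nat \<Rightarrow> instr list \<Rightarrow> nat \<Rightarrow> config \<Rightarrow> config \<Rightarrow> bool" where
  "steps W P t c c' \<longleftrightarrow> run W P t c = return_pmf c'"

lemma run_0: "run W P 0 = return_pmf"
  by (simp add: fun_eq_iff)

lemma run_add: "run W P (s + t) c = bind_pmf (run W P s c) (run W P t)"
proof (induction s arbitrary: c)
  case (Suc s)
  have "run W P (Suc s + t) c = bind_pmf (step W P c) (\<lambda>c'. run W P (s + t) c')"
    by simp
  also have "\<dots> = bind_pmf (run W P (Suc s) c) (run W P t)"
    unfolding Suc by (simp add: bind_assoc_pmf)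
  finally show ?case .
qed (simp add: bind_return_pmf)

lemma steps_refl: "steps W P 0 c c"
  by (simp add: steps_def)

lemma steps_trans: "steps W P s c c' \<Longrightarrow> steps W P t c' c'' \<Longrightarrow> steps W P (s + t) c c''"
  by (simp add: steps_def run_add bind_return_pmf)

lemma steps_instr:
  assumes "P ! k = i" "k < length P" "exec W i (cfg k r m) = return_pmf c'"
  shows "steps W P 1 (cfg k r m) c'"
  using assms by (simp add: steps_def step_def halted_def bind_return_pmf run_0)

lemma steps_Const:
  assumes "P ! k = Const f c" "k < length P" "c mod 2 ^ W = y"
  shows "steps W P 1 (cfg k r m) (cfg (k + 1) (r(f := y)) m)"
  unfolding assms(3)[symmetric] by (rule steps_instr[OF assms(1,2)]) (simp add: set_reg_def)

lemma steps_Bin: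
  assumes "P ! k = Bin g f s t" "k < length P" "binop_val W g (r s) (r t) = y"
  shows "steps W P 1 (cfg k r m) (cfg (k + 1) (r(f := y)) m)"
  unfolding assms(3)[symmetric] by (rule steps_instr[OF assms(1,2)]) (simp add: set_reg_def)

lemma steps_Jump:
  assumes "P ! k = JumpIfZero s l" "k < length P" "(if r s = 0 then l else k + 1) = q"
  shows "steps W P 1 (cfg k r m) (cfg q r m)"
  unfolding assms(3)[symmetric] by (rule steps_instr[OF assms(1,2)]) simp

lemma halted_run: "halted P c \<Longrightarrow> run W P t c = return_pmf c"
  by (induction t) (simp_all add: step_def bind_return_pmf)

lemma and_self_nat [simp]: "semiring_bit_operations_class.and x x = (x :: nat)"
  by (simp add: and.idem)

text \<open>The invariant of the register file: variables sit below the stack top \<open>f\<close>,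
  parameters in the first registers. All parameters from 40 on share register 40, which forces a
  common value on them; in complete programs it is 0.\<close>

definition rep :: "(nat \<Rightarrow> nat) \<Rightarrow> nat \<Rightarrow> (nat \<Rightarrow> nat) \<Rightarrow> (nat \<Rightarrow> nat) \<Rightarrow> (nat \<Rightarrow> nat) \<Rightarrow> bool" where
  "rep \<rho> f r v p \<longleftrightarrow> 40 < f \<and> (\<forall>x. \<rho> x < f \<and> r (\<rho> x) = v x) \<and> (\<forall>j. r (min j 40) = p j)"

lemma rep_mono: "rep \<rho> f r v p \<Longrightarrow> \<forall>j<f. r' j = r j \<Longrightarrow> f \<le> f' \<Longrightarrow> rep \<rho> f' r' v p"
  unfolding rep_def by (metis (no_types, opaque_lifting) less_le_trans min.cobounded2 le_less_trans)

lemma rep_upd: "rep \<rho> f r v p \<Longrightarrow> r f = a \<Longrightarrow> rep (\<rho>(x := f)) (f + 1) r (v(x := a)) p"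
  unfolding rep_def by (auto simp: less_SucI)

lemma rep_par: "rep \<rho> f r v p \<Longrightarrow> r (min j 40) = p j"
  unfolding rep_def by blast

lemma reachI:
  assumes "steps W P t c (cfg q r' m)" "t = t'" "q = q'" "r' f = x" "\<forall>j<f. r' j = r j"
  shows "\<exists>r'. steps W P t' c (cfg q' r' m) \<and> r' f = x \<and> (\<forall>j<f. r' j = r j)"
  using assms by blast

text \<open>Preservation of the registers below \<open>f\<close> makes the induction work: operands
  already evaluated, variables and parameters survive while the next subexpression runs on higher
  registers. The bound on the parameters keeps loop counters from wrapping around.\<close>

lemma cexp_correct:
  assumes "code_at P k (cexp k \<rho> f e)" "rep \<rho> f r v p" "\<forall>j. p j < 2 ^ W"
  shows "\<exists>r'. steps W P (texp p e) (cfg k r m)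
           (cfg (k + length (cexp k \<rho> f e)) r' m) \<and>
         r' f = eval W p m e v \<and> (\<forall>j<f. r' j = r j)"
  using assms(1,2)
proof (induction e arbitrary: k \<rho> f r v)
  case (Num c)
  then have "steps W P 1 (cfg k r m) (cfg (k + 1) (r(f := c mod 2 ^ W)) m)"
    by (intro steps_Const[of P k f c]) simp_all
  then show ?case
    by (rule reachI) simp_all
next
  case (Par j)
  then have "steps W P 1 (cfg k r m) (cfg (k + 1) (r(f := p j)) m)"
    by (intro steps_Bin[where g = And and s = "min j 40" and t = "min j 40"])
      (simp_all add: rep_par)
  then show ?case
    by (rule reachI) simp_all
next
  case (Var x)
  then have "steps W P 1 (cfg k r m) (cfg (k + 1) (r(f := v x)) m)"
    by (intro steps_Bin[where g = And and s = "\<rho> x" and t = "\<rho> x"])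
      (simp_all add: rep_def)
  then show ?case
    by (rule reachI) simp_all
next
  case (Op g a b)
  let ?A = "cexp k \<rho> f a"
  let ?B = "cexp (k + length ?A) \<rho> (f + 1) b"
  obtain r1 where r1: "steps W P (texp p a) (cfg k r m)
      (cfg (k + length ?A) r1 m)" "r1 f = eval W p m a v" "\<forall>j<f. r1 j = r j"
    using Op.IH(1)[OF _ Op.prems(2)] Op.prems(1) by (auto simp: Let_def)
  obtain r2 where r2: "steps W P (texp p b) (cfg (k + length ?A) r1 m)
      (cfg (k + length ?A + length ?B) r2 m)" "r2 (f + 1) = eval W p m b v"
      "\<forall>j<f+1. r2 j = r1 j"
    using Op.IH(2)[OF _ rep_mono[OF Op.prems(2) r1(3)], of "k + length ?A" "f + 1"] Op.prems(1)
    by (auto simp: Let_def)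
  have "steps W P 1 (cfg (k + length ?A + length ?B) r2 m)
     (cfg (k + length ?A + length ?B + 1) (r2(f := binop_val W g (eval W p m a v) (eval W p m b v))) m)"
    using Op.prems r1(2) r2(2,3) by (intro steps_instr) (auto simp: Let_def set_reg_def)
  from steps_trans[OF steps_trans[OF r1(1) r2(1)] this] show ?case
    by (rule reachI) (use r1(3) r2(3) in \<open>auto simp: Let_def add.assoc\<close>)
next
  case (Read a)
  let ?A = "cexp k \<rho> f a"
  obtain r1 where r1: "steps W P (texp p a) (cfg k r m)
      (cfg (k + length ?A) r1 m)" "r1 f = eval W p m a v" "\<forall>j<f. r1 j = r j"
    using Read.IH(1)[OF _ Read.prems(2)] Read.prems(1) by (auto simp: Let_def)
  have "steps W P 1 (cfg (k + length ?A) r1 m)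
     (cfg (k + length ?A + 1) (r1(f := m (eval W p m a v))) m)"
    using Read.prems r1(2) by (intro steps_instr) (auto simp: Let_def set_reg_def)
  from steps_trans[OF r1(1) this] show ?case
    by (rule reachI) (use r1(3) in auto)
next
  case (Bind x a b)
  let ?A = "cexp k \<rho> f a"
  let ?B = "cexp (k + length ?A) (\<rho>(x := f)) (f + 1) b"
  obtain r1 where r1: "steps W P (texp p a) (cfg k r m)
      (cfg (k + length ?A) r1 m)" "r1 f = eval W p m a v" "\<forall>j<f. r1 j = r j"
    using Bind.IH(1)[OF _ Bind.prems(2)] Bind.prems(1) by (auto simp: Let_def)
  obtain r2 where r2: "steps W P (texp p b) (cfg (k + length ?A) r1 m)
      (cfg (k + length ?A + length ?B) r2 m)"
      "r2 (f + 1) = eval W p m b (v(x := eval W p m a v))" "\<forall>j<f+1. r2 j = r1 j"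
    using Bind.IH(2)[OF _ rep_upd[OF rep_mono[OF Bind.prems(2) r1(3) order.refl] r1(2)],
        of "k + length ?A" x] Bind.prems(1)
    by (simp only: cexp.simps Let_def code_at_append) blast
  have "steps W P 1 (cfg (k + length ?A + length ?B) r2 m)
     (cfg (k + length ?A + length ?B + 1) (r2(f := eval W p m b (v(x := eval W p m a v)))) m)"
    using Bind.prems r2(2,3) by (intro steps_instr) (auto simp: Let_def set_reg_def)
  from steps_trans[OF steps_trans[OF r1(1) r2(1)] this] show ?case
    by (rule reachI) (use r1(3) r2(3) in \<open>auto simp: Let_def add.assoc\<close>)
next
  case (Cond c a b)
  let ?C = "cexp k \<rho> f c"
  let ?A = "cexp (k + length ?C) \<rho> (f + 1) a"
  let ?B = "cexp (k + length ?C + length ?A) \<rho> (f + 2) b"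
  let ?q = "k + length ?C + length ?A + length ?B"
  let ?z = "eval W p m c v" and ?x = "eval W p m a v" and ?y = "eval W p m b v"
  obtain r0 where r0: "steps W P (texp p c) (cfg k r m)
      (cfg (k + length ?C) r0 m)" "r0 f = ?z" "\<forall>j<f. r0 j = r j"
    using Cond.IH(1)[OF _ Cond.prems(2)] Cond.prems(1) by (auto simp: Let_def)
  obtain r1 where r1: "steps W P (texp p a) (cfg (k + length ?C) r0 m)
      (cfg (k + length ?C + length ?A) r1 m)" "r1 (f + 1) = ?x" "\<forall>j<f+1. r1 j = r0 j"
    using Cond.IH(2)[OF _ rep_mono[OF Cond.prems(2) r0(3)], of "k + length ?C" "f + 1"] Cond.prems(1)
    by (auto simp: Let_def)
  have rep1: "rep \<rho> (f + 2) r1 v p"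
    using rep_mono[of \<rho> f r v p r1 "f + 2"] Cond.prems(2) r0(3) r1(3) by auto
  obtain r2 where r2: "steps W P (texp p b) (cfg (k + length ?C + length ?A) r1 m)
      (cfg ?q r2 m)" "r2 (f + 2) = ?y" "\<forall>j<f+2. r2 j = r1 j"
    using Cond.IH(3)[OF _ rep1, of "k + length ?C + length ?A"] Cond.prems(1)
    by (auto simp: Let_def)
  define res where "res = eval W p m (Cond c a b) v"
  define z where "z = (of_bool (?z = 0) :: nat)"
  \<comment> \<open>Word size 0 is not excluded. Then the constant 1 is the word 0, so both sides
    are taken modulo \<open>2 ^ W\<close>.\<close>
  have z: "(1 mod 2 ^ W + 2 ^ W - z) mod 2 ^ W = (1 - z) mod 2 ^ W"
    using mod_add_self2[of 1 "2 ^ W :: nat"] by (cases "W = 0") (auto simp: z_def)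
  have res: "(?x * ((1 - z) mod 2 ^ W) mod 2 ^ W + ?y * z mod 2 ^ W) mod 2 ^ W = res"
    by (cases "W = 0") (auto simp: z_def res_def)
  have q: "P ! ?q = Const (f + 3) 0" "P ! (?q + 1) = Bin Eq f f (f + 3)"
    "P ! (?q + 2) = Bin Mul (f + 2) (f + 2) f" "P ! (?q + 3) = Const (f + 3) 1"
    "P ! (?q + 4) = Bin Sub f (f + 3) f" "P ! (?q + 5) = Bin Mul (f + 1) (f + 1) f"
    "P ! (?q + 6) = Bin Add f (f + 1) (f + 2)" "?q + 6 < length P"
    using Cond.prems(1) by (simp_all add: Let_def eval_nat_numeral)
  have val: "r2 f = ?z" "r2 (f + 1) = ?x" "r2 (f + 2) = ?y"
    using r0 r1 r2 by auto
  define s1 where "s1 = r2(f + 3 := 0)"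
  define s2 where "s2 = s1(f := z)"
  define s3 where "s3 = s2(f + 2 := ?y * z mod 2 ^ W)"
  define s4 where "s4 = s3(f + 3 := 1 mod 2 ^ W)"
  define s5 where "s5 = s4(f := (1 - z) mod 2 ^ W)"
  define s6 where "s6 = s5(f + 1 := ?x * ((1 - z) mod 2 ^ W) mod 2 ^ W)"
  define r3 where "r3 = s6(f := res)"
  note sd = s1_def s2_def s3_def s4_def s5_def s6_def r3_def
  have "steps W P 1 (cfg ?q r2 m) (cfg (?q + 1) s1 m)"
    unfolding s1_def by (rule steps_Const[OF q(1)]) (use q(8) in auto)
  moreover have "steps W P 1 (cfg (?q + 1) s1 m) (cfg (?q + 1 + 1) s2 m)"
    unfolding s2_def by (rule steps_Bin[OF q(2)]) (use q(8) val in \<open>auto simp: sd z_def\<close>)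
  moreover have "steps W P 1 (cfg (?q + 2) s2 m) (cfg (?q + 2 + 1) s3 m)"
    unfolding s3_def by (rule steps_Bin[OF q(3)]) (use q(8) val in \<open>auto simp: s1_def s2_def\<close>)
  moreover have "steps W P 1 (cfg (?q + 3) s3 m) (cfg (?q + 3 + 1) s4 m)"
    unfolding s4_def by (rule steps_Const[OF q(4)]) (use q(8) in auto)
  moreover have "steps W P 1 (cfg (?q + 4) s4 m) (cfg (?q + 4 + 1) s5 m)"
    unfolding s5_def
    by (rule steps_Bin[OF q(5)]) (use q(8) z in \<open>auto simp: s1_def s2_def s3_def s4_def\<close>)
  moreover have "steps W P 1 (cfg (?q + 5) s5 m) (cfg (?q + 5 + 1) s6 m)"
    unfolding s6_def
    by (rule steps_Bin[OF q(6)]) (use q(8) val in \<open>auto simp: s1_def s2_def s3_def s4_def s5_def\<close>)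
  moreover have "steps W P 1 (cfg (?q + 6) s6 m) (cfg (?q + 6 + 1) r3 m)"
    unfolding r3_def
    by (rule steps_Bin[OF q(7)]) (use q(8) res in \<open>auto simp: s1_def s2_def s3_def s4_def s5_def s6_def\<close>)
  ultimately have "steps W P (1 + 1 + 1 + 1 + 1 + 1 + 1) (cfg ?q r2 m) (cfg (?q + 7) r3 m)"
    by (intro steps_trans) (simp_all add: eval_nat_numeral)
  from steps_trans[OF steps_trans[OF steps_trans[OF r0(1) r1(1)] r2(1)] this] show ?case
    by (rule reachI) (use r0(3) r1(3) r2(3) in \<open>auto simp: Let_def add.assoc sd res_def\<close>)
next
  case (Iter j x i a b)
  let ?A = "cexp k \<rho> f a"
  let ?s = "k + length ?A + 1"
  let ?B = "cexp (?s + 2) (\<rho>(x := f, i := f + 1)) (f + 2) b"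
  let ?e = "?s + 2 + length ?B + 5"
  let ?F = "\<lambda>n. itr n (\<lambda>j y. eval W p m b (v(x := y, i := j))) (eval W p m a v)"
  have code: "P ! (k + length ?A) = Const (f + 1) 0" "P ! ?s = Bin Less (f + 2) (f + 1) (min j 40)"
     "P ! (?s + 1) = JumpIfZero (f + 2) ?e" "code_at P (?s + 2) ?B"
     "P ! (?s + 2 + length ?B) = mov f (f + 2)"
     "P ! (?s + 2 + length ?B + 1) = Const (f + 2) 1"
     "P ! (?s + 2 + length ?B + 2) = Bin Add (f + 1) (f + 1) (f + 2)"
     "P ! (?s + 2 + length ?B + 3) = Const (f + 2) 0"
     "P ! (?s + 2 + length ?B + 4) = JumpIfZero (f + 2) ?s"
     "?e \<le> length P"
    using Iter.prems(1) by (simp_all add: Let_def eval_nat_numeral)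
  obtain r1 where r1: "steps W P (texp p a) (cfg k r m)
      (cfg (k + length ?A) r1 m)" "r1 f = eval W p m a v" "\<forall>j<f. r1 j = r j"
    using Iter.IH(1)[OF _ Iter.prems(2)] Iter.prems(1) by (auto simp: Let_def)
  have init: "steps W P (texp p a + 1) (cfg k r m) (cfg ?s (r1(f + 1 := 0)) m)"
    by (rule steps_trans[OF r1(1)], rule steps_instr[OF code(1)])
      (use code(10) in \<open>auto simp: set_reg_def\<close>)
  \<comment> \<open>The program counter is back at the test \<open>?s\<close> after each pass, so n
    passes take exactly n times the cost of one.\<close>
  have loop: "\<exists>r'. steps W P (n * (texp p b + 7)) (cfg ?s (r1(f + 1 := 0)) m)
      (cfg ?s r' m) \<and> r' f = ?F n \<and> r' (f + 1) = n \<and> (\<forall>j<f. r' j = r j)"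
    if "n \<le> p j" for n
    using that
  proof (induction n)
    case 0
    have "steps W P (0 * (texp p b + 7)) (cfg ?s (r1(f + 1 := 0)) m) (cfg ?s (r1(f + 1 := 0)) m)"
      by (simp only: mult_0 steps_refl)
    then show ?case
      by (intro exI[of _ "r1(f + 1 := 0)"] conjI) (assumption, use r1 in simp_all)
  next
    case (Suc n)
    from Suc.IH[OF Suc_leD[OF Suc.prems]] obtain r2 where r2: "steps W P (n * (texp p b + 7)) (cfg ?s (r1(f + 1 := 0)) m)
      (cfg ?s r2 m)" "r2 f = ?F n" "r2 (f + 1) = n" "\<forall>j<f. r2 j = r j"
      by blast
    have rep2: "rep \<rho> f r2 v p"
      using rep_mono[OF Iter.prems(2) r2(4) order.refl] .
    let ?r3 = "r2(f + 2 := 1)"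
    have rep3: "rep (\<rho>(x := f, i := f + 1)) (f + 2) ?r3 (v(x := ?F n, i := n)) p"
      using rep_mono[of "\<rho>(x := f, i := f + 1)" "f + 2" r2 "v(x := ?F n, i := n)" p ?r3 "f + 2"]
        rep_upd[OF rep_upd[OF rep2 r2(2), of x], of n i] r2(3) by simp
    have "steps W P 1 (cfg ?s r2 m) (cfg (?s + 1) ?r3 m)"
      by (rule steps_Bin[OF code(2)]) (use code(10) Suc.prems r2(3) rep_par[OF rep2, of j] in auto)
    moreover have "steps W P 1 (cfg (?s + 1) ?r3 m) (cfg (?s + 2) ?r3 m)"
      by (rule steps_Jump[OF code(3)]) (use code(10) in auto)
    ultimately have test:
      "steps W P (1 + 1) (cfg ?s r2 m) (cfg (?s + 2) ?r3 m)"
      by (rule steps_trans)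
    obtain r4 where r4: "steps W P (texp p b) (cfg (?s + 2) ?r3 m) (cfg (?s + 2 + length ?B) r4 m)"
      "r4 (f + 2) = eval W p m b (v(x := ?F n, i := n))" "\<forall>j<f+2. r4 j = ?r3 j"
      using Iter.IH(2)[OF code(4) rep3] by blast
    \<comment> \<open>The counter never exceeds the parameter, which is a word; this also excludes
      word size 0.\<close>
    have nW: "Suc n < 2 ^ W" using Suc.prems assms(3)[rule_format, of j] by linarith
    then have "W \<noteq> 0" by (cases "W = 0") auto
    then have W1: "1 mod 2 ^ W = (1 :: nat)" by simp
    define s1 where "s1 = r4(f := r4 (f + 2))"
    define s2 where "s2 = s1(f + 2 := 1)"
    define s3 where "s3 = s2(f + 1 := Suc n)"
    define s4 where "s4 = s3(f + 2 := 0)"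
    let ?u = "?s + 2 + length ?B"
    have "steps W P 1 (cfg ?u r4 m) (cfg (?u + 1) s1 m)"
      unfolding s1_def by (rule steps_Bin[OF code(5)]) (use code(10) in auto)
    moreover have "steps W P 1 (cfg (?u + 1) s1 m) (cfg (?u + 1 + 1) s2 m)"
      unfolding s2_def by (rule steps_Const[OF code(6)]) (use code(10) W1 in auto)
    moreover have "steps W P 1 (cfg (?u + 2) s2 m) (cfg (?u + 2 + 1) s3 m)"
      unfolding s3_def
      by (rule steps_Bin[OF code(7)]) (use code(10) r4(3) r2(3) nW in \<open>auto simp: s1_def s2_def\<close>)
    moreover have "steps W P 1 (cfg (?u + 3) s3 m) (cfg (?u + 3 + 1) s4 m)"
      unfolding s4_def by (rule steps_Const[OF code(8)]) (use code(10) in auto)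
    moreover have "steps W P 1 (cfg (?u + 4) s4 m) (cfg ?s s4 m)"
      by (rule steps_Jump[OF code(9)]) (use code(10) in \<open>auto simp: s4_def\<close>)
    ultimately have fin: "steps W P (1 + 1 + 1 + 1 + 1) (cfg ?u r4 m) (cfg ?s s4 m)"
      by (intro steps_trans) (simp_all add: eval_nat_numeral)
    have "steps W P (n * (texp p b + 7) + (1 + 1 + (texp p b + (1 + 1 + 1 + 1 + 1))))
        (cfg ?s (r1(f + 1 := 0)) m) (cfg ?s s4 m)"
      by (rule steps_trans[OF r2(1) steps_trans[OF test steps_trans[OF r4(1) fin]]])
    also have "n * (texp p b + 7) + (1 + 1 + (texp p b + (1 + 1 + 1 + 1 + 1))) = Suc n * (texp p b + 7)"
      by simp
    finally show ?case
      by (intro exI[of _ s4] conjI)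
        (assumption, use r4(2,3) r2(4) in \<open>simp_all add: s1_def s2_def s3_def s4_def fun_upd_def\<close>)
  qed
  from loop[OF order.refl] obtain r2 where
    r2: "steps W P (p j * (texp p b + 7)) (cfg ?s (r1(f + 1 := 0)) m)
      (cfg ?s r2 m)" "r2 f = ?F (p j)" "r2 (f + 1) = p j" "\<forall>j<f. r2 j = r j"
    by blast
  have rep2: "rep \<rho> f r2 v p"
    using rep_mono[OF Iter.prems(2) r2(4) order.refl] .
  have "steps W P 1 (cfg ?s r2 m) (cfg (?s + 1) (r2(f + 2 := 0)) m)"
    by (rule steps_Bin[OF code(2)]) (use code(10) r2(3) rep_par[OF rep2, of j] in auto)
  moreover have "steps W P 1 (cfg (?s + 1) (r2(f + 2 := 0)) m) (cfg ?e (r2(f + 2 := 0)) m)"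
    by (rule steps_Jump[OF code(3)]) (use code(10) in auto)
  ultimately have ex: "steps W P (1 + 1) (cfg ?s r2 m) (cfg ?e (r2(f + 2 := 0)) m)"
    by (rule steps_trans)
  from steps_trans[OF steps_trans[OF init r2(1)] ex] show ?case
    by (rule reachI) (use r2(2,4) in \<open>simp_all add: Let_def eval_nat_numeral\<close>)
qed

lemma reachI':
  assumes "steps W P t c (cfg q r' m)" "t = t'" "q = q'" "m = m'" "\<forall>j<f. r' j = r j"
  shows "\<exists>r'. steps W P t' c (cfg q' r' m') \<and> (\<forall>j<f. r' j = r j)"
  using assms by blast

lemma ccom_correct:
  assumes "code_at P k (ccom k \<rho> f c)" "rep \<rho> f r v p" "\<forall>j. p j < 2 ^ W"
  shows "\<exists>r'. steps W P (tcom p c) (cfg k r m)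
           (cfg (k + length (ccom k \<rho> f c)) r' (sem W p c v m)) \<and> (\<forall>j<f. r' j = r j)"
  using assms(1,2)
proof (induction c arbitrary: k \<rho> f r v m)
  case (Write a b)
  let ?A = "cexp k \<rho> f a"
  let ?B = "cexp (k + length ?A) \<rho> (f + 1) b"
  let ?q = "k + length ?A + length ?B"
  have code: "code_at P k ?A" "code_at P (k + length ?A) ?B" "P ! ?q = Store f (f + 1)"
    "?q < length P"
    using Write.prems(1) by (simp_all add: Let_def)
  obtain r1 where r1: "steps W P (texp p a) (cfg k r m)
      (cfg (k + length ?A) r1 m)" "r1 f = eval W p m a v" "\<forall>j<f. r1 j = r j"
    using cexp_correct[OF code(1) Write.prems(2) assms(3)] by blast
  have "rep \<rho> (f + 1) r1 v p"
    using rep_mono[OF Write.prems(2) r1(3)] by simp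
  then obtain r2 where r2: "steps W P (texp p b) (cfg (k + length ?A) r1 m)
      (cfg ?q r2 m)" "r2 (f + 1) = eval W p m b v" "\<forall>j<f+1. r2 j = r1 j"
    using cexp_correct[OF code(2) _ assms(3)] by blast
  have "steps W P 1 (cfg ?q r2 m) (cfg (?q + 1) r2 (m(eval W p m a v := eval W p m b v)))"
    by (rule steps_instr[OF code(3,4)]) (use r1(2) r2(2,3) in simp)
  from steps_trans[OF steps_trans[OF r1(1) r2(1)] this] show ?case
    by (rule reachI') (use r1(3) r2(3) in \<open>simp_all add: Let_def fun_upd_def\<close>)
next
  case (Seq c1 c2)
  let ?A = "ccom k \<rho> f c1"
  have code: "code_at P k ?A" "code_at P (k + length ?A) (ccom (k + length ?A) \<rho> f c2)"
    using Seq.prems(1) by (simp_all add: Let_def)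
  obtain r1 where r1: "steps W P (tcom p c1) (cfg k r m)
      (cfg (k + length ?A) r1 (sem W p c1 v m))" "\<forall>j<f. r1 j = r j"
    using Seq.IH(1)[OF code(1) Seq.prems(2)] by blast
  obtain r2 where r2: "steps W P (tcom p c2) (cfg (k + length ?A) r1 (sem W p c1 v m))
      (cfg (k + length ?A + length (ccom (k + length ?A) \<rho> f c2)) r2 (sem W p c2 v (sem W p c1 v m)))" "\<forall>j<f. r2 j = r1 j"
    using Seq.IH(2)[OF code(2) rep_mono[OF Seq.prems(2) r1(2) order.refl]] by blast
  from steps_trans[OF r1(1) r2(1)] show ?case
    by (rule reachI') (use r1(2) r2(2) in \<open>simp_all add: Let_def\<close>)
next
  case (Local x a c)
  let ?A = "cexp k \<rho> f a"
  let ?C = "ccom (k + length ?A) (\<rho>(x := f)) (f + 1) c"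
  have code: "code_at P k ?A" "code_at P (k + length ?A) ?C"
    using Local.prems(1) by (simp_all only: Let_def ccom.simps code_at_append)
  obtain r1 where r1: "steps W P (texp p a) (cfg k r m)
      (cfg (k + length ?A) r1 m)" "r1 f = eval W p m a v" "\<forall>j<f. r1 j = r j"
    using cexp_correct[OF code(1) Local.prems(2) assms(3)] by blast
  have "rep (\<rho>(x := f)) (f + 1) r1 (v(x := eval W p m a v)) p"
    using rep_upd[OF rep_mono[OF Local.prems(2) r1(3) order.refl] r1(2)] .
  then obtain r2 where r2: "steps W P (tcom p c) (cfg (k + length ?A) r1 m)
      (cfg (k + length ?A + length ?C) r2 (sem W p c (v(x := eval W p m a v)) m))"
      "\<forall>j<f+1. r2 j = r1 j"
    using Local.IH[OF code(2)] by blast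
  from steps_trans[OF r1(1) r2(1)] show ?case
    by (rule reachI') (use r1(3) r2(2) in \<open>simp_all add: Let_def fun_upd_def\<close>)
next
  case (For j i c)
  let ?s = "k + 1"
  let ?B = "ccom (?s + 2) (\<rho>(i := f)) (f + 1) c"
  let ?u = "?s + 2 + length ?B"
  let ?e = "?u + 4"
  let ?F = "\<lambda>n. itr n (\<lambda>j. sem W p c (v(i := j))) m"
  have code: "P ! k = Const f 0" "P ! ?s = Bin Less (f + 1) f (min j 40)"
     "P ! (?s + 1) = JumpIfZero (f + 1) ?e" "code_at P (?s + 2) ?B"
     "P ! ?u = Const (f + 1) 1" "P ! (?u + 1) = Bin Add f f (f + 1)"
     "P ! (?u + 2) = Const (f + 1) 0" "P ! (?u + 3) = JumpIfZero (f + 1) ?s" "?e \<le> length P"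
    using For.prems(1) by (simp_all add: Let_def eval_nat_numeral)
  have init: "steps W P 1 (cfg k r m) (cfg ?s (r(f := 0)) m)"
    by (rule steps_Const[OF code(1)]) (use code(9) in auto)
  have loop: "\<exists>r'. steps W P (n * (tcom p c + 6)) (cfg ?s (r(f := 0)) m)
      (cfg ?s r' (?F n)) \<and> r' f = n \<and> (\<forall>j<f. r' j = r j)"
    if "n \<le> p j" for n
    using that
  proof (induction n)
    case 0
    have "steps W P (0 * (tcom p c + 6)) (cfg ?s (r(f := 0)) m) (cfg ?s (r(f := 0)) (?F 0))"
      by (simp only: mult_0 steps_refl itr.simps)
    then show ?case
      by (intro exI[of _ "r(f := 0)"] conjI) (assumption, simp_all)
  next
    case (Suc n)
    from Suc.IH[OF Suc_leD[OF Suc.prems]] obtain r2 where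
      r2: "steps W P (n * (tcom p c + 6)) (cfg ?s (r(f := 0)) m)
        (cfg ?s r2 (?F n))" "r2 f = n" "\<forall>j<f. r2 j = r j"
      by blast
    have rep2: "rep \<rho> f r2 v p"
      using rep_mono[OF For.prems(2) r2(3) order.refl] .
    let ?r3 = "r2(f + 1 := 1)"
    have rep3: "rep (\<rho>(i := f)) (f + 1) ?r3 (v(i := n)) p"
      using rep_mono[OF rep_upd[OF rep2 r2(2)], of ?r3 "f + 1"] by simp
    have "steps W P 1 (cfg ?s r2 (?F n)) (cfg (?s + 1) ?r3 (?F n))"
      by (rule steps_Bin[OF code(2)]) (use code(9) Suc.prems r2(2) rep_par[OF rep2, of j] in auto)
    moreover have "steps W P 1 (cfg (?s + 1) ?r3 (?F n)) (cfg (?s + 2) ?r3 (?F n))"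
      by (rule steps_Jump[OF code(3)]) (use code(9) in auto)
    ultimately have test: "steps W P (1 + 1) (cfg ?s r2 (?F n)) (cfg (?s + 2) ?r3 (?F n))"
      by (rule steps_trans)
    let ?m = "sem W p c (v(i := n)) (?F n)"
    obtain r4 where r4: "steps W P (tcom p c) (cfg (?s + 2) ?r3 (?F n))
      (cfg ?u r4 ?m)" "\<forall>j<f+1. r4 j = ?r3 j"
      using For.IH[OF code(4) rep3] by blast
    have nW: "Suc n < 2 ^ W" using Suc.prems assms(3)[rule_format, of j] by linarith
    then have "W \<noteq> 0" by (cases "W = 0") auto
    then have W1: "1 mod 2 ^ W = (1 :: nat)" by simp
    define s2 where "s2 = r4(f + 1 := 1)"
    define s3 where "s3 = s2(f := Suc n)"
    define s4 where "s4 = s3(f + 1 := 0)"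
    have "steps W P 1 (cfg ?u r4 ?m) (cfg (?u + 1) s2 ?m)"
      unfolding s2_def by (rule steps_Const[OF code(5)]) (use code(9) W1 in auto)
    moreover have "steps W P 1 (cfg (?u + 1) s2 ?m) (cfg (?u + 1 + 1) s3 ?m)"
      unfolding s3_def
      by (rule steps_Bin[OF code(6)]) (use code(9) r4(2) r2(2) nW in \<open>auto simp: s2_def\<close>)
    moreover have "steps W P 1 (cfg (?u + 2) s3 ?m) (cfg (?u + 2 + 1) s4 ?m)"
      unfolding s4_def by (rule steps_Const[OF code(7)]) (use code(9) in auto)
    moreover have "steps W P 1 (cfg (?u + 3) s4 ?m) (cfg ?s s4 ?m)"
      by (rule steps_Jump[OF code(8)]) (use code(9) in \<open>auto simp: s4_def\<close>)
    ultimately have fin: "steps W P (1 + 1 + 1 + 1) (cfg ?u r4 ?m) (cfg ?s s4 ?m)"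
      by (intro steps_trans) (simp_all add: eval_nat_numeral)
    have "steps W P (n * (tcom p c + 6) + (1 + 1 + (tcom p c + (1 + 1 + 1 + 1))))
        (cfg ?s (r(f := 0)) m) (cfg ?s s4 ?m)"
      by (rule steps_trans[OF r2(1) steps_trans[OF test steps_trans[OF r4(1) fin]]])
    also have "n * (tcom p c + 6) + (1 + 1 + (tcom p c + (1 + 1 + 1 + 1))) = Suc n * (tcom p c + 6)"
      by simp
    also have "?m = ?F (Suc n)"
      by simp
    finally show ?case
      by (intro exI[of _ s4] conjI)
        (assumption, use r4(2) r2(3) in \<open>simp_all add: s2_def s3_def s4_def fun_upd_def\<close>)
  qed
  from loop[OF order.refl] obtain r2 where
    r2: "steps W P (p j * (tcom p c + 6)) (cfg ?s (r(f := 0)) m)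
      (cfg ?s r2 (?F (p j)))" "r2 f = p j" "\<forall>j<f. r2 j = r j"
    by blast
  have rep2: "rep \<rho> f r2 v p"
    using rep_mono[OF For.prems(2) r2(3) order.refl] .
  let ?m = "?F (p j)"
  have "steps W P 1 (cfg ?s r2 ?m) (cfg (?s + 1) (r2(f + 1 := 0)) ?m)"
    by (rule steps_Bin[OF code(2)]) (use code(9) r2(2) rep_par[OF rep2, of j] in auto)
  moreover have "steps W P 1 (cfg (?s + 1) (r2(f + 1 := 0)) ?m) (cfg ?e (r2(f + 1 := 0)) ?m)"
    by (rule steps_Jump[OF code(3)]) (use code(9) in auto)
  ultimately have ex: "steps W P (1 + 1) (cfg ?s r2 ?m) (cfg ?e (r2(f + 1 := 0)) ?m)"
    by (rule steps_trans)
  from steps_trans[OF steps_trans[OF init r2(1)] ex] show ?case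
    by (rule reachI') (use r2(3) in \<open>simp_all add: Let_def eval_nat_numeral\<close>)
qed

primrec cpars :: "nat \<Rightarrow> nat \<Rightarrow> exp list \<Rightarrow> instr list" where
  "cpars k i [] = []"
| "cpars k i (e # es) =
     (let A = cexp k (\<lambda>_. 40) 41 e in A @ [mov i 41] @ cpars (k + length A + 1) (i + 1) es)"

text \<open>Parameter number \<open>i\<close> is computed from the memory and the parameters with smaller numbers.\<close>

definition below :: "nat \<Rightarrow> (nat \<Rightarrow> nat) \<Rightarrow> nat \<Rightarrow> nat" where
  "below i p j = (if j < i then p j else 0)"

definition params :: "nat \<Rightarrow> exp list \<Rightarrow> (nat \<Rightarrow> nat) \<Rightarrow> (nat \<Rightarrow> nat) \<Rightarrow> bool" where
  "params W es m p \<longleftrightarrow> length es \<le> 40 \<and> (\<forall>j. p j < 2 ^ W) \<and> below (length es) p = p \<and>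
     (\<forall>i < length es. eval W (below i p) m (es ! i) (\<lambda>_. 0) = p i)"

definition tpars :: "exp list \<Rightarrow> (nat \<Rightarrow> nat) \<Rightarrow> nat" where
  "tpars es p = (\<Sum>i < length es. texp (below i p) (es ! i) + 1)"

text \<open>Registers start at 0, so parameters not computed yet read as 0; that is what
  \<open>below i p\<close> describes. The induction is on the number of parameters still to
  come.\<close>

lemma cpars_correct:
  assumes "params W es m p" "i \<le> length es" "code_at P k (cpars k i (drop i es))"
    and "rep (\<lambda>_. 40) 41 r (\<lambda>_. 0) (below i p)"
  shows "\<exists>r'. steps W P (\<Sum>j = i..<length es. texp (below j p) (es ! j) + 1)
           (cfg k r m) (cfg (k + length (cpars k i (drop i es))) r' m) \<and>
         rep (\<lambda>_. 40) 41 r' (\<lambda>_. 0) p"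
  using assms(2-)
proof (induction "length es - i" arbitrary: i k r)
  case 0
  then have "i = length es" by simp
  then show ?case
    using 0 assms(1) by (auto simp: params_def steps_refl intro!: exI[of _ r])
next
  case (Suc n)
  then have i: "i < length es" by simp
  let ?e = "es ! i"
  let ?A = "cexp k (\<lambda>_. 40) 41 ?e"
  have drop: "drop i es = ?e # drop (i + 1) es"
    using Cons_nth_drop_Suc[OF i] by simp
  have len: "length es \<le> 40" and pW: "\<forall>j. p j < 2 ^ W"
    using assms(1) by (auto simp: params_def)
  have pW': "\<forall>j. below i p j < 2 ^ W"
    using pW by (auto simp: below_def)
  have code: "code_at P k ?A" "P ! (k + length ?A) = mov i 41" "k + length ?A < length P"
    "code_at P (k + length ?A + 1) (cpars (k + length ?A + 1) (i + 1) (drop (i + 1) es))"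
    using Suc.prems(2) unfolding drop by (simp_all add: Let_def)
  obtain r1 where r1: "steps W P (texp (below i p) ?e) (cfg k r m)
      (cfg (k + length ?A) r1 m)" "r1 41 = eval W (below i p) m ?e (\<lambda>_. 0)"
      "\<forall>j<41. r1 j = r j"
    using cexp_correct[OF code(1) Suc.prems(3) pW'] by blast
  have val: "r1 41 = p i"
    using r1(2) assms(1) i by (simp add: params_def)
  have s: "steps W P 1 (cfg (k + length ?A) r1 m) (cfg (k + length ?A + 1) (r1(i := p i)) m)"
    by (rule steps_Bin[OF code(2)]) (use code(3) val in auto)
  have rep: "r (min j 40) = below i p j" "r 40 = 0" for j
    using Suc.prems(3) by (simp_all add: rep_def)
  have rep': "(r1(i := p i)) (min j 40) = below (i + 1) p j" for j
  proof (cases "j = i")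
    case True
    then show ?thesis using i len by (simp add: below_def)
  next
    case False
    then have "min j 40 \<noteq> i" using i len by auto
    then show ?thesis using False r1(3) rep(1)[of j] by (auto simp: below_def)
  qed
  have "rep (\<lambda>_. 40) 41 (r1(i := p i)) (\<lambda>_. 0) (below (i + 1) p)"
    unfolding rep_def using rep' i len rep(2) r1(3) by (auto simp del: fun_upd_apply) auto
  then obtain r2 where r2: "steps W P (\<Sum>j = i + 1..<length es. texp (below j p) (es ! j) + 1)
           (cfg (k + length ?A + 1) (r1(i := p i)) m)
           (cfg (k + length ?A + 1 + length (cpars (k + length ?A + 1) (i + 1) (drop (i + 1) es))) r2 m)" "rep (\<lambda>_. 40) 41 r2 (\<lambda>_. 0) p"
    using Suc.hyps(1)[OF _ _ code(4)] Suc.hyps(2) i by fastforce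
  have time: "(\<Sum>j = i..<length es. texp (below j p) (es ! j) + 1) =
      texp (below i p) ?e + 1 + (\<Sum>j = i + 1..<length es. texp (below j p) (es ! j) + 1)"
    using i by (simp add: sum.atLeast_Suc_lessThan)
  have len: "length (cpars k i (drop i es)) =
      length ?A + 1 + length (cpars (k + length ?A + 1) (i + 1) (drop (i + 1) es))"
    unfolding drop by (simp add: Let_def)
  show ?case
    unfolding time len add.assoc[symmetric]
    using steps_trans[OF steps_trans[OF r1(1) s] r2(1)] r2(2) by blast
qed

section \<open>Random cells and complete programs\<close>

primrec rwords :: "nat \<Rightarrow> nat \<Rightarrow> nat list pmf" where
  "rwords W 0 = return_pmf []"
| "rwords W (Suc n) = bind_pmf (pmf_of_set {..<2 ^ W}) (\<lambda>x. map_pmf (Cons x) (rwords W n))"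

definition put :: "nat \<Rightarrow> nat list \<Rightarrow> (nat \<Rightarrow> nat) \<Rightarrow> nat \<Rightarrow> nat" where
  "put a xs m b = (if a \<le> b \<and> b < a + length xs then xs ! (b - a) else m b)"

lemma put_Nil: "put a [] m = m"
  by (simp add: put_def fun_eq_iff)

lemma put_Cons: "put a (x # xs) m = put (a + 1) xs (m(a := x))"
  by (auto simp: put_def fun_eq_iff nth_Cons' Suc_le_eq)

text \<open>All random words are drawn into memory in advance. The rest of a program is then a
  deterministic command, and probabilities concern only the list of drawn words.\<close>

definition cfill :: "nat \<Rightarrow> nat \<Rightarrow> exp \<Rightarrow> instr list" where
  "cfill k j a =
     (let A = cexp k (\<lambda>_. 40) 41 a; s = k + length A + 1 in
      A @ [Const 42 0, Bin Less 43 42 (min j 40), JumpIfZero 43 (s + 9), Bin Add 43 41 42, Rand 44,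
           Store 43 44, Const 43 1, Bin Add 42 42 43, Const 43 0, JumpIfZero 43 s])"

text \<open>The loop draws its words in the order of the recursion of \<open>rwords\<close>. The
  last assumption keeps the sum of base address and index from wrapping around.\<close>

lemma cfill_correct:
  assumes "code_at P k (cfill k j a)" "rep (\<lambda>_. 40) 41 r (\<lambda>_. 0) p" "\<forall>j. p j < 2 ^ W"
    and "eval W p m a (\<lambda>_. 0) + p j < 2 ^ W"
  shows "\<exists>R. run W P (texp p a + 1 + p j * 9 + 2) (cfg k r m) =
      map_pmf (\<lambda>xs. cfg (k + length (cfill k j a)) (R xs) (put (eval W p m a (\<lambda>_. 0)) xs m)) (rwords W (p j)) \<and>
    (\<forall>xs. rep (\<lambda>_. 40) 41 (R xs) (\<lambda>_. 0) p)"
proof -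
  let ?A = "cexp k (\<lambda>_. 40) 41 a"
  let ?s = "k + length ?A + 1"
  let ?a = "eval W p m a (\<lambda>_. 0)"
  have code: "code_at P k ?A" "P ! (k + length ?A) = Const 42 0"
    "P ! ?s = Bin Less 43 42 (min j 40)" "P ! (?s + 1) = JumpIfZero 43 (?s + 9)"
    "P ! (?s + 2) = Bin Add 43 41 42" "P ! (?s + 3) = Rand 44"
    "P ! (?s + 4) = Store 43 44" "P ! (?s + 5) = Const 43 1" "P ! (?s + 6) = Bin Add 42 42 43"
    "P ! (?s + 7) = Const 43 0" "P ! (?s + 8) = JumpIfZero 43 ?s" "?s + 9 \<le> length P"
    using assms(1) by (simp_all add: cfill_def Let_def eval_nat_numeral)
  obtain r1 where r1: "steps W P (texp p a) (cfg k r m)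
      (cfg (k + length ?A) r1 m)" "r1 41 = ?a" "\<forall>j<41. r1 j = r j"
    using cexp_correct[OF code(1) assms(2,3)] by blast
  have s0: "steps W P 1 (cfg (k + length ?A) r1 m) (cfg (k + length ?A + 1) (r1(42 := 0)) m)"
    by (rule steps_Const[OF code(2)]) (use code in auto)
  define nxt where "nxt = (\<lambda>(r :: nat \<Rightarrow> nat) x. r(43 := 0, 44 := x, 42 := r 42 + 1))"
  have nxt: "nxt r x 42 = r 42 + 1" "j < 42 \<Longrightarrow> nxt r x j = r j" for r x j
    by (auto simp: nxt_def)
  \<comment> \<open>Within a pass only the fourth instruction is random, so the nine steps are cut
    into 3 + 1 + 5.\<close>
  have one: "run W P 9 (cfg ?s r' m') =
      map_pmf (\<lambda>x. cfg ?s (nxt r' x) (m'(?a + r' 42 := x))) (pmf_of_set {..<2 ^ W})"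
    if r': "r' 41 = ?a" "r' 42 < p j" "\<forall>j<41. r' j = r j" for r' m'
  proof -
    have pj: "r' (min j 40) = p j"
      using r'(3) rep_par[OF assms(2), of j] by simp
    have W: "?a + r' 42 < 2 ^ W" "r' 42 + 1 < 2 ^ W"
      using assms(3)[rule_format, of j] assms(4) r'(2) by linarith+
    then have "W \<noteq> 0" by (cases "W = 0") auto
    then have W1: "1 mod 2 ^ W = (1 :: nat)" by simp
    define t1 where "t1 = r'(43 := 1)"
    define t2 where "t2 = t1(43 := ?a + r' 42)"
    have a: "steps W P 1 (cfg ?s r' m') (cfg (?s + 1) t1 m')"
      unfolding t1_def by (rule steps_Bin[OF code(3)]) (use code r'(2) pj in auto)
    have b: "steps W P 1 (cfg (?s + 1) t1 m') (cfg (?s + 2) t1 m')"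
      by (rule steps_Jump[OF code(4)]) (use code in \<open>auto simp: t1_def\<close>)
    have c: "steps W P 1 (cfg (?s + 2) t1 m') (cfg (?s + 2 + 1) t2 m')"
      unfolding t2_def by (rule steps_Bin[OF code(5)]) (use code r'(1) W in \<open>auto simp: t1_def\<close>)
    have pre: "steps W P (1 + 1 + 1) (cfg ?s r' m') (cfg (?s + 3) t2 m')"
      using steps_trans[OF steps_trans[OF a b] c] by (simp add: eval_nat_numeral)
    have rnd: "run W P 1 (cfg (?s + 3) t2 m') =
        map_pmf (\<lambda>x. cfg (?s + 4) (t2(44 := x)) m') (pmf_of_set {..<2 ^ W})"
      using code(6,12)
      by (simp add: run_0 bind_return_pmf' step_def halted_def set_reg_def eval_nat_numeral)
    have post: "steps W P (1 + 1 + 1 + 1 + 1) (cfg (?s + 4) (t2(44 := x)) m')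
        (cfg ?s (nxt r' x) (m'(?a + r' 42 := x)))" for x
    proof -
      let ?m = "m'(?a + r' 42 := x)"
      define t3 where "t3 = t2(44 := x)"
      define t4 where "t4 = t3(43 := 1)"
      define t5 where "t5 = t4(42 := r' 42 + 1)"
      define t6 where "t6 = t5(43 := 0)"
      have "steps W P 1 (cfg (?s + 4) t3 m') (cfg (?s + 5) t3 ?m)"
        by (rule steps_instr[OF code(7)]) (use code in \<open>auto simp: t3_def t2_def t1_def\<close>)
      moreover have "steps W P 1 (cfg (?s + 5) t3 ?m) (cfg (?s + 5 + 1) t4 ?m)"
        unfolding t4_def by (rule steps_Const[OF code(8)]) (use code W1 in auto)
      moreover have "steps W P 1 (cfg (?s + 6) t4 ?m) (cfg (?s + 6 + 1) t5 ?m)"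
        unfolding t5_def
        by (rule steps_Bin[OF code(9)]) (use code W in \<open>auto simp: t4_def t3_def t2_def t1_def\<close>)
      moreover have "steps W P 1 (cfg (?s + 7) t5 ?m) (cfg (?s + 7 + 1) t6 ?m)"
        unfolding t6_def by (rule steps_Const[OF code(10)]) (use code in auto)
      moreover have "steps W P 1 (cfg (?s + 8) t6 ?m) (cfg ?s t6 ?m)"
        by (rule steps_Jump[OF code(11)]) (use code in \<open>auto simp: t6_def\<close>)
      ultimately have "steps W P (1 + 1 + 1 + 1 + 1) (cfg (?s + 4) t3 m') (cfg ?s t6 ?m)"
        by (intro steps_trans) (simp_all add: eval_nat_numeral)
      moreover have "t6 = nxt r' x"
        by (auto simp: t6_def t5_def t4_def t3_def t2_def t1_def nxt_def)
      ultimately show ?thesis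
        unfolding t3_def by simp
    qed
    have "run W P ((1 + 1 + 1) + (1 + (1 + 1 + 1 + 1 + 1))) (cfg ?s r' m') =
        bind_pmf (map_pmf (\<lambda>x. cfg (?s + 4) (t2(44 := x)) m') (pmf_of_set {..<2 ^ W}))
          (run W P (1 + 1 + 1 + 1 + 1))"
      unfolding run_add pre[unfolded steps_def run_add] bind_return_pmf rnd[symmetric] by simp
    also have "\<dots> = map_pmf (\<lambda>x. cfg ?s (nxt r' x) (m'(?a + r' 42 := x)))
        (pmf_of_set {..<2 ^ W})"
      by (simp only: bind_map_pmf post[unfolded steps_def]) (simp add: map_pmf_def)
    finally show ?thesis by (simp add: eval_nat_numeral)
  qed
  have loop: "run W P (n * 9) (cfg ?s r' m') =
      map_pmf (\<lambda>xs. cfg ?s (foldl nxt r' xs) (put (?a + r' 42) xs m')) (rwords W n)"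
    if "r' 41 = ?a" "r' 42 + n \<le> p j" "\<forall>j<41. r' j = r j" for n r' m'
    using that
  proof (induction n arbitrary: r' m')
    case 0
    then show ?case by (simp add: run_0 put_Nil)
  next
    case (Suc n)
    have "run W P (Suc n * 9) (cfg ?s r' m') =
        bind_pmf (run W P 9 (cfg ?s r' m')) (run W P (n * 9))"
      unfolding mult_Suc run_add ..
    also have "\<dots> = bind_pmf (pmf_of_set {..<2 ^ W}) (\<lambda>x. run W P (n * 9)
        (cfg ?s (nxt r' x) (m'(?a + r' 42 := x))))"
      using Suc.prems by (subst one) (auto simp: bind_map_pmf)
    also have "\<dots> = bind_pmf (pmf_of_set {..<2 ^ W}) (\<lambda>x.
        map_pmf (\<lambda>xs. cfg ?s (foldl nxt (nxt r' x) xs) (put (?a + nxt r' x 42) xs (m'(?a + r' 42 := x)))) (rwords W n))"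
      using Suc.prems by (subst Suc.IH) (auto simp: nxt)
    also have "\<dots> = map_pmf (\<lambda>xs. cfg ?s (foldl nxt r' xs) (put (?a + r' 42) xs m'))
        (rwords W (Suc n))"
      by (simp add: map_bind_pmf map_pmf_comp put_Cons nxt)
    finally show ?case .
  qed
  define R where "R = (\<lambda>xs. (foldl nxt (r1(42 := 0)) xs)(43 := 0))"
  have fol: "foldl nxt r' xs j = r' j" if "j < 42" for r' xs j
    using that by (induction xs arbitrary: r') (auto simp: nxt)
  have fol42: "foldl nxt r' xs 42 = r' 42 + length xs" for r' xs
    by (induction xs arbitrary: r') (auto simp: nxt)
  have len: "length xs = n" if "xs \<in> set_pmf (rwords W n)" for xs n
    using that by (induction n arbitrary: xs) auto
  have rep: "rep (\<lambda>_. 40) 41 (R xs) (\<lambda>_. 0) p" for xs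
    by (rule rep_mono[OF assms(2) _ order.refl]) (auto simp: R_def fol r1(3))
  have ex: "run W P 2 (cfg ?s (foldl nxt (r1(42 := 0)) xs) m') =
      return_pmf (cfg (?s + 9) (R xs) m')" if "xs \<in> set_pmf (rwords W (p j))" for xs m'
  proof -
    have "steps W P 1 (cfg ?s (foldl nxt (r1(42 := 0)) xs) m') (cfg (?s + 1) (R xs) m')"
      unfolding R_def
      by (rule steps_Bin[OF code(3)])
        (use code len[OF that] fol r1(3) rep_par[OF assms(2), of j] in \<open>auto simp: fol42\<close>)
    moreover have "steps W P 1 (cfg (?s + 1) (R xs) m') (cfg (?s + 9) (R xs) m')"
      by (rule steps_Jump[OF code(4)]) (use code in \<open>auto simp: R_def\<close>)
    ultimately show ?thesis
      using steps_trans[of W P 1 _ _ 1] unfolding steps_def one_add_one by blast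
  qed
  have "run W P (texp p a + 1 + p j * 9 + 2) (cfg k r m) =
      bind_pmf (run W P (p j * 9) (cfg ?s (r1(42 := 0)) m)) (run W P 2)"
    using steps_trans[OF r1(1) s0] unfolding steps_def
    by (simp only: run_add[of _ _ _ 2] run_add[of _ _ _ "p j * 9"] bind_return_pmf)
  also have "\<dots> = bind_pmf (rwords W (p j)) (\<lambda>xs. run W P 2
      (cfg ?s (foldl nxt (r1(42 := 0)) xs) (put ?a xs m)))"
    using r1 by (subst loop) (auto simp: bind_map_pmf)
  also have "\<dots> = bind_pmf (rwords W (p j)) (\<lambda>xs. return_pmf
      (cfg (?s + 9) (R xs) (put ?a xs m)))"
    by (intro bind_pmf_cong refl ex)
  finally show ?thesis
    using rep by (intro exI[of _ R]) (simp add: map_pmf_def cfill_def Let_def eval_nat_numeral)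
qed

definition det_prog :: "exp list \<Rightarrow> com \<Rightarrow> instr list" where
  "det_prog es c = (let A = cpars 0 0 es in A @ ccom (length A) (\<lambda>_. 40) 41 c)"

definition rand_prog :: "exp list \<Rightarrow> nat \<Rightarrow> exp \<Rightarrow> com \<Rightarrow> instr list" where
  "rand_prog es j a c = (let A = cpars 0 0 es; F = cfill (length A) j a in
     A @ F @ ccom (length A + length F) (\<lambda>_. 40) 41 c)"

lemma rep_init: "rep (\<lambda>_. 40) 41 (\<lambda>_. 0) (\<lambda>_. 0) (below 0 p)"
  by (simp add: rep_def below_def)

text \<open>A halted configuration persists, so any time bound above the exact running time gives
  the same outcome.\<close>

lemma det_prog_correct:
  assumes "params W es m p" "tpars es p + tcom p c \<le> t"
  shows "\<exists>r. run W (det_prog es c) t (cfg 0 (\<lambda>_. 0) m) =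
    return_pmf (cfg (length (det_prog es c)) r (sem W p c (\<lambda>_. 0) m))"
proof -
  let ?P = "det_prog es c"
  let ?A = "cpars 0 0 es"
  let ?C = "ccom (length ?A) (\<lambda>_. 40) 41 c"
  have "code_at ?P 0 ?P"
    by (simp add: code_at_def)
  then have code: "code_at ?P 0 ?A" "code_at ?P (length ?A) ?C"
    by (simp_all add: det_prog_def Let_def)
  have pW: "\<forall>j. p j < 2 ^ W"
    using assms(1) by (simp add: params_def)
  obtain r1 where r1: "steps W ?P (tpars es p) (cfg 0 (\<lambda>_. 0) m)
      (cfg (length ?A) r1 m)" "rep (\<lambda>_. 40) 41 r1 (\<lambda>_. 0) p"
    using cpars_correct[OF assms(1) _ _ rep_init, of ?P 0] code(1)
    by (auto simp: tpars_def atLeast0LessThan)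
  obtain r2 where r2: "steps W ?P (tcom p c) (cfg (length ?A) r1 m)
      (cfg (length ?A + length ?C) r2 (sem W p c (\<lambda>_. 0) m))"
    using ccom_correct[OF code(2) r1(2) pW] by blast
  have "run W ?P (tpars es p + tcom p c + (t - (tpars es p + tcom p c))) (cfg 0 (\<lambda>_. 0) m) =
      return_pmf (cfg (length ?P) r2 (sem W p c (\<lambda>_. 0) m))"
    unfolding run_add[of _ _ "tpars es p + tcom p c"] steps_trans[OF r1(1) r2, unfolded steps_def]
      bind_return_pmf
    by (subst halted_run) (simp_all add: halted_def det_prog_def Let_def)
  then show ?thesis
    unfolding le_add_diff_inverse[OF assms(2)] by blast
qed

lemma rand_prog_correct:
  assumes "params W es m p" "eval W p m a (\<lambda>_. 0) + p j < 2 ^ W"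
    and "tpars es p + (texp p a + 1 + p j * 9 + 2) + tcom p c \<le> t"
  shows "\<exists>R. run W (rand_prog es j a c) t (cfg 0 (\<lambda>_. 0) m) =
    map_pmf (\<lambda>xs. cfg (length (rand_prog es j a c)) (R xs) (sem W p c (\<lambda>_. 0) (put (eval W p m a (\<lambda>_. 0)) xs m))) (rwords W (p j))"
proof -
  let ?P = "rand_prog es j a c"
  let ?A = "cpars 0 0 es"
  let ?F = "cfill (length ?A) j a"
  let ?C = "ccom (length ?A + length ?F) (\<lambda>_. 40) 41 c"
  let ?a = "eval W p m a (\<lambda>_. 0)"
  have "code_at ?P 0 ?P"
    by (simp add: code_at_def)
  then have code: "code_at ?P 0 ?A" "code_at ?P (length ?A) ?F" "code_at ?P (length ?A + length ?F) ?C"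
    by (simp_all add: rand_prog_def Let_def)
  have pW: "\<forall>j. p j < 2 ^ W"
    using assms(1) by (simp add: params_def)
  obtain r1 where r1: "steps W ?P (tpars es p) (cfg 0 (\<lambda>_. 0) m)
      (cfg (length ?A) r1 m)" "rep (\<lambda>_. 40) 41 r1 (\<lambda>_. 0) p"
    using cpars_correct[OF assms(1) _ _ rep_init, of ?P 0] code(1)
    by (auto simp: tpars_def atLeast0LessThan)
  obtain R where R: "run W ?P (texp p a + 1 + p j * 9 + 2) (cfg (length ?A) r1 m) =
      map_pmf (\<lambda>xs. cfg (length ?A + length ?F) (R xs) (put ?a xs m)) (rwords W (p j))"
    "\<And>xs. rep (\<lambda>_. 40) 41 (R xs) (\<lambda>_. 0) p"
    using cfill_correct[OF code(2) r1(2) pW assms(2)] by blast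
  have "\<exists>r2. steps W ?P (tcom p c) (cfg (length ?A + length ?F) (R xs) (put ?a xs m))
      (cfg (length ?P) r2 (sem W p c (\<lambda>_. 0) (put ?a xs m)))" for xs
  proof -
    have "length ?P = length ?A + length ?F + length ?C"
      by (simp add: rand_prog_def Let_def)
    then show ?thesis
      using ccom_correct[OF code(3) R(2) pW, where m = "put ?a xs m"] by auto
  qed
  then obtain R' where R': "\<And>xs. steps W ?P (tcom p c)
      (cfg (length ?A + length ?F) (R xs) (put ?a xs m))
      (cfg (length ?P) (R' xs) (sem W p c (\<lambda>_. 0) (put ?a xs m)))"
    by metis
  let ?T = "tpars es p + (texp p a + 1 + p j * 9 + 2) + tcom p c"
  have "run W ?P (?T + (t - ?T)) (cfg 0 (\<lambda>_. 0) m) =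
      map_pmf (\<lambda>xs. cfg (length ?P) (R' xs) (sem W p c (\<lambda>_. 0) (put ?a xs m)))
        (rwords W (p j))"
    unfolding run_add[of _ _ ?T] run_add[of _ _ "tpars es p + (texp p a + 1 + p j * 9 + 2)"]
      run_add[of _ _ "tpars es p"] r1(1)[unfolded steps_def] bind_return_pmf R(1) bind_map_pmf
      R'[unfolded steps_def] bind_assoc_pmf
    by (subst halted_run) (simp_all add: halted_def map_pmf_def)
  then show ?thesis
    unfolding le_add_diff_inverse[OF assms(3)] by blast
qed

section \<open>Averages over random words\<close>

text \<open>The expectation over \<open>m\<close> independent uniform words as nested finite sums.
  Conditioning on the first words is then mere unfolding.\<close>

primrec avg :: "nat \<Rightarrow> nat \<Rightarrow> (nat list \<Rightarrow> real) \<Rightarrow> real" where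
  "avg Q 0 \<phi> = \<phi> []"
| "avg Q (Suc m) \<phi> = (\<Sum>x<Q. avg Q m (\<lambda>xs. \<phi> (x # xs))) / Q"

lemma avg_mono: "(\<And>xs. length xs = m \<Longrightarrow> \<phi> xs \<le> \<psi> xs) \<Longrightarrow> avg Q m \<phi> \<le> avg Q m \<psi>"
  by (induction m arbitrary: \<phi> \<psi>) (auto intro!: divide_right_mono sum_mono)

lemma avg_cong: "(\<And>xs. length xs = m \<Longrightarrow> \<phi> xs = \<psi> xs) \<Longrightarrow> avg Q m \<phi> = avg Q m \<psi>"
  by (intro antisym avg_mono) auto

lemma avg_add: "avg Q m (\<lambda>xs. \<phi> xs + \<psi> xs) = avg Q m \<phi> + avg Q m \<psi>"
  by (induction m arbitrary: \<phi> \<psi>) (simp_all add: sum.distrib add_divide_distrib)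

lemma avg_cmult: "avg Q m (\<lambda>xs. c * \<phi> xs) = c * avg Q m \<phi>"
  by (induction m arbitrary: \<phi>) (simp_all add: sum_distrib_left)

lemma avg_diff: "avg Q m (\<lambda>xs. \<phi> xs - \<psi> xs) = avg Q m \<phi> - avg Q m \<psi>"
  using avg_add[of Q m \<phi> "\<lambda>xs. - 1 * \<psi> xs"] by (simp add: avg_cmult[of Q m "-1", simplified])

lemma avg_zero: "avg Q m (\<lambda>_. 0) = 0"
  using avg_cmult[of Q m 0 "\<lambda>_. 0"] by simp

lemma avg_sum: "avg Q m (\<lambda>xs. \<Sum>i\<in>I. \<phi> i xs) = (\<Sum>i\<in>I. avg Q m (\<phi> i))"
  by (induction I rule: infinite_finite_induct) (simp_all add: avg_zero avg_add)

lemma avg_const: "Q > 0 \<Longrightarrow> avg Q m (\<lambda>_. c) = c"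
  by (induction m) simp_all

lemma avg_append: "avg Q (a + b) \<phi> = avg Q a (\<lambda>xs. avg Q b (\<lambda>ys. \<phi> (xs @ ys)))"
  by (induction a arbitrary: \<phi>) simp_all

text \<open>A column of a rainbow table has one hash function and hence two random words.\<close>

lemma avg_2:
  "avg Q (2 * Suc r) \<phi> = (\<Sum>a<Q. \<Sum>c<Q. avg Q (2 * r) (\<lambda>ws. \<phi> (a # c # ws))) / Q\<^sup>2"
  by (simp add: sum_divide_distrib power2_eq_square)

lemma expectation_rwords:
  "measure_pmf.expectation (rwords W m) \<phi> = avg (2 ^ W) m (\<phi> :: _ \<Rightarrow> real)"
proof (induction m arbitrary: \<phi>)
  case (Suc m)
  have ne: "{..<2 ^ W :: nat} \<noteq> {}"
    by (metis lessThan_iff empty_iff zero_less_power zero_less_numeral)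
  have fin: "finite (set_pmf (rwords W k))" for k
    by (induction k) (auto simp: set_pmf_of_set[OF ne])
  have "measure_pmf.expectation (rwords W (Suc m)) \<phi> =
      (\<Sum>x<2 ^ W. measure_pmf.expectation (map_pmf (Cons x) (rwords W m)) \<phi> /\<^sub>R real (card {..<2 ^ W :: nat}))"
    unfolding rwords.simps by (intro pmf_expectation_bind_pmf_of_set) (use ne in \<open>simp_all add: fin\<close>)
  also have "\<dots> = avg (2 ^ W) (Suc m) \<phi>"
    by (simp add: Suc sum_distrib_left divide_inverse_commute)
  finally show ?case .
qed simp

lemma prob_rwords:
  "measure_pmf.prob (rwords W m) {rs. P rs} = avg (2 ^ W) m (\<lambda>rs. of_bool (P rs))"
proof -
  have "measure_pmf.prob (rwords W m) {rs. P rs} =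
      measure_pmf.expectation (rwords W m) (indicator {rs. P rs})"
    by simp
  also have "\<dots> = avg (2 ^ W) m (indicator {rs. P rs})"
    by (rule expectation_rwords)
  finally show ?thesis
    by (simp add: indicator_def[abs_def])
qed

section \<open>Coverage of rainbow tables\<close>

text \<open>Hash functions \<open>h a c\<close> lead from bucket numbers to elements,
  \<open>f\<close> leads back. \<open>uniform\<close> and \<open>pairwise\<close> express that a
  random hash function is uniform at each point and, as far as upper bounds go, independent at two
  points. \<open>G\<close> bounds the size of a bucket.\<close>

locale rainbow =
  fixes Q N G t :: nat and h :: "nat \<Rightarrow> nat \<Rightarrow> nat \<Rightarrow> nat" and f :: "nat \<Rightarrow> nat"
  assumes Q_pos: "0 < Q" and N_pos: "0 < N"
    and h_less: "h a c b < N"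
    and f_less: "x < N \<Longrightarrow> f x < N"
    and fibre: "x < N \<Longrightarrow> card {y. y < N \<and> f y = f x} \<le> G"
    and uniform: "b < N \<Longrightarrow> x < N \<Longrightarrow>
      (\<Sum>a<Q. \<Sum>c<Q. of_bool (h a c b = x) :: real) = Q\<^sup>2 / N"
    and pairwise: "b < N \<Longrightarrow> b' < N \<Longrightarrow> b \<noteq> b' \<Longrightarrow> x < N \<Longrightarrow> y < N \<Longrightarrow>
      (\<Sum>a<Q. \<Sum>c<Q. of_bool (h a c b = x \<and> h a c b' = y) :: real) \<le> Q\<^sup>2 / N\<^sup>2"
begin

text \<open>A chain starts at \<open>b\<close> and spends two words per column;
  \<open>bucket\<close> is its end, \<open>elem i\<close> the element met in column
  \<open>i\<close>. For lists that are too short, \<open>elem\<close> is 0 by convention.\<close>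

fun bucket :: "nat list \<Rightarrow> nat \<Rightarrow> nat" where
  "bucket (a # c # ws) b = bucket ws (f (h a c b))"
| "bucket ws b = b"

fun elem :: "nat \<Rightarrow> nat list \<Rightarrow> nat \<Rightarrow> nat" where
  "elem 0 (a # c # ws) b = h a c b"
| "elem (Suc i) (a # c # ws) b = elem i ws (f (h a c b))"
| "elem i ws b = 0"

definition prob :: "nat \<Rightarrow> (nat list \<Rightarrow> bool) \<Rightarrow> real" where
  "prob r P = avg Q (2 * r) (\<lambda>ws. of_bool (P ws))"

lemma prob_nonneg: "0 \<le> prob r P"
  using avg_mono[of "2 * r" "\<lambda>_. 0" "\<lambda>ws. of_bool (P ws)" Q] by (simp add: prob_def avg_zero)

lemma prob_0: "prob 0 P = of_bool (P [])"
  by (simp add: prob_def)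

lemma prob_Suc: "prob (Suc r) P = (\<Sum>a<Q. \<Sum>c<Q. prob r (\<lambda>ws. P (a # c # ws))) / Q\<^sup>2"
  unfolding prob_def avg_2 ..

text \<open>Conditioning on the first column: \<open>h a c b\<close> is uniform on the N elements,
  so an average over the two seeds is at most the average, over the element met, of any bound that
  depends on this element alone.\<close>

lemma split_one:
  assumes "b < N" "\<And>x. x < N \<Longrightarrow> 0 \<le> \<phi> x" "\<And>a c. a < Q \<Longrightarrow> c < Q \<Longrightarrow> F a c \<le> \<phi> (h a c b)"
  shows "(\<Sum>a<Q. \<Sum>c<Q. F a c) / Q\<^sup>2 \<le> (\<Sum>x<N. \<phi> x) / N"
proof -
  have "(\<Sum>a<Q. \<Sum>c<Q. F a c) \<le> (\<Sum>a<Q. \<Sum>c<Q. \<Sum>x<N. of_bool (h a c b = x) * \<phi> x)"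
  proof (intro sum_mono)
    fix a c assume "a \<in> {..<Q}" "c \<in> {..<Q}"
    then have "F a c \<le> \<phi> (h a c b)" using assms(3) by auto
    also have "\<dots> = (\<Sum>x<N. of_bool (h a c b = x) * \<phi> x)"
      using h_less[of a c b] by (subst sum.remove[of _ "h a c b"]) (auto intro!: sum.neutral)
    finally show "F a c \<le> (\<Sum>x<N. of_bool (h a c b = x) * \<phi> x)" .
  qed
  also have "\<dots> = (\<Sum>a<Q. \<Sum>x<N. \<Sum>c<Q. of_bool (h a c b = x) * \<phi> x)"
    by (intro sum.cong refl sum.swap)
  also have "\<dots> = (\<Sum>x<N. \<Sum>a<Q. \<Sum>c<Q. of_bool (h a c b = x) * \<phi> x)"
    by (rule sum.swap)
  also have "\<dots> = (\<Sum>x<N. (\<Sum>a<Q. \<Sum>c<Q. of_bool (h a c b = x)) * \<phi> x)"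
    by (simp add: sum_distrib_right)
  also have "\<dots> = (\<Sum>x<N. Q\<^sup>2 / N * \<phi> x)"
    using uniform[OF assms(1)] by (intro sum.cong) auto
  also have "\<dots> = Q\<^sup>2 * ((\<Sum>x<N. \<phi> x) / N)"
    by (simp add: sum_distrib_left sum_divide_distrib)
  finally show ?thesis
    using Q_pos by (subst pos_divide_le_eq) (simp_all only: mult.commute zero_less_power of_nat_0_less_iff)
qed

text \<open>Conditioning on the first column for two chains at once. The inequality
  \<open>pairwise\<close> is weighted by \<open>\<phi>\<close>, which is where the sign of
  \<open>\<phi>\<close> enters.\<close>

lemma split_two:
  assumes "b < N" "b' < N" "b \<noteq> b'" "\<And>x y. x < N \<Longrightarrow> y < N \<Longrightarrow> 0 \<le> \<phi> x y"
    and "\<And>a c. a < Q \<Longrightarrow> c < Q \<Longrightarrow> F a c \<le> \<phi> (h a c b) (h a c b')"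
  shows "(\<Sum>a<Q. \<Sum>c<Q. F a c) / Q\<^sup>2 \<le> (\<Sum>x<N. \<Sum>y<N. \<phi> x y) / N\<^sup>2"
proof -
  let ?I = "\<lambda>a c x y. of_bool (h a c b = x \<and> h a c b' = y) :: real"
  have cp: "(\<Sum>a\<in>A. \<Sum>c\<in>B. g a c) = (\<Sum>p\<in>A \<times> B. g (fst p) (snd p))"
    for A B :: "nat set" and g :: "nat \<Rightarrow> nat \<Rightarrow> real"
    by (simp add: sum.cartesian_product case_prod_beta)
  note cpQ = cp[where A = "{..<Q}" and B = "{..<Q}"] and cpN = cp[where A = "{..<N}" and B = "{..<N}"]
  have "(\<Sum>a<Q. \<Sum>c<Q. F a c) \<le> (\<Sum>a<Q. \<Sum>c<Q. \<Sum>x<N. \<Sum>y<N. ?I a c x y * \<phi> x y)"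
  proof (intro sum_mono)
    fix a c assume "a \<in> {..<Q}" "c \<in> {..<Q}"
    then have "F a c \<le> \<phi> (h a c b) (h a c b')" using assms(5) by auto
    also have "\<dots> = (\<Sum>y<N. ?I a c (h a c b) y * \<phi> (h a c b) y)"
      using h_less[of a c b'] by (subst sum.remove[of _ "h a c b'"]) (auto intro!: sum.neutral)
    also have "\<dots> = (\<Sum>x<N. \<Sum>y<N. ?I a c x y * \<phi> x y)"
      using h_less[of a c b]
      by (subst (2) sum.remove[of _ "h a c b"]) (auto intro!: sum.neutral)
    finally show "F a c \<le> (\<Sum>x<N. \<Sum>y<N. ?I a c x y * \<phi> x y)" .
  qed
  also have "\<dots> = (\<Sum>p\<in>{..<Q} \<times> {..<Q}. \<Sum>q\<in>{..<N} \<times> {..<N}.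
      ?I (fst p) (snd p) (fst q) (snd q) * \<phi> (fst q) (snd q))"
    unfolding cpQ cpN ..
  also have "\<dots> = (\<Sum>q\<in>{..<N} \<times> {..<N}. \<Sum>p\<in>{..<Q} \<times> {..<Q}.
      ?I (fst p) (snd p) (fst q) (snd q) * \<phi> (fst q) (snd q))"
    by (rule sum.swap)
  also have "\<dots> = (\<Sum>x<N. \<Sum>y<N. (\<Sum>a<Q. \<Sum>c<Q. ?I a c x y) * \<phi> x y)"
    unfolding cpQ cpN sum_distrib_right ..
  also have "\<dots> \<le> (\<Sum>x<N. \<Sum>y<N. Q\<^sup>2 / N\<^sup>2 * \<phi> x y)"
    using pairwise[OF assms(1-3)] assms(4) by (intro sum_mono mult_right_mono) auto
  also have "\<dots> = Q\<^sup>2 * ((\<Sum>x<N. \<Sum>y<N. \<phi> x y) / N\<^sup>2)"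
    by (simp add: sum_distrib_left sum_divide_distrib)
  finally show ?thesis
    using Q_pos by (subst pos_divide_le_eq) (simp_all only: mult.commute zero_less_power of_nat_0_less_iff)
qed

lemma fibre_sum:
  assumes "x < N"
  shows "(\<Sum>y<N. of_bool (f x = f y)) \<le> real G"
proof -
  have "(\<Sum>y<N. of_bool (f x = f y)) = real (card {y. y < N \<and> f y = f x})"
    by (simp add: of_bool_def sum.If_cases Int_def eq_commute)
  then show ?thesis using fibre[OF assms] by simp
qed

text \<open>Column \<open>i\<close> has a fresh hash function, so its element is uniform whatever
  the chain did before.\<close>

lemma prob_elem_le: "b < N \<Longrightarrow> x < N \<Longrightarrow> i < r \<Longrightarrow> prob r (\<lambda>ws. elem i ws b = x) \<le> 1 / N"
proof (induction i arbitrary: b r)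
  case 0
  then obtain r' where r: "r = Suc r'" by (cases r) auto
  have "prob r (\<lambda>ws. elem 0 ws b = x) \<le> (\<Sum>y<N. of_bool (y = x)) / N"
    unfolding r prob_Suc using 0
    by (intro split_one[of b]) (auto simp: prob_def avg_const[OF Q_pos])
  also have "\<dots> = 1 / N" using 0 by (simp add: of_bool_def sum.delta')
  finally show ?case .
next
  case (Suc i)
  then obtain r' where r: "r = Suc r'" by (cases r) auto
  have "prob r (\<lambda>ws. elem (Suc i) ws b = x) \<le> (\<Sum>y<N. 1 / N) / N"
    unfolding r prob_Suc using Suc r f_less h_less
    by (intro split_one[of b]) (auto simp: prob_nonneg)
  then show ?case using N_pos by simp
qed

lemma prob_elem_eq: "b < N \<Longrightarrow> x < N \<Longrightarrow> i < r \<Longrightarrow> prob r (\<lambda>ws. elem i ws b = x) = 1 / N"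
proof (induction i arbitrary: b r)
  case 0
  then obtain r' where r: "r = Suc r'" by (cases r) auto
  have "prob r (\<lambda>ws. elem 0 ws b = x) = (\<Sum>a<Q. \<Sum>c<Q. of_bool (h a c b = x)) / Q\<^sup>2"
    unfolding r prob_Suc by (simp add: prob_def avg_const[OF Q_pos])
  then show ?case using uniform[OF 0(1,2)] Q_pos by simp
next
  case (Suc i)
  then obtain r' where r: "r = Suc r'" by (cases r) auto
  have "prob r (\<lambda>ws. elem (Suc i) ws b = x) = (\<Sum>a<Q. \<Sum>c<Q. 1 / N) / Q\<^sup>2"
    unfolding r prob_Suc using Suc r f_less h_less
    by (intro arg_cong2[where f = "(/)"] sum.cong refl) auto
  then show ?case using Q_pos by (simp add: power2_eq_square)
qed

text \<open>Two chains in different buckets fall into a common bucket in one column with probability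
  at most N * G / N^2 = G / N. This is summed over the columns; once merged, chains stay
  merged.\<close>

lemma prob_merge:
  assumes "b < N" "b' < N" "b \<noteq> b'"
  shows "prob r (\<lambda>ws. bucket ws b = bucket ws b') \<le> r * G / N"
  using assms
proof (induction r arbitrary: b b')
  case 0
  then show ?case by (simp add: prob_0)
next
  case (Suc r)
  have "prob (Suc r) (\<lambda>ws. bucket ws b = bucket ws b') \<le>
      (\<Sum>x<N. \<Sum>y<N. of_bool (f x = f y) + r * G / N) / N\<^sup>2"
    unfolding prob_Suc
  proof (intro split_two[of b b'])
    fix a c
    show "prob r (\<lambda>ws. bucket (a # c # ws) b = bucket (a # c # ws) b') \<le>
        of_bool (f (h a c b) = f (h a c b')) + r * G / N"
    proof (cases "f (h a c b) = f (h a c b')")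
      case True
      then show ?thesis by (simp add: prob_def avg_const[OF Q_pos])
    next
      case False
      then show ?thesis using Suc.IH[OF _ _ False] f_less h_less by simp
    qed
  qed (use Suc.prems in auto)
  also have "\<dots> = ((\<Sum>x<N. \<Sum>y<N. of_bool (f x = f y)) + real (N * (r * G))) / N\<^sup>2"
    using N_pos by (simp add: sum.distrib)
  also have "\<dots> \<le> (real (N * G) + real (N * (r * G))) / N\<^sup>2"
  proof (intro divide_right_mono add_right_mono)
    have "(\<Sum>x<N. \<Sum>y<N. of_bool (f x = f y)) \<le> (\<Sum>x<N. real G)"
      using fibre_sum by (intro sum_mono) auto
    then show "(\<Sum>x<N. \<Sum>y<N. of_bool (f x = f y)) \<le> real (N * G)" by simp
  qed simp_all
  also have "\<dots> = Suc r * G / N"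
    using N_pos by (simp add: field_simps power2_eq_square)
  finally show ?case .
qed

text \<open>Meeting \<open>x\<close> and merging behave as if they were independent. If the chains
  merge before column \<open>i\<close>, the element there is still uniform. If they merge in column
  \<open>i\<close>, the other chain has to meet one of the at most \<open>G\<close> elements in the
  bucket of \<open>x\<close>. If they merge later, \<open>prob_merge\<close> applies after
  \<open>x\<close> has been met.\<close>

lemma prob_elem_merge:
  assumes "b < N" "b' < N" "b \<noteq> b'" "x < N" "i < r"
  shows "prob r (\<lambda>ws. elem i ws b = x \<and> bucket ws b = bucket ws b') \<le> r * G / N\<^sup>2"
  using assms
proof (induction i arbitrary: b b' r)
  case 0
  then obtain r' where r: "r = Suc r'" by (cases r) auto
  have "prob (Suc r') (\<lambda>ws. elem 0 ws b = x \<and> bucket ws b = bucket ws b') \<le>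
      (\<Sum>z<N. \<Sum>y<N. of_bool (z = x) * (of_bool (f x = f y) + r' * G / N)) / N\<^sup>2"
    unfolding prob_Suc
  proof (intro split_two[of b b'])
    fix a c
    show "prob r' (\<lambda>ws. elem 0 (a # c # ws) b = x \<and> bucket (a # c # ws) b = bucket (a # c # ws) b') \<le>
       of_bool (h a c b = x) * (of_bool (f x = f (h a c b')) + r' * G / N)"
    proof (cases "h a c b = x \<and> f x \<noteq> f (h a c b')")
      case True
      then have "prob r' (\<lambda>ws. bucket ws (f x) = bucket ws (f (h a c b'))) \<le> r' * G / N"
        using prob_merge[of "f x" "f (h a c b')" r'] f_less h_less 0 by blast
      then show ?thesis using True by simp
    qed (auto simp: prob_def avg_const[OF Q_pos] avg_zero)
  qed (use 0 in auto)
  also have "(\<Sum>z<N. \<Sum>y<N. of_bool (z = x) * (of_bool (f x = f y) + real (r' * G) / N)) =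
      (\<Sum>y<N. of_bool (f x = f y) + r' * G / N)"
    unfolding sum_distrib_left[symmetric] sum_distrib_right[symmetric]
    using 0 by (simp add: of_bool_def sum.delta)
  also have "\<dots> / N\<^sup>2 \<le> (real G + real (r' * G)) / N\<^sup>2"
    using fibre_sum[OF \<open>x < N\<close>] N_pos by (intro divide_right_mono) (auto simp: sum.distrib)
  finally show ?case by (simp add: r algebra_simps)
next
  case (Suc i)
  then obtain r' where r: "r = Suc r'" by (cases r) auto
  have "prob (Suc r') (\<lambda>ws. elem (Suc i) ws b = x \<and> bucket ws b = bucket ws b') \<le>
      (\<Sum>z<N. \<Sum>y<N. of_bool (f z = f y) * (1 / N) + r' * G / N\<^sup>2) / N\<^sup>2"
    unfolding prob_Suc
  proof (intro split_two[of b b'])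
    fix a c
    let ?z = "f (h a c b)" and ?y = "f (h a c b')"
    show "prob r' (\<lambda>ws. elem (Suc i) (a # c # ws) b = x \<and>
          bucket (a # c # ws) b = bucket (a # c # ws) b') \<le>
        of_bool (?z = ?y) * (1 / N) + r' * G / N\<^sup>2"
    proof (cases "?z = ?y")
      case True
      have "prob r' (\<lambda>ws. elem i ws ?z = x) \<le> 1 / N"
        using Suc.prems r f_less h_less by (intro prob_elem_le) auto
      also have "\<dots> \<le> 1 / N + r' * G / N\<^sup>2" by simp
      finally show ?thesis using True by simp
    next
      case False
      then show ?thesis using Suc.IH[OF _ _ False] Suc.prems r f_less h_less by simp
    qed
  qed (use Suc.prems in auto)
  also have "(\<Sum>z<N. \<Sum>y<N. of_bool (f z = f y) * (1 / N) + real (r' * G) / N\<^sup>2) =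
      (\<Sum>z<N. \<Sum>y<N. of_bool (f z = f y)) * (1 / N) + real (r' * G)"
  proof -
    have "(\<Sum>z<N. \<Sum>y<N. of_bool (f z = f y) * (1 / N) + u) =
        (\<Sum>z<N. \<Sum>y<N. of_bool (f z = f y)) * (1 / N) + real N * real N * u" for u :: real
      by (simp only: sum.distrib sum_distrib_right) simp
    then show ?thesis using N_pos by (simp add: power2_eq_square)
  qed
  also have "\<dots> / N\<^sup>2 \<le> (real G + real (r' * G)) / N\<^sup>2"
  proof (intro divide_right_mono add_right_mono)
    have "(\<Sum>x<N. \<Sum>y<N. of_bool (f x = f y)) \<le> (\<Sum>x<N. real G)"
      using fibre_sum by (intro sum_mono) auto
    then show "(\<Sum>z<N. \<Sum>y<N. of_bool (f z = f y)) * (1 / N) \<le> real G"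
      using N_pos by (simp add: field_simps)
  qed simp_all
  finally show ?case by (simp add: r algebra_simps)
qed

text \<open>The later column is fresh given the earlier one, also when both elements lie on the same
  chain.\<close>

lemma prob_elem_elem:
  assumes "b < N" "b' < N" "x < N" "i < i'" "i' < r"
  shows "prob r (\<lambda>ws. elem i ws b = x \<and> elem i' ws b' = x) \<le> 1 / N\<^sup>2"
  using assms
proof (induction i arbitrary: b b' r i')
  case 0
  then obtain r' i'' where r: "r = Suc r'" "i' = Suc i''" by (cases r; cases i') auto
  have "prob (Suc r') (\<lambda>ws. elem 0 ws b = x \<and> elem i' ws b' = x) \<le>
      (\<Sum>z<N. of_bool (z = x) * (1 / N)) / N"
    unfolding prob_Suc
  proof (intro split_one[of b])
    fix a c
    have "prob r' (\<lambda>ws. elem i'' ws (f (h a c b')) = x) \<le> 1 / N"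
      using 0 r f_less h_less by (intro prob_elem_le) auto
    then show "prob r' (\<lambda>ws. elem 0 (a # c # ws) b = x \<and> elem i' (a # c # ws) b' = x)
        \<le> of_bool (h a c b = x) * (1 / N)"
      unfolding r by (cases "h a c b = x") (auto simp: prob_def avg_zero)
  qed (use 0 in auto)
  also have "(\<Sum>z<N. of_bool (z = x) * (1 / real N)) = 1 / N"
    using 0 by (subst sum.remove[of _ x]) (auto intro!: sum.neutral)
  also have "1 / real N / N = 1 / N\<^sup>2"
    by (simp add: power2_eq_square)
  finally show ?case by (simp add: r)
next
  case (Suc i)
  then obtain r' i'' where r: "r = Suc r'" "i' = Suc i''" by (cases r; cases i') auto
  have "prob r (\<lambda>ws. elem (Suc i) ws b = x \<and> elem i' ws b' = x) \<le> (\<Sum>y<N. 1 / N\<^sup>2) / N"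
    unfolding r prob_Suc using Suc r f_less h_less
    by (intro split_one[of b]) (auto simp: prob_nonneg)
  then show ?case using N_pos by simp
qed

text \<open>This disposes of two chains that meet an element in the same column: from there on they
  coincide.\<close>

lemma elem_eq_bucket:
  "elem i ws b = elem i ws b' \<Longrightarrow> length ws = 2 * r \<Longrightarrow> i < r \<Longrightarrow> bucket ws b = bucket ws b'"
proof (induction i arbitrary: ws b b' r)
  case 0
  then obtain a c ws' where ws: "ws = a # c # ws'"
    using numeral_2_eq_2 by (cases r) (auto simp: length_Suc_conv)
  then show ?case using 0(1) by simp
next
  case (Suc i)
  then obtain a c ws' where ws: "ws = a # c # ws'"
    using numeral_2_eq_2 by (cases r) (auto simp: length_Suc_conv)
  then show ?case using Suc.IH[of ws' "f (h a c b)" "f (h a c b')" "r - 1"] Suc.prems by auto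
qed

text \<open>A lookup knows only the end of a chain and has to recover its start, so meeting
  \<open>x\<close> is of use only on a chain that shares its end with no other chain of the
  table.\<close>

definition hit :: "nat \<Rightarrow> nat list \<Rightarrow> nat \<Rightarrow> nat \<Rightarrow> nat \<Rightarrow> bool" where
  "hit M ws x c i \<longleftrightarrow> elem i ws c = x \<and> (\<forall>c'<M. c' \<noteq> c \<longrightarrow> bucket ws c' \<noteq> bucket ws c)"

definition covered :: "nat \<Rightarrow> nat list \<Rightarrow> nat \<Rightarrow> bool" where
  "covered M ws x \<longleftrightarrow> (\<exists>c<M. \<exists>i<t. hit M ws x c i)"

text \<open>
  Second moment bound: if \<open>z\<close> counts the hits of \<open>x\<close>, then \<open>x\<close> is covered at least
  \<open>2 * z - z\<^sup>2\<close> times.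
\<close>

lemma prob_covered:
  assumes "M \<le> N" "x < N"
  shows "M * t / N - (M * t) * (M * t * G) / N\<^sup>2 - (M * t)\<^sup>2 / N\<^sup>2 \<le> prob t (\<lambda>ws. covered M ws x)"
proof -
  define I where "I = {..<M} \<times> {..<t}"
  have I: "finite I" "card I = M * t" by (auto simp: I_def)
  define A where "A = (\<lambda>ws q. of_bool (hit M ws x (fst q) (snd q)) :: real)"
  define E where "E = avg Q (2 * t)"
  have pointwise: "(\<Sum>q\<in>I. A ws q) - (\<Sum>q\<in>I. \<Sum>q'\<in>I - {q}. A ws q * A ws q') \<le>
      of_bool (covered M ws x)" for ws
  proof -
    define z where "z = (\<Sum>q\<in>I. of_bool (hit M ws x (fst q) (snd q)) :: nat)"
    have z: "(\<Sum>q\<in>I. A ws q) = real z"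
      by (simp add: z_def A_def)
    \<comment> \<open>As \<open>A\<close> takes only the values 0 and 1, the sum over ordered pairs
      of distinct hits is z * z - z.\<close>
    have "(\<Sum>q\<in>I. \<Sum>q'\<in>I - {q}. A ws q * A ws q') = (\<Sum>q\<in>I. A ws q * (real z - A ws q))"
      using I by (simp add: sum_distrib_left[symmetric] sum_diff1 z)
    also have "\<dots> = real z * real z - (\<Sum>q\<in>I. A ws q * A ws q)"
      by (simp add: right_diff_distrib sum_subtractf sum_distrib_right[symmetric] z)
    also have "(\<Sum>q\<in>I. A ws q * A ws q) = real z"
      unfolding z[symmetric] by (intro sum.cong) (auto simp: A_def)
    finally have eq: "(\<Sum>q\<in>I. A ws q) - (\<Sum>q\<in>I. \<Sum>q'\<in>I - {q}. A ws q * A ws q') =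
        2 * real z - real z * real z" unfolding z by simp
    show ?thesis
    proof (cases "z = 0")
      case True
      then show ?thesis unfolding eq by simp
    next
      case False
      have "\<exists>q\<in>I. hit M ws x (fst q) (snd q)"
      proof (rule ccontr)
        assume "\<not> (\<exists>q\<in>I. hit M ws x (fst q) (snd q))"
        then have "z = 0" unfolding z_def by (intro sum.neutral) auto
        then show False using False by simp
      qed
      then obtain q where "q \<in> I" "hit M ws x (fst q) (snd q)" by blast
      then have "covered M ws x"
        unfolding covered_def I_def mem_Times_iff lessThan_iff by blast
      moreover have "2 * real z - real z * real z \<le> 1"
        using zero_le_power2[of "real z - 1"] by (simp add: power2_eq_square algebra_simps)
      ultimately show ?thesis unfolding eq by simp
    qed
  qed
  \<comment> \<open>Meeting \<open>x\<close> fails to be a hit only if some other chain merges; a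
    union bound over the other chains is subtracted.\<close>
  have EA: "1 / N - M * t * G / N\<^sup>2 \<le> E (\<lambda>ws. A ws q)" if qI: "q \<in> I" for q
  proof -
    obtain c i where q: "q = (c, i)" "c < M" "i < t"
      using qI unfolding I_def by (cases q) auto
    have "E (\<lambda>ws. of_bool (elem i ws c = x) -
        (\<Sum>c'\<in>{..<M} - {c}. of_bool (elem i ws c = x \<and> bucket ws c = bucket ws c'))) \<le> E (\<lambda>ws. A ws q)"
      unfolding E_def
    proof (intro avg_mono)
      fix ws :: "nat list"
      let ?S = "\<Sum>c'\<in>{..<M} - {c}. of_bool (elem i ws c = x \<and> bucket ws c = bucket ws c') :: real"
      have nn: "0 \<le> ?S" by (intro sum_nonneg) auto
      show "of_bool (elem i ws c = x) - ?S \<le> A ws q"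
      proof (cases "hit M ws x c i \<or> elem i ws c \<noteq> x")
        case True
        then show ?thesis using nn by (auto simp: A_def q hit_def)
      next
        case False
        then obtain c' where c': "c' < M" "c' \<noteq> c" "bucket ws c = bucket ws c'" "elem i ws c = x"
          unfolding hit_def by metis
        have "1 \<le> ?S"
          using c' member_le_sum[of c' "{..<M} - {c}"
            "\<lambda>c'. of_bool (elem i ws c = x \<and> bucket ws c = bucket ws c') :: real"] by simp
        then show ?thesis using c' by (simp add: A_def)
      qed
    qed
    also have "E (\<lambda>ws. of_bool (elem i ws c = x) -
        (\<Sum>c'\<in>{..<M} - {c}. of_bool (elem i ws c = x \<and> bucket ws c = bucket ws c'))) =
        prob t (\<lambda>ws. elem i ws c = x) -
        (\<Sum>c'\<in>{..<M} - {c}. prob t (\<lambda>ws. elem i ws c = x \<and> bucket ws c = bucket ws c'))"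
      unfolding E_def avg_diff avg_sum prob_def ..
    finally have "prob t (\<lambda>ws. elem i ws c = x) -
        (\<Sum>c'\<in>{..<M} - {c}. prob t (\<lambda>ws. elem i ws c = x \<and> bucket ws c = bucket ws c')) \<le>
        E (\<lambda>ws. A ws q)" .
    moreover have "prob t (\<lambda>ws. elem i ws c = x) = 1 / N"
      using q assms by (intro prob_elem_eq) auto
    moreover have "(\<Sum>c'\<in>{..<M} - {c}. prob t (\<lambda>ws. elem i ws c = x \<and> bucket ws c = bucket ws c'))
        \<le> (\<Sum>c'\<in>{..<M} - {c}. t * G / N\<^sup>2)"
      using q assms by (intro sum_mono prob_elem_merge) auto
    moreover have "(\<Sum>c'\<in>{..<M} - {c}. real (t * G) / N\<^sup>2) \<le> (\<Sum>c'\<in>{..<M}. t * G / N\<^sup>2)"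
      by (intro sum_mono2) auto
    ultimately show ?thesis by simp
  qed
  have EAA: "E (\<lambda>ws. A ws q * A ws q') \<le> 1 / N\<^sup>2" if qI: "q \<in> I" "q' \<in> I - {q}" for q q'
  proof -
    obtain c i c' i' where q: "q = (c, i)" "c < M" "i < t" "q' = (c', i')" "c' < M" "i' < t"
      "(c, i) \<noteq> (c', i')"
      using qI unfolding I_def by (cases q; cases q') auto
    have swap: "E (\<lambda>ws. A ws q * A ws q') \<le> prob t (\<lambda>ws. elem i ws c = x \<and> elem i' ws c' = x)"
      unfolding E_def prob_def by (intro avg_mono) (auto simp: A_def q hit_def)
    consider "i < i'" | "i' < i" | "i = i'" "c \<noteq> c'" using q(7) by force
    then show ?thesis
    proof cases
      case 1
      then show ?thesis using swap prob_elem_elem[of c c' x i i' t] q assms by linarith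
    next
      case 2
      then show ?thesis
        using swap prob_elem_elem[of c' c x i' i t] q assms by (simp add: conj_commute)
    next
      \<comment> \<open>Same column, different chains: if both met \<open>x\<close> they would have
        a common end, which a hit excludes, so the product vanishes.\<close>
      case 3
      have "E (\<lambda>ws. A ws q * A ws q') \<le> E (\<lambda>_. 0)"
        unfolding E_def
      proof (intro avg_mono)
        fix ws :: "nat list"
        assume "length ws = 2 * t"
        then show "A ws q * A ws q' \<le> 0"
          using elem_eq_bucket[of i ws c c' t] 3 q by (auto simp: A_def hit_def)
      qed
      then show ?thesis unfolding E_def avg_zero
        by (meson order.trans divide_nonneg_nonneg of_nat_0_le_iff zero_le_one)
    qed
  qed
  have "M * t / N - (M * t) * (M * t * G) / N\<^sup>2 - (M * t)\<^sup>2 / N\<^sup>2 =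
      (\<Sum>q\<in>I. 1 / N - M * t * G / N\<^sup>2) - (\<Sum>q\<in>I. \<Sum>q'\<in>I. 1 / N\<^sup>2)"
    using I by (simp add: power2_eq_square right_diff_distrib)
  also have "\<dots> \<le> (\<Sum>q\<in>I. E (\<lambda>ws. A ws q)) - (\<Sum>q\<in>I. \<Sum>q'\<in>I - {q}. E (\<lambda>ws. A ws q * A ws q'))"
  proof (intro diff_mono sum_mono EA)
    fix q assume q: "q \<in> I"
    have "(\<Sum>q'\<in>I - {q}. E (\<lambda>ws. A ws q * A ws q')) \<le> (\<Sum>q'\<in>I - {q}. 1 / N\<^sup>2)"
      using q by (intro sum_mono EAA)
    also have "\<dots> \<le> (\<Sum>q'\<in>I. 1 / N\<^sup>2)"
      using I by (intro sum_mono2) auto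
    finally show "(\<Sum>q'\<in>I - {q}. E (\<lambda>ws. A ws q * A ws q')) \<le> (\<Sum>q'\<in>I. 1 / N\<^sup>2)" .
  qed
  also have "\<dots> = E (\<lambda>ws. (\<Sum>q\<in>I. A ws q) - (\<Sum>q\<in>I. \<Sum>q'\<in>I - {q}. A ws q * A ws q'))"
    unfolding E_def avg_diff avg_sum ..
  also have "\<dots> \<le> prob t (\<lambda>ws. covered M ws x)"
    unfolding E_def prob_def by (intro avg_mono pointwise)
  finally show ?thesis .
qed

definition block :: "nat \<Rightarrow> nat list \<Rightarrow> nat list" where
  "block s rs = take (2 * t) (drop (2 * t * s) rs)"

text \<open>With M * t * G = N / 4 the mean number of times that x is met is 1 / (4 * G); merges and
  double hits each cost at most a quarter of it, which leaves 1 / (8 * G). Different tables use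
  disjoint blocks of words, so their failure probabilities multiply.\<close>

lemma prob_uncovered:
  assumes "4 * M * t * G = N" "x < N" "1 \<le> G"
  shows "avg Q (2 * t * l) (\<lambda>rs. of_bool (\<forall>s<l. \<not> covered M (block s rs) x)) \<le> (1 - 1 / (8 * G)) ^ l"
proof (induction l)
  case (Suc l)
  let ?p = "avg Q (2 * t * l) (\<lambda>rs. of_bool (\<forall>s<l. \<not> covered M (block s rs) x))"
  have "M \<le> N" using assms N_pos by (cases "t = 0") auto
  have "t \<noteq> 0" using assms N_pos by (intro notI) simp
  have MtG: "real M * t * G = N / 4"
    using assms(1) by (metis nonzero_mult_div_cancel_left of_nat_mult of_nat_numeral mult.assoc zero_neq_numeral)
  have "1 / (8 * G) \<le> 1 / (4 * G) - 1 / (4 * G) * (1 / 4) - (1 / (4 * real G)) * (1 / 4)"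
    using assms(3) by (simp add: field_simps)
  also have "\<dots> \<le> 1 / (4 * G) - 1 / (4 * G) * (1 / 4) - (1 / (4 * real G)) * (1 / (4 * G))"
    using assms(3) by (intro diff_left_mono mult_left_mono) (auto simp: field_simps)
  also have "\<dots> = M * t / N - (M * t) * (M * t * G) / N\<^sup>2 - (M * t)\<^sup>2 / N\<^sup>2"
  proof -
    have "real M * t / N = 1 / (4 * G)"
    proof -
      have "real M * t = N / (4 * G)" using MtG assms(3) by (simp add: field_simps)
      then show ?thesis using N_pos by simp
    qed
    moreover have "real M * t * G / N = 1 / 4"
      using MtG N_pos by simp
    moreover have "(M * t) * (M * t * G) / N\<^sup>2 = (real M * t / N) * (real M * t * G / N)"
      by (simp add: power2_eq_square)
    moreover have "(real (M * t))\<^sup>2 / N\<^sup>2 = (real M * t / N) * (real M * t / N)"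
      by (simp add: power2_eq_square)
    ultimately show ?thesis by (simp only: of_nat_mult of_nat_power of_nat_numeral)
  qed
  also have "\<dots> \<le> prob t (\<lambda>ws. covered M ws x)"
    by (rule prob_covered[OF \<open>M \<le> N\<close> assms(2)])
  finally have p: "1 / (8 * G) \<le> prob t (\<lambda>ws. covered M ws x)" .
  have "prob t (\<lambda>ws. \<not> covered M ws x) = avg Q (2 * t) (\<lambda>ws. 1 - of_bool (covered M ws x))"
    unfolding prob_def by (intro avg_cong) auto
  also have "\<dots> = 1 - prob t (\<lambda>ws. covered M ws x)"
    unfolding avg_diff prob_def avg_const[OF Q_pos] ..
  finally have p': "prob t (\<lambda>ws. \<not> covered M ws x) \<le> 1 - 1 / (8 * G)"
    using p by simp
  have "avg Q (2 * t * Suc l) (\<lambda>rs. of_bool (\<forall>s<Suc l. \<not> covered M (block s rs) x)) =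
      avg Q (2 * t) (\<lambda>ws. avg Q (2 * t * l) (\<lambda>rs.
        of_bool (\<forall>s<Suc l. \<not> covered M (block s (ws @ rs)) x)))"
    unfolding mult_Suc_right avg_append ..
  also have "\<dots> = avg Q (2 * t) (\<lambda>ws. avg Q (2 * t * l) (\<lambda>rs. of_bool (\<not> covered M ws x) *
        of_bool (\<forall>s<l. \<not> covered M (block s rs) x)))"
  proof (intro avg_cong)
    fix ws rs :: "nat list"
    assume "length ws = 2 * t"
    then have "block 0 (ws @ rs) = ws" "block (Suc s) (ws @ rs) = block s rs" for s
      by (simp_all add: block_def)
    then show "(of_bool (\<forall>s<Suc l. \<not> covered M (block s (ws @ rs)) x) :: real) =
        of_bool (\<not> covered M ws x) * of_bool (\<forall>s<l. \<not> covered M (block s rs) x)"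
      unfolding of_bool_conj[symmetric] All_less_Suc2 by simp
  qed
  also have "\<dots> = avg Q (2 * t) (\<lambda>ws. ?p * of_bool (\<not> covered M ws x))"
    by (intro avg_cong) (simp only: avg_cmult mult.commute)
  also have "\<dots> = ?p * prob t (\<lambda>ws. \<not> covered M ws x)"
    unfolding avg_cmult prob_def ..
  also have "\<dots> \<le> (1 - 1 / (8 * G)) ^ l * (1 - 1 / (8 * G))"
    using assms(3) by (intro mult_mono p' Suc) (auto simp: prob_nonneg field_simps)
  finally show ?case by (simp add: mult.commute)
qed simp

end

section \<open>Multiply-shift hashing\<close>

text \<open>The multiply-shift scheme of Dietzfelbinger for \<open>k\<close>-bit arguments: the
  upper half of the 2 * k bits of a linear function. The discarded \<open>k\<close> bits absorb the
  zero divisors modulo a power of two and so make the scheme pairwise independent.\<close>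

definition mshash :: "nat \<Rightarrow> nat \<Rightarrow> nat \<Rightarrow> nat \<Rightarrow> nat" where
  "mshash k a c b = ((a * b + c) mod 2 ^ (2 * k)) div 2 ^ k"

lemma sum_periodic: "(\<Sum>c<q * m. \<phi> (c mod m)) = real q * (\<Sum>r<m. \<phi> r :: real)"
proof (induction q)
  case (Suc q)
  have "(\<Sum>c<Suc q * m. \<phi> (c mod m)) = (\<Sum>c<q * m. \<phi> (c mod m)) + (\<Sum>c=q * m..<q * m + m. \<phi> (c mod m))"
    by (simp add: lessThan_atLeast0 sum.atLeastLessThan_concat add.commute)
  also have "(\<Sum>c=q * m..<q * m + m. \<phi> (c mod m)) = (\<Sum>r<m. \<phi> r)"
    using sum.shift_bounds_nat_ivl[of "\<lambda>c. \<phi> (c mod m)" 0 "q * m" m]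
    by (simp add: lessThan_atLeast0 add.commute)
  finally show ?case unfolding Suc by (simp add: algebra_simps)
qed simp

lemma sum_shift_mod:
  assumes "0 < (m :: nat)"
  shows "(\<Sum>c<m. \<phi> ((z + c) mod m)) = (\<Sum>r<m. \<phi> r :: real)"
proof -
  have inj: "inj_on (\<lambda>c. (z + c) mod m) {..<m}"
  proof (rule linorder_inj_onI')
    fix c c' assume c: "c \<in> {..<m}" "c' \<in> {..<m}" "c < c'"
    show "(z + c) mod m \<noteq> (z + c') mod m"
    proof
      assume "(z + c) mod m = (z + c') mod m"
      then have "m dvd (z + c') - (z + c)"
        using c by (metis add_left_mono less_imp_le_nat mod_eq_dvd_iff_nat)
      then have "m dvd c' - c" by simp
      then show False using c dvd_imp_le[of m "c' - c"] by auto
    qed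
  qed
  have "(\<lambda>c. (z + c) mod m) ` {..<m} = {..<m}"
    using assms by (intro endo_inj_surj inj) auto
  then show ?thesis
    using sum.reindex[OF inj, of \<phi>] by simp
qed

text \<open>A linear congruence: two solutions differ by a multiple of \<open>m div g\<close>, so
  each of the g intervals of that length contains at most one.\<close>

lemma card_fibre_le:
  fixes \<delta> m u y :: nat
  assumes "0 < m"
  shows "card {a. a < m \<and> (u + a * \<delta>) mod m = y} \<le> gcd \<delta> m"
proof -
  define g where "g = gcd \<delta> m"
  have g: "g dvd \<delta>" "g dvd m" "0 < g" using assms by (auto simp: g_def)
  define m' where "m' = m div g"
  have m: "m = m' * g" using g by (simp add: m'_def)
  have "0 < m'" using m assms by (cases "m' = 0") auto
  have cop: "coprime m' (\<delta> div g)"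
    unfolding m'_def g_def using assms
    by (metis coprime_commute div_gcd_coprime gr_implies_not0)
  have key: "a = a'" if "a \<le> a'" "(u + a * \<delta>) mod m = (u + a' * \<delta>) mod m" "a div m' = a' div m'" for a a'
  proof -
    have "m dvd (u + a' * \<delta>) - (u + a * \<delta>)"
      using that(1,2) by (metis add_left_mono mod_eq_dvd_iff_nat mult_le_mono1)
    then have "m dvd (a' - a) * \<delta>"
      by (simp add: diff_mult_distrib)
    then have "m' * g dvd (a' - a) * (\<delta> div g) * g"
      using g by (simp add: m[symmetric] mult.assoc)
    then have "m' dvd (a' - a) * (\<delta> div g)"
      using g(3) by simp
    then have "m' dvd a' - a"
      using cop by (simp add: coprime_dvd_mult_left_iff)
    then have "a mod m' = a' mod m'"
      using that(1) by (metis mod_eq_dvd_iff_nat)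
    then show "a = a'"
      using that(3) by (metis div_mult_mod_eq)
  qed
  have "inj_on (\<lambda>a. a div m') {a. a < m \<and> (u + a * \<delta>) mod m = y}"
  proof (rule inj_onI)
    fix a a' assume *: "a \<in> {a. a < m \<and> (u + a * \<delta>) mod m = y}"
      "a' \<in> {a. a < m \<and> (u + a * \<delta>) mod m = y}" "a div m' = a' div m'"
    then show "a = a'"
      using key[of a a'] key[of a' a] by (cases "a \<le> a'") auto
  qed
  moreover have "(\<lambda>a. a div m') ` {a. a < m \<and> (u + a * \<delta>) mod m = y} \<subseteq> {..<g}"
    using m \<open>0 < m'\<close> by (auto simp: div_less_iff_less_mult mult.commute)
  ultimately show ?thesis
    using card_inj_on_le[of "\<lambda>a. a div m'" _ "{..<g}"] by (simp add: g_def)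
qed

text \<open>Let g be the gcd of \<open>\<delta>\<close> and \<open>m\<close>. Only values congruent
  to \<open>u\<close> modulo g occur, each of them at most g times. As \<open>N\<close> does not
  divide \<open>\<delta>\<close>, the power of two g divides \<open>N\<close>, so a block of
  \<open>N\<close> consecutive values contains just N / g of them.\<close>

lemma card_multiples_le:
  fixes \<delta> u x k :: nat
  defines "N \<equiv> 2 ^ k" and "m \<equiv> 2 ^ (2 * k)"
  assumes "\<not> N dvd \<delta>"
  shows "card {a. a < m \<and> ((u + a * \<delta>) mod m) div N = x} \<le> N"
proof -
  define g where "g = gcd \<delta> m"
  have m: "m = N * N" by (simp add: m_def N_def power_mult[symmetric] power2_eq_square mult_2 power_add)
  have "0 < m" "0 < N" by (simp_all add: m_def N_def)
  have "g dvd 2 ^ (2 * k)" by (simp add: g_def m_def)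
  then obtain e where e: "g = 2 ^ e"
    using divides_primepow_nat[of 2 g "2 * k"] two_is_prime_nat by blast
  have "g dvd N"
  proof (rule ccontr)
    assume "\<not> g dvd N"
    then have "k \<le> e" unfolding e N_def by (metis le_imp_power_dvd nle_le)
    then have "N dvd g" unfolding e N_def by (rule le_imp_power_dvd)
    then show False using assms(3) by (metis dvd_trans g_def gcd_dvd1)
  qed
  then obtain q where q: "N = q * g" by (metis dvdE mult.commute)
  have "0 < g" by (simp add: e)
  define Y where "Y = {y. y < m \<and> y div N = x \<and> y mod g = u mod g}"
  have cardY: "card Y \<le> q"
  proof -
    have "inj_on (\<lambda>y. y mod N div g) Y"
    proof (rule inj_onI)
      fix y y' assume *: "y \<in> Y" "y' \<in> Y" "y mod N div g = y' mod N div g"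
      then have "y mod N mod g = y' mod N mod g"
        using mod_mod_cancel[OF \<open>g dvd N\<close>] by (auto simp: Y_def)
      then have "y mod N = y' mod N"
        using *(3) by (metis div_mult_mod_eq)
      then show "y = y'"
        using * by (metis (mono_tags, lifting) Y_def div_mult_mod_eq mem_Collect_eq)
    qed
    moreover have "(\<lambda>y. y mod N div g) ` Y \<subseteq> {..<q}"
      using \<open>0 < g\<close> \<open>0 < N\<close> q by (auto simp: div_less_iff_less_mult)
    ultimately show ?thesis
      using card_inj_on_le[of _ Y "{..<q}"] by simp
  qed
  have "finite Y" by (auto simp: Y_def)
  have sub: "{a. a < m \<and> ((u + a * \<delta>) mod m) div N = x} \<subseteq>
      (\<Union>y\<in>Y. {a. a < m \<and> (u + a * \<delta>) mod m = y})"
  proof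
    fix a assume a: "a \<in> {a. a < m \<and> ((u + a * \<delta>) mod m) div N = x}"
    have "(u + a * \<delta>) mod m mod g = (u + a * \<delta>) mod g"
      by (simp add: g_def mod_mod_cancel)
    also have "\<dots> = (u + a * \<delta> mod g) mod g"
      by (simp add: mod_add_right_eq)
    also have "a * \<delta> mod g = 0" by (simp add: g_def)
    finally have "(u + a * \<delta>) mod m \<in> Y"
      using a \<open>0 < m\<close> by (simp add: Y_def)
    then show "a \<in> (\<Union>y\<in>Y. {a. a < m \<and> (u + a * \<delta>) mod m = y})"
      using a by auto
  qed
  have "card {a. a < m \<and> ((u + a * \<delta>) mod m) div N = x} \<le>
      card (\<Union>y\<in>Y. {a. a < m \<and> (u + a * \<delta>) mod m = y})"
    using \<open>finite Y\<close> by (intro card_mono sub) auto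
  also have "\<dots> \<le> (\<Sum>y\<in>Y. card {a. a < m \<and> (u + a * \<delta>) mod m = y})"
    by (rule card_UN_le[OF \<open>finite Y\<close>])
  also have "\<dots> \<le> (\<Sum>y\<in>Y. g)"
    unfolding g_def by (intro sum_mono card_fibre_le \<open>0 < m\<close>)
  also have "\<dots> \<le> N"
    using cardY by (simp add: q)
  finally show ?thesis .
qed

lemma mshash_less: "mshash k a c b < 2 ^ k"
  by (simp add: mshash_def div_less_iff_less_mult power_add[symmetric] mult_2[symmetric])

lemma sum_div_eq:
  fixes x k :: nat
  assumes "x < 2 ^ k"
  shows "(\<Sum>r<2 ^ (2 * k). of_bool (r div 2 ^ k = x)) = (2 ^ k :: real)"
proof -
  have "{r. r < 2 ^ (2 * k) \<and> r div 2 ^ k = x} = {x * 2 ^ k..<x * 2 ^ k + (2 ^ k :: nat)}"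
  proof (intro set_eqI iffI)
    fix r assume "r \<in> {x * 2 ^ k..<x * 2 ^ k + (2 ^ k :: nat)}"
    then have r: "x * 2 ^ k \<le> r" "r < Suc x * 2 ^ k" by auto
    then have "r div 2 ^ k = x" by (intro div_nat_eqI) (auto simp: mult.commute)
    moreover have "r < 2 ^ k * 2 ^ k"
      using r(2) mult_le_mono1[of "Suc x" "2 ^ k" "2 ^ k"] assms by linarith
    ultimately show "r \<in> {r. r < 2 ^ (2 * k) \<and> r div 2 ^ k = x}"
      by (simp add: mult_2 power_add)
  next
    fix r assume "r \<in> {r. r < 2 ^ (2 * k) \<and> r div 2 ^ k = x}"
    then have "r div 2 ^ k = x" by simp
    then have "x * 2 ^ k + r mod 2 ^ k = r" using div_mult_mod_eq[of r "2 ^ k"] by metis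
    moreover have "r mod 2 ^ k < 2 ^ k" by simp
    ultimately show "r \<in> {x * 2 ^ k..<x * 2 ^ k + (2 ^ k :: nat)}"
      unfolding atLeastLessThan_iff by linarith
  qed
  then have "card {r. r < 2 ^ (2 * k) \<and> r div 2 ^ k = x} = 2 ^ k" by simp
  moreover have "(\<Sum>r<2 ^ (2 * k). of_bool (r div 2 ^ k = x)) =
      real (card {r. r < 2 ^ (2 * k) \<and> r div 2 ^ k = x})"
    by (simp add: of_bool_def sum.If_cases Int_def)
  ultimately show ?thesis by simp
qed

text \<open>For a fixed multiplier the summand \<open>c\<close> alone makes the hash value uniform.
  Seeds are full words, and \<open>2 * k \<le> W\<close> makes the range of words a whole number of
  periods.\<close>

lemma mshash_uniform:
  assumes "2 * k \<le> W" "x < 2 ^ k"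
  shows "(\<Sum>a<2 ^ W. \<Sum>c<2 ^ W. of_bool (mshash k a c b = x) :: real) = (real (2 ^ W))\<^sup>2 / real (2 ^ k)"
proof -
  let ?m = "2 ^ (2 * k) :: nat"
  have W: "2 ^ W = 2 ^ (W - 2 * k) * ?m"
    using assms(1) by (simp add: power_add[symmetric])
  have "(\<Sum>c<2 ^ W. of_bool (mshash k a c b = x)) = (real (2 ^ W) / 2 ^ k)" for a
  proof -
    have "(\<Sum>c<2 ^ W. of_bool (mshash k a c b = x)) =
        (\<Sum>c<2 ^ (W - 2 * k) * ?m. of_bool ((a * b + c mod ?m) mod ?m div 2 ^ k = x) :: real)"
      unfolding W mshash_def by (simp add: mod_add_right_eq)
    also have "\<dots> = real (2 ^ (W - 2 * k)) * (\<Sum>r<?m. of_bool ((a * b + r) mod ?m div 2 ^ k = x))"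
      by (rule sum_periodic)
    also have "(\<Sum>r<?m. of_bool ((a * b + r) mod ?m div 2 ^ k = x)) =
        (\<Sum>r<?m. of_bool (r div 2 ^ k = x) :: real)"
      by (rule sum_shift_mod) simp
    also have "\<dots> = 2 ^ k" by (rule sum_div_eq[OF assms(2)])
    finally show ?thesis
      unfolding W by (simp add: mult_2 power_add)
  qed
  then show ?thesis by (simp add: power2_eq_square)
qed

text \<open>Let u be the linear function at \<open>b'\<close> before the shift. As \<open>c\<close>
  varies, u runs through all residues, and the value at \<open>b\<close> is u plus \<open>a\<close>
  times the difference of the arguments. For each u, at most N multipliers bring this value into the
  required block.\<close>

lemma mshash_pairwise:
  assumes "2 * k \<le> W" "b < 2 ^ k" "b' < 2 ^ k" "b \<noteq> b'" "x < 2 ^ k" "y < 2 ^ k"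
  shows "(\<Sum>a<2 ^ W. \<Sum>c<2 ^ W. of_bool (mshash k a c b = x \<and> mshash k a c b' = y) :: real)
    \<le> (real (2 ^ W))\<^sup>2 / (real (2 ^ k))\<^sup>2"
proof -
  define m where "m = (2 ^ (2 * k) :: nat)"
  define N where "N = (2 ^ k :: nat)"
  define q where "q = (2 ^ (W - 2 * k) :: nat)"
  have W: "2 ^ W = q * m"
    using assms(1) by (simp add: power_add[symmetric] q_def m_def)
  have "0 < m" "0 < N" by (simp_all add: m_def N_def)
  have mN: "m = N * N" by (simp add: m_def N_def mult_2 power_add)
  have "b' < m" using assms(3) \<open>0 < N\<close> mN by (simp add: N_def[symmetric] less_le_trans)
  \<comment> \<open>The difference of the arguments modulo \<open>m\<close>, kept
    nonnegative.\<close>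
  define \<delta> where "\<delta> = b + (m - b')"
  have "\<not> N dvd \<delta>"
  proof
    assume "N dvd \<delta>"
    then have "(b + (m - b')) mod N = 0" by (simp add: \<delta>_def)
    then have "(b + (m - b') + b') mod N = b' mod N"
      by (metis add.commute add_0_right mod_add_right_eq)
    moreover have "b + (m - b') + b' = b + N * N" using \<open>b' < m\<close> mN by simp
    ultimately show False using assms(2-4) by (simp add: N_def)
  qed
  have count: "card {a. a < m \<and> ((u + a * \<delta>) mod m) div N = z} \<le> N" for u z
    using card_multiples_le[of k \<delta> u z] \<open>\<not> N dvd \<delta>\<close> by (simp add: m_def N_def)
  have inner: "(\<Sum>c<m. of_bool ((a * b + c) mod m div N = x \<and> (a * b' + c) mod m div N = y)) =
      (\<Sum>u<m. of_bool ((u + a * \<delta>) mod m div N = x \<and> u div N = y) :: real)" for a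
  proof -
    have "(a * b + c) mod m = ((a * b' + c) mod m + a * \<delta>) mod m" for c
    proof -
      have "\<delta> + b' = b + m"
        using \<open>b' < m\<close> by (simp add: \<delta>_def)
      then have "a * \<delta> + a * b' = a * b + a * m"
        by (metis add_mult_distrib2)
      then have "a * b' + c + a * \<delta> = a * b + c + a * m"
        by simp
      then show ?thesis by (metis mod_add_left_eq mod_mult_self1 mult.commute)
    qed
    then show ?thesis
      using sum_shift_mod[OF \<open>0 < m\<close>,
        of "\<lambda>u. of_bool ((u + a * \<delta>) mod m div N = x \<and> u div N = y)" "a * b'"] by simp
  qed
  have "(\<Sum>a<2 ^ W. \<Sum>c<2 ^ W. of_bool (mshash k a c b = x \<and> mshash k a c b' = y) :: real) =
      (\<Sum>a<q * m. \<Sum>c<q * m. of_bool ((a mod m * b + c mod m) mod m div N = x \<and>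
        (a mod m * b' + c mod m) mod m div N = y))"
  proof -
    have "(a mod m * b + c mod m) mod m = (a * b + c) mod m" for a b c
      by (metis mod_add_left_eq mod_add_right_eq mod_mult_left_eq)
    then show ?thesis
      unfolding W mshash_def m_def[symmetric] N_def[symmetric] by presburger
  qed
  also have "\<dots> = (\<Sum>a<q * m. real q * (\<Sum>c<m. of_bool ((a mod m * b + c) mod m div N = x \<and>
        (a mod m * b' + c) mod m div N = y)))"
    by (subst sum_periodic) (rule refl)
  also have "\<dots> = real q * (\<Sum>a<m. real q * (\<Sum>c<m. of_bool ((a * b + c) mod m div N = x \<and>
        (a * b' + c) mod m div N = y)))"
    by (rule sum_periodic)
  also have "\<dots> = real q * real q * (\<Sum>a<m. \<Sum>u<m. of_bool ((u + a * \<delta>) mod m div N = x \<and> u div N = y))"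
    unfolding inner by (simp add: sum_distrib_left mult.assoc)
  also have "(\<Sum>a<m. \<Sum>u<m. of_bool ((u + a * \<delta>) mod m div N = x \<and> u div N = y)) =
      (\<Sum>u<m. of_bool (u div N = y) * (\<Sum>a<m. of_bool ((u + a * \<delta>) mod m div N = x)) :: real)"
    by (rule trans[OF sum.swap], intro sum.cong refl)
      (simp only: sum_distrib_left of_bool_conj mult.commute)
  also have "\<dots> \<le> (\<Sum>u<m. of_bool (u div N = y) * real N)"
  proof (intro sum_mono mult_left_mono)
    fix u
    have "(\<Sum>a<m. of_bool ((u + a * \<delta>) mod m div N = x) :: real) =
        card {a. a < m \<and> ((u + a * \<delta>) mod m) div N = x}"
      by (simp add: of_bool_def sum.If_cases Int_def)
    then show "(\<Sum>a<m. of_bool ((u + a * \<delta>) mod m div N = x) :: real) \<le> N"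
      using count[of u x] by simp
  qed simp
  also have "\<dots> = real N * real N"
    using sum_div_eq[OF assms(6)] by (simp add: sum_distrib_right[symmetric] m_def N_def)
  finally have *: "(\<Sum>a<2 ^ W. \<Sum>c<2 ^ W. of_bool (mshash k a c b = x \<and> mshash k a c b' = y) :: real)
      \<le> real q * real q * (real N * real N)"
    by (simp add: mult_left_mono)
  have "real q * real q * (real N * real N) = (real (2 ^ W))\<^sup>2 / (real (2 ^ k))\<^sup>2"
    unfolding W N_def[symmetric] mN using \<open>0 < N\<close> by (simp add: power2_eq_square field_simps)
  with * show ?thesis by linarith
qed

section \<open>Binary search\<close>

text \<open>The result is fixed bit by bit from the top. For antitone \<open>P\<close> it is the
  largest positive number below \<open>2 ^ k\<close> that satisfies \<open>P\<close>, or 0 if there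
  is none; only positive numbers are probed.\<close>

definition bsearch :: "nat \<Rightarrow> (nat \<Rightarrow> bool) \<Rightarrow> nat" where
  "bsearch k P = itr k (\<lambda>i j. if P (j + 2 ^ (k - 1 - i)) then j + 2 ^ (k - 1 - i) else j) 0"

lemma bsearch:
  assumes "\<forall>c c'. 0 < c \<longrightarrow> c \<le> c' \<longrightarrow> c' < 2 ^ k \<longrightarrow> P c' \<longrightarrow> P c"
  shows "bsearch k P < 2 ^ k" "0 < c \<Longrightarrow> c < 2 ^ k \<Longrightarrow> P c \<longleftrightarrow> c \<le> bsearch k P"
proof -
  let ?F = "\<lambda>i j. if P (j + 2 ^ (k - 1 - i)) then j + 2 ^ (k - 1 - i) else j"
  have inv: "itr i ?F 0 + 2 ^ (k - i) \<le> 2 ^ k \<and> (itr i ?F 0 = 0 \<or> P (itr i ?F 0)) \<and>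
      (\<forall>c. itr i ?F 0 + 2 ^ (k - i) \<le> c \<longrightarrow> c < 2 ^ k \<longrightarrow> \<not> P c)" if "i \<le> k" for i
    using that
  proof (induction i)
    case (Suc i)
    let ?j = "itr i ?F 0" and ?s = "2 ^ (k - 1 - i) :: nat"
    have "k - i = Suc (k - 1 - i)" using Suc.prems by simp
    then have s: "2 ^ (k - i) = ?s + ?s" by simp
    have s': "2 ^ (k - Suc i) = ?s" by simp
    have ex: "itr (Suc i) ?F 0 = (if P (?j + ?s) then ?j + ?s else ?j)" by simp
    have IH: "?j + ?s + ?s \<le> 2 ^ k" "?j = 0 \<or> P ?j"
      "\<And>c. ?j + ?s + ?s \<le> c \<Longrightarrow> c < 2 ^ k \<Longrightarrow> \<not> P c"
      using Suc.IH[OF Suc_leD[OF Suc.prems]] unfolding s add.assoc by blast+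
    show ?case
    proof (cases "P (?j + ?s)")
      case True
      then show ?thesis unfolding ex s' if_P[OF True] using IH by blast
    next
      case False
      have "\<not> P c" if "?j + ?s \<le> c" "c < 2 ^ k" for c
        using assms[rule_format, of "?j + ?s" c] that False zero_less_power[of "2 :: nat" "k - 1 - i"] by fastforce
      moreover have "?j + ?s \<le> 2 ^ k" using IH(1) by linarith
      ultimately show ?thesis unfolding ex s' if_not_P[OF False] using IH(2) by blast
    qed
  qed auto
  let ?r = "bsearch k P"
  have fin: "?r + 1 \<le> 2 ^ k" "?r = 0 \<or> P ?r" "?r + 1 \<le> c \<Longrightarrow> c < 2 ^ k \<Longrightarrow> \<not> P c" for c
    using inv[of k] by (simp_all add: bsearch_def)
  show less: "?r < 2 ^ k"
    using fin(1) by simp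
  show "P c \<longleftrightarrow> c \<le> ?r" if c: "0 < c" "c < 2 ^ k"
  proof
    assume "P c"
    then show "c \<le> ?r"
      using fin(3)[of c] c by linarith
  next
    assume "c \<le> ?r"
    then show "P c"
      using fin(2) c assms[rule_format, of c ?r] less by auto
  qed
qed

lemma bsearch_eqI:
  assumes "r < 2 ^ k" "\<And>c. 0 < c \<Longrightarrow> c < 2 ^ k \<Longrightarrow> P c \<longleftrightarrow> c \<le> r"
  shows "bsearch k P = r"
proof -
  have *: "\<forall>c c'. 0 < c \<longrightarrow> c \<le> c' \<longrightarrow> c' < 2 ^ k \<longrightarrow> P c' \<longrightarrow> P c"
    using assms(2) by (meson le_less_trans less_le_trans le_trans)
  let ?b = "bsearch k P"
  have b: "c \<le> ?b \<longleftrightarrow> c \<le> r" if "0 < c" "c < 2 ^ k" for c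
    using bsearch(2)[OF * that] assms(2)[OF that] by blast
  have "?b < 2 ^ k"
    by (rule bsearch(1)[OF *])
  then show ?thesis
    using b[of ?b] b[of r] assms(1) by (cases "?b = 0"; cases "r = 0") auto
qed

section \<open>Radix sort\<close>

text \<open>Stable passes from the lowest bit upwards sort in linear time per bit, and their loop
  bounds are known in advance.\<close>

definition radix_pass :: "nat \<Rightarrow> nat list \<Rightarrow> nat list" where
  "radix_pass b xs = filter (\<lambda>x. x div 2 ^ b mod 2 = 0) xs @ filter (\<lambda>x. x div 2 ^ b mod 2 = 1) xs"

primrec radix :: "nat \<Rightarrow> nat list \<Rightarrow> nat list" where
  "radix 0 xs = xs"
| "radix (Suc b) xs = radix_pass b (radix b xs)"

lemma mset_radix_pass: "mset (radix_pass b xs) = mset xs"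
proof -
  have "filter (\<lambda>x. x div 2 ^ b mod 2 = 1) xs = filter (\<lambda>x. \<not> x div 2 ^ b mod 2 = 0) xs"
    by (intro filter_cong) auto
  then show ?thesis
    by (simp add: radix_pass_def del: not_mod_2_eq_0_eq_1)
qed

lemma mset_radix [simp]: "mset (radix b xs) = mset xs"
  by (induction b) (simp_all add: mset_radix_pass)

lemma length_radix [simp]: "length (radix b xs) = length xs"
  by (metis mset_radix size_mset)

lemma set_radix [simp]: "set (radix b xs) = set xs"
  by (metis mset_radix set_mset_mset)

text \<open>Stability is the point: among words that agree in bit b, the order by the lower bits
  persists.\<close>

lemma sorted_radix: "sorted_wrt (\<lambda>x y. x mod 2 ^ b \<le> y mod 2 ^ b) (radix b xs)"
proof (induction b)
  case 0
  then show ?case by (induction xs) auto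
next
  case (Suc b)
  have m: "x mod 2 ^ Suc b = x mod 2 ^ b + 2 ^ b * (x div 2 ^ b mod 2)" for x :: nat
    using mod_mult2_eq[of x "2 ^ b" 2] by (simp add: mult.commute)
  have "sorted_wrt (\<lambda>x y. x mod 2 ^ Suc b \<le> y mod 2 ^ Suc b)
      (filter (\<lambda>x. x div 2 ^ b mod 2 = r) (radix b xs))" for r
  proof (rule sorted_wrt_mono_rel[OF _ sorted_wrt_filter[OF Suc]])
    fix x y
    assume "x \<in> set (filter (\<lambda>x. x div 2 ^ b mod 2 = r) (radix b xs))"
      "y \<in> set (filter (\<lambda>x. x div 2 ^ b mod 2 = r) (radix b xs))" and le: "x mod 2 ^ b \<le> y mod 2 ^ b"
    then have "x div 2 ^ b mod 2 = r" "y div 2 ^ b mod 2 = r" by simp_all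
    then show "x mod 2 ^ Suc b \<le> y mod 2 ^ Suc b"
      unfolding m using le by (simp only: add_le_mono order.refl)
  qed
  moreover have "x mod 2 ^ Suc b \<le> y mod 2 ^ Suc b"
    if "x div 2 ^ b mod 2 = 0" "y div 2 ^ b mod 2 = 1" for x y :: nat
  proof -
    have "x mod 2 ^ b < 2 ^ b" by simp
    then show ?thesis unfolding m that by linarith
  qed
  ultimately show ?case
    unfolding radix.simps radix_pass_def sorted_wrt_append set_filter by simp
qed

lemma radix_sort:
  assumes "\<forall>x\<in>set xs. x < 2 ^ b"
  shows "radix b xs = sort xs"
proof (rule properties_for_sort[symmetric])
  show "sorted (radix b xs)"
    using sorted_radix[of b xs] by (rule sorted_wrt_mono_rel[rotated]) (use assms in auto)
qed simp

abbreviation (input) "eAdd \<equiv> Op Add"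
abbreviation (input) "eSub \<equiv> Op Sub"
abbreviation (input) "eMul \<equiv> Op Mul"
abbreviation (input) "eDiv \<equiv> Op Div"
abbreviation (input) "eMod \<equiv> Op Mod"
abbreviation (input) "eShl \<equiv> Op Shl"
abbreviation (input) "eShr \<equiv> Op Shr"
abbreviation (input) "eLess \<equiv> Op Less"
abbreviation (input) "eEq \<equiv> Op Eq"
abbreviation (input) "eAnd \<equiv> Op And"

text \<open>
  One half of a pass appends the words with the given bit to the buffer. The other words are
  written to the otherwise unused cell after the counter.
\<close>

definition half_com :: "nat \<Rightarrow> nat \<Rightarrow> nat \<Rightarrow> nat \<Rightarrow> nat \<Rightarrow> com" where
  "half_com n a b c r = For n 101 (Local 102 (Read (eAdd (Par a) (Var 101)))
     (Local 103 (eEq (eMod (eShr (Var 102) (Var 100)) (Num 2)) (Num r))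
       (Seq (Write (Cond (Var 103) (eAdd (Par b) (Read (Par c))) (eAdd (Par c) (Num 1))) (Var 102))
         (Write (Par c) (eAdd (Read (Par c)) (Var 103))))))"

definition copy_com :: "nat \<Rightarrow> nat \<Rightarrow> nat \<Rightarrow> com" where
  "copy_com n a b = For n 101 (Write (eAdd (Par a) (Var 101)) (Read (eAdd (Par b) (Var 101))))"

definition sort_com :: "nat \<Rightarrow> nat \<Rightarrow> nat \<Rightarrow> nat \<Rightarrow> nat \<Rightarrow> com" where
  "sort_com k n a b c = For k 100 (Seq (Write (Par c) (Num 0)) (Seq (half_com n a b c 0)
     (Seq (half_com n a b c 1) (copy_com n a b))))"

definition arr :: "(nat \<Rightarrow> nat) \<Rightarrow> nat \<Rightarrow> nat \<Rightarrow> nat list" where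
  "arr m a n = map (\<lambda>i. m (a + i)) [0..<n]"

lemma length_arr [simp]: "length (arr m a n) = n"
  by (simp add: arr_def)

lemma nth_arr [simp]: "i < n \<Longrightarrow> arr m a n ! i = m (a + i)"
  by (simp add: arr_def)

lemma arr_Suc: "arr m a (Suc n) = arr m a n @ [m (a + n)]"
  by (simp add: arr_def)

lemma arr_cong: "(\<And>i. i < n \<Longrightarrow> m (a + i) = m' (a + i)) \<Longrightarrow> arr m a n = arr m' a n"
  by (simp add: arr_def)

locale sorting =
  fixes W :: nat and p :: "nat \<Rightarrow> nat" and kn ka kb kc n a b c :: nat
  assumes p: "p kn = n" "p ka = a" "p kb = b" "p kc = c"
    and disj: "a + n \<le> b" "b + n \<le> c" "c + 1 < 2 ^ W"
begin

lemma half_com: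
  assumes "m c = s" "s + length (filter (\<lambda>x. x div 2 ^ v 100 mod 2 = r) (arr m a n)) \<le> n"
    and "r < 2" "1 < W"
  shows "(let m' = sem W p (half_com kn ka kb kc r) v m;
      L = arr m b s @ filter (\<lambda>x. x div 2 ^ v 100 mod 2 = r) (arr m a n)
    in m' c = length L \<and> arr m' b (length L) = L \<and>
      (\<forall>x. x \<notin> {b..<b + n} \<union> {c, c + 1} \<longrightarrow> m' x = m x))"
proof -
  define P where "P = (\<lambda>x :: nat. x div 2 ^ v 100 mod 2 = r)"
  define body where "body = (\<lambda>j. sem W p (Local 102 (Read (eAdd (Par ka) (Var 101)))
     (Local 103 (eEq (eMod (eShr (Var 102) (Var 100)) (Num 2)) (Num r))
       (Seq (Write (Cond (Var 103) (eAdd (Par kb) (Read (Par kc))) (eAdd (Par kc) (Num 1))) (Var 102))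
         (Write (Par kc) (eAdd (Read (Par kc)) (Var 103)))))) (v(101 := j)))"
  define L where "L = (\<lambda>i. arr m b s @ filter P (arr m a i))"
  \<comment> \<open>The words collected so far do not overflow the buffer, and a word about to be
    appended still finds a free cell.\<close>
  have Lle: "length (L i) \<le> n" "i < n \<Longrightarrow> P (m (a + i)) \<Longrightarrow> length (L i) < n" if "i \<le> n" for i
  proof -
    have "arr m a n = arr m a i @ map (\<lambda>i. m (a + i)) [i..<n]"
      using that upt_add_eq_append[of 0 i "n - i"] by (simp add: arr_def)
    then have eq: "length (L i) + length (filter P (map (\<lambda>i. m (a + i)) [i..<n])) \<le> n"
      using assms(2) by (simp add: L_def P_def)
    then show "length (L i) \<le> n" by simp
    show "length (L i) < n" if "i < n" "P (m (a + i))"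
      using eq that by (simp add: upt_conv_Cons)
  qed
  have W1: "(2 :: nat) mod 2 ^ W = 2" "(1 :: nat) mod 2 ^ W = 1" "r mod 2 ^ W = r"
    using \<open>1 < W\<close> assms(3) power_strict_increasing[of 1 W "2 :: nat"] by auto
  have inv: "itr i body m c = length (L i) \<and> arr (itr i body m) b (length (L i)) = L i \<and>
      (\<forall>x. x \<notin> {b..<b + n} \<union> {c, c + 1} \<longrightarrow> itr i body m x = m x)" if "i \<le> n" for i
    using that
  proof (induction i)
    case 0
    then show ?case using assms(1) by (simp add: L_def) (simp add: arr_def)
  next
    case (Suc i)
    define m1 where "m1 = itr i body m"
    have IH: "m1 c = length (L i)" "arr m1 b (length (L i)) = L i"
      "\<And>x. x \<notin> {b..<b + n} \<union> {c, c + 1} \<Longrightarrow> m1 x = m x"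
      using Suc by (auto simp: m1_def)
    have i: "i < n" using Suc.prems by simp
    have ai: "(a + i) mod 2 ^ W = a + i" "m1 (a + i) = m (a + i)"
      using i disj IH(3) by auto
    have ci: "(c + 1) mod 2 ^ W = c + 1" using disj by simp
    have bi: "(b + length (L i)) mod 2 ^ W = b + length (L i)"
      using Lle(1)[of i] Suc.prems disj by simp
    let ?x = "m (a + i)"
    let ?t = "if P ?x then b + length (L i) else c + 1"
    have "body i m1 = (let m2 = m1(?t := ?x) in m2(c := (m2 c + of_bool (P ?x)) mod 2 ^ W))"
      by (cases "P ?x") (simp_all add: body_def P_def drop_bit_eq_div p ai ci[simplified] bi W1 IH(1)
          less_trans[OF zero_less_one \<open>1 < W\<close>])
    also have "\<dots> = m1(?t := ?x, c := (length (L i) + of_bool (P ?x)) mod 2 ^ W)"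
      using Lle(2)[of i] Suc.prems IH(1) disj by auto
    also have "(length (L i) + of_bool (P ?x)) mod 2 ^ W = length (L i) + of_bool (P ?x)"
      using Lle[of i] Suc.prems disj by auto
    finally have m2': "itr (Suc i) body m = m1(?t := ?x, c := length (L i) + of_bool (P ?x))"
      by (simp add: m1_def fun_upd_def)
    define M2 where "M2 = itr (Suc i) body m"
    note m2 = m2'[folded M2_def]
    have LS: "L (Suc i) = L i @ (if P ?x then [?x] else [])"
      by (simp add: L_def arr_Suc)
    have "arr M2 b (length (L i)) = arr m1 b (length (L i))"
      unfolding m2 using Lle(1)[of i] Suc.prems disj by (intro arr_cong) auto
    then have "arr M2 b (length (L (Suc i))) = L (Suc i)"
      using IH(2) Lle(2)[of i] i disj by (auto simp: LS arr_Suc m2)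
    moreover have "M2 c = length (L (Suc i))"
      by (simp add: m2 LS)
    moreover have "M2 x = m x" if "x \<notin> {b..<b + n} \<union> {c, c + 1}" for x
      using IH(3)[OF that] that Lle(2)[of i] i by (auto simp: m2)
    ultimately show ?case
      unfolding M2_def[symmetric] by blast
  qed
  have "sem W p (half_com kn ka kb kc r) v m = itr n body m"
    by (simp add: half_com_def body_def p)
  then show ?thesis
    using inv[of n] by (simp add: Let_def L_def P_def)
qed

lemma half_com':
  assumes "m c = s" "v 100 = j" "arr m a n = xs" "arr m b s = ys"
    and "s + length (filter (\<lambda>x. x div 2 ^ j mod 2 = r) xs) \<le> n" "r < 2" "1 < W"
    and m': "m' = sem W p (half_com kn ka kb kc r) v m"
  defines "zs \<equiv> filter (\<lambda>x. x div 2 ^ j mod 2 = r) xs"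
  shows "m' c = s + length zs" "arr m' b (s + length zs) = ys @ zs"
    "x \<notin> {b..<b + n} \<union> {c, c + 1} \<Longrightarrow> m' x = m x"
proof -
  have "length ys = s" using assms(4) by auto
  have "(let L = ys @ zs in m' c = length L \<and> arr m' b (length L) = L \<and>
      (\<forall>x. x \<notin> {b..<b + n} \<union> {c, c + 1} \<longrightarrow> m' x = m x))"
    using half_com[of m s v r, OF assms(1) _ assms(6,7)] assms(5)
    unfolding assms(2,3,4) m'[symmetric] zs_def Let_def by blast
  then show "m' c = s + length zs" "arr m' b (s + length zs) = ys @ zs"
    "x \<notin> {b..<b + n} \<union> {c, c + 1} \<Longrightarrow> m' x = m x"
    unfolding Let_def length_append \<open>length ys = s\<close> by blast+
qed

lemma copy_com:
  shows "sem W p (copy_com kn ka kb) v m =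
    (\<lambda>x. if a \<le> x \<and> x < a + n then m (b + (x - a)) else m x)"
proof -
  define body where "body = (\<lambda>j. sem W p (Write (eAdd (Par ka) (Var 101))
    (Read (eAdd (Par kb) (Var 101)))) (v(101 := j)))"
  have "itr i body m = (\<lambda>x. if a \<le> x \<and> x < a + i then m (b + (x - a)) else m x)" if "i \<le> n" for i
    using that
  proof (induction i)
    case (Suc i)
    have "(a + i) mod 2 ^ W = a + i" "(b + i) mod 2 ^ W = b + i" using Suc.prems disj by auto
    then show ?case
      using Suc disj by (auto simp: body_def p fun_eq_iff)
  qed (auto simp: fun_eq_iff)
  then show ?thesis
    by (simp add: copy_com_def body_def p)
qed

lemma sort_com:
  assumes "1 < W"
  shows "arr (sem W p (sort_com k kn ka kb kc) v m) a n = radix (p k) (arr m a n) \<and>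
    (\<forall>x. x \<notin> {a..<a + n} \<union> {b..<b + n} \<union> {c, c + 1} \<longrightarrow>
      sem W p (sort_com k kn ka kb kc) v m x = m x)"
proof -
  define body where "body = (\<lambda>j. sem W p (Seq (Write (Par kc) (Num 0)) (Seq (half_com kn ka kb kc 0)
     (Seq (half_com kn ka kb kc 1) (copy_com kn ka kb)))) (v(100 := j)))"
  have "arr (itr j body m) a n = radix j (arr m a n) \<and>
    (\<forall>x. x \<notin> {a..<a + n} \<union> {b..<b + n} \<union> {c, c + 1} \<longrightarrow> itr j body m x = m x)" for j
  proof (induction j)
    case (Suc j)
    define m0 where "m0 = itr j body m"
    define m1 where "m1 = m0(c := 0)"
    define m2 where "m2 = sem W p (half_com kn ka kb kc 0) (v(100 := j)) m1"
    define m3 where "m3 = sem W p (half_com kn ka kb kc 1) (v(100 := j)) m2"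
    define xs where "xs = arr m0 a n"
    let ?f = "\<lambda>r. filter (\<lambda>x. x div 2 ^ j mod 2 = r) xs"
    have radix: "radix_pass j xs = ?f 0 @ ?f 1" by (simp add: radix_pass_def)
    have "length (radix_pass j xs) = n" by (metis mset_radix_pass size_mset length_arr xs_def)
    then have len: "length (?f 0) + length (?f 1) = n"
      unfolding radix length_append .
    have xs1: "arr m1 a n = xs" unfolding xs_def m1_def using disj by (intro arr_cong) auto
    have bs1: "arr m1 b 0 = []" by (simp add: arr_def)
    have c1: "m1 c = 0" by (simp add: m1_def)
    have z2: "(0 :: nat) < 2" and o2: "(1 :: nat) < 2" by simp_all
    have f0: "0 + length (?f 0) \<le> n" using len by linarith
    note 2 = half_com'[where v = "v(100 := j)" and j = j and r = 0, OF c1 fun_upd_same xs1 bs1 f0 z2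
        assms m2_def, unfolded add_0 append_Nil]
    have xs2: "arr m2 a n = xs" unfolding xs1[symmetric] using disj by (intro arr_cong 2) auto
    have f1: "length (?f 0) + length (?f 1) \<le> n" using len by linarith
    note 3 = half_com'[where v = "v(100 := j)" and j = j and r = 1, OF 2(1) fun_upd_same xs2 2(2) f1
        o2 assms m3_def]
    have m3: "arr m3 b n = radix_pass j xs"
      using 3(2) unfolding len radix .
    have m4: "itr (Suc j) body m = (\<lambda>x. if a \<le> x \<and> x < a + n then m3 (b + (x - a)) else m3 x)"
    proof -
      have "itr (Suc j) body m = body j m0"
        unfolding itr.simps m0_def ..
      also have "\<dots> = sem W p (copy_com kn ka kb) (v(100 := j)) m3"
        unfolding body_def m3_def m2_def m1_def by (simp add: p)
      finally show ?thesis unfolding copy_com .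
    qed
    have "arr (itr (Suc j) body m) a n = arr m3 b n"
      unfolding m4 by (intro nth_equalityI) auto
    also note m3
    finally have "arr (itr (Suc j) body m) a n = radix (Suc j) (arr m a n)"
      using Suc by (simp add: xs_def m0_def)
    moreover have "itr (Suc j) body m x = m x" if "x \<notin> {a..<a + n} \<union> {b..<b + n} \<union> {c, c + 1}" for x
    proof -
      have "itr (Suc j) body m x = m3 x" unfolding m4 using that by auto
      also have "\<dots> = m0 x" using 2(3)[of x] 3(3)[of x] that by (auto simp: m1_def)
      finally show ?thesis using Suc that by (auto simp: m0_def)
    qed
    ultimately show ?case by blast
  qed simp
  then show ?thesis
    by (simp add: sort_com_def body_def)
qed

end

section \<open>The implicit sorted array\<close>

lemma itr_cong: "(\<And>i. i < n \<Longrightarrow> F i (itr i F a) = G i (itr i F a)) \<Longrightarrow> itr n F a = itr n G a"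
proof (induction n)
  case (Suc n)
  then have "itr n F a = itr n G a" by simp
  then show ?case using Suc.prems[of n] by simp
qed simp

lemma itr_Suc_front: "itr (Suc n) F a = itr n (\<lambda>i. F (Suc i)) (F 0 a)"
  by (induction n) simp_all

text \<open>Loop bounds must be parameters, so a part of a chain is walked by a loop over all
  columns that idles outside of it.\<close>

lemma itr_window:
  assumes "lo \<le> hi"
  shows "itr n (\<lambda>i b. if lo \<le> i \<and> i < hi then F i b else b) b =
    itr (min n hi - lo) (\<lambda>i. F (lo + i)) b"
proof (induction n)
  case (Suc n)
  show ?case
  proof (cases "lo \<le> n \<and> n < hi")
    case True
    then have "min (Suc n) hi - lo = Suc (n - lo)" "min n hi - lo = n - lo" by auto
    then show ?thesis using Suc True by simp
  next
    case False
    then have "min (Suc n) hi - lo = min n hi - lo" using assms by auto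
    then show ?thesis using Suc False by auto
  qed
qed simp

lemma itr_min:
  fixes K :: "nat \<Rightarrow> nat"
  shows "itr L (\<lambda>q a. if C q \<and> K q < a then K q else a) z = Min (insert z {K q |q. q < L \<and> C q})"
proof (induction L)
  case (Suc L)
  have fin: "finite {K q |q. q < L \<and> C q}" by simp
  define m where "m = Min (insert z {K q |q. q < L \<and> C q})"
  have IH: "itr L (\<lambda>q a. if C q \<and> K q < a then K q else a) z = m"
    using Suc by (simp only: m_def)
  show ?case
  proof (cases "C L")
    case True
    then have "{K q |q. q < Suc L \<and> C q} = insert (K L) {K q |q. q < L \<and> C q}"
      by (auto simp: less_Suc_eq)
    then have "Min (insert z {K q |q. q < Suc L \<and> C q}) =
        min (K L) (Min (insert z {K q |q. q < L \<and> C q}))"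
      using fin Min_insert[of "insert z {K q |q. q < L \<and> C q}" "K L"] by (simp only: insert_commute) simp
    then show ?thesis
      unfolding m_def[symmetric] itr.simps IH using True by (simp add: min_def)
  next
    case False
    then have "{K q |q. q < Suc L \<and> C q} = {K q |q. q < L \<and> C q}"
      by (auto simp: less_Suc_eq)
    then show ?thesis using Suc False by simp
  qed
qed simp

lemma digit_unique:
  fixes a b x y m :: nat
  assumes "x < m" "y < m" "a * m + x = b * m + y"
  shows "a = b \<and> x = y"
proof -
  have "(a * m + x) div m = a" "(b * m + y) div m = b" using assms(1,2) by auto
  then show ?thesis using assms(3) by simp
qed

lemma card_less_sorted:
  assumes "sorted xs" "distinct xs" "r < length xs"
  shows "xs ! r < z \<longleftrightarrow> r < card {x \<in> set xs. x < z}"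
proof -
  have strict: "sorted_wrt (<) xs"
    using assms(1,2) by (simp add: strict_sorted_iff)
  have "{x \<in> set xs. x < z} = (!) xs ` {i. i < length xs \<and> xs ! i < z}"
    by (auto simp: set_conv_nth)
  moreover have "inj_on ((!) xs) {i. i < length xs \<and> xs ! i < z}"
    using assms(2) by (auto simp: inj_on_def nth_eq_iff_index_eq)
  ultimately have card: "card {x \<in> set xs. x < z} = card {i. i < length xs \<and> xs ! i < z}"
    by (simp add: card_image)
  show ?thesis
  proof
    assume "xs ! r < z"
    then have "{..r} \<subseteq> {i. i < length xs \<and> xs ! i < z}"
      using assms(3) sorted_nth_mono[OF assms(1)] by (auto intro: le_less_trans)
    then have "card {..r} \<le> card {i. i < length xs \<and> xs ! i < z}"
      by (intro card_mono) auto
    then show "r < card {x \<in> set xs. x < z}" using card by simp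
  next
    assume *: "r < card {x \<in> set xs. x < z}"
    show "xs ! r < z"
    proof (rule ccontr)
      assume "\<not> xs ! r < z"
      then have "{i. i < length xs \<and> xs ! i < z} \<subseteq> {..<r}"
        using sorted_nth_mono[OF assms(1)] by (auto simp: not_less) (meson leD le_less_trans not_less)
      then have "card {i. i < length xs \<and> xs ! i < z} \<le> card {..<r}"
        by (intro card_mono) auto
      then show False using * card by simp
    qed
  qed
qed

text \<open>The exponents satisfy N = B * t for the buckets and N = 4 * M * t^2 for the chains; the
  latter is the equation under which a table covers each element with probability at least 1 / (8 *
  t). \<open>rs\<close> holds two seeds for each of the t columns of the \<open>l\<close>
  tables.\<close>

locale index =
  fixes kN kt kB kM Kb l :: nat and key :: "nat \<Rightarrow> nat" and W :: nat and rs :: "nat list"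
  assumes kN: "kN = kB + kt" "kN = kM + 2 + 2 * kt"
    and key_inj: "inj_on key {..<2 ^ kN}"
    and key_less: "X < 2 ^ kN \<Longrightarrow> key X < 2 ^ Kb"
    and W_hash: "2 * kN \<le> W"
    and rs_length: "length rs = 2 * (l * 2 ^ kt)"
begin

abbreviation "N \<equiv> 2 ^ kN :: nat"
abbreviation "t \<equiv> 2 ^ kt :: nat"
abbreviation "B \<equiv> 2 ^ kB :: nat"
abbreviation "M \<equiv> 2 ^ kM :: nat"

lemma N_eq: "N = B * t"
  by (simp add: kN(1) power_add)

lemma N_eq': "4 * M * t * t = N"
  by (simp add: kN(2) power_add mult_2)

definition A :: "nat list" where
  "A = sort (map key [0..<N])"

definition lb :: "nat \<Rightarrow> nat" where
  "lb z = card {X. X < N \<and> key X < z}"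

lemma length_A [simp]: "length A = N"
  by (simp add: A_def)

lemma set_A: "set A = key ` {..<N}"
  by (auto simp: A_def)

lemma sorted_A: "sorted A"
  by (simp add: A_def)

lemma distinct_A: "distinct A"
  unfolding A_def by (simp add: distinct_map key_inj lessThan_atLeast0[symmetric])

lemma lb_card: "lb z = card {x \<in> set A. x < z}"
proof -
  have "{x \<in> set A. x < z} = key ` {X. X < N \<and> key X < z}"
    unfolding set_A by auto
  moreover have "inj_on key {X. X < N \<and> key X < z}"
    by (rule inj_on_subset[OF key_inj]) auto
  ultimately show ?thesis
    by (simp add: lb_def card_image)
qed

lemma A_less_iff: "r < N \<Longrightarrow> A ! r < z \<longleftrightarrow> r < lb z"
  unfolding lb_card by (rule card_less_sorted[OF sorted_A distinct_A]) simp

lemma lb_le: "lb z \<le> N"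
proof -
  have "card {X. X < N \<and> key X < z} \<le> card {..<N}" by (intro card_mono) auto
  then show ?thesis by (simp add: lb_def)
qed

lemma lb_Suc_key:
  assumes "X < N"
  shows "lb (Suc (key X)) = Suc (lb (key X))"
proof -
  have "{Y. Y < N \<and> key Y < Suc (key X)} = insert X {Y. Y < N \<and> key Y < key X}"
    using assms inj_onD[OF key_inj] by (auto simp: less_Suc_eq)
  then show ?thesis by (simp add: lb_def)
qed

lemma lb_key_less: "X < N \<Longrightarrow> lb (key X) < N"
  using lb_Suc_key[of X] lb_le[of "Suc (key X)"] by simp

lemma A_le_iff: "r < N \<Longrightarrow> X < N \<Longrightarrow> A ! r \<le> key X \<longleftrightarrow> r \<le> lb (key X)"
  using A_less_iff[of r "Suc (key X)"] lb_Suc_key[of X] by (simp add: less_Suc_eq_le)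

lemma A_lb_key: "X < N \<Longrightarrow> A ! lb (key X) = key X"
  using A_le_iff[of "lb (key X)" X] A_less_iff[of "lb (key X)" "key X"] lb_key_less[of X] by simp

lemma A_ex: "r < N \<Longrightarrow> \<exists>X<N. key X = A ! r \<and> lb (key X) = r"
proof -
  assume r: "r < N"
  then obtain X where X: "X < N" "key X = A ! r"
    using nth_mem[of r A] by (auto simp: set_A)
  have "A ! lb (key X) = A ! r" using A_lb_key[OF X(1)] X(2) by simp
  then have "lb (key X) = r"
    using nth_eq_iff_index_eq[OF distinct_A] lb_key_less[OF X(1)] r by simp
  then show ?thesis using X by blast
qed

lemma A_less: "r < N \<Longrightarrow> A ! r < 2 ^ Kb"
  using A_ex[of r] key_less by auto

definition bucket_of :: "nat \<Rightarrow> nat" where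
  "bucket_of X = lb (key X) div t"

lemma bucket_of_less: "X < N \<Longrightarrow> bucket_of X < B"
  using lb_key_less[of X] by (simp add: bucket_of_def N_eq div_less_iff_less_mult)

text \<open>The bucket function requires only the first key of every bucket, that is B = N / t
  stored words; the rest of \<open>A\<close> stays implicit.\<close>

lemma bucket_of_bsearch: "X < N \<Longrightarrow> bsearch kB (\<lambda>c. A ! (c * t) \<le> key X) = bucket_of X"
proof (rule bsearch_eqI)
  assume X: "X < N"
  then show "bucket_of X < B" by (rule bucket_of_less)
  fix c assume "0 < c" "c < B"
  then have "c * t < N" by (simp add: N_eq)
  then show "A ! (c * t) \<le> key X \<longleftrightarrow> c \<le> bucket_of X"
    using X by (simp add: A_le_iff bucket_of_def less_eq_div_iff_mult_less_eq)
qed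

lemma card_bucket: "card {Y. Y < N \<and> bucket_of Y = j} \<le> t"
proof -
  have "inj_on (\<lambda>Y. lb (key Y) mod t) {Y. Y < N \<and> bucket_of Y = j}"
  proof (rule inj_onI)
    fix X Y assume *: "X \<in> {Y. Y < N \<and> bucket_of Y = j}" "Y \<in> {Y. Y < N \<and> bucket_of Y = j}"
      "lb (key X) mod t = lb (key Y) mod t"
    then have "lb (key X) = lb (key Y)"
      by (metis (mono_tags, lifting) bucket_of_def div_mult_mod_eq mem_Collect_eq)
    then have "key X = key Y" using A_lb_key * by (metis (mono_tags, lifting) mem_Collect_eq)
    then show "X = Y" using * inj_onD[OF key_inj] by auto
  qed
  then have "card {Y. Y < N \<and> bucket_of Y = j} \<le> card {..<t}"
    by (rule card_inj_on_le) auto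
  then show ?thesis by simp
qed

text \<open>The chain length also serves as the fibre bound, as a bucket has at most t
  elements.\<close>

sublocale rainbow "2 ^ W" N t t "mshash kN" bucket_of
proof (unfold_locales, goal_cases)
  case (3 a c b)
  then show ?case by (rule mshash_less)
next
  case (4 X)
  then show ?case
    using lb_key_less[of X] by (auto simp: bucket_of_def intro: le_less_trans[OF div_le_dividend])
next
  case (5 X)
  show ?case by (rule card_bucket)
next
  case (6 b x)
  then show ?case using mshash_uniform[OF W_hash, of x b] by simp
next
  case (7 b b' x y)
  then show ?case using mshash_pairwise[OF W_hash, of b b' x y] by simp
qed simp_all

section \<open>Chains and tables addressed by columns\<close>

definition hs :: "nat \<Rightarrow> nat \<Rightarrow> nat" where
  "hs q b = mshash kN (rs ! (2 * q)) (rs ! (2 * q + 1)) b"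

lemma hs_less: "hs q b < N"
  unfolding hs_def by (rule mshash_less)

definition walk :: "nat \<Rightarrow> nat \<Rightarrow> nat \<Rightarrow> nat \<Rightarrow> nat" where
  "walk s lo hi b = itr t (\<lambda>i b. if lo \<le> i \<and> i < hi then bucket_of (hs (s * t + i) b) else b) b"

lemma walk_eq:
  "lo \<le> hi \<Longrightarrow> hi \<le> t \<Longrightarrow> walk s lo hi b = itr (hi - lo) (\<lambda>i b. bucket_of (hs (s * t + (lo + i)) b)) b"
  unfolding walk_def by (subst itr_window) (simp_all add: min_absorb2)

lemma bucket_itr:
  "length ws = 2 * r \<Longrightarrow> bucket ws b = itr r (\<lambda>i b. bucket_of (mshash kN (ws ! (2 * i)) (ws ! (2 * i + 1)) b)) b"
proof (induction r arbitrary: ws b)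
  case (Suc r)
  then obtain a c ws' where ws: "ws = a # c # ws'"
    using numeral_2_eq_2 by (auto simp: length_Suc_conv)
  then show ?case using Suc by (simp add: itr_Suc_front del: itr.simps(2))
qed simp

lemma elem_itr:
  "length ws = 2 * r \<Longrightarrow> i < r \<Longrightarrow> elem i ws b = mshash kN (ws ! (2 * i)) (ws ! (2 * i + 1))
    (itr i (\<lambda>i b. bucket_of (mshash kN (ws ! (2 * i)) (ws ! (2 * i + 1)) b)) b)"
proof (induction i arbitrary: ws b r)
  case 0
  then obtain a c ws' where ws: "ws = a # c # ws'"
    using numeral_2_eq_2 by (cases r) (auto simp: length_Suc_conv)
  then show ?case by simp
next
  case (Suc i)
  then obtain a c ws' where ws: "ws = a # c # ws'"
    using numeral_2_eq_2 by (cases r) (auto simp: length_Suc_conv)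
  then show ?case
    using Suc.IH[of ws' "r - 1"] Suc.prems by (simp add: itr_Suc_front del: itr.simps(2))
qed

lemma block_nth:
  assumes "s < l" "i < t"
  shows "length (block s rs) = 2 * t" "block s rs ! (2 * i) = rs ! (2 * (s * t + i))"
    "block s rs ! (2 * i + 1) = rs ! (2 * (s * t + i) + 1)"
proof -
  have "Suc s * t \<le> l * t" using assms(1) by (intro mult_le_mono1) simp
  then have "2 * t * s + 2 * t \<le> length rs" by (simp add: rs_length algebra_simps)
  then show "length (block s rs) = 2 * t" "block s rs ! (2 * i) = rs ! (2 * (s * t + i))"
    "block s rs ! (2 * i + 1) = rs ! (2 * (s * t + i) + 1)"
    using assms(2) by (simp_all add: block_def algebra_simps)
qed

text \<open>Table, end and start of a chain packed into one number. Sorting these numbers sorts by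
  table and then by end, so a single sorted list serves all tables.\<close>

definition word :: "nat \<Rightarrow> nat \<Rightarrow> nat \<Rightarrow> nat" where
  "word s e c = (s * B + e) * M + c"

definition T :: "nat list" where
  "T = sort (map (\<lambda>q. word (q div M) (walk (q div M) 0 t (q mod M)) (q mod M)) [0..<l * M])"

lemma length_T [simp]: "length T = l * M"
  by (simp add: T_def)

lemma M_le_N: "M \<le> N"
  by (intro power_increasing) (use kN(2) in auto)

lemma B_le_N: "B \<le> N"
  by (intro power_increasing) (use kN(1) in auto)

lemma walk_end: "c < N \<Longrightarrow> walk s 0 t c < B"
proof -
  assume c: "c < N"
  have "walk s 0 t c = itr t (\<lambda>i b. bucket_of (hs (s * t + i) b)) c"
    by (simp add: walk_eq)
  also obtain r where r: "t = Suc r" by (cases t) auto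
  have "itr t (\<lambda>i b. bucket_of (hs (s * t + i) b)) c =
      bucket_of (hs (s * t + r) (itr r (\<lambda>i b. bucket_of (hs (s * t + i) b)) c))"
    by (simp only: r itr.simps)
  finally show ?thesis using bucket_of_less[OF hs_less] by simp
qed

lemma word_less: "s < l \<Longrightarrow> e < B \<Longrightarrow> c < M \<Longrightarrow> word s e c < l * B * M"
proof -
  assume *: "s < l" "e < B" "c < M"
  have "s * B + e < Suc s * B" using * by simp
  also have "\<dots> \<le> l * B" using * by (intro mult_le_mono1) simp
  finally have "Suc (s * B + e) * M \<le> l * B * M" by (intro mult_le_mono1) simp
  then show ?thesis using * by (simp add: word_def)
qed

lemma set_T: "x \<in> set T \<longleftrightarrow> (\<exists>s<l. \<exists>c<M. x = word s (walk s 0 t c) c)"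
proof
  assume "x \<in> set T"
  then obtain q where q: "q < l * M" "x = word (q div M) (walk (q div M) 0 t (q mod M)) (q mod M)"
    by (auto simp: T_def)
  then show "\<exists>s<l. \<exists>c<M. x = word s (walk s 0 t c) c"
    by (intro exI[of _ "q div M"] conjI exI[of _ "q mod M"]) (auto simp: div_less_iff_less_mult)
next
  assume "\<exists>s<l. \<exists>c<M. x = word s (walk s 0 t c) c"
  then obtain s c where sc: "s < l" "c < M" "x = word s (walk s 0 t c) c" by blast
  have "s * M + c < Suc s * M" using sc by simp
  also have "\<dots> \<le> l * M" using sc by (intro mult_le_mono1) simp
  finally have "s * M + c \<in> set [0..<l * M]" by simp
  moreover have "(s * M + c) div M = s" "(s * M + c) mod M = c" using sc by simp_all
  ultimately show "x \<in> set T"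
    unfolding T_def set_sort set_map using sc by (auto intro!: rev_image_eqI)
qed

lemma T_less: "q < l * M \<Longrightarrow> T ! q < l * B * M"
proof -
  assume "q < l * M"
  then have "T ! q \<in> set T" by simp
  then obtain s c where "s < l" "c < M" "T ! q = word s (walk s 0 t c) c"
    unfolding set_T by blast
  then show ?thesis using word_less walk_end[OF less_le_trans[OF _ M_le_N]] by metis
qed

text \<open>The element of bucket \<open>j\<close> that is expected in column \<open>q mod t\<close>
  of table \<open>q div t\<close>: the chain is completed from \<open>j\<close> to its end, the last
  stored word below the words of the next end supplies a start, and the chain is replayed from there
  up to the column. The result may be wrong; \<open>nxt\<close> checks it.\<close>

definition cand :: "nat \<Rightarrow> nat \<Rightarrow> nat \<Rightarrow> nat" where
  "cand kL j q = (let s = q div t; i = q mod t; e = walk s (i + 1) t j;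
      pos = bsearch kL (\<lambda>c. c < l * M \<and> T ! c < (s * B + e + 1) * M);
      c = T ! pos mod M in hs q (walk s 0 i c))"

lemma cand_less: "cand kL j q < N"
  by (simp add: cand_def Let_def hs_less)

text \<open>The chain that covers \<open>X\<close> passes \<open>bucket_of X\<close> right after its
  column, so completing from there yields its end. As a hit shares this end with no other chain of
  the table, the lookup can return only its start.\<close>

lemma cand_complete:
  assumes "s < l" "covered M (block s rs) X" "X < N" "l * M \<le> 2 ^ kL"
  shows "\<exists>q < l * t. cand kL (bucket_of X) q = X"
proof -
  obtain c i where c: "c < M" "i < t" "hit M (block s rs) X c i"
    using assms(2) unfolding covered_def by blast
  define ws where "ws = block s rs"
  have len: "length ws = 2 * t" using block_nth(1)[OF assms(1) c(2)] by (simp add: ws_def)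
  have step: "mshash kN (ws ! (2 * i)) (ws ! (2 * i + 1)) = hs (s * t + i)" if "i < t" for i
    using block_nth(2,3)[OF assms(1) that] by (simp add: ws_def hs_def fun_eq_iff)
  have bk: "bucket ws b = walk s 0 t b" for b
    unfolding bucket_itr[OF len] walk_eq[OF zero_le order.refl] diff_zero
    by (intro itr_cong) (simp only: step add_0)
  have el: "X = hs (s * t + i) (walk s 0 i c)"
  proof -
    have "X = elem i ws c" using c(3) by (simp add: hit_def ws_def)
    also have "\<dots> = hs (s * t + i) (itr i (\<lambda>i b. bucket_of (mshash kN (ws ! (2 * i)) (ws ! (2 * i + 1)) b)) c)"
      unfolding elem_itr[OF len c(2)] step[OF c(2)] ..
    also have "itr i (\<lambda>i b. bucket_of (mshash kN (ws ! (2 * i)) (ws ! (2 * i + 1)) b)) c =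
        itr i (\<lambda>i b. bucket_of (hs (s * t + i) b)) c"
      using c(2) by (intro itr_cong) (simp only: step)
    finally show ?thesis using c(2) by (simp add: walk_eq)
  qed
  have e: "walk s (i + 1) t (bucket_of X) = walk s 0 t c"
  proof -
    define F where "F = (\<lambda>i b. bucket_of (hs (s * t + i) b))"
    have "itr (r + k) F b = itr r (\<lambda>i. F (k + i)) (itr k F b)" for r k b
      by (induction r) (simp_all add: add.commute)
    from this[of "t - (i + 1)" "i + 1" c]
    have "itr t F c = itr (t - (i + 1)) (\<lambda>j. F (i + 1 + j)) (itr (i + 1) F c)"
      using c(2) by simp
    moreover have "itr (i + 1) F c = bucket_of X"
      using el c(2) by (simp add: F_def walk_eq)
    ultimately show ?thesis
      using c(2) by (simp add: walk_eq F_def)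
  qed
  define q where "q = s * t + i"
  have q: "q div t = s" "q mod t = i" using c(2) by (simp_all add: q_def)
  have "q < Suc s * t" using c(2) by (simp add: q_def)
  also have "\<dots> \<le> l * t" using assms(1) by (intro mult_le_mono1) simp
  finally have ql: "q < l * t" .
  define e where "e = walk s 0 t c"
  define bnd where "bnd = (s * B + e + 1) * M"
  define P where "P = (\<lambda>c. c < l * M \<and> T ! c < bnd)"
  define pos where "pos = bsearch kL P"
  have sortT: "sorted T" by (simp add: T_def)
  have anti: "\<forall>c c'. 0 < c \<longrightarrow> c \<le> c' \<longrightarrow> c' < 2 ^ kL \<longrightarrow> P c' \<longrightarrow> P c"
  proof (intro allI impI)
    fix c c' assume "c \<le> c'" "P c'"
    then show "P c"
      using sorted_nth_mono[OF sortT, of c c'] by (simp add: P_def)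
  qed
  have "word s e c \<in> set T" unfolding set_T e_def using assms(1) c(1) by blast
  then obtain i0 where i0: "i0 < l * M" "T ! i0 = word s e c"
    by (auto simp: in_set_conv_nth)
  have Pi0: "P i0" using i0 c(1) by (simp add: P_def bnd_def word_def)
  \<comment> \<open>Position 0 is never probed by the binary search, but it is the default
    answer.\<close>
  have "i0 \<le> pos"
    using bsearch(2)[OF anti, of i0] Pi0 i0 assms(4) unfolding pos_def by (cases "i0 = 0") auto
  moreover have Ppos: "P pos"
  proof (cases "pos = 0")
    case True
    then show ?thesis using Pi0 \<open>i0 \<le> pos\<close> by simp
  next
    case False
    then show ?thesis using bsearch[OF anti] unfolding pos_def by auto
  qed
  ultimately have "word s e c \<le> T ! pos" "T ! pos < bnd" "pos < l * M"
    using sorted_nth_mono[OF sortT, of i0 pos] i0 by (auto simp: P_def)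
  then have div: "T ! pos div M = s * B + e"
    by (intro div_nat_eqI) (auto simp: word_def bnd_def mult.commute)
  have "T ! pos \<in> set T" using \<open>pos < l * M\<close> by simp
  then obtain s' c' where sc: "s' < l" "c' < M" "T ! pos = word s' (walk s' 0 t c') c'"
    unfolding set_T by blast
  have "s' * B + walk s' 0 t c' = s * B + e"
    using div sc(2) unfolding sc(3) word_def by simp
  moreover have "walk s' 0 t c' < B" "e < B"
    unfolding e_def using walk_end[OF less_le_trans[OF _ M_le_N]] sc(2) c(1) by blast+
  ultimately have "s' = s" "walk s' 0 t c' = e"
    using digit_unique by blast+
  then have "c' = c"
    using c(3) sc(2) unfolding hit_def ws_def[symmetric] bk e_def by metis
  then have "T ! pos mod M = c"
    using sc by (simp add: word_def)
  then have "cand kL (bucket_of X) q = X"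
    unfolding cand_def Let_def q e e_def[symmetric] bnd_def[symmetric] P_def[symmetric] pos_def[symmetric]
    using el by (simp add: q_def)
  then show ?thesis using ql by blast
qed

text \<open>Wrong candidates are harmless, since only those verified to lie in bucket
  \<open>j\<close> compete for the minimum. The initial value \<open>2 ^ Kb\<close> exceeds all
  keys.\<close>

definition nxt :: "nat \<Rightarrow> nat \<Rightarrow> nat \<Rightarrow> nat" where
  "nxt kL j y = itr (l * t) (\<lambda>q a. if bucket_of (cand kL j q) = j \<and> y \<le> key (cand kL j q) \<and>
     key (cand kL j q) < a then key (cand kL j q) else a) (2 ^ Kb)"

text \<open>The accumulator is one more than the last key found, so the next call of
  \<open>nxt\<close> looks for strictly larger keys. The first \<open>r mod t + 1\<close> rounds do
  this, the others idle, and the final subtraction undoes the shift.\<close>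

definition access :: "nat \<Rightarrow> nat \<Rightarrow> nat" where
  "access kL r = itr t (\<lambda>i y. if r mod t < i then y else nxt kL (r div t) y + 1) 0 - 1"

lemma nxt_le: "nxt kL j y \<le> 2 ^ Kb"
proof -
  have "itr i (\<lambda>q a. if bucket_of (cand kL j q) = j \<and> y \<le> key (cand kL j q) \<and>
     key (cand kL j q) < a then key (cand kL j q) else a) (2 ^ Kb) \<le> 2 ^ Kb" for i
    by (induction i) auto
  then show ?thesis by (simp add: nxt_def)
qed

end

text \<open>Coverage of every element is the only thing that queries demand of the seeds.\<close>

locale good_index = index +
  fixes kL :: nat
  assumes good: "X < 2 ^ kN \<Longrightarrow> \<exists>s<l. covered (2 ^ kM) (block s rs) X"
    and kL: "l * 2 ^ kM \<le> 2 ^ kL"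
begin

text \<open>Coverage puts the wanted element among the candidates; the test of the bucket ensures
  that no verified candidate in the range is smaller.\<close>

lemma nxt_eq:
  assumes "r < N" "r div t = j" "y \<le> A ! r" "\<And>r'. r' < r \<Longrightarrow> r' div t = j \<Longrightarrow> A ! r' < y"
  shows "nxt kL j y = A ! r"
proof -
  let ?S = "{key (cand kL j q) |q. q < l * t \<and> bucket_of (cand kL j q) = j \<and> y \<le> key (cand kL j q)}"
  have "nxt kL j y = itr (l * t) (\<lambda>q a. if (bucket_of (cand kL j q) = j \<and> y \<le> key (cand kL j q)) \<and>
     key (cand kL j q) < a then key (cand kL j q) else a) (2 ^ Kb)"
    unfolding nxt_def conj_assoc ..
  also have "\<dots> = Min (insert (2 ^ Kb) ?S)"
    unfolding itr_min ..
  also have "\<dots> = A ! r"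
  proof (rule Min_eqI)
    show "finite (insert (2 ^ Kb) ?S)" by simp
    obtain X where X: "X < N" "key X = A ! r" "lb (key X) = r" using A_ex[OF assms(1)] by blast
    have b: "bucket_of X = j" using X assms(2) by (simp add: bucket_of_def)
    obtain q where "q < l * t" "cand kL j q = X"
      using good[OF X(1)] cand_complete[OF _ _ X(1) kL] b by blast
    then show "A ! r \<in> insert (2 ^ Kb) ?S"
      using X b assms(3) by (metis (mono_tags, lifting) insertI2 mem_Collect_eq)
    show "A ! r \<le> z" if zI: "z \<in> insert (2 ^ Kb) ?S" for z
    proof (cases "z = 2 ^ Kb")
      case True
      then show ?thesis using A_less[OF assms(1)] by simp
    next
      case False
      then obtain q where q: "z = key (cand kL j q)" "bucket_of (cand kL j q) = j" "y \<le> z"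
        using zI by blast
      let ?X = "cand kL j q"
      have "?X < N" by (rule cand_less)
      have "\<not> lb (key ?X) < r"
      proof
        assume "lb (key ?X) < r"
        then have "A ! lb (key ?X) < y" using assms(4) q(2) by (simp add: bucket_of_def)
        then show False using A_lb_key[OF \<open>?X < N\<close>] q by simp
      qed
      then have "A ! r \<le> A ! lb (key ?X)"
        using sorted_nth_mono[OF sorted_A, of r "lb (key ?X)"] lb_key_less[OF \<open>?X < N\<close>] by simp
      then show ?thesis using A_lb_key[OF \<open>?X < N\<close>] q by simp
    qed
  qed
  finally show ?thesis .
qed

lemma access_eq:
  assumes "r < N"
  shows "access kL r = A ! r"
proof -
  define j g where "j = r div t" and "g = r mod t"
  have r: "r = j * t + g" "g < t" by (simp_all only: j_def g_def div_mult_mod_eq) simp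
  let ?F = "\<lambda>i y. if g < i then y else nxt kL j y + 1"
  have "itr (Suc i) ?F 0 = A ! (j * t + min i g) + 1" for i
  proof (induction i)
    case 0
    have "nxt kL j 0 = A ! (j * t)"
    proof (rule nxt_eq)
      fix r' assume r': "r' < j * t" "r' div t = j"
      have "r' div t < j" using r'(1) by (simp add: div_less_iff_less_mult)
      then show "A ! r' < 0" using r'(2) by (metis less_irrefl)
    qed (use assms r in auto)
    then show ?case by simp
  next
    case (Suc i)
    show ?case
    proof (cases "g < Suc i")
      case True
      then have "min (Suc i) g = min i g" by simp
      then show ?thesis using Suc True by simp
    next
      case False
      then have min: "min i g = i" "min (Suc i) g = Suc i" by auto
      have "nxt kL j (A ! (j * t + i) + 1) = A ! (j * t + Suc i)"
      proof (rule nxt_eq)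
        show lt: "j * t + Suc i < N" using False assms r by simp
        show "(j * t + Suc i) div t = j"
          using False r(2) by (intro div_nat_eqI) (simp_all add: mult.commute)
        show "A ! (j * t + i) + 1 \<le> A ! (j * t + Suc i)"
          using sorted_wrt_nth_less[of "(<)" A "j * t + i" "j * t + Suc i"] sorted_A distinct_A lt
          by (simp add: strict_sorted_iff)
        fix r' assume "r' < j * t + Suc i" "r' div t = j"
        then show "A ! r' < A ! (j * t + i) + 1"
          using sorted_nth_mono[OF sorted_A, of r' "j * t + i"] lt by (simp add: less_Suc_eq_le)
      qed
      then show ?thesis using Suc False unfolding min by simp
    qed
  qed
  from this[of "t - 1"] have "itr t ?F 0 = A ! r + 1"
    using r by (simp add: min_absorb2)
  then show ?thesis unfolding access_def j_def[symmetric] g_def[symmetric] by simp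
qed

text \<open>Ranks run from 0 to N inclusive, which takes \<open>kN + 1\<close> bits; probes above N
  are rejected by the first conjunct.\<close>

lemma lb_bsearch: "bsearch (kN + 1) (\<lambda>c. c \<le> N \<and> access kL (c - 1) < z) = lb z"
proof (rule bsearch_eqI)
  show "lb z < 2 ^ (kN + 1)"
    using lb_le[of z] by (simp add: le_less_trans)
  fix c :: nat assume "0 < c" "c < 2 ^ (kN + 1)"
  then show "c \<le> N \<and> access kL (c - 1) < z \<longleftrightarrow> c \<le> lb z"
    using access_eq[of "c - 1"] A_less_iff[of "c - 1" z] lb_le[of z] by (cases "c \<le> N") auto
qed

end

section \<open>Programs for the implicit sorted array\<close>

text \<open>
  Loop parameters by number: 6 is the chain length and bucket size, 7 and 8 the number of elements
  (as exponent and value), 9 and 29 the number of buckets, 11 the number of chains per table, 13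
  the total number of chains, 14 the number of columns of all tables, 18 the key length, 22, 23
  and 24 the addresses of the hash functions, samples and chains, 28 the length of chain positions.
\<close>

definition bsE :: "nat \<Rightarrow> nat \<Rightarrow> exp \<Rightarrow> exp" where
  "bsE k x e = Iter k (x + 1) (x + 2) (Num 0)
     (Bind x (eAdd (Var (x + 1)) (eShl (Num 1) (eSub (eSub (Par k) (Num 1)) (Var (x + 2)))))
       (Cond e (Var x) (Var (x + 1))))"

text \<open>Constructs that are nested in each other bind different variable numbers, so an argument
  evaluated under such bindings keeps its meaning. The arithmetic wraps modulo \<open>2 ^ W\<close>,
  which is harmless before the reduction modulo \<open>2 ^ (2 * kN)\<close>.\<close>

definition hE :: "exp \<Rightarrow> exp \<Rightarrow> exp" where
  "hE q b = Bind 5 q (Bind 6 b (eShr (eMod (eAdd (eMul (Read (eAdd (Par 22) (eMul (Num 2) (Var 5))))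
     (Var 6)) (Read (eAdd (eAdd (Par 22) (eMul (Num 2) (Var 5))) (Num 1))))
     (eShl (Num 1) (eMul (Num 2) (Par 7)))) (Par 7)))"

definition nlessE :: "exp \<Rightarrow> exp \<Rightarrow> exp" where
  "nlessE a b = eEq (eLess a b) (Num 0)"

definition keyE :: "exp \<Rightarrow> exp \<Rightarrow> exp" where
  "keyE KE X = Bind 0 X KE"

definition fE :: "exp \<Rightarrow> exp \<Rightarrow> exp" where
  "fE KE X = Bind 1 (keyE KE X) (bsE 9 2 (nlessE (Var 1) (Read (eAdd (Par 23) (Var 2)))))"

definition walkE :: "exp \<Rightarrow> exp \<Rightarrow> exp \<Rightarrow> exp \<Rightarrow> exp \<Rightarrow> exp" where
  "walkE KE s lo hi b = Bind 7 s (Bind 8 lo (Bind 9 hi (Iter 6 10 11 b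
     (Cond (eAnd (nlessE (Var 11) (Var 8)) (eLess (Var 11) (Var 9)))
       (fE KE (hE (eAdd (eMul (Var 7) (Par 6)) (Var 11)) (Var 10))) (Var 10)))))"

definition candE :: "exp \<Rightarrow> exp \<Rightarrow> exp \<Rightarrow> exp" where
  "candE KE j q = Bind 12 j (Bind 13 q (Bind 14 (eDiv (Var 13) (Par 6)) (Bind 15 (eMod (Var 13) (Par 6))
     (Bind 16 (walkE KE (Var 14) (eAdd (Var 15) (Num 1)) (Par 6) (Var 12))
     (Bind 17 (eMul (eAdd (eAdd (eMul (Var 14) (Par 29)) (Var 16)) (Num 1)) (Par 11))
     (Bind 18 (bsE 28 19 (eAnd (eLess (Var 19) (Par 13)) (eLess (Read (eAdd (Par 24) (Var 19))) (Var 17))))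
     (Bind 22 (eMod (Read (eAdd (Par 24) (Var 18))) (Par 11))
       (hE (Var 13) (walkE KE (Var 14) (Num 0) (Var 15) (Var 22))))))))))"

definition nextE :: "exp \<Rightarrow> exp \<Rightarrow> exp \<Rightarrow> exp" where
  "nextE KE j y = Bind 23 j (Bind 24 y (Iter 14 25 26 (eShl (Num 1) (Par 18))
     (Bind 27 (candE KE (Var 23) (Var 26)) (Bind 28 (keyE KE (Var 27))
       (Cond (eAnd (eAnd (eEq (fE KE (Var 27)) (Var 23)) (nlessE (Var 28) (Var 24)))
           (eLess (Var 28) (Var 25))) (Var 28) (Var 25))))))"

definition accessE :: "exp \<Rightarrow> exp \<Rightarrow> exp" where
  "accessE KE r = Bind 29 r (eSub (Iter 6 30 31 (Num 0)
     (Cond (eLess (eMod (Var 29) (Par 6)) (Var 31)) (Var 30)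
       (eAdd (nextE KE (eDiv (Var 29) (Par 6)) (Var 30)) (Num 1)))) (Num 1))"

definition lbE :: "exp \<Rightarrow> exp \<Rightarrow> exp" where
  "lbE KE z = Bind 32 z (bsE 30 33 (eAnd (nlessE (Par 8) (Var 33))
     (eLess (accessE KE (eSub (Var 33) (Num 1))) (Var 32))))"

lemma and_of_bool [simp]:
  "semiring_bit_operations_class.and (of_bool P) (of_bool Q) = (of_bool (P \<and> Q) :: nat)"
  by (cases P; cases Q) simp_all

lemma eval_opI: "eval W p m a v = x \<Longrightarrow> eval W p m b v = y \<Longrightarrow>
    eval W p m (Op f a b) v = binop_val W f x y"
  by simp

lemma eval_nlessE: "0 < W \<Longrightarrow> eval W p m (nlessE a b) v = of_bool (\<not> eval W p m a v < eval W p m b v)"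
  by (simp add: nlessE_def)

lemma eval_sub:
  assumes "eval W p m b v \<le> eval W p m a v" "eval W p m a v < 2 ^ W"
  shows "eval W p m (eSub a b) v = eval W p m a v - eval W p m b v"
proof -
  have "eval W p m a v + 2 ^ W - eval W p m b v = (eval W p m a v - eval W p m b v) + 2 ^ W"
    using assms(1) by simp
  then show ?thesis using assms(2) by (simp only: eval.simps binop_val.simps mod_add_self2) simp
qed

lemma eval_shl: "eval W p m a v * 2 ^ eval W p m b v < 2 ^ W \<Longrightarrow>
    eval W p m (eShl a b) v = eval W p m a v * 2 ^ eval W p m b v"
  by (simp add: push_bit_eq_mult)

text \<open>The expression has to agree with \<open>P\<close> only at positions that can be
  probed.\<close>

lemma eval_bsE:
  assumes "p k = n" "n \<le> W" "n < 2 ^ W" "0 < W"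
    and e: "\<And>a i c. 0 < c \<Longrightarrow> c < 2 ^ n \<Longrightarrow> (eval W p m e (v(x + 1 := a, x + 2 := i, x := c)) \<noteq> 0) = P c"
  shows "eval W p m (bsE k x e) v = bsearch n P"
proof -
  let ?F = "\<lambda>i j. if P (j + 2 ^ (n - 1 - i)) then j + 2 ^ (n - 1 - i) else j :: nat"
  let ?G = "\<lambda>i j. eval W p m (Bind x (eAdd (Var (x + 1)) (eShl (Num 1) (eSub (eSub (Par k) (Num 1)) (Var (x + 2)))))
       (Cond e (Var x) (Var (x + 1)))) (v(x + 1 := j, x + 2 := i))"
  have nW: "2 ^ n \<le> (2 :: nat) ^ W" using assms(2) by simp
  have "itr i ?G 0 = itr i ?F 0 \<and> itr i ?F 0 + 2 ^ (n - i) \<le> 2 ^ n" if "i \<le> n" for i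
    using that
  proof (induction i)
    case (Suc i)
    let ?j = "itr i ?F 0" and ?s = "2 ^ (n - 1 - i) :: nat"
    have "n - i = Suc (n - 1 - i)" using Suc.prems by simp
    then have s: "2 ^ (n - i) = ?s + ?s" by simp
    have s': "2 ^ (n - Suc i) = ?s" by simp
    have IH': "itr i ?G 0 = ?j \<and> ?j + 2 ^ (n - i) \<le> 2 ^ n"
      by (rule Suc.IH[OF Suc_leD[OF Suc.prems]])
    then have IH: "itr i ?G 0 = ?j" "?j + ?s + ?s \<le> 2 ^ n"
      unfolding s add.assoc by blast+
    have lt: "?j + ?s < 2 ^ n"
      using IH(2) zero_less_power[of "2 :: nat" "n - 1 - i"] by linarith
    have pos: "0 < ?j + ?s"
      by simp
    have sub: "eval W p m (eSub (eSub (Par k) (Num 1)) (Var (x + 2))) (v(x + 1 := ?j, x + 2 := i)) = n - 1 - i"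
    proof -
      let ?v = "v(x + 1 := ?j, x + 2 := i)"
      have e: "eval W p m (Par k) ?v = n" "eval W p m (Num 1) ?v = 1" "eval W p m (Var (x + 2)) ?v = i"
        using assms(1,4) by simp_all
      have 1: "eval W p m (eSub (Par k) (Num 1)) ?v = n - 1"
        using eval_sub[of W p m "Num 1" ?v "Par k"] Suc.prems assms(3) unfolding e by linarith
      have "i \<le> n - 1" "n - 1 < 2 ^ W" using Suc.prems assms(3) by linarith+
      then show ?thesis
        using eval_sub[of W p m "Var (x + 2)" ?v "eSub (Par k) (Num 1)"] unfolding e 1 by simp
    qed
    have "?s < 2 ^ W" using lt nW by linarith
    moreover have "eval W p m (Num 1) (v(x + 1 := ?j, x + 2 := i)) = 1" using assms(4) by simp
    ultimately have shl: "eval W p m (eShl (Num 1) (eSub (eSub (Par k) (Num 1)) (Var (x + 2))))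
        (v(x + 1 := ?j, x + 2 := i)) = ?s"
      using eval_shl[of W p m "Num 1" "v(x + 1 := ?j, x + 2 := i)"
        "eSub (eSub (Par k) (Num 1)) (Var (x + 2))"] unfolding sub by (simp only: mult_1)
    have var: "eval W p m (Var (x + 1)) (v(x + 1 := ?j, x + 2 := i)) = ?j" by simp
    have "?j + ?s < 2 ^ W" using lt nW by linarith
    then have add: "eval W p m (eAdd (Var (x + 1)) (eShl (Num 1) (eSub (eSub (Par k) (Num 1)) (Var (x + 2)))))
        (v(x + 1 := ?j, x + 2 := i)) = ?j + ?s"
      unfolding eval_opI[OF var shl] binop_val.simps by (rule mod_less)
    have "?G i ?j = (if P (?j + ?s) then ?j + ?s else ?j) mod 2 ^ W"
      unfolding eval.simps(6) add eval.simps(7) e[OF pos lt] by simp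
    also have "\<dots> = ?F i ?j"
      by (intro mod_less le_less_trans[OF _ \<open>?j + ?s < 2 ^ W\<close>]) simp
    finally have "itr (Suc i) ?G 0 = itr (Suc i) ?F 0"
      unfolding itr.simps IH(1) .
    moreover have "itr (Suc i) ?F 0 + 2 ^ (n - Suc i) \<le> 2 ^ n"
      unfolding itr.simps s' using IH(2) by auto
    ultimately show ?case by blast
  next
    case 0
    show ?case by (simp only: itr.simps)  simp
  qed
  from this[of n] have "itr n ?G 0 = itr n ?F 0" by blast
  moreover have "eval W p m (Num 0) v = 0" by simp
  ultimately show ?thesis
    unfolding bsE_def bsearch_def eval.simps(8) assms(1) by metis
qed

text \<open>Seeds and samples suffice to evaluate the bucket function and to walk along chains. They
  are separated from the tables because the construction walks along chains before any table
  exists.\<close>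

locale index_code = index +
  fixes p m :: "nat \<Rightarrow> nat" and KE :: exp and P0 P1 :: nat
  assumes par: "p 6 = 2 ^ kt" "p 7 = kN" "p 8 = 2 ^ kN" "p 9 = kB" "p 22 = P0" "p 23 = P1"
    and P1: "P0 + 2 * (l * 2 ^ kt) \<le> P1" "P1 + 2 ^ kB < 2 ^ W"
    and W: "2 * kN + 2 < W"
    and KE: "v 0 < 2 ^ kN \<Longrightarrow> eval W p m KE v = key (v 0)"
    and seeds: "q < 2 * (l * 2 ^ kt) \<Longrightarrow> m (P0 + q) = rs ! q"
    and samples: "c < 2 ^ kB \<Longrightarrow> m (P1 + c) = A ! (c * 2 ^ kt)"
begin

lemma W0: "0 < W" using W by simp

lemma pow_less_W: "k < W \<Longrightarrow> (2 :: nat) ^ k < 2 ^ W"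
  by simp

lemma small: "kB < W" "kB < 2 ^ W" "(2::nat) < 2 ^ W" "kN < 2 ^ W" "2 * kN < 2 ^ W" "2 ^ kN < (2 :: nat) ^ W"
proof -
  show "kB < W" using kN(1) W by simp
  then show "kB < 2 ^ W" by (rule less_trans) (rule less_exp)
  show "(2::nat) < 2 ^ W" using pow_less_W[of 1] W by simp
  have "2 * kN < W" "kN < W" using W by simp_all
  then show "2 * kN < 2 ^ W" "kN < 2 ^ W" by (meson less_exp less_trans)+
  show "2 ^ kN < (2 :: nat) ^ W" using W by (intro pow_less_W) simp
qed

lemma eval_keyE: "eval W p m X v < 2 ^ kN \<Longrightarrow> eval W p m (keyE KE X) v = key (eval W p m X v)"
  by (simp add: keyE_def KE)

lemma eval_fE:
  assumes "eval W p m X v < 2 ^ kN"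
  shows "eval W p m (fE KE X) v = bucket_of (eval W p m X v)"
proof -
  let ?X = "eval W p m X v"
  have "eval W p m (bsE 9 2 (nlessE (Var 1) (Read (eAdd (Par 23) (Var 2))))) (v(1 := key ?X)) =
      bsearch kB (\<lambda>c. A ! (c * t) \<le> key ?X)"
  proof (rule eval_bsE[where n = kB])
    fix a i c :: nat assume c: "c < 2 ^ kB"
    then have "(P1 + c) mod 2 ^ W = P1 + c" using P1(2) by simp
    then show "(eval W p m (nlessE (Var 1) (Read (eAdd (Par 23) (Var 2))))
        (v(1 := key ?X, 2 + 1 := a, 2 + 2 := i, 2 := c)) \<noteq> 0) = (A ! (c * t) \<le> key ?X)"
      unfolding eval_nlessE[OF W0] using samples[OF c] by (simp add: par not_less)
  qed (use small W0 par in auto)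
  then show ?thesis
    unfolding fE_def eval.simps eval_keyE[OF assms] bucket_of_bsearch[OF assms] .
qed

lemma mod_hash: "((x mod 2 ^ W) + c) mod 2 ^ W mod 2 ^ (2 * kN) = (x + c) mod 2 ^ (2 * kN)" for x c :: nat
proof -
  have "(2 :: nat) ^ (2 * kN) dvd 2 ^ W" using W by (intro le_imp_power_dvd) simp
  then show ?thesis by (simp add: mod_mod_cancel mod_add_left_eq)
qed

lemma eval_hE:
  assumes "eval W p m q v < l * 2 ^ kt"
  shows "eval W p m (hE q b) v = hs (eval W p m q v) (eval W p m b (v(5 := eval W p m q v)))"
proof -
  let ?q = "eval W p m q v"
  let ?b = "eval W p m b (v(5 := ?q))"
  have q: "2 * ?q + 1 < 2 * (l * 2 ^ kt)" using assms by linarith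
  then have less: "P0 + 2 * ?q + 1 < 2 ^ W" using P1 by linarith
  have mods: "2 * ?q mod 2 ^ W = 2 * ?q" "(P0 + 2 * ?q) mod 2 ^ W = P0 + 2 * ?q"
    "(P0 + 2 * ?q + 1) mod 2 ^ W = P0 + 2 * ?q + 1"
    using less by auto
  have m: "m (P0 + 2 * ?q) = rs ! (2 * ?q)" "m (P0 + 2 * ?q + 1) = rs ! (2 * ?q + 1)"
    using seeds[of "2 * ?q"] seeds[of "2 * ?q + 1"] q by (auto simp: add.assoc)
  have shl: "eval W p m (eShl (Num 1) (eMul (Num 2) (Par 7))) v' = 2 ^ (2 * kN)" for v'
  proof -
    have "eval W p m (eMul (Num 2) (Par 7)) v' = 2 * kN"
      using small by (simp add: par)
    then show ?thesis using W W0 by (subst eval_shl) auto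
  qed
  have pw: "2 * kN mod 2 ^ W = 2 * kN" "2 ^ (2 * kN) mod 2 ^ W = (2 :: nat) ^ (2 * kN)"
    using small(5) pow_less_W[of "2 * kN"] W by simp_all
  have two: "2 mod 2 ^ W = (2 :: nat)" "1 mod 2 ^ W = (1 :: nat)" using small by auto
  have "eval W p m (hE q b) v =
      ((rs ! (2 * ?q) * ?b) mod 2 ^ W + rs ! (2 * ?q + 1)) mod 2 ^ W mod 2 ^ (2 * kN) div 2 ^ kN"
    unfolding hE_def eval.simps binop_val.simps shl[unfolded eval.simps binop_val.simps] two par
    using m by (simp add: mods mods[unfolded Suc_eq_plus1[symmetric]] drop_bit_eq_div pw)
  then show ?thesis
    unfolding hs_def mshash_def mod_hash .
qed

lemma eval_walkE:
  assumes s: "eval W p m s v = s'" "s' < l"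
    and lo: "eval W p m lo (v(7 := s')) = lo'"
    and hi: "eval W p m hi (v(7 := s', 8 := lo')) = hi'"
    and b: "eval W p m b (v(7 := s', 8 := lo', 9 := hi')) = b'" "b' < 2 ^ kN"
  shows "eval W p m (walkE KE s lo hi b) v = walk s' lo' hi' b'"
proof -
  let ?F = "\<lambda>i b. if lo' \<le> i \<and> i < hi' then bucket_of (hs (s' * t + i) b) else b"
  let ?v = "\<lambda>y j. v(7 := s', 8 := lo', 9 := hi', 10 := y, 11 := j)"
  let ?G = "\<lambda>j y. eval W p m (Cond (eAnd (nlessE (Var 11) (Var 8)) (eLess (Var 11) (Var 9)))
       (fE KE (hE (eAdd (eMul (Var 7) (Par 6)) (Var 11)) (Var 10))) (Var 10)) (?v y j)"
  have lt: "itr i ?F b' < N" for i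
    by (induction i) (use b(2) f_less hs_less in auto)
  have "itr t ?F b' = itr t ?G b'"
  proof (rule itr_cong)
    fix i assume i: "i < t"
    let ?y = "itr i ?F b'"
    have "s' * t + i < Suc s' * t" using i by simp
    also have "\<dots> \<le> l * t" using s(2) by (intro mult_le_mono1) simp
    finally have q: "s' * t + i < l * t" .
    then have qW: "s' * t + i < 2 ^ W" using P1 by linarith
    have e: "eval W p m (eAdd (eMul (Var 7) (Par 6)) (Var 11)) (?v ?y i) = s' * t + i"
      using qW by (simp add: par)
    have h: "eval W p m (hE (eAdd (eMul (Var 7) (Par 6)) (Var 11)) (Var 10)) (?v ?y i) = hs (s' * t + i) ?y"
      using q by (subst eval_hE) (simp_all only: e, simp)
    have f: "eval W p m (fE KE (hE (eAdd (eMul (Var 7) (Par 6)) (Var 11)) (Var 10))) (?v ?y i) =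
        bucket_of (hs (s' * t + i) ?y)"
      by (subst eval_fE) (simp_all only: h hs_less)
    have c: "eval W p m (eAnd (nlessE (Var 11) (Var 8)) (eLess (Var 11) (Var 9))) (?v ?y i) =
        of_bool (lo' \<le> i \<and> i < hi')"
      unfolding eval.simps(4) eval_nlessE[OF W0] by (simp add: not_less)
    have y: "eval W p m (Var 10) (?v ?y i) = ?y" by simp
    have "?G i ?y = (?F i ?y) mod 2 ^ W"
      unfolding eval.simps(7) c f y by simp
    also have "\<dots> = ?F i ?y"
      by (rule mod_less[OF less_trans[OF lt[of "Suc i", unfolded itr.simps] small(6)]])
    finally show "?F i ?y = ?G i ?y" ..
  qed
  then show ?thesis
    unfolding walkE_def eval.simps(6,8) s(1) lo hi b(1) par(1) walk_def by simp
qed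

end

locale full_index_code = index_code + good_index +
  fixes P2 :: nat
  assumes par2: "p 11 = 2 ^ kM" "p 13 = l * 2 ^ kM" "p 14 = l * 2 ^ kt" "p 18 = Kb" "p 24 = P2"
      "p 28 = kL" "p 29 = 2 ^ kB" "p 30 = kN + 1"
    and P2: "P2 + l * 2 ^ kM < 2 ^ W"
    and W2: "Kb + 1 < W" "kL < W" "l * 2 ^ kB * 2 ^ kM < 2 ^ W"
    and tables: "q < l * 2 ^ kM \<Longrightarrow> m (P2 + q) = T ! q"
begin

lemma eval_candE:
  assumes j: "eval W p m j v = j'" "j' < B"
    and q: "eval W p m q (v(12 := j')) = q'" "q' < l * t"
  shows "eval W p m (candE KE j q) v = cand kL j' q'"
proof -
  define s i where "s = q' div t" and "i = q' mod t"
  have si: "s < l" "i < t" using q(2) by (simp_all add: s_def i_def div_less_iff_less_mult)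
  define e where "e = walk s (i + 1) t j'"
  define bnd where "bnd = (s * B + e + 1) * M"
  define P where "P = (\<lambda>c. c < l * M \<and> T ! c < bnd)"
  define pos where "pos = bsearch kL P"
  define c where "c = T ! pos mod M"
  have "j' < N" using j(2) B_le_N by linarith
  have "i + 1 < 2 ^ W"
  proof -
    have "t \<le> N" using kN by (intro power_increasing) auto
    then show ?thesis using si(2) small(6) by linarith
  qed
  then have i1: "(i + 1) mod 2 ^ W = i + 1" by simp
  \<comment> \<open>In the last column nothing is left to walk and the end is \<open>j'\<close>
    itself; here the bound on \<open>j'\<close> enters.\<close>
  have eB: "e < B"
  proof (cases "i + 1 < t")
    case True
    then obtain r where r: "t - (i + 1) = Suc r" by (metis Suc_diff_Suc)
    have "e = itr (Suc r) (\<lambda>k b. bucket_of (hs (s * t + (i + 1 + k)) b)) j'"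
      unfolding e_def r[symmetric] using True by (intro walk_eq) simp_all
    then show ?thesis using bucket_of_less[OF hs_less] by simp
  next
    case False
    then have "e = j'" using si(2) by (simp add: e_def walk_eq)
    then show ?thesis using j(2) by simp
  qed
  have "s * B + e + 1 \<le> Suc s * B" using eB by simp
  also have "\<dots> \<le> l * B" using si(1) by (intro mult_le_mono1) simp
  finally have sB: "s * B + e + 1 \<le> l * B" .
  then have "bnd \<le> l * B * M" unfolding bnd_def by (intro mult_le_mono1)
  then have bndW: "bnd < 2 ^ W" using W2(3) by linarith
  have "(s * B + e + 1) * 1 \<le> bnd" unfolding bnd_def by (intro mult_le_mono2) simp
  then have sBW: "s * B + e + 1 < 2 ^ W" using bndW unfolding mult_1_right by linarith
  have b: "eval W p m (eMul (eAdd (eAdd (eMul (Var 14) (Par 29)) (Var 16)) (Num 1)) (Par 11)) v' = bnd"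
    if "v' 14 = s" "v' 16 = e" for v'
    using sBW bndW W0 that by (simp add: par2 bnd_def)
  let ?v1 = "v(12 := j', 13 := q', 14 := s, 15 := i)"
  have w1: "eval W p m (walkE KE (Var 14) (eAdd (Var 15) (Num 1)) (Par 6) (Var 12)) ?v1 = e"
    unfolding e_def
    by (rule eval_walkE) (use si i1 \<open>j' < N\<close> W0 in \<open>simp_all add: par\<close>)
  let ?v2 = "?v1(16 := e, 17 := bnd)"
  have bs: "eval W p m (bsE 28 19 (eAnd (eLess (Var 19) (Par 13)) (eLess (Read (eAdd (Par 24) (Var 19))) (Var 17)))) ?v2 = pos"
    unfolding pos_def
  proof (rule eval_bsE[where n = kL])
    fix a b c :: nat
    show "(eval W p m (eAnd (eLess (Var 19) (Par 13)) (eLess (Read (eAdd (Par 24) (Var 19))) (Var 17)))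
        (?v2(19 + 1 := a, 19 + 2 := b, 19 := c)) \<noteq> 0) = P c"
    proof (cases "c < l * M")
      case True
      then have "(P2 + c) mod 2 ^ W = P2 + c" using P2 by simp
      then show ?thesis using tables[OF True] True by (simp add: par2 P_def)
    next
      case False
      then show ?thesis by (simp add: par2 P_def)
    qed
  qed (use W2 W0 par2 less_trans[OF W2(2) less_exp] in auto)
  have "0 < l * M" using si(1) by simp
  \<comment> \<open>The probed cell must lie inside the table also for a candidate that misses; the
    default position 0 does, because the table is not empty.\<close>
  have "pos < l * M"
  proof (cases "pos = 0")
    case True
    then show ?thesis using \<open>0 < l * M\<close> by simp
  next
    case False
    have anti: "\<forall>c c'. 0 < c \<longrightarrow> c \<le> c' \<longrightarrow> c' < 2 ^ kL \<longrightarrow> P c' \<longrightarrow> P c"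
    proof (intro allI impI)
      fix c c' assume "c \<le> c'" "P c'"
      then show "P c"
        using sorted_nth_mono[of T c c'] by (simp add: P_def T_def)
    qed
    have "P pos" using bsearch(1)[OF anti] bsearch(2)[OF anti, of pos] False unfolding pos_def by simp
    then show ?thesis by (simp add: P_def)
  qed
  then have "(P2 + pos) mod 2 ^ W = P2 + pos" "m (P2 + pos) = T ! pos" using P2 tables by auto
  then have cv: "eval W p m (eMod (Read (eAdd (Par 24) (Var 18))) (Par 11)) v' = c" if "v' 18 = pos" for v'
    using that by (simp add: par2 c_def)
  have "c < N" unfolding c_def using M_le_N mod_less_divisor[of M "T ! pos"] by (meson less_le_trans zero_less_power pos2)
  let ?v3 = "?v2(18 := pos, 22 := c)"
  have w2: "eval W p m (walkE KE (Var 14) (Num 0) (Var 15) (Var 22)) (?v3(5 := q')) = walk s 0 i c"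
    by (rule eval_walkE) (use si \<open>c < N\<close> in simp_all)
  have "eval W p m (hE (Var 13) (walkE KE (Var 14) (Num 0) (Var 15) (Var 22))) ?v3 = hs q' (walk s 0 i c)"
  proof -
    have "eval W p m (Var 13) ?v3 = q'" by simp
    then show ?thesis using q(2) w2 by (subst eval_hE) simp_all
  qed
  moreover have "eval W p m (eDiv (Var 13) (Par 6)) (v(12 := j', 13 := q')) = s"
    "eval W p m (eMod (Var 13) (Par 6)) (v(12 := j', 13 := q', 14 := s)) = i"
    by (simp_all add: par s_def i_def)
  ultimately have "eval W p m (candE KE j q) v = hs q' (walk s 0 i c)"
    unfolding candE_def eval.simps(6) j(1) q(1) using w1 b[of "?v1(16 := e)"] bs cv[of "?v2(18 := pos)"]
    by simp
  then show ?thesis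
    unfolding cand_def Let_def s_def[symmetric] i_def[symmetric] e_def[symmetric] bnd_def[symmetric]
      P_def[symmetric] pos_def[symmetric] c_def[symmetric] .
qed

lemma eval_nextE:
  assumes j: "eval W p m j v = j'" "j' < B"
    and y: "eval W p m y (v(23 := j')) = y'"
  shows "eval W p m (nextE KE j y) v = nxt kL j' y'"
proof -
  let ?C = "cand kL j'"
  let ?F = "\<lambda>q a. if bucket_of (?C q) = j' \<and> y' \<le> key (?C q) \<and> key (?C q) < a then key (?C q) else a"
  let ?v = "\<lambda>a q. v(23 := j', 24 := y', 25 := a, 26 := q)"
  let ?G = "\<lambda>q a. eval W p m (Bind 27 (candE KE (Var 23) (Var 26)) (Bind 28 (keyE KE (Var 27))
       (Cond (eAnd (eAnd (eEq (fE KE (Var 27)) (Var 23)) (nlessE (Var 28) (Var 24)))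
           (eLess (Var 28) (Var 25))) (Var 28) (Var 25)))) (?v a q)"
  have KbW: "2 ^ Kb < (2 :: nat) ^ W" using W2(1) by (intro pow_less_W) simp
  have lt: "itr i ?F (2 ^ Kb) \<le> 2 ^ Kb" for i
    by (induction i) auto
  have "itr (l * t) ?F (2 ^ Kb) = itr (l * t) ?G (2 ^ Kb)"
  proof (rule itr_cong)
    fix i assume i: "i < l * t"
    let ?y = "itr i ?F (2 ^ Kb)"
    have c: "eval W p m (candE KE (Var 23) (Var 26)) (?v ?y i) = ?C i"
      by (rule eval_candE) (use i j(2) in simp_all)
    let ?v1 = "?v ?y i"
    let ?v2 = "?v1(27 := ?C i)"
    have k: "eval W p m (keyE KE (Var 27)) ?v2 = key (?C i)"
      by (subst eval_keyE) (simp_all add: cand_less)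
    let ?v3 = "?v2(28 := key (?C i))"
    have f: "eval W p m (fE KE (Var 27)) ?v3 = bucket_of (?C i)"
      by (subst eval_fE) (simp_all add: cand_less)
    have cond: "eval W p m (eAnd (eAnd (eEq (fE KE (Var 27)) (Var 23)) (nlessE (Var 28) (Var 24)))
           (eLess (Var 28) (Var 25))) ?v3 =
        of_bool (bucket_of (?C i) = j' \<and> y' \<le> key (?C i) \<and> key (?C i) < ?y)"
      unfolding eval.simps(4) f eval_nlessE[OF W0] by (simp add: not_less)
    have "?G i ?y = ?F i ?y mod 2 ^ W"
      unfolding eval.simps(6) c k unfolding eval.simps(7) cond by simp
    also have "\<dots> = ?F i ?y"
      by (rule mod_less[OF le_less_trans[OF lt[of "Suc i", unfolded itr.simps] KbW]])
    finally show "?F i ?y = ?G i ?y" ..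
  qed
  moreover have "eval W p m (eShl (Num 1) (Par 18)) v' = 2 ^ Kb" for v'
    using KbW W0 by (subst eval_shl) (simp_all add: par2)
  ultimately show ?thesis
    unfolding nextE_def eval.simps(6,8) j(1) y par2(3) nxt_def by simp
qed

lemma eval_accessE:
  assumes r: "eval W p m r v = r'" "r' < N"
  shows "eval W p m (accessE KE r) v = access kL r'"
proof -
  let ?F = "\<lambda>i y. if r' mod t < i then y else nxt kL (r' div t) y + 1"
  let ?v = "\<lambda>y i. v(29 := r', 30 := y, 31 := i)"
  let ?G = "\<lambda>i y. eval W p m (Cond (eLess (eMod (Var 29) (Par 6)) (Var 31)) (Var 30)
       (eAdd (nextE KE (eDiv (Var 29) (Par 6)) (Var 30)) (Num 1))) (?v y i)"
  have KbW: "2 ^ Kb + 1 < (2 :: nat) ^ W"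
  proof -
    have "(2 :: nat) ^ (Kb + 1) < 2 ^ W" using W2(1) by (rule pow_less_W)
    moreover have "(2 :: nat) ^ Kb + 1 \<le> 2 ^ (Kb + 1)" by simp
    ultimately show ?thesis by linarith
  qed
  have lt: "itr i ?F 0 \<le> 2 ^ Kb + 1" for i
    by (induction i) (use nxt_le in auto)
  have jB: "r' div t < B" using r(2) by (simp add: N_eq div_less_iff_less_mult)
  have eq: "itr i ?F 0 = itr i ?G 0" for i
  proof (rule itr_cong)
    fix i
    let ?y = "itr i ?F 0"
    have n: "eval W p m (nextE KE (eDiv (Var 29) (Par 6)) (Var 30)) (?v ?y i) = nxt kL (r' div t) ?y"
      by (rule eval_nextE) (use jB in \<open>simp_all add: par\<close>)
    have n1: "eval W p m (eAdd (nextE KE (eDiv (Var 29) (Par 6)) (Var 30)) (Num 1)) (?v ?y i) =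
        nxt kL (r' div t) ?y + 1"
      unfolding eval.simps(4) n using nxt_le[of kL "r' div t" ?y] KbW W0 by simp
    have c: "eval W p m (eLess (eMod (Var 29) (Par 6)) (Var 31)) (?v ?y i) = of_bool (r' mod t < i)"
      by (simp add: par)
    have "?G i ?y = ?F i ?y mod 2 ^ W"
      unfolding eval.simps(7) n1 c by simp
    also have "\<dots> = ?F i ?y"
      by (rule mod_less[OF le_less_trans[OF lt[of "Suc i", unfolded itr.simps] KbW]])
    finally show "?F i ?y = ?G i ?y" ..
  qed
  have pos: "0 < itr t ?F 0"
  proof -
    have "0 < itr (Suc i) ?F 0" for i by (induction i) auto
    moreover obtain i where "t = Suc i" by (cases t) auto
    ultimately show ?thesis by metis
  qed
  have it: "eval W p m (Iter 6 30 31 (Num 0) (Cond (eLess (eMod (Var 29) (Par 6)) (Var 31)) (Var 30)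
       (eAdd (nextE KE (eDiv (Var 29) (Par 6)) (Var 30)) (Num 1)))) (v(29 := r')) = itr t ?F 0"
    unfolding eval.simps(8) par(1) eq by simp
  have "eval W p m (accessE KE r) v = itr t ?F 0 - 1"
    unfolding accessE_def eval.simps(6) r(1)
  proof (subst eval_sub)
    show "eval W p m (Num 1) (v(29 := r')) \<le> eval W p m (Iter 6 30 31 (Num 0)
       (Cond (eLess (eMod (Var 29) (Par 6)) (Var 31)) (Var 30)
       (eAdd (nextE KE (eDiv (Var 29) (Par 6)) (Var 30)) (Num 1)))) (v(29 := r'))"
      unfolding it using pos W0 by simp
    show "eval W p m (Iter 6 30 31 (Num 0) (Cond (eLess (eMod (Var 29) (Par 6)) (Var 31)) (Var 30)
       (eAdd (nextE KE (eDiv (Var 29) (Par 6)) (Var 30)) (Num 1)))) (v(29 := r')) < 2 ^ W"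
      unfolding it using lt[of t] KbW by linarith
  qed (unfold it, use W0 in simp)
  then show ?thesis by (simp add: access_def)
qed

lemma eval_lbE: "eval W p m (lbE KE z) v = lb (eval W p m z v)"
proof -
  let ?z = "eval W p m z v"
  have kNW: "kN + 1 < W" using W by simp
  have "eval W p m (bsE 30 33 (eAnd (nlessE (Par 8) (Var 33))
     (eLess (accessE KE (eSub (Var 33) (Num 1))) (Var 32)))) (v(32 := ?z)) =
     bsearch (kN + 1) (\<lambda>c. c \<le> N \<and> access kL (c - 1) < ?z)"
  proof (rule eval_bsE[where n = "kN + 1"])
    fix a i c :: nat assume c: "0 < c" "c < 2 ^ (kN + 1)"
    let ?v = "v(32 := ?z, 33 + 1 := a, 33 + 2 := i, 33 := c)"
    show "(eval W p m (eAnd (nlessE (Par 8) (Var 33))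
        (eLess (accessE KE (eSub (Var 33) (Num 1))) (Var 32))) ?v \<noteq> 0) =
        (c \<le> N \<and> access kL (c - 1) < ?z)"
    proof (cases "c \<le> N")
      case True
      then have cW: "c < 2 ^ W" using small(6) by linarith
      have s: "eval W p m (eSub (Var 33) (Num 1)) ?v = c - 1"
        using c(1) cW W0 by (subst eval_sub) simp_all
      have "c - 1 < N" using True c(1) by linarith
      then have a: "eval W p m (accessE KE (eSub (Var 33) (Num 1))) ?v = access kL (c - 1)"
        by (rule eval_accessE[OF s])
      show ?thesis
        unfolding eval.simps(4) a eval_nlessE[OF W0] using True by (simp add: par not_le)
    next
      \<comment> \<open>Beyond N the access may return anything; the conjunction with the word 0
        discards it.\<close>
      case False
      then show ?thesis
        unfolding eval.simps(4) eval_nlessE[OF W0] by (simp add: par)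
    qed
  next
    show "kN + 1 < 2 ^ W" using kNW by (rule less_trans) (rule less_exp)
  qed (use kNW par2 in auto)
  then show ?thesis
    unfolding lbE_def eval.simps(6) lb_bsearch .
qed

end

section \<open>Dyadic decomposition of intervals\<close>

text \<open>
  The numbers from \<open>2 ^ w\<close> to \<open>2 ^ (w + 1) - 1\<close> are the leaves of a binary tree whose nodes are
  numbered as in a heap. An interval of leaves is the disjoint union of the leaves below at most
  two nodes per level; code \<open>2 * level + side\<close> stands for the left or the right one of them.
\<close>

definition low_node :: "nat \<Rightarrow> nat \<Rightarrow> nat \<Rightarrow> nat" where
  "low_node w lo k = (2 ^ w + lo + (2 ^ k - 1)) div 2 ^ k"

definition high_node :: "nat \<Rightarrow> nat \<Rightarrow> nat \<Rightarrow> nat" where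
  "high_node w hi k = (2 ^ w + hi + 1) div 2 ^ k"

text \<open>At level k the nodes from \<open>low_node\<close> to \<open>high_node - 1\<close> lie
  inside the interval. The first one is taken if it is odd, the last one if it is even, that is if
  \<open>high_node\<close> is odd: exactly then the parent sticks out on that side. This is the
  bottom-up range query of a segment tree.\<close>

definition taken :: "nat \<Rightarrow> nat \<Rightarrow> nat \<Rightarrow> nat \<Rightarrow> bool" where
  "taken w lo hi e \<longleftrightarrow> e div 2 \<le> w \<and> low_node w lo (e div 2) < high_node w hi (e div 2) \<and>
     odd (if e mod 2 = 0 then low_node w lo (e div 2) else high_node w hi (e div 2))"

definition tnode :: "nat \<Rightarrow> nat \<Rightarrow> nat \<Rightarrow> nat \<Rightarrow> nat" where
  "tnode w lo hi e = (if e mod 2 = 0 then low_node w lo (e div 2) else high_node w hi (e div 2) - 1)"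

definition anc :: "nat \<Rightarrow> nat \<Rightarrow> nat \<Rightarrow> nat" where
  "anc w x k = (2 ^ w + x) div 2 ^ k"

definition inside :: "nat \<Rightarrow> nat \<Rightarrow> nat \<Rightarrow> nat \<Rightarrow> nat \<Rightarrow> bool" where
  "inside w lo hi x k \<longleftrightarrow> 2 ^ w + lo \<le> anc w x k * 2 ^ k \<and> (anc w x k + 1) * 2 ^ k \<le> 2 ^ w + hi + 1"

lemma low_node_le_iff: "low_node w lo k \<le> v \<longleftrightarrow> 2 ^ w + lo \<le> v * 2 ^ k"
proof -
  have "low_node w lo k \<le> v \<longleftrightarrow> 2 ^ w + lo + (2 ^ k - 1) < Suc v * 2 ^ k"
    unfolding low_node_def by (subst less_Suc_eq_le[symmetric], subst div_less_iff_less_mult) auto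
  also have "\<dots> \<longleftrightarrow> 2 ^ w + lo \<le> v * 2 ^ k"
    using one_le_power[of "2 :: nat" k] by (simp only: mult_Suc) linarith
  finally show ?thesis .
qed

lemma less_high_node_iff: "v < high_node w hi k \<longleftrightarrow> (v + 1) * 2 ^ k \<le> 2 ^ w + hi + 1"
  unfolding high_node_def by (subst Suc_le_eq[symmetric], subst less_eq_div_iff_mult_less_eq) auto

lemma inside_iff: "inside w lo hi x k \<longleftrightarrow> low_node w lo k \<le> anc w x k \<and> anc w x k < high_node w hi k"
  by (simp add: inside_def low_node_le_iff less_high_node_iff)

lemma anc_Suc: "anc w x (Suc k) = anc w x k div 2"
  unfolding anc_def power_Suc2 by (rule div_mult2_eq)

text \<open>A parent covers its children, so the levels at which the ancestor of \<open>x\<close>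
  lies inside form an initial segment; the topmost of them is the one that belongs to the
  decomposition.\<close>

lemma inside_Suc: "inside w lo hi x (Suc k) \<Longrightarrow> inside w lo hi x k"
proof -
  assume *: "inside w lo hi x (Suc k)"
  have "anc w x k div 2 * 2 \<le> anc w x k" "anc w x k + 1 \<le> (anc w x k div 2 + 1) * 2" by simp_all
  then have "anc w x k div 2 * 2 * 2 ^ k \<le> anc w x k * 2 ^ k"
    "(anc w x k + 1) * 2 ^ k \<le> (anc w x k div 2 + 1) * 2 * 2 ^ k" by (intro mult_le_mono1; simp)+
  then show "inside w lo hi x k"
    using * unfolding inside_def anc_Suc power_Suc mult.assoc by linarith
qed

lemma inside_mono: "inside w lo hi x k' \<Longrightarrow> k \<le> k' \<Longrightarrow> inside w lo hi x k"
  by (induction k') (auto simp: le_Suc_eq dest: inside_Suc)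

lemma inside_0: "inside w lo hi x 0 \<longleftrightarrow> lo \<le> x \<and> x \<le> hi"
  by (simp add: inside_def anc_def)

lemma inside_le:
  assumes "inside w lo hi x k" "x < 2 ^ w"
  shows "k \<le> w"
proof (rule ccontr)
  assume "\<not> k \<le> w"
  then have "(2 :: nat) ^ Suc w \<le> 2 ^ k" by (intro power_increasing) auto
  then have "anc w x k = 0" using assms(2) by (simp add: anc_def)
  then show False using assms(1) by (simp add: inside_def)
qed

text \<open>A taken node is maximal inside the interval, because its parity puts its sibling
  outside.\<close>

lemma taken_match:
  assumes "taken w lo hi e" "anc w x (e div 2) = tnode w lo hi e"
  shows "inside w lo hi x (e div 2)" "\<not> inside w lo hi x (Suc (e div 2))"
proof -
  define k v where "k = e div 2" and "v = anc w x k"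
  have lt: "low_node w lo k < high_node w hi k" using assms(1) by (simp add: taken_def k_def)
  have v: "v = (if e mod 2 = 0 then low_node w lo k else high_node w hi k - 1)"
    using assms(2) by (simp add: tnode_def k_def v_def)
  show "inside w lo hi x (e div 2)"
    using lt v unfolding inside_iff k_def[symmetric] v_def[symmetric] by auto
  show "\<not> inside w lo hi x (Suc (e div 2))"
  proof (cases "e mod 2 = 0")
    case True
    then have "odd v" "v = low_node w lo k" using assms(1) v by (simp_all add: taken_def k_def)
    then obtain u where u: "v = 2 * u + 1" by (elim oddE)
    have "\<not> low_node w lo k \<le> 2 * u" using \<open>v = low_node w lo k\<close> u by simp
    then have "\<not> 2 ^ w + lo \<le> 2 * u * 2 ^ k" unfolding low_node_le_iff .
    then show ?thesis
      unfolding k_def[symmetric] inside_def anc_Suc v_def[symmetric] u by (simp add: mult_ac)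
  next
    case False
    then have o: "odd (high_node w hi k)" "v = high_node w hi k - 1"
      using assms(1) v by (simp_all add: taken_def k_def)
    then obtain u where u: "high_node w hi k = 2 * u + 1" by (elim oddE)
    then have v2: "v = 2 * u" using o by simp
    have "\<not> 2 * u + 1 < high_node w hi k" using u by simp
    then have "\<not> (2 * u + 1 + 1) * 2 ^ k \<le> 2 ^ w + hi + 1" unfolding less_high_node_iff .
    then show ?thesis
      unfolding k_def[symmetric] inside_def anc_Suc v_def[symmetric] v2 by (simp add: algebra_simps)
  qed
qed

text \<open>If the parent is not inside, the sibling is outside, to the left of an odd node and to
  the right of an even one; so the node is extreme at its level.\<close>

lemma match_taken:
  assumes "inside w lo hi x k" "\<not> inside w lo hi x (Suc k)" "k \<le> w"
  shows "\<exists>e. e div 2 = k \<and> taken w lo hi e \<and> anc w x k = tnode w lo hi e"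
proof -
  define v where "v = anc w x k"
  have rng: "low_node w lo k \<le> v" "v < high_node w hi k"
    using assms(1) by (simp_all add: inside_iff v_def)
  have ins: "2 ^ w + lo \<le> v * 2 ^ k" "(v + 1) * 2 ^ k \<le> 2 ^ w + hi + 1"
    using assms(1) by (simp_all add: inside_def v_def)
  have out: "\<not> (2 ^ w + lo \<le> (v div 2) * 2 * 2 ^ k \<and> (v div 2 + 1) * 2 * 2 ^ k \<le> 2 ^ w + hi + 1)"
    using assms(2) unfolding inside_def anc_Suc v_def[symmetric] by (simp add: mult_ac)
  show ?thesis
  proof (cases "odd v")
    case True
    then obtain u where u: "v = 2 * u + 1" by (elim oddE)
    have "\<not> 2 ^ w + lo \<le> 2 * u * 2 ^ k"
      using out ins(2) unfolding u by (simp add: algebra_simps)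
    then have "\<not> low_node w lo k \<le> 2 * u" unfolding low_node_le_iff .
    then have "low_node w lo k = v" using rng u by simp
    then show ?thesis
      using rng assms(3) True by (intro exI[of _ "2 * k"]) (auto simp: taken_def tnode_def v_def)
  next
    case False
    then obtain u where u: "v = 2 * u" by (auto simp: dvd_def)
    have "\<not> (2 * u + 1 + 1) * 2 ^ k \<le> 2 ^ w + hi + 1"
      using out ins(1) unfolding u by (simp add: algebra_simps)
    then have "\<not> 2 * u + 1 < high_node w hi k" unfolding less_high_node_iff .
    then have "high_node w hi k = v + 1" using rng u by simp
    then show ?thesis
      using rng assms(3) False by (intro exI[of _ "2 * k + 1"]) (auto simp: taken_def tnode_def v_def)
  qed
qed

text \<open>At level 0 the ancestor is the leaf itself, which is inside, and above the root it is
  not; so there is a last level inside.\<close>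

lemma ex_taken:
  assumes "lo \<le> x" "x \<le> hi" "x < 2 ^ w"
  shows "\<exists>e. taken w lo hi e \<and> anc w x (e div 2) = tnode w lo hi e"
proof -
  have "inside w lo hi x 0" using assms by (simp add: inside_0)
  moreover have "\<not> inside w lo hi x (Suc w)" using inside_le[of w lo hi x "Suc w"] assms(3) by auto
  ultimately obtain k where "inside w lo hi x k" "\<not> inside w lo hi x (Suc k)"
    using nat_induct[of "inside w lo hi x" "Suc w"] by blast
  then show ?thesis using match_taken[of w lo hi x k] inside_le[OF _ assms(3)] by metis
qed

lemma tnode_bounds:
  assumes "taken w lo hi e" "hi < 2 ^ w"
  shows "2 ^ (w - e div 2) \<le> tnode w lo hi e" "tnode w lo hi e < 2 ^ Suc (w - e div 2)"
proof -
  define k where "k = e div 2"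
  have k: "k \<le> w" and lt: "low_node w lo k < high_node w hi k"
    using assms(1) by (simp_all add: taken_def k_def)
  have t: "low_node w lo k \<le> tnode w lo hi e" "tnode w lo hi e < high_node w hi k"
    using lt by (auto simp: tnode_def k_def)
  have w: "(2 :: nat) ^ w = 2 ^ (w - k) * 2 ^ k" using k by (simp add: power_add[symmetric])
  have "2 ^ (w - k) * 2 ^ k \<le> tnode w lo hi e * 2 ^ k"
    using t(1) unfolding low_node_le_iff w by linarith
  then show "2 ^ (w - e div 2) \<le> tnode w lo hi e" by (simp add: k_def)
  have "(tnode w lo hi e + 1) * 2 ^ k \<le> 2 ^ Suc (w - k) * 2 ^ k"
    using t(2) assms(2) unfolding less_high_node_iff power_Suc using w by linarith
  then have "tnode w lo hi e + 1 \<le> 2 ^ Suc (w - k)"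
    by (metis mult_le_cancel2 pos2 zero_less_power)
  then show "tnode w lo hi e < 2 ^ Suc (w - e div 2)" by (simp add: k_def)
qed

lemma anc_bounds:
  assumes "x < 2 ^ w" "k \<le> w"
  shows "2 ^ (w - k) \<le> anc w x k" "anc w x k < 2 ^ Suc (w - k)"
proof -
  have w: "(2 :: nat) ^ w = 2 ^ (w - k) * 2 ^ k" using assms(2) by (simp add: power_add[symmetric])
  show "2 ^ (w - k) \<le> anc w x k"
    unfolding anc_def using w by (simp add: less_eq_div_iff_mult_less_eq)
  show "anc w x k < 2 ^ Suc (w - k)"
    unfolding anc_def using w assms(1) by (simp add: div_less_iff_less_mult)
qed

text \<open>The heap number of a node has w - k + 1 binary digits and thus reveals its
  level.\<close>

lemma level_unique:
  fixes v :: nat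
  assumes "2 ^ (w - k) \<le> v" "v < 2 ^ Suc (w - k)" "2 ^ (w - k') \<le> v" "v < 2 ^ Suc (w - k')" "k \<le> w" "k' \<le> w"
  shows "k = k'"
proof -
  have "(2 :: nat) ^ (w - k) < 2 ^ Suc (w - k')" "(2 :: nat) ^ (w - k') < 2 ^ Suc (w - k)"
    using assms by linarith+
  then have "w - k < Suc (w - k')" "w - k' < Suc (w - k)"
    by (auto dest!: power_less_imp_less_exp[rotated] simp del: power_Suc)
  then show ?thesis using assms(5,6) by simp
qed

text \<open>If the left and the right node of a level were the same, \<open>low_node\<close> and its
  successor \<open>high_node\<close> would both be odd.\<close>

lemma tnode_inj:
  assumes "taken w lo hi e" "taken w lo hi e'" "tnode w lo hi e = tnode w lo hi e'" "hi < 2 ^ w"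
  shows "e = e'"
proof -
  have k: "e div 2 \<le> w" "e' div 2 \<le> w" using assms by (simp_all add: taken_def)
  have eq: "e div 2 = e' div 2"
    using level_unique[OF tnode_bounds[OF assms(1,4)] _ _ k] tnode_bounds[OF assms(2,4)] assms(3) by simp
  have "e mod 2 = e' mod 2"
  proof (rule ccontr)
    assume ne: "e mod 2 \<noteq> e' mod 2"
    have lt: "low_node w lo (e div 2) < high_node w hi (e div 2)" using assms(1) by (simp add: taken_def)
    have "odd (low_node w lo (e div 2))" "odd (high_node w hi (e div 2))"
      "low_node w lo (e div 2) = high_node w hi (e div 2) - 1"
      using assms ne eq unfolding taken_def tnode_def by (auto split: if_splits)
    then show False using lt by (metis Suc_diff_1 even_Suc less_zeroE neq0_conv)
  qed
  then show ?thesis using eq by (metis div_mult_mod_eq)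
qed

text \<open>Both levels are the topmost one inside and therefore equal; then
  \<open>tnode_inj\<close> decides the side.\<close>

lemma taken_unique:
  assumes "taken w lo hi e" "anc w x (e div 2) = tnode w lo hi e"
    and "taken w lo hi e'" "anc w x (e' div 2) = tnode w lo hi e'" "hi < 2 ^ w"
  shows "e = e'"
proof -
  have "e div 2 = e' div 2"
    using taken_match[OF assms(1,2)] taken_match[OF assms(3,4)]
    by (meson inside_mono not_less_eq_eq linorder_cases Suc_leI)
  then show ?thesis using tnode_inj[OF assms(1,3) _ assms(5)] assms(2,4) by simp
qed

lemma itr_sum:
  fixes P :: "nat \<Rightarrow> bool" and f :: "nat \<Rightarrow> nat"
  shows "itr n (\<lambda>q a. if P q then a + f q else a) 0 = (\<Sum>q\<in>{q. q < n \<and> P q}. f q)"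
proof (induction n)
  case (Suc n)
  have "{q. q < Suc n \<and> P q} = (if P n then insert n {q. q < n \<and> P q} else {q. q < n \<and> P q})"
    by (auto simp: less_Suc_eq)
  then show ?case using Suc by simp
qed simp

section \<open>Digits\<close>

text \<open>A number below \<open>2 ^ (c * D)\<close> stands for a function from D positions to
  c-bit values, so one loop over numbers replaces D nested loops.\<close>

definition dig :: "nat \<Rightarrow> nat \<Rightarrow> nat \<Rightarrow> nat" where
  "dig c q j = q div 2 ^ (c * j) mod 2 ^ c"

lemma dig_Suc: "dig c q (Suc j) = dig c (q div 2 ^ c) j"
  by (simp add: dig_def div_mult2_eq power_add)

lemma dig_mod: "j < D \<Longrightarrow> dig c (q mod 2 ^ (c * D)) j = dig c q j"
proof -
  assume "j < D"
  then have "c * j + c \<le> c * D" by (metis Suc_leI add.commute mult_Suc_right mult_le_mono2)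
  then obtain r where r: "c * D = c * j + (c + r)" by (metis add.assoc le_Suc_ex)
  have "q mod 2 ^ (c * D) = 2 ^ (c * j) * (q div 2 ^ (c * j) mod 2 ^ (c + r)) + q mod 2 ^ (c * j)"
    unfolding r power_add[of 2 "c * j"] by (rule mod_mult2_eq)
  then have "q mod 2 ^ (c * D) div 2 ^ (c * j) = q div 2 ^ (c * j) mod 2 ^ (c + r)"
    by simp
  then show ?thesis
    unfolding dig_def by (simp add: mod_mod_cancel le_imp_power_dvd)
qed

lemma ex_dig:
  assumes "\<And>j. j < D \<Longrightarrow> f j < 2 ^ c"
  shows "\<exists>q < 2 ^ (c * D). \<forall>j<D. dig c q j = f j"
  using assms
proof (induction D arbitrary: f)
  case (Suc D)
  obtain q where q: "q < 2 ^ (c * D)" "\<forall>j<D. dig c q j = f (Suc j)"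
    using Suc.IH[of "\<lambda>j. f (Suc j)"] Suc.prems by auto
  define r where "r = q * 2 ^ c + f 0"
  have f0: "f 0 < 2 ^ c" using Suc.prems by simp
  have "r < Suc q * 2 ^ c" using f0 by (simp add: r_def)
  also have "\<dots> \<le> 2 ^ (c * D) * 2 ^ c" using q(1) by (intro mult_le_mono1) simp
  finally have "r < 2 ^ (c * Suc D)" by (simp add: power_add mult.commute)
  moreover have "dig c r j = f j" if "j < Suc D" for j
  proof (cases j)
    case 0
    then show ?thesis using f0 by (simp add: dig_def r_def)
  next
    case (Suc i)
    have "r div 2 ^ c = q" using f0 by (simp add: r_def)
    then show ?thesis using q(2) that Suc by (simp add: dig_Suc)
  qed
  ultimately show ?case by blast
qed (auto simp: dig_def)

lemma dig_eqI: "q < 2 ^ (c * D) \<Longrightarrow> q' < 2 ^ (c * D) \<Longrightarrow> (\<And>j. j < D \<Longrightarrow> dig c q j = dig c q' j) \<Longrightarrow> q = q'"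
proof (induction D arbitrary: q q')
  case (Suc D)
  have "q div 2 ^ c < 2 ^ (c * D)" "q' div 2 ^ c < 2 ^ (c * D)"
    using Suc.prems(1,2) by (simp_all add: div_less_iff_less_mult power_add mult.commute)
  moreover have "dig c (q div 2 ^ c) j = dig c (q' div 2 ^ c) j" if "j < D" for j
    using Suc.prems(3)[of "Suc j"] that by (simp add: dig_Suc)
  ultimately have "q div 2 ^ c = q' div 2 ^ c" by (rule Suc.IH)
  moreover have "q mod 2 ^ c = q' mod 2 ^ c"
    using Suc.prems(3)[of 0] by (simp add: dig_def)
  ultimately show ?case by (metis div_mult_mod_eq)
qed simp

text \<open>The first digit is the most significant one, in contrast to \<open>dig\<close>: the code
  is computed by Horner's rule in a single loop.\<close>

definition vcode :: "nat \<Rightarrow> nat \<Rightarrow> (nat \<Rightarrow> nat) \<Rightarrow> nat" where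
  "vcode c D f = itr D (\<lambda>j a. a * 2 ^ c + f j) 0"

lemma vcode_Suc: "vcode c (Suc D) f = vcode c D f * 2 ^ c + f D"
  by (simp add: vcode_def)

lemma vcode_0: "vcode c 0 f = 0"
  by (simp add: vcode_def)

lemma vcode_less: "(\<And>j. j < D \<Longrightarrow> f j < 2 ^ c) \<Longrightarrow> vcode c D f < 2 ^ (c * D)"
proof (induction D)
  case (Suc D)
  have "vcode c (Suc D) f < Suc (vcode c D f) * 2 ^ c" using Suc.prems[of D] by (simp add: vcode_Suc)
  also have "\<dots> \<le> 2 ^ (c * D) * 2 ^ c" using Suc by (intro mult_le_mono1) (simp add: Suc_le_eq)
  finally show ?case by (simp add: power_add mult.commute)
qed (simp add: vcode_0)

lemma vcode_inj:
  "(\<And>j. j < D \<Longrightarrow> f j < 2 ^ c) \<Longrightarrow> (\<And>j. j < D \<Longrightarrow> g j < 2 ^ c) \<Longrightarrow> vcode c D f = vcode c D g \<Longrightarrow>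
    j < D \<Longrightarrow> f j = g j"
proof (induction D)
  case (Suc D)
  have "vcode c D f = vcode c D g \<and> f D = g D"
    using Suc.prems(1-3) by (intro digit_unique) (auto simp: vcode_Suc)
  then show ?case using Suc by (metis less_Suc_eq)
qed simp

lemma vcode_cong: "(\<And>j. j < D \<Longrightarrow> f j = g j) \<Longrightarrow> vcode c D f = vcode c D g"
  by (induction D) (simp_all add: vcode_0 vcode_Suc)

lemma vcode_pos: "0 < D \<Longrightarrow> (\<And>j. j < D \<Longrightarrow> 0 < f j) \<Longrightarrow> 0 < vcode c D f"
  by (cases D) (simp_all add: vcode_Suc)

section \<open>Tuples of points with dyadic levels\<close>

text \<open>A code consists of d indices of points with \<open>k1\<close> bits each and, above them,
  d * d levels with \<open>k2\<close> bits each. \<open>cf i a\<close> is coordinate a of point i;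
  \<open>dk\<close> is the rank of the distance as a function of all coordinates, where 0 will stand
  for tuples that span no hyperplane.\<close>

locale tuples =
  fixes d n w k1 k2 Bd :: nat and cf :: "nat \<Rightarrow> nat \<Rightarrow> nat" and dk :: "(nat \<Rightarrow> nat) \<Rightarrow> nat"
  assumes d: "1 \<le> d" and k1: "n \<le> 2 ^ k1" and k2: "w + 1 \<le> 2 ^ k2"
    and cf: "i < n \<Longrightarrow> a < d \<Longrightarrow> cf i a < 2 ^ w"
    and dk_less: "dk z < 2 ^ Bd"
    and dk_cong: "(\<And>j. j < d * d \<Longrightarrow> z j = z' j) \<Longrightarrow> dk z = dk z'"
begin

abbreviation "D \<equiv> d * d"

definition "kN = d * k1 + D * k2"
definition "kD = Bd + kN"
definition "Kb = (w + 1) * D + 1 + kD"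

definition pix :: "nat \<Rightarrow> nat \<Rightarrow> nat" where
  "pix X j = X div 2 ^ (k1 * (j div d)) mod 2 ^ k1"

definition lev :: "nat \<Rightarrow> nat \<Rightarrow> nat" where
  "lev X j = X div 2 ^ (d * k1 + k2 * j) mod 2 ^ k2"

definition crd :: "nat \<Rightarrow> nat \<Rightarrow> nat" where
  "crd X j = cf (pix X j) (j mod d)"

definition valid :: "nat \<Rightarrow> bool" where
  "valid X \<longleftrightarrow> (\<forall>j<D. pix X j < n \<and> lev X j \<le> w)"

definition node :: "nat \<Rightarrow> nat \<Rightarrow> nat" where
  "node X j = anc w (crd X j) (lev X j)"

text \<open>Appending the code makes the values distinct, refines the order by rank, and lets the
  code be recovered modulo \<open>2 ^ kN\<close>.\<close>

definition dist_part :: "nat \<Rightarrow> nat" where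
  "dist_part X = dk (crd X) * 2 ^ kN + X"

text \<open>
  The keys of valid codes start with node numbers, which are positive, and hence exceed \<open>2 ^ kN\<close>.
  So the identity on invalid codes keeps the key function injective.
\<close>

definition key :: "nat \<Rightarrow> nat" where
  "key X = (if valid X then vcode (w + 1) D (node X) * 2 ^ kD + dist_part X else X)"

lemma D_pos: "0 < D" using d by simp

lemma crd_less: "valid X \<Longrightarrow> j < D \<Longrightarrow> crd X j < 2 ^ w"
  unfolding crd_def using d by (intro cf) (auto simp: valid_def)

lemma node_bounds:
  assumes "valid X" "j < D"
  shows "2 ^ (w - lev X j) \<le> node X j" "node X j < 2 ^ Suc (w - lev X j)"
  using anc_bounds[OF crd_less[OF assms]] assms by (auto simp: node_def valid_def)

lemma node_less: "valid X \<Longrightarrow> j < D \<Longrightarrow> node X j < 2 ^ (w + 1)"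
  by (rule less_le_trans[OF node_bounds(2)]) (auto intro!: power_increasing simp del: power_Suc)

lemma dist_part_less: "X < 2 ^ kN \<Longrightarrow> dist_part X < 2 ^ kD"
proof -
  assume X: "X < 2 ^ kN"
  have "dist_part X < Suc (dk (crd X)) * 2 ^ kN" using X by (simp add: dist_part_def)
  also have "\<dots> \<le> 2 ^ Bd * 2 ^ kN" using dk_less by (intro mult_le_mono1) (simp add: Suc_le_eq)
  finally show ?thesis by (simp add: kD_def power_add)
qed

lemma dist_part_mod: "X < 2 ^ kN \<Longrightarrow> dist_part X mod 2 ^ kN = X"
  by (simp add: dist_part_def)

lemma key_mod: "X < 2 ^ kN \<Longrightarrow> key X mod 2 ^ kN = X"
proof -
  assume X: "X < 2 ^ kN"
  have "(c * 2 ^ kD + x) mod 2 ^ kN = x mod 2 ^ kN" for c x :: nat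
    unfolding kD_def power_add by (simp add: mult.assoc[symmetric])
  then show ?thesis using X by (simp add: key_def dist_part_mod)
qed

lemma key_inj: "inj_on key {..<2 ^ kN}"
  using key_mod by (metis inj_on_def lessThan_iff)

lemma key_less:
  assumes "X < 2 ^ kN"
  shows "key X < 2 ^ Kb"
proof -
  have v: "(if valid X then vcode (w + 1) D (node X) else 0) < 2 ^ ((w + 1) * D)"
    using vcode_less[of D "node X" "w + 1"] node_less by simp
  have kNk: "(2 :: nat) ^ kN \<le> 2 ^ kD" by (intro power_increasing) (simp_all add: kD_def)
  have "X < 2 ^ kD" using assms kNk by (rule less_le_trans)
  then have "key X < Suc (if valid X then vcode (w + 1) D (node X) else 0) * 2 ^ kD"
    using dist_part_less[OF assms] by (simp add: key_def)
  also have "\<dots> \<le> 2 ^ ((w + 1) * D) * 2 ^ kD"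
    using v by (intro mult_le_mono1) (simp add: Suc_le_eq)
  also have "\<dots> \<le> 2 ^ Kb"
    unfolding Kb_def power_add by simp
  finally show ?thesis .
qed

text \<open>The node numbers are the leading digits of a key, so fixing them and bounding the rest
  from below describes an interval. Positivity of \<open>c\<close> keeps out the invalid codes,
  whose keys are below \<open>2 ^ kN\<close>.\<close>

lemma key_interval:
  assumes "X < 2 ^ kN" "0 < c" "x \<le> 2 ^ kD"
  shows "c * 2 ^ kD + x \<le> key X \<and> key X < (c + 1) * 2 ^ kD \<longleftrightarrow>
    valid X \<and> vcode (w + 1) D (node X) = c \<and> x \<le> dist_part X"
proof (cases "valid X")
  case True
  define v r where "v = vcode (w + 1) D (node X)" and "r = dist_part X"
  have r: "r < 2 ^ kD" using dist_part_less[OF assms(1)] by (simp add: r_def)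
  have key: "key X = v * 2 ^ kD + r" using True by (simp add: key_def v_def r_def)
  have "c * 2 ^ kD + x \<le> key X \<and> key X < (c + 1) * 2 ^ kD \<longleftrightarrow> v = c \<and> x \<le> r"
  proof
    assume *: "c * 2 ^ kD + x \<le> key X \<and> key X < (c + 1) * 2 ^ kD"
    then have "key X div 2 ^ kD = c" by (intro div_nat_eqI) (auto simp: mult.commute)
    moreover have "key X div 2 ^ kD = v" unfolding key using r by simp
    ultimately show "v = c \<and> x \<le> r" using * key by simp
  qed (use r key in auto)
  then show ?thesis using True by (simp add: v_def r_def)
next
  case False
  have "(2 :: nat) ^ kN \<le> 2 ^ kD" by (intro power_increasing) (simp_all add: kD_def)
  moreover have "1 * 2 ^ kD \<le> c * (2 :: nat) ^ kD" using assms(2) by (intro mult_le_mono1) simp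
  ultimately have "X < c * 2 ^ kD" using assms(1) by linarith
  then have "\<not> c * 2 ^ kD + x \<le> key X" using False by (simp add: key_def)
  then show ?thesis using False by simp
qed

section \<open>Counting and selecting among the tuples in given boxes\<close>

definition lb :: "nat \<Rightarrow> nat" where
  "lb z = card {X. X < 2 ^ kN \<and> key X < z}"

lemma lb_diff:
  assumes "0 < c" "x \<le> 2 ^ kD"
  shows "lb ((c + 1) * 2 ^ kD) - lb (c * 2 ^ kD + x) =
    card {X. X < 2 ^ kN \<and> valid X \<and> vcode (w + 1) D (node X) = c \<and> x \<le> dist_part X}"
proof -
  let ?U = "{X. X < 2 ^ kN \<and> key X < (c + 1) * 2 ^ kD}"
  let ?L = "{X. X < 2 ^ kN \<and> key X < c * 2 ^ kD + x}"
  have "?L \<subseteq> ?U" using assms(2) by auto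
  then have "card (?U - ?L) = card ?U - card ?L" by (intro card_Diff_subset) auto
  moreover have "?U - ?L = {X. X < 2 ^ kN \<and> valid X \<and> vcode (w + 1) D (node X) = c \<and> x \<le> dist_part X}"
    using key_interval[OF _ assms] by fastforce
  ultimately show ?thesis by (simp add: lb_def)
qed

definition qtaken :: "(nat \<Rightarrow> nat) \<Rightarrow> (nat \<Rightarrow> nat) \<Rightarrow> nat \<Rightarrow> bool" where
  "qtaken lo hi q \<longleftrightarrow> (\<forall>j<D. taken w (lo j) (hi j) (dig (k2 + 1) q j))"

definition qcode :: "(nat \<Rightarrow> nat) \<Rightarrow> (nat \<Rightarrow> nat) \<Rightarrow> nat \<Rightarrow> nat" where
  "qcode lo hi q = vcode (w + 1) D (\<lambda>j. tnode w (lo j) (hi j) (dig (k2 + 1) q j))"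

text \<open>Each \<open>q\<close> chooses a level and a side for every coordinate,
  \<open>k2 + 1\<close> bits each. In the application \<open>2 ^ k2\<close> is of the order of w, so
  there are only polylogarithmically many choices.\<close>

definition cnt :: "(nat \<Rightarrow> nat) \<Rightarrow> (nat \<Rightarrow> nat) \<Rightarrow> nat \<Rightarrow> nat" where
  "cnt lo hi x = itr (2 ^ ((k2 + 1) * D)) (\<lambda>q a. if qtaken lo hi q then
     a + (lb ((qcode lo hi q + 1) * 2 ^ kD) - lb (qcode lo hi q * 2 ^ kD + x)) else a) 0"

text \<open>The codes of one tuple differ in their levels. The levels of the dyadic decomposition
  are selected here, so that every tuple in the boxes is counted once.\<close>

definition canonical :: "(nat \<Rightarrow> nat) \<Rightarrow> (nat \<Rightarrow> nat) \<Rightarrow> nat set" where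
  "canonical lo hi = {X. X < 2 ^ kN \<and> valid X \<and>
     (\<forall>j<D. \<exists>e. taken w (lo j) (hi j) e \<and> e div 2 = lev X j \<and> node X j = tnode w (lo j) (hi j) e)}"

lemma taken_code_less: "taken w lo hi e \<Longrightarrow> e < 2 ^ (k2 + 1)"
  using k2 by (auto simp: taken_def)

lemma tnode_less:
  assumes "taken w lo hi e" "hi < 2 ^ w"
  shows "tnode w lo hi e < 2 ^ (w + 1)" "0 < tnode w lo hi e"
proof -
  show "tnode w lo hi e < 2 ^ (w + 1)"
    by (rule less_le_trans[OF tnode_bounds(2)[OF assms]]) (intro power_increasing, auto)
  show "0 < tnode w lo hi e"
    by (rule less_le_trans[OF _ tnode_bounds(1)[OF assms]]) simp
qed

text \<open>Different choices \<open>q\<close> have different node codes, because a taken node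
  determines its level and its side. Hence the intervals of keys are disjoint and their sizes add
  up.\<close>

lemma cnt_eq:
  assumes hi: "\<And>j. j < D \<Longrightarrow> hi j < 2 ^ w" and x: "x \<le> 2 ^ kD"
  shows "cnt lo hi x = card {X \<in> canonical lo hi. x \<le> dist_part X}"
proof -
  define I where "I = {q. q < 2 ^ ((k2 + 1) * D) \<and> qtaken lo hi q}"
  define F where "F = (\<lambda>c. {X. X < 2 ^ kN \<and> valid X \<and> vcode (w + 1) D (node X) = c \<and> x \<le> dist_part X})"
  define g where "g = (\<lambda>q j. tnode w (lo j) (hi j) (dig (k2 + 1) q j))"
  have qcode: "qcode lo hi q = vcode (w + 1) D (g q)" for q
    by (simp add: qcode_def g_def)
  have It: "taken w (lo j) (hi j) (dig (k2 + 1) q j)" if "q \<in> I" "j < D" for q j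
    using that by (simp add: I_def qtaken_def)
  have tb: "g q j < 2 ^ (w + 1)" "0 < g q j" if "q \<in> I" "j < D" for q j
    unfolding g_def using tnode_less[OF It[OF that] hi[OF that(2)]] .
  have pos: "0 < qcode lo hi q" if "q \<in> I" for q
    unfolding qcode by (rule vcode_pos[OF D_pos tb(2)[OF that]])
  have g_inj: "q = q'" if qI: "q \<in> I" "q' \<in> I" and eq: "qcode lo hi q = qcode lo hi q'" for q q'
  proof (rule dig_eqI[of _ "k2 + 1" D])
    show "q < 2 ^ ((k2 + 1) * D)" "q' < 2 ^ ((k2 + 1) * D)" using qI by (simp_all add: I_def)
    fix j assume j: "j < D"
    have "g q j = g q' j"
      by (rule vcode_inj[OF tb(1)[OF qI(1)] tb(1)[OF qI(2)] eq[unfolded qcode] j])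
    then show "dig (k2 + 1) q j = dig (k2 + 1) q' j"
      unfolding g_def by (rule tnode_inj[OF It[OF qI(1) j] It[OF qI(2) j] _ hi[OF j]])
  qed
  have "cnt lo hi x = (\<Sum>q\<in>I. lb ((qcode lo hi q + 1) * 2 ^ kD) - lb (qcode lo hi q * 2 ^ kD + x))"
    unfolding cnt_def I_def
    using itr_sum[of "2 ^ ((k2 + 1) * D)" "qtaken lo hi"
      "\<lambda>q. lb ((qcode lo hi q + 1) * 2 ^ kD) - lb (qcode lo hi q * 2 ^ kD + x)"] .
  also have "\<dots> = (\<Sum>q\<in>I. card (F (qcode lo hi q)))"
    unfolding F_def by (intro sum.cong refl lb_diff pos x)
  also have "\<dots> = card (\<Union>q\<in>I. F (qcode lo hi q))"
  proof (rule card_UN_disjoint[symmetric])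
    have "F c \<inter> F c' = {}" if "c \<noteq> c'" for c c'
      using that by (auto simp: F_def)
    then show "\<forall>q\<in>I. \<forall>q'\<in>I. q \<noteq> q' \<longrightarrow> F (qcode lo hi q) \<inter> F (qcode lo hi q') = {}"
      using g_inj by blast
  qed (auto simp: I_def F_def)
  also have "(\<Union>q\<in>I. F (qcode lo hi q)) = {X \<in> canonical lo hi. x \<le> dist_part X}"
  proof (intro set_eqI iffI)
    fix X assume "X \<in> (\<Union>q\<in>I. F (qcode lo hi q))"
    then obtain q where q: "q \<in> I" "X < 2 ^ kN" "valid X" "vcode (w + 1) D (node X) = qcode lo hi q"
      "x \<le> dist_part X" by (auto simp: F_def)
    have "\<exists>e. taken w (lo j) (hi j) e \<and> e div 2 = lev X j \<and> node X j = tnode w (lo j) (hi j) e"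
      if j: "j < D" for j
    proof -
      let ?e = "dig (k2 + 1) q j"
      have t: "taken w (lo j) (hi j) ?e" using It[OF q(1) j] .
      have "node X j = g q j"
        by (rule vcode_inj[OF node_less[OF q(3)] tb(1)[OF q(1)] q(4)[unfolded qcode] j])
      then have eq: "node X j = tnode w (lo j) (hi j) ?e" by (simp add: g_def)
      have "?e div 2 \<le> w" "lev X j \<le> w" using t q(3) j by (auto simp: taken_def valid_def)
      then have "?e div 2 = lev X j"
        using level_unique[OF tnode_bounds[OF t hi[OF j]], of "lev X j"] node_bounds[OF q(3) j] eq by simp
      then show ?thesis using t eq by blast
    qed
    then show "X \<in> {X \<in> canonical lo hi. x \<le> dist_part X}"
      using q by (simp add: canonical_def)
  next
    fix X assume X: "X \<in> {X \<in> canonical lo hi. x \<le> dist_part X}"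
    then obtain E where E: "\<And>j. j < D \<Longrightarrow> taken w (lo j) (hi j) (E j) \<and> E j div 2 = lev X j \<and>
        node X j = tnode w (lo j) (hi j) (E j)"
      unfolding canonical_def by (auto dest!: choice_iff'[THEN iffD1])
    obtain q where q: "q < 2 ^ ((k2 + 1) * D)" "\<forall>j<D. dig (k2 + 1) q j = E j"
      using ex_dig[of D E "k2 + 1"] E taken_code_less by blast
    have "q \<in> I" using q E by (simp add: I_def qtaken_def)
    moreover have "vcode (w + 1) D (node X) = qcode lo hi q"
      unfolding qcode using q(2) E by (intro vcode_cong) (simp add: g_def)
    ultimately show "X \<in> (\<Union>q\<in>I. F (qcode lo hi q))"
      using X by (auto simp: F_def canonical_def)
  qed
  finally show ?thesis .
qed

text \<open>The k-th largest value of \<open>dist_part\<close> is the largest x that at least k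
  codes reach; its last \<open>kN\<close> bits are the code.\<close>

definition answer :: "(nat \<Rightarrow> nat) \<Rightarrow> (nat \<Rightarrow> nat) \<Rightarrow> nat \<Rightarrow> nat" where
  "answer lo hi k = bsearch kD (\<lambda>x. k \<le> cnt lo hi x) mod 2 ^ kN"

lemma answer_correct:
  assumes hi: "\<And>j. j < D \<Longrightarrow> hi j < 2 ^ w"
    and k: "1 \<le> k" "k \<le> card {X \<in> canonical lo hi. 1 \<le> dk (crd X)}"
  defines "X \<equiv> answer lo hi k"
  shows "X \<in> canonical lo hi" "1 \<le> dk (crd X)"
    "card {Y \<in> canonical lo hi. dk (crd X) < dk (crd Y)} < k"
    "k \<le> card {Y \<in> canonical lo hi. dk (crd X) \<le> dk (crd Y)}"
proof -
  let ?C = "canonical lo hi"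
  have fin: "finite {Y \<in> ?C. P Y}" for P by (rule finite_subset[of _ "{..<2 ^ kN}"]) (auto simp: canonical_def)
  have CX: "Y < 2 ^ kN" if "Y \<in> ?C" for Y using that by (simp add: canonical_def)
  define x where "x = bsearch kD (\<lambda>x. k \<le> cnt lo hi x)"
  have cnt: "cnt lo hi y = card {Y \<in> ?C. y \<le> dist_part Y}" if "y \<le> 2 ^ kD" for y
    by (rule cnt_eq[OF hi that])
  have mono: "card {Y \<in> ?C. y' \<le> dist_part Y} \<le> card {Y \<in> ?C. y \<le> dist_part Y}" if "y \<le> y'" for y y'
    using that by (intro card_mono fin) auto
  have anti: "\<forall>c c'. 0 < c \<longrightarrow> c \<le> c' \<longrightarrow> c' < 2 ^ kD \<longrightarrow> k \<le> cnt lo hi c' \<longrightarrow> k \<le> cnt lo hi c"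
  proof (intro allI impI)
    fix c c' assume c: "c \<le> c'" "c' < 2 ^ kD" "k \<le> cnt lo hi c'"
    have "cnt lo hi c' \<le> cnt lo hi c"
      using cnt[of c] cnt[of c'] mono[OF c(1)] c(1,2) by linarith
    then show "k \<le> cnt lo hi c" using c(3) by linarith
  qed
  \<comment> \<open>Codes of rank 0 have the smallest values of \<open>dist_part\<close>, so they
    are not selected as long as k is at most the number of the others.\<close>
  have dk1: "1 \<le> dk (crd Y) \<longleftrightarrow> 2 ^ kN \<le> dist_part Y" if "Y \<in> ?C" for Y
  proof
    assume "1 \<le> dk (crd Y)"
    then have "1 * 2 ^ kN \<le> dk (crd Y) * 2 ^ kN" by (intro mult_le_mono1)
    then show "2 ^ kN \<le> dist_part Y" unfolding dist_part_def by linarith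
  next
    assume "2 ^ kN \<le> dist_part Y"
    then show "1 \<le> dk (crd Y)" using CX[OF that] by (cases "dk (crd Y)") (auto simp: dist_part_def)
  qed
  have "k \<le> card {Y \<in> ?C. 2 ^ kN \<le> dist_part Y}"
  proof -
    have "{Y \<in> ?C. 1 \<le> dk (crd Y)} = {Y \<in> ?C. 2 ^ kN \<le> dist_part Y}" using dk1 by blast
    then show ?thesis using k(2) by simp
  qed
  moreover have "Bd \<noteq> 0"
  proof
    assume "Bd = 0"
    then have "dk z = 0" for z using dk_less[of z] by simp
    then show False using k by simp
  qed
  then have lt: "(2 :: nat) ^ kN < 2 ^ kD" by (simp add: kD_def)
  ultimately have x1: "2 ^ kN \<le> x"
    using bsearch(2)[OF anti, of "2 ^ kN"] cnt[of "2 ^ kN"] by (simp add: x_def)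
  then have x0: "0 < x" by (metis less_le_trans pos2 zero_less_power)
  have xl: "x < 2 ^ kD" unfolding x_def by (rule bsearch(1)[OF anti])
  have kx: "k \<le> card {Y \<in> ?C. x \<le> dist_part Y}"
    using bsearch(2)[OF anti x0 xl] cnt[of x] xl by (simp add: x_def)
  have kx': "card {Y \<in> ?C. Suc x \<le> dist_part Y} < k"
  proof (cases "Suc x < 2 ^ kD")
    case True
    then show ?thesis
      using bsearch(2)[OF anti _ True] cnt[of "Suc x"] by (simp add: x_def)
  next
    case False
    have "{Y \<in> ?C. Suc x \<le> dist_part Y} = {}"
      using False dist_part_less[OF CX] by fastforce
    then have "card {Y \<in> ?C. Suc x \<le> dist_part Y} = 0" by (simp only: card.empty)
    then show ?thesis using k(1) by linarith
  qed
  \<comment> \<open>The count falls below k between x and x + 1, so x itself is attained.\<close>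
  have "\<exists>Y\<in>?C. dist_part Y = x"
  proof (rule ccontr)
    assume "\<not> (\<exists>Y\<in>?C. dist_part Y = x)"
    then have "{Y \<in> ?C. x \<le> dist_part Y} = {Y \<in> ?C. Suc x \<le> dist_part Y}"
      by (auto simp: Suc_le_eq le_less)
    then show False using kx kx' by simp
  qed
  then obtain Y where Y: "Y \<in> ?C" "dist_part Y = x" by blast
  have "X = Y"
    using dist_part_mod[OF CX[OF Y(1)]] Y(2) by (simp add: X_def answer_def x_def)
  then have X: "X \<in> ?C" "dist_part X = x" using Y by simp_all
  show "X \<in> ?C" by (rule X(1))
  show "1 \<le> dk (crd X)" using dk1[OF X(1)] x1 X(2) by simp
  have less: "dk (crd X) < dk (crd Y) \<Longrightarrow> dist_part X < dist_part Y" for Y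
  proof -
    assume "dk (crd X) < dk (crd Y)"
    then have "Suc (dk (crd X)) * 2 ^ kN \<le> dk (crd Y) * 2 ^ kN" by (intro mult_le_mono1) simp
    then show ?thesis using CX[OF X(1)] unfolding dist_part_def mult_Suc by linarith
  qed
  have le: "dist_part X \<le> dist_part Y \<Longrightarrow> dk (crd X) \<le> dk (crd Y)" if "Y \<in> ?C" for Y
  proof (rule ccontr)
    assume "dist_part X \<le> dist_part Y" "\<not> dk (crd X) \<le> dk (crd Y)"
    moreover from this(2) have "Suc (dk (crd Y)) * 2 ^ kN \<le> dk (crd X) * 2 ^ kN" by (intro mult_le_mono1) simp
    ultimately show False using CX[OF that] unfolding dist_part_def mult_Suc by linarith
  qed
  have "card {Y \<in> ?C. dk (crd X) < dk (crd Y)} \<le> card {Y \<in> ?C. Suc x \<le> dist_part Y}"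
    using less X(2) by (intro card_mono fin) (auto simp: Suc_le_eq)
  then show "card {Y \<in> ?C. dk (crd X) < dk (crd Y)} < k" using kx' by simp
  have "card {Y \<in> ?C. x \<le> dist_part Y} \<le> card {Y \<in> ?C. dk (crd X) \<le> dk (crd Y)}"
    using le X(2) by (intro card_mono fin) auto
  then show "k \<le> card {Y \<in> ?C. dk (crd X) \<le> dk (crd Y)}" using kx by simp
qed

end

section \<open>Programs for keys and queries\<close>

definition pow2E :: "exp \<Rightarrow> exp" where
  "pow2E a = eShl (Num 1) a"

definition pixE :: "nat \<Rightarrow> exp \<Rightarrow> exp \<Rightarrow> exp" where
  "pixE d X j = eMod (eShr X (eMul (Par 3) (eDiv j (Num d)))) (pow2E (Par 3))"

text \<open>\<open>\<beta>\<close> is the address of the input block: 0 during the construction, the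
  length of the query when a query is answered. The points follow a header of three words.\<close>

definition crdE :: "nat \<Rightarrow> nat \<Rightarrow> exp \<Rightarrow> exp \<Rightarrow> exp" where
  "crdE d \<beta> X j = Read (eAdd (eAdd (Num (\<beta> + 3)) (eMul (Num d) (pixE d X j))) (eMod j (Num d)))"

definition levE :: "nat \<Rightarrow> exp \<Rightarrow> exp \<Rightarrow> exp" where
  "levE d X j = eMod (eShr X (eAdd (eMul (Num d) (Par 3)) (eMul (Par 4) j))) (pow2E (Par 4))"

definition validE :: "nat \<Rightarrow> exp" where
  "validE d = Iter 19 50 51 (Num 1) (eAnd (Var 50) (eAnd (eLess (pixE d (Var 0) (Var 51)) (Par 0))
     (nlessE (Par 1) (levE d (Var 0) (Var 51)))))"

definition codeE :: "nat \<Rightarrow> nat \<Rightarrow> exp" where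
  "codeE d \<beta> = Iter 19 52 53 (Num 0) (eAdd (eMul (Var 52) (pow2E (Par 31)))
     (eShr (eAdd (pow2E (Par 1)) (crdE d \<beta> (Var 0) (Var 53))) (levE d (Var 0) (Var 53))))"

definition KE :: "nat \<Rightarrow> nat \<Rightarrow> exp \<Rightarrow> exp" where
  "KE d \<beta> DE = Cond (validE d)
     (eAdd (eMul (eAdd (eMul (codeE d \<beta>) (pow2E (Par 16))) DE) (Par 8)) (Var 0)) (Var 0)"

text \<open>After the word for k, each box occupies 2 * d words of the query, its lower corner
  first.\<close>

definition loE :: "nat \<Rightarrow> exp \<Rightarrow> exp" where
  "loE d j = Read (eAdd (eAdd (Num 1) (eMul (Num (2 * d)) (eDiv j (Num d)))) (eMod j (Num d)))"

definition hiE :: "nat \<Rightarrow> exp \<Rightarrow> exp" where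
  "hiE d j = Read (eAdd (eAdd (Num (1 + d)) (eMul (Num (2 * d)) (eDiv j (Num d)))) (eMod j (Num d)))"

definition digE :: "exp \<Rightarrow> exp \<Rightarrow> exp" where
  "digE q j = eMod (eShr q (eMul (eAdd (Par 4) (Num 1)) j)) (pow2E (eAdd (Par 4) (Num 1)))"

definition halfE :: exp where
  "halfE = eDiv (Var 60) (Num 2)"

definition sideE :: exp where
  "sideE = eMod (Var 60) (Num 2)"

definition lowE :: "nat \<Rightarrow> exp \<Rightarrow> exp" where
  "lowE d j = eShr (eAdd (eAdd (pow2E (Par 1)) (loE d j)) (eSub (pow2E halfE) (Num 1))) halfE"

definition highE :: "nat \<Rightarrow> exp \<Rightarrow> exp" where
  "highE d j = eShr (eAdd (eAdd (pow2E (Par 1)) (hiE d j)) (Num 1)) halfE"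

definition takenE :: "nat \<Rightarrow> exp \<Rightarrow> exp" where
  "takenE d j = eAnd (nlessE (Par 1) halfE) (eAnd (eLess (lowE d j) (highE d j))
     (eEq (eMod (Cond sideE (highE d j) (lowE d j)) (Num 2)) (Num 1)))"

definition tnodeE :: "nat \<Rightarrow> exp \<Rightarrow> exp" where
  "tnodeE d j = Cond sideE (eSub (highE d j) (Num 1)) (lowE d j)"

definition qtakenE :: "nat \<Rightarrow> exp \<Rightarrow> exp" where
  "qtakenE d q = Iter 19 61 62 (Num 1) (Bind 60 (digE q (Var 62)) (eAnd (Var 61) (takenE d (Var 62))))"

definition qcodeE :: "nat \<Rightarrow> exp \<Rightarrow> exp" where
  "qcodeE d q = Iter 19 63 64 (Num 0) (Bind 60 (digE q (Var 64))
     (eAdd (eMul (Var 63) (pow2E (Par 31))) (tnodeE d (Var 64))))"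

definition cntE :: "nat \<Rightarrow> exp \<Rightarrow> exp \<Rightarrow> exp" where
  "cntE d K x = Bind 36 x (Iter 21 37 38 (Num 0) (Cond (qtakenE d (Var 38)) (Bind 39 (qcodeE d (Var 38))
     (eAdd (Var 37) (eSub (lbE K (eMul (eAdd (Var 39) (Num 1)) (pow2E (Par 17))))
       (lbE K (eAdd (eMul (Var 39) (pow2E (Par 17))) (Var 36)))))) (Var 37)))"

definition answerE :: "nat \<Rightarrow> exp \<Rightarrow> exp" where
  "answerE d K = eMod (bsE 17 40 (nlessE (cntE d K (Var 40)) (Read (Num 0)))) (Par 8)"

text \<open>The output overwrites the query. This is safe, since the answer has been computed
  before, and the points lie beyond \<open>\<beta>\<close>, which is at least d * d.\<close>

definition query_com :: "nat \<Rightarrow> nat \<Rightarrow> exp \<Rightarrow> com" where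
  "query_com d \<beta> DE = Local 43 (answerE d (KE d \<beta> DE))
     (For 19 44 (Write (Var 44) (crdE d \<beta> (Var 43) (Var 44))))"

lemma eval_pow2E: "eval W p m a v = x \<Longrightarrow> x < W \<Longrightarrow> eval W p m (pow2E a) v = 2 ^ x"
  by (simp add: pow2E_def push_bit_eq_mult)

lemma eval_add: "eval W p m a v = x \<Longrightarrow> eval W p m b v = y \<Longrightarrow> x + y < 2 ^ W \<Longrightarrow>
    eval W p m (eAdd a b) v = x + y"
  by simp

lemma eval_mul: "eval W p m a v = x \<Longrightarrow> eval W p m b v = y \<Longrightarrow> x * y < 2 ^ W \<Longrightarrow>
    eval W p m (eMul a b) v = x * y"
  by simp

lemma eval_minus: "eval W p m a v = x \<Longrightarrow> eval W p m b v = y \<Longrightarrow> y \<le> x \<Longrightarrow> x < 2 ^ W \<Longrightarrow>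
    eval W p m (eSub a b) v = x - y"
  using eval_sub by metis

lemma eval_shr: "eval W p m a v = x \<Longrightarrow> eval W p m b v = y \<Longrightarrow> eval W p m (eShr a b) v = x div 2 ^ y"
  by (simp add: drop_bit_eq_div)

lemma eval_mod: "eval W p m a v = x \<Longrightarrow> eval W p m b v = y \<Longrightarrow> eval W p m (eMod a b) v = x mod y"
  by simp

lemma eval_div: "eval W p m a v = x \<Longrightarrow> eval W p m b v = y \<Longrightarrow> eval W p m (eDiv a b) v = x div y"
  by simp

lemma eval_num: "c < 2 ^ W \<Longrightarrow> eval W p m (Num c) v = c"
  by simp

lemma eval_par: "p k = x \<Longrightarrow> eval W p m (Par k) v = x"
  by simp

lemma eval_var: "v k = x \<Longrightarrow> eval W p m (Var k) v = x"
  by simp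

lemma eval_and: "eval W p m a v = of_bool P \<Longrightarrow> eval W p m b v = of_bool Q \<Longrightarrow>
    eval W p m (eAnd a b) v = of_bool (P \<and> Q)"
  by simp

lemma eval_and_False: "eval W p m a v = 0 \<Longrightarrow> eval W p m (eAnd a b) v = 0"
  by simp

lemma eval_nless: "0 < W \<Longrightarrow> eval W p m a v = x \<Longrightarrow> eval W p m b v = y \<Longrightarrow>
    eval W p m (nlessE a b) v = of_bool (y \<le> x)"
  by (simp add: eval_nlessE not_less)

lemma eval_less: "eval W p m a v = x \<Longrightarrow> eval W p m b v = y \<Longrightarrow> eval W p m (eLess a b) v = of_bool (x < y)"
  by simp

lemma eval_eq: "eval W p m a v = x \<Longrightarrow> eval W p m b v = y \<Longrightarrow> eval W p m (eEq a b) v = of_bool (x = y)"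
  by simp

lemma eval_cond: "eval W p m c v = x \<Longrightarrow> (x \<noteq> 0 \<Longrightarrow> eval W p m a v = y) \<Longrightarrow>
    (x = 0 \<Longrightarrow> eval W p m b v = y) \<Longrightarrow> y < 2 ^ W \<Longrightarrow> eval W p m (Cond c a b) v = y"
  by simp

lemma eval_read: "eval W p m a v = x \<Longrightarrow> m x = y \<Longrightarrow> eval W p m (Read a) v = y"
  by simp

lemma eval_bind: "eval W p m a v = x \<Longrightarrow> eval W p m b (v(k := x)) = y \<Longrightarrow> eval W p m (Bind k a b) v = y"
  by simp

lemma eval_iter:
  assumes "p k = n" "eval W p m a v = x"
    and "\<And>i. i < n \<Longrightarrow> eval W p m b (v(y := itr i F x, z := i)) = F i (itr i F x)"
  shows "eval W p m (Iter k y z a b) v = itr n F x"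
proof -
  have "itr n F x = itr n (\<lambda>i u. eval W p m b (v(y := u, z := i))) x"
    by (rule itr_cong) (simp only: assms(3))
  then show ?thesis unfolding eval.simps(8) assms(1,2) by simp
qed

lemma itr_conj: "itr n (\<lambda>j a. of_bool (a = Suc 0 \<and> P j)) (Suc 0) = (of_bool (\<forall>j<n. P j) :: nat)"
  by (induction n) (auto simp: less_Suc_eq)

locale key_code = tuples +
  fixes W :: nat and p m :: "nat \<Rightarrow> nat" and \<beta> :: nat and DE :: exp
  assumes par: "p 0 = n" "p 1 = w" "p 3 = k1" "p 4 = k2" "p 8 = 2 ^ kN" "p 16 = Bd" "p 19 = d * d"
      "p 31 = w + 1"
    and points: "i < n \<Longrightarrow> a < d \<Longrightarrow> m (\<beta> + 3 + d * i + a) = cf i a"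
    and address: "\<beta> + 3 + d * n < 2 ^ W" "2 * d < 2 ^ W"
    and W: "Kb + 2 < W"
    and DE: "v 0 < 2 ^ kN \<Longrightarrow> valid (v 0) \<Longrightarrow> eval W p m DE v = dk (crd (v 0))"
begin

lemma kN_le_Kb: "kN < Kb" "kD < Kb" "w < W" "w + 1 < W" "k1 < W" "k2 < W" "0 < W" "kN < W" "Bd < W"
proof -
  show kN: "kN < Kb" "kD < Kb" by (simp_all add: Kb_def kD_def)
  have "(w + 1) * 1 \<le> (w + 1) * D" using D_pos by (intro mult_le_mono2) linarith
  then show "w + 1 < W" "w < W" using W by (simp_all add: Kb_def)
  have "1 * k1 \<le> d * k1" "1 * k2 \<le> D * k2" using d D_pos by (intro mult_le_mono1; linarith)+
  then have "k1 \<le> kN" "k2 \<le> kN" unfolding kN_def mult_1 by linarith+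
  then show "k1 < W" "k2 < W" "kN < W" "0 < W" using kN W by linarith+
  show "Bd < W" using kN W by (simp add: kD_def)
qed

lemma lt_pow: "x < W \<Longrightarrow> x < 2 ^ W"
  by (rule less_trans[OF _ less_exp])

lemma one_less: "1 < (2 :: nat) ^ W"
  by (rule lt_pow) (use kN_le_Kb(4) in linarith)

lemma d_less: "d < 2 ^ W" using address(2) by simp

lemma eval_pixE:
  assumes X: "eval W p m' X v = x" and j: "eval W p m' j v = j'" "j' < D"
  shows "eval W p m' (pixE d X j) v = pix x j'"
proof -
  have "j' div d < d" using j(2) by (rule less_mult_imp_div_less)
  then have "k1 * (j' div d) \<le> k1 * d" by (intro mult_le_mono2) simp
  also have "\<dots> \<le> kN" by (simp add: kN_def mult.commute)
  also have "\<dots> < 2 ^ W" by (rule lt_pow[OF kN_le_Kb(8)])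
  finally have "k1 * (j' div d) < 2 ^ W" .
  then show ?thesis
    unfolding pixE_def pix_def
    by (intro eval_mod eval_shr eval_mul eval_div eval_pow2E eval_par eval_num X j(1) par d_less kN_le_Kb)
qed

lemma eval_crdE:
  assumes X: "eval W p m' X v = x" and j: "eval W p m' j v = j'" "j' < D" and pix: "pix x j' < n"
    and points': "\<And>i a. i < n \<Longrightarrow> a < d \<Longrightarrow> m' (\<beta> + 3 + d * i + a) = cf i a"
  shows "eval W p m' (crdE d \<beta> X j) v = crd x j'"
proof -
  have md: "j' mod d < d" using d by simp
  have "d * pix x j' + j' mod d < d * (pix x j' + 1)" using md by simp
  also have "\<dots> \<le> d * n" using pix by (intro mult_le_mono2) simp
  finally have lt: "\<beta> + 3 + d * pix x j' + j' mod d < 2 ^ W" using address by simp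
  show ?thesis
    unfolding crdE_def crd_def
  proof (rule eval_read[where x = "\<beta> + 3 + d * pix x j' + j' mod d"])
    show "m' (\<beta> + 3 + d * pix x j' + j' mod d) = cf (pix x j') (j' mod d)"
      by (rule points'[OF pix md])
  qed (intro eval_add eval_mul eval_mod eval_num eval_pixE[OF X j] j(1) d_less; use lt in simp)
qed

lemma eval_levE:
  assumes X: "eval W p m X v = x" and j: "eval W p m j v = j'" "j' < D"
  shows "eval W p m (levE d X j) v = lev x j'"
proof -
  have "d * k1 + k2 * j' \<le> kN" using j(2) by (simp add: kN_def mult.commute)
  then have le: "d * k1 + k2 * j' < 2 ^ W" using lt_pow[of kN] kN_le_Kb by simp
  show ?thesis
    unfolding levE_def lev_def
    by (intro eval_mod eval_shr eval_add eval_mul eval_pow2E eval_par eval_num X j(1) par d_less kN_le_Kb)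
      (use le in simp_all)
qed

lemma eval_validE: "eval W p m (validE d) v = of_bool (valid (v 0))"
proof -
  have "eval W p m (validE d) v =
      itr D (\<lambda>j a. of_bool (a = Suc 0 \<and> (pix (v 0) j < n \<and> lev (v 0) j \<le> w))) (Suc 0)"
    unfolding validE_def
  proof (rule eval_iter)
    fix i assume i: "i < D"
    let ?P = "\<lambda>j. pix (v 0) j < n \<and> lev (v 0) j \<le> w"
    let ?F = "\<lambda>j a. of_bool (a = Suc 0 \<and> ?P j) :: nat"
    let ?v = "v(50 := itr i ?F (Suc 0), 51 := i)"
    have a: "eval W p m (Var 50) ?v = of_bool (itr i ?F (Suc 0) = Suc 0)"
      unfolding itr_conj by simp
    have "eval W p m (eAnd (Var 50) (eAnd (eLess (pixE d (Var 0) (Var 51)) (Par 0))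
        (nlessE (Par 1) (levE d (Var 0) (Var 51))))) ?v = of_bool (itr i ?F (Suc 0) = Suc 0 \<and> ?P i)"
      by (intro eval_and a eval_less eval_nless eval_pixE eval_levE eval_par eval_var par i kN_le_Kb) simp_all
    then show "eval W p m (eAnd (Var 50) (eAnd (eLess (pixE d (Var 0) (Var 51)) (Par 0))
        (nlessE (Par 1) (levE d (Var 0) (Var 51))))) ?v = ?F i (itr i ?F (Suc 0))" .
  qed (use par kN_le_Kb in auto)
  then show ?thesis unfolding itr_conj valid_def by simp
qed

lemma code_step_less:
  assumes "\<And>j. j < D \<Longrightarrow> f j < 2 ^ (w + 1)" "i < D"
  shows "vcode (w + 1) i f * 2 ^ (w + 1) + f i < 2 ^ W" "vcode (w + 1) i f * 2 ^ (w + 1) < 2 ^ W"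
proof -
  have "vcode (w + 1) (Suc i) f < 2 ^ ((w + 1) * Suc i)"
    using assms by (intro vcode_less) auto
  also have "\<dots> \<le> 2 ^ ((w + 1) * D)" using assms(2) by (intro power_increasing mult_le_mono2) auto
  also have "\<dots> \<le> 2 ^ W" using W by (intro power_increasing) (simp_all add: Kb_def)
  finally show "vcode (w + 1) i f * 2 ^ (w + 1) + f i < 2 ^ W" by (simp add: vcode_Suc)
  then show "vcode (w + 1) i f * 2 ^ (w + 1) < 2 ^ W" by simp
qed

lemma eval_codeE:
  assumes "valid (v 0)"
  shows "eval W p m (codeE d \<beta>) v = vcode (w + 1) D (node (v 0))"
  unfolding codeE_def vcode_def
proof (rule eval_iter)
  fix i assume i: "i < D"
  let ?a = "itr i (\<lambda>j a. a * 2 ^ (w + 1) + node (v 0) j) 0"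
  have a: "?a = vcode (w + 1) i (node (v 0))" by (simp add: vcode_def)
  have c: "crd (v 0) i < 2 ^ w" by (rule crd_less[OF assms i])
  have "2 ^ w + crd (v 0) i < 2 ^ (w + 1)" using c by simp
  also have "\<dots> < 2 ^ W" using kN_le_Kb by (intro power_strict_increasing) simp_all
  finally have lt: "2 ^ w + crd (v 0) i < 2 ^ W" .
  note st = code_step_less[OF node_less[OF assms] i]
  have pix: "pix (v 0) i < n" using assms i by (simp add: valid_def)
  let ?v = "v(52 := ?a, 53 := i)"
  have shr: "eval W p m (eShr (eAdd (pow2E (Par 1)) (crdE d \<beta> (Var 0) (Var 53))) (levE d (Var 0) (Var 53))) ?v =
      node (v 0) i"
    unfolding node_def anc_def
    by (intro eval_add eval_shr eval_crdE eval_levE eval_pow2E eval_par eval_var par i kN_le_Kb pix points lt) simp_all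
  show "eval W p m (eAdd (eMul (Var 52) (pow2E (Par 31)))
     (eShr (eAdd (pow2E (Par 1)) (crdE d \<beta> (Var 0) (Var 53))) (levE d (Var 0) (Var 53))))
     ?v = ?a * 2 ^ (w + 1) + node (v 0) i"
    unfolding a
    by (intro eval_add eval_mul eval_pow2E eval_par eval_var par kN_le_Kb shr[unfolded a] st) simp
qed (use par in auto)

lemma eval_KE: "v 0 < 2 ^ kN \<Longrightarrow> eval W p m (KE d \<beta> DE) v = key (v 0)"
proof -
  assume X: "v 0 < 2 ^ kN"
  have Kb: "key (v 0) < 2 ^ W"
    using key_less[OF X] power_strict_increasing[of Kb W "2 :: nat"] W by linarith
  show ?thesis
    unfolding KE_def
  proof (rule eval_cond[OF eval_validE])
    assume "of_bool (valid (v 0)) \<noteq> (0 :: nat)"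
    then have val: "valid (v 0)" by simp
    let ?c = "vcode (w + 1) D (node (v 0))" and ?r = "dk (crd (v 0))"
    have key: "key (v 0) = (?c * 2 ^ Bd + ?r) * 2 ^ kN + v 0"
      using val by (simp add: key_def dist_part_def kD_def power_add algebra_simps)
    then have 1: "(?c * 2 ^ Bd + ?r) * 2 ^ kN + v 0 < 2 ^ W" "(?c * 2 ^ Bd + ?r) * 2 ^ kN < 2 ^ W"
      using Kb by linarith+
    have "(?c * 2 ^ Bd + ?r) * 1 \<le> (?c * 2 ^ Bd + ?r) * 2 ^ kN" by (intro mult_le_mono2) simp
    then have 2: "?c * 2 ^ Bd + ?r < 2 ^ W" using 1 unfolding mult_1_right by linarith
    then have 3: "?c * 2 ^ Bd < 2 ^ W" by linarith
    show "eval W p m (eAdd (eMul (eAdd (eMul (codeE d \<beta>) (pow2E (Par 16))) DE) (Par 8)) (Var 0)) v = key (v 0)"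
      unfolding key
      by (intro eval_add eval_mul eval_codeE eval_pow2E eval_par eval_var DE X val par kN_le_Kb 1 2 3 refl)
  next
    assume "of_bool (valid (v 0)) = (0 :: nat)"
    then show "eval W p m (Var 0) v = key (v 0)" by (simp add: key_def)
  qed (rule Kb)
qed

end

text \<open>Tuples and implicit array are joined here: the array is sorted by the keys of the
  tuples, and \<open>KE\<close> is the program for these keys.\<close>

locale query_code = key_code +
  I: full_index_code kN kt kB kM Kb l key W rs p m "KE d \<beta> DE" P0 P1 kL P2
  for kt kB kM l rs P0 P1 kL P2 +
  fixes lo hi :: "nat \<Rightarrow> nat"
  assumes qpar: "p 17 = kD" "p 21 = 2 ^ ((k2 + 1) * (d * d))"
    and qW: "(k2 + 1) * (d * d) < W" "2 * (d * d) + 1 < 2 ^ W"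
    and lo: "j < d * d \<Longrightarrow> m (1 + 2 * d * (j div d) + j mod d) = lo j"
    and hi: "j < d * d \<Longrightarrow> m (1 + d + 2 * d * (j div d) + j mod d) = hi j"
    and lo_less: "j < d * d \<Longrightarrow> lo j < 2 ^ w"
    and hi_less: "j < d * d \<Longrightarrow> hi j < 2 ^ w"
begin

lemma I_lb: "I.lb z = lb z"
  by (simp add: I.lb_def lb_def)

lemma query_address:
  assumes "j < D"
  shows "1 + d + 2 * d * (j div d) + j mod d < 2 ^ W"
proof -
  have "j div d < d" using assms by (rule less_mult_imp_div_less)
  then have "Suc (j div d) \<le> d" by simp
  then have "2 * d * Suc (j div d) \<le> 2 * d * d" by (intro mult_le_mono2)
  moreover have "j mod d < d" using d by simp
  ultimately have "d + 2 * d * (j div d) + j mod d < 2 * D" by (simp add: mult.assoc)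
  then show ?thesis using qW(2) by simp
qed

lemma eval_loE:
  assumes "eval W p m j v = j'" "j' < D"
  shows "eval W p m (loE d j) v = lo j'"
proof -
  have md: "j' mod d < d" using d by simp
  note ad = query_address[OF assms(2)]
  show ?thesis
    unfolding loE_def
  proof (rule eval_read[where x = "1 + 2 * d * (j' div d) + j' mod d"])
    show "m (1 + 2 * d * (j' div d) + j' mod d) = lo j'" by (rule lo[OF assms(2)])
  qed (intro eval_add eval_mul eval_mod eval_div eval_num assms(1) d_less address(2); use ad in simp)
qed

lemma eval_hiE:
  assumes "eval W p m j v = j'" "j' < D"
  shows "eval W p m (hiE d j) v = hi j'"
proof -
  have md: "j' mod d < d" using d by simp
  note ad = query_address[OF assms(2)]
  show ?thesis
    unfolding hiE_def
  proof (rule eval_read[where x = "1 + d + 2 * d * (j' div d) + j' mod d"])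
    show "m (1 + d + 2 * d * (j' div d) + j' mod d) = hi j'" by (rule hi[OF assms(2)])
  qed (intro eval_add eval_mul eval_mod eval_div eval_num assms(1) d_less address(2); use ad in simp)
qed

lemma eval_digE:
  assumes "eval W p m q v = q'" "eval W p m j v = j'" "j' < D"
  shows "eval W p m (digE q j) v = dig (k2 + 1) q' j'"
proof -
  have "(k2 + 1) * j' \<le> (k2 + 1) * D" using assms(3) by (intro mult_le_mono2) simp
  then have 1: "(k2 + 1) * j' < W" using qW(1) by linarith
  have "(k2 + 1) * 1 \<le> (k2 + 1) * D" using D_pos by (intro mult_le_mono2) linarith
  then have 2: "k2 + 1 < W" using qW(1) unfolding mult_1_right by linarith
  show ?thesis
    unfolding digE_def dig_def
    by (intro eval_mod eval_shr eval_mul eval_add eval_par eval_num eval_pow2E assms(1,2) par 2 lt_pow 1)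
      (use 2 lt_pow[of 1] in simp_all)
qed

lemma eval_halfE: "v 60 = e \<Longrightarrow> eval W p m halfE v = e div 2"
  and eval_sideE: "v 60 = e \<Longrightarrow> eval W p m sideE v = e mod 2"
proof -
  have "(2 :: nat) < 2 ^ W" using kN_le_Kb(1) W by (intro lt_pow) linarith
  then show "v 60 = e \<Longrightarrow> eval W p m halfE v = e div 2" "v 60 = e \<Longrightarrow> eval W p m sideE v = e mod 2"
    by (simp_all add: halfE_def sideE_def)
qed

lemma node_range:
  assumes "j < D" "k \<le> w"
  shows "2 ^ w + lo j + (2 ^ k - 1) < 2 ^ W" "2 ^ w + hi j + 1 < 2 ^ W"
    "low_node w (lo j) k < 2 ^ W" "high_node w (hi j) k < 2 ^ W" "2 ^ w + lo j < 2 ^ W" "2 ^ w + hi j < 2 ^ W"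
proof -
  have "(2 :: nat) ^ (w + 2) \<le> 2 ^ W" using kN_le_Kb by (intro power_increasing) simp_all
  then have 4: "4 * (2 :: nat) ^ w \<le> 2 ^ W" by simp
  have "(2 :: nat) ^ k \<le> 2 ^ w" using assms(2) by (intro power_increasing) simp_all
  then show 1: "2 ^ w + lo j + (2 ^ k - 1) < 2 ^ W" using 4 lo_less[OF assms(1)] by linarith
  show 2: "2 ^ w + hi j + 1 < 2 ^ W" using 4 hi_less[OF assms(1)] by linarith
  show "low_node w (lo j) k < 2 ^ W"
    unfolding low_node_def by (rule le_less_trans[OF div_le_dividend 1])
  show "high_node w (hi j) k < 2 ^ W"
    unfolding high_node_def by (rule le_less_trans[OF div_le_dividend 2])
  show "2 ^ w + lo j < 2 ^ W" "2 ^ w + hi j < 2 ^ W" using 1 2 by linarith+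
qed

lemma eval_lowE:
  assumes "v 60 = e" "e div 2 \<le> w" "eval W p m j v = j'" "j' < D"
  shows "eval W p m (lowE d j) v = low_node w (lo j') (e div 2)"
  unfolding lowE_def low_node_def
proof -
  have e: "e div 2 < W" using assms(2) kN_le_Kb by linarith
  then have e': "(2 :: nat) ^ (e div 2) < 2 ^ W" by simp
  show "eval W p m (eShr (eAdd (eAdd (pow2E (Par 1)) (loE d j)) (eSub (pow2E halfE) (Num 1))) halfE) v =
      (2 ^ w + lo j' + (2 ^ (e div 2) - 1)) div 2 ^ (e div 2)"
    by (intro eval_shr eval_add eval_minus eval_pow2E eval_par par eval_halfE eval_loE eval_num assms(1,3,4)
      kN_le_Kb node_range[OF assms(4,2)] e e' one_less) simp
qed

lemma eval_highE:
  assumes "v 60 = e" "e div 2 \<le> w" "eval W p m j v = j'" "j' < D"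
  shows "eval W p m (highE d j) v = high_node w (hi j') (e div 2)"
  unfolding highE_def high_node_def
  by (intro eval_shr eval_add eval_pow2E eval_par par eval_halfE eval_hiE eval_num assms(1,3,4)
    kN_le_Kb node_range[OF assms(4,2)] one_less)

lemma eval_takenE:
  assumes "v 60 = e" "eval W p m j v = j'" "j' < D"
  shows "eval W p m (takenE d j) v = of_bool (taken w (lo j') (hi j') e)"
proof -
  have h: "eval W p m (nlessE (Par 1) halfE) v = of_bool (e div 2 \<le> w)"
    by (intro eval_nless eval_par par eval_halfE assms(1) kN_le_Kb)
  show ?thesis
  proof (cases "e div 2 \<le> w")
    \<comment> \<open>Above level w the shifts may exceed the word size, but the first test already
      yields 0.\<close>
    case False
    have "eval W p m (takenE d j) v = 0"
      unfolding takenE_def by (rule eval_and_False) (use h False in simp)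
    then show ?thesis using False by (simp add: taken_def)
  next
    case True
    have c: "eval W p m (Cond sideE (highE d j) (lowE d j)) v =
        (if e mod 2 = 0 then low_node w (lo j') (e div 2) else high_node w (hi j') (e div 2))"
      using node_range[OF assms(3) True] eval_lowE[OF assms(1) True assms(2,3)]
        eval_highE[OF assms(1) True assms(2,3)]
      by (intro eval_cond[OF eval_sideE[of v, OF assms(1)]]) auto
    have "eval W p m (takenE d j) v = of_bool (e div 2 \<le> w \<and>
        (low_node w (lo j') (e div 2) < high_node w (hi j') (e div 2) \<and>
        (if e mod 2 = 0 then low_node w (lo j') (e div 2) else high_node w (hi j') (e div 2)) mod 2 = 1))"
      unfolding takenE_def
      by (intro eval_and h eval_less eval_lowE eval_highE eval_eq eval_mod c eval_num assms True)
        (use kN_le_Kb lt_pow[of 1] lt_pow[of 2] W in simp_all)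
    then show ?thesis unfolding taken_def odd_iff_mod_2_eq_one by simp
  qed
qed

lemma eval_tnodeE:
  assumes "v 60 = e" "eval W p m j v = j'" "j' < D" "taken w (lo j') (hi j') e"
  shows "eval W p m (tnodeE d j) v = tnode w (lo j') (hi j') e"
proof -
  have e: "e div 2 \<le> w" and lt: "low_node w (lo j') (e div 2) < high_node w (hi j') (e div 2)"
    using assms(4) by (simp_all add: taken_def)
  note r = node_range[OF assms(3) e]
  have one: "eval W p m (Num 1) v = 1" using kN_le_Kb by simp
  have h: "eval W p m (eSub (highE d j) (Num 1)) v = high_node w (hi j') (e div 2) - 1"
    by (intro eval_minus eval_highE one assms e r) (use lt in simp)
  show ?thesis
    unfolding tnodeE_def tnode_def
    using r le_less_trans[OF diff_le_self r(4)] h eval_lowE[OF assms(1) e assms(2,3)] by (intro eval_cond[OF eval_sideE[of v, OF assms(1)]]) auto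
qed

lemma eval_qtakenE:
  assumes "eval W p m q (v(61 := a, 62 := b)) = q'" "\<And>a b. eval W p m q (v(61 := a, 62 := b)) = q'"
  shows "eval W p m (qtakenE d q) v = of_bool (qtaken lo hi q')"
proof -
  let ?P = "\<lambda>j. taken w (lo j) (hi j) (dig (k2 + 1) q' j)"
  let ?F = "\<lambda>j a. of_bool (a = Suc 0 \<and> ?P j) :: nat"
  have "eval W p m (qtakenE d q) v = itr D ?F (Suc 0)"
    unfolding qtakenE_def
  proof (rule eval_iter)
    fix i assume i: "i < D"
    let ?v = "v(61 := itr i ?F (Suc 0), 62 := i)"
    let ?e = "dig (k2 + 1) q' i"
    have a: "eval W p m (Var 61) (?v(60 := ?e)) = of_bool (itr i ?F (Suc 0) = Suc 0)"
      unfolding itr_conj by simp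
    show "eval W p m (Bind 60 (digE q (Var 62)) (eAnd (Var 61) (takenE d (Var 62)))) ?v =
        ?F i (itr i ?F (Suc 0))"
    proof (rule eval_bind)
      show "eval W p m (digE q (Var 62)) ?v = ?e"
        by (intro eval_digE assms(2) i) simp
      show "eval W p m (eAnd (Var 61) (takenE d (Var 62))) (?v(60 := ?e)) = ?F i (itr i ?F (Suc 0))"
        by (intro eval_and a eval_takenE i) simp_all
    qed
  qed (use par kN_le_Kb in auto)
  then show ?thesis unfolding itr_conj qtaken_def by simp
qed

lemma eval_qcodeE:
  assumes "\<And>a b. eval W p m q (v(63 := a, 64 := b)) = q'" "qtaken lo hi q'"
  shows "eval W p m (qcodeE d q) v = qcode lo hi q'"
  unfolding qcodeE_def qcode_def vcode_def
proof (rule eval_iter)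
  fix i assume i: "i < D"
  let ?f = "\<lambda>j. tnode w (lo j) (hi j) (dig (k2 + 1) q' j)"
  let ?a = "itr i (\<lambda>j a. a * 2 ^ (w + 1) + ?f j) 0"
  let ?v = "v(63 := ?a, 64 := i)"
  let ?e = "dig (k2 + 1) q' i"
  have a: "?a = vcode (w + 1) i ?f" by (simp add: vcode_def)
  have tk: "taken w (lo j) (hi j) (dig (k2 + 1) q' j)" if "j < D" for j
    using assms(2) that by (simp add: qtaken_def)
  note st = code_step_less[of ?f, OF tnode_less(1)[OF tk hi_less] i]
  show "eval W p m (Bind 60 (digE q (Var 64)) (eAdd (eMul (Var 63) (pow2E (Par 31))) (tnodeE d (Var 64)))) ?v =
      ?a * 2 ^ (w + 1) + ?f i"
  proof (rule eval_bind)
    show "eval W p m (digE q (Var 64)) ?v = ?e"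
      by (intro eval_digE assms(1) i) simp
    show "eval W p m (eAdd (eMul (Var 63) (pow2E (Par 31))) (tnodeE d (Var 64))) (?v(60 := ?e)) =
        ?a * 2 ^ (w + 1) + ?f i"
      by (intro eval_add eval_mul eval_pow2E eval_par par kN_le_Kb eval_tnodeE tk i st[folded a])
        (simp_all add: st[folded a] i)
  qed
qed (use par in auto)

lemma eval_cntE:
  assumes "eval W p m x v = x'" "x' < 2 ^ kD"
  shows "eval W p m (cntE d (KE d \<beta> DE) x) v = cnt lo hi x'"
proof -
  let ?f = "\<lambda>q. lb ((qcode lo hi q + 1) * 2 ^ kD) - lb (qcode lo hi q * 2 ^ kD + x')"
  let ?F = "\<lambda>q a. if qtaken lo hi q then a + ?f q else a"
  let ?Q = "2 ^ ((k2 + 1) * D) :: nat"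
  \<comment> \<open>A partial sum is at most the full count, which is at most the number of codes;
    so the accumulator does not wrap around.\<close>
  have tot: "itr i ?F 0 < 2 ^ W" if "i \<le> ?Q" for i
  proof -
    have "itr i ?F 0 \<le> itr ?Q ?F 0"
      unfolding itr_sum using that by (intro sum_mono2) auto
    also have "\<dots> = cnt lo hi x'" by (simp add: cnt_def)
    also have "\<dots> = card {X \<in> canonical lo hi. x' \<le> dist_part X}"
      using assms(2) by (intro cnt_eq hi_less) auto
    also have "\<dots> \<le> card {..<2 ^ kN :: nat}"
      by (intro card_mono) (auto simp: canonical_def)
    also have "\<dots> < 2 ^ W" using kN_le_Kb by simp
    finally show ?thesis .
  qed
  have kDW: "kD < W" using kN_le_Kb W by linarith
  have "eval W p m (Iter 21 37 38 (Num 0) (Cond (qtakenE d (Var 38)) (Bind 39 (qcodeE d (Var 38))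
     (eAdd (Var 37) (eSub (lbE (KE d \<beta> DE) (eMul (eAdd (Var 39) (Num 1)) (pow2E (Par 17))))
       (lbE (KE d \<beta> DE) (eAdd (eMul (Var 39) (pow2E (Par 17))) (Var 36)))))) (Var 37))) (v(36 := x')) =
     itr ?Q ?F 0"
  proof (rule eval_iter)
    fix i assume i: "i < ?Q"
    let ?a = "itr i ?F 0"
    let ?v = "v(36 := x', 37 := ?a, 38 := i)"
    have tk: "eval W p m (qtakenE d (Var 38)) ?v = of_bool (qtaken lo hi i)"
      by (rule eval_qtakenE) simp_all
    show "eval W p m (Cond (qtakenE d (Var 38)) (Bind 39 (qcodeE d (Var 38))
     (eAdd (Var 37) (eSub (lbE (KE d \<beta> DE) (eMul (eAdd (Var 39) (Num 1)) (pow2E (Par 17))))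
       (lbE (KE d \<beta> DE) (eAdd (eMul (Var 39) (pow2E (Par 17))) (Var 36)))))) (Var 37)) ?v = ?F i ?a"
    proof (rule eval_cond[OF tk])
      assume "of_bool (qtaken lo hi i) \<noteq> (0 :: nat)"
      then have q: "qtaken lo hi i" by simp
      let ?c = "qcode lo hi i"
      have "tnode w (lo j) (hi j) (dig (k2 + 1) i j) < 2 ^ (w + 1)" if "j < D" for j
        using q that by (intro tnode_less(1) hi_less) (auto simp: qtaken_def)
      then have "?c < 2 ^ ((w + 1) * D)" unfolding qcode_def by (intro vcode_less)
      then have "(?c + 1) * 2 ^ kD \<le> 2 ^ ((w + 1) * D) * 2 ^ kD" by (intro mult_le_mono1) simp
      also have "\<dots> < 2 ^ Kb" by (simp add: Kb_def power_add)
      also have "\<dots> < 2 ^ W" using W by (intro power_strict_increasing) simp_all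
      finally have cW: "(?c + 1) * 2 ^ kD < 2 ^ W" .
      have "(?c + 1) * 1 \<le> (?c + 1) * 2 ^ kD" by (intro mult_le_mono2) simp
      then have cW': "?c + 1 < 2 ^ W" using cW unfolding mult_1_right by linarith
      have cW'': "?c * 2 ^ kD + x' < 2 ^ W" "?c * 2 ^ kD < 2 ^ W" using cW assms(2) by simp_all
      let ?v' = "?v(39 := ?c)"
      have z1: "eval W p m (eMul (eAdd (Var 39) (Num 1)) (pow2E (Par 17))) ?v' = (?c + 1) * 2 ^ kD"
        by (intro eval_mul eval_add eval_pow2E eval_par qpar kDW cW cW') (use kN_le_Kb in simp_all)
      have z2: "eval W p m (eAdd (eMul (Var 39) (pow2E (Par 17))) (Var 36)) ?v' = ?c * 2 ^ kD + x'"
        by (intro eval_mul eval_add eval_pow2E eval_par qpar kDW cW'') simp_all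
      have "?c * 2 ^ kD + x' \<le> (?c + 1) * 2 ^ kD" using assms(2) by simp
      then have mono: "lb (?c * 2 ^ kD + x') \<le> lb ((?c + 1) * 2 ^ kD)"
        unfolding lb_def by (intro card_mono) auto
      have "lb z \<le> card {..<2 ^ kN :: nat}" for z
        unfolding lb_def by (intro card_mono) auto
      then have "lb z \<le> 2 ^ kN" for z by simp
      then have lbW: "lb z < 2 ^ W" for z
        by (rule le_less_trans) (intro power_strict_increasing kN_le_Kb, simp)
      have sub: "eval W p m (eSub (lbE (KE d \<beta> DE) (eMul (eAdd (Var 39) (Num 1)) (pow2E (Par 17))))
       (lbE (KE d \<beta> DE) (eAdd (eMul (Var 39) (pow2E (Par 17))) (Var 36)))) ?v' = ?f i"
        by (rule eval_minus[OF _ _ mono lbW]) (simp_all only: I.eval_lbE z1 z2 I_lb)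
      have "?a + ?f i < 2 ^ W" using tot[of "Suc i"] i q by simp
      then have "eval W p m (Bind 39 (qcodeE d (Var 38))
         (eAdd (Var 37) (eSub (lbE (KE d \<beta> DE) (eMul (eAdd (Var 39) (Num 1)) (pow2E (Par 17))))
           (lbE (KE d \<beta> DE) (eAdd (eMul (Var 39) (pow2E (Par 17))) (Var 36)))))) ?v = ?a + ?f i"
        by (intro eval_bind[where x = ?c] eval_add eval_qcodeE q sub) simp_all
      then show "eval W p m (Bind 39 (qcodeE d (Var 38))
         (eAdd (Var 37) (eSub (lbE (KE d \<beta> DE) (eMul (eAdd (Var 39) (Num 1)) (pow2E (Par 17))))
           (lbE (KE d \<beta> DE) (eAdd (eMul (Var 39) (pow2E (Par 17))) (Var 36)))))) ?v = ?F i ?a"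
        using q by simp
    next
      assume "of_bool (qtaken lo hi i) = (0 :: nat)"
      then show "eval W p m (Var 37) ?v = ?F i ?a" by simp
    next
      show "?F i ?a < 2 ^ W" using tot[of "Suc i"] i by simp
    qed
  qed (use qpar in simp_all)
  then show ?thesis
    unfolding cntE_def cnt_def by (rule eval_bind[OF assms(1)])
qed

lemma eval_answerE: "eval W p m (answerE d (KE d \<beta> DE)) v = answer lo hi (m 0)"
  unfolding answerE_def answer_def
proof (intro eval_mod eval_par par eval_bsE qpar)
  show "kD \<le> W" "kD < 2 ^ W" "0 < W" using kN_le_Kb W lt_pow[of kD] by linarith+
  fix a i c :: nat
  assume "c < 2 ^ kD"
  then have "eval W p m (cntE d (KE d \<beta> DE) (Var 40)) (v(40 + 1 := a, 40 + 2 := i, 40 := c)) = cnt lo hi c"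
    by (intro eval_cntE) simp_all
  then have "eval W p m (nlessE (cntE d (KE d \<beta> DE) (Var 40)) (Read (Num 0))) (v(40 + 1 := a, 40 + 2 := i, 40 := c)) =
      of_bool (m 0 \<le> cnt lo hi c)"
    by (intro eval_nless kN_le_Kb) simp_all
  then show "(eval W p m (nlessE (cntE d (KE d \<beta> DE) (Var 40)) (Read (Num 0)))
      (v(40 + 1 := a, 40 + 2 := i, 40 := c)) \<noteq> 0) = (m 0 \<le> cnt lo hi c)"
    by simp
qed

lemma query_com:
  assumes "\<And>j. j < D \<Longrightarrow> pix (answer lo hi (m 0)) j < n" "d * d \<le> \<beta>"
  shows "\<forall>j<D. sem W p (query_com d \<beta> DE) v m j = crd (answer lo hi (m 0)) j"
proof -
  let ?X = "answer lo hi (m 0)"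
  let ?v = "v(43 := ?X)"
  let ?F = "\<lambda>j. sem W p (Write (Var 44) (crdE d \<beta> (Var 43) (Var 44))) (?v(44 := j))"
  \<comment> \<open>The points are read from the memory that is being changed; they lie beyond the
    cells written.\<close>
  have "itr i ?F m = (\<lambda>b. if b < i then crd ?X b else m b)" if "i \<le> D" for i
    using that
  proof (induction i)
    case (Suc i)
    have i: "i < D" using Suc.prems by simp
    let ?m = "\<lambda>b. if b < i then crd ?X b else m b"
    have "eval W p ?m (crdE d \<beta> (Var 43) (Var 44)) (?v(44 := i)) = crd ?X i"
    proof (rule eval_crdE[OF _ _ i assms(1)[OF i]])
      fix k a assume "k < n" "a < d"
      then show "?m (\<beta> + 3 + d * k + a) = cf k a" using points[of k a] assms(2) i by simp
    qed simp_all
    then have "?F i ?m = ?m(i := crd ?X i)" by simp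
    also have "\<dots> = (\<lambda>b. if b < Suc i then crd ?X b else m b)" by (auto simp: less_Suc_eq)
    finally have "?F i ?m = (\<lambda>b. if b < Suc i then crd ?X b else m b)" .
    then show ?case unfolding itr.simps(2) Suc.IH[OF less_imp_le[OF i]] .
  qed simp
  moreover have "sem W p (query_com d \<beta> DE) v m = itr D ?F m"
    unfolding query_com_def sem.simps(3,4) eval_answerE par ..
  ultimately show ?thesis by simp
qed

end

section \<open>Parameters\<close>

text \<open>Linear search for the least argument at which \<open>P\<close> fails, as a replacement
  for logarithms and roots; \<open>c\<close> has to bound the answer.\<close>

definition lgc :: "nat \<Rightarrow> (nat \<Rightarrow> bool) \<Rightarrow> nat" where
  "lgc c P = itr c (\<lambda>_ a. if P a then a + 1 else a) 0"

lemma lgc: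
  assumes "b \<le> c" "\<not> P b"
  shows "\<not> P (lgc c P)" "a < lgc c P \<Longrightarrow> P a" "lgc c P \<le> b"
proof -
  let ?F = "\<lambda>_ a. if P a then a + 1 else a"
  have inv: "(\<forall>a < itr i ?F 0. P a) \<and> (\<not> P (itr i ?F 0) \<or> itr i ?F 0 = i)" for i :: nat
    by (induction i) (auto simp: less_Suc_eq)
  show 1: "\<not> P (lgc c P)"
    using inv[of c] assms unfolding lgc_def by (metis le_neq_implies_less)
  show "a < lgc c P \<Longrightarrow> P a"
    using inv[of c] unfolding lgc_def by blast
  show "lgc c P \<le> b"
    using inv[of c] assms(2) unfolding lgc_def by (metis not_le)
qed

text \<open>Entry i computes parameter i; the values are listed in \<open>par_vals\<close>. Entry 2
  bounds the loops for the logarithms by d * w + 3, which suffices because n distinct grid points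
  force n \<le> 2 ^ (d * w).\<close>

definition par_exps :: "nat \<Rightarrow> nat \<Rightarrow> nat \<Rightarrow> exp list" where
  "par_exps d g \<beta> = [
    Read (Num \<beta>),
    Read (Num (\<beta> + 1)),
    eAdd (eMul (Num d) (Par 1)) (Num 3),
    Iter 2 0 1 (Num 0) (Cond (eLess (pow2E (Var 0)) (eMul (Num 4) (Par 0))) (eAdd (Var 0) (Num 1)) (Var 0)),
    Iter 2 0 1 (Num 0) (Cond (eLess (pow2E (Var 0)) (eAdd (Par 1) (Num 1))) (eAdd (Var 0) (Num 1)) (Var 0)),
    Iter 3 0 1 (Num 0) (Cond (nlessE (Read (Num (\<beta> + 2))) (pow2E (eMul (Num 4) (eAdd (Var 0) (Num 1))))) (eAdd (Var 0) (Num 1)) (Var 0)),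
    pow2E (Par 5),
    eAdd (eMul (Num d) (Par 3)) (eMul (Num (d * d)) (Par 4)),
    pow2E (Par 7),
    eSub (Par 7) (Par 5),
    eSub (eSub (Par 7) (Num 2)) (eMul (Num 2) (Par 5)),
    pow2E (Par 10),
    eMul (eMul (Num 8) (Par 6)) (eAdd (Par 7) (eMul (Num g) (Par 3))),
    eMul (Par 12) (Par 11),
    eMul (Par 12) (Par 6),
    eMul (Num 2) (Par 14),
    eAdd (eMul (Num (6 * d)) (Par 1)) (Num (6 * (d * d) + 3 * d + 2)),
    eAdd (Par 16) (Par 7),
    eAdd (eMul (eAdd (Par 1) (Num 1)) (Num (d * d))) (eAdd (Num 1) (Par 17)),
    Num (d * d),
    eMul (eAdd (Par 4) (Num 1)) (Num (d * d)),
    pow2E (Par 20),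
    eAdd (Num (\<beta> + 3)) (eMul (Num d) (Par 0)),
    eAdd (Par 22) (Par 15),
    eAdd (Par 23) (pow2E (Par 9)),
    eAdd (Par 24) (Par 13),
    eAdd (eAdd (Par 5) (Num 3)) (eAdd (Par 7) (eMul (Num g) (Par 3))),
    eAdd (eAdd (Par 26) (Par 9)) (Par 10),
    eAdd (Par 26) (Par 10),
    pow2E (Par 9),
    eAdd (Par 7) (Num 1),
    eAdd (Par 1) (Num 1),
    eAdd (Par 25) (Par 8),
    eAdd (Par 32) (Par 8),
    eAdd (Par 25) (Par 13)]"

locale sizes =
  fixes d g n w u \<beta> :: nat
  assumes d: "1 \<le> d" and n: "1 \<le> n" "n \<le> 2 ^ (d * w)" and u: "1 \<le> u" "u \<le> n"
begin

text \<open>Rounding up \<open>4 * n\<close> rather than \<open>n\<close> provides the two bits that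
  \<open>kM\<close> spends.\<close>

definition "k1 = lgc (d * w + 3) (\<lambda>a. 2 ^ a < 4 * n)"
definition "k2 = lgc (d * w + 3) (\<lambda>a. 2 ^ a < w + 1)"
text \<open>The word \<open>u\<close> is about n^\<alpha>, so t = 2 ^ kt is its fourth root, rounded
  down to a power of two.\<close>

definition "kt = lgc k1 (\<lambda>a. 2 ^ (4 * (a + 1)) \<le> u)"
text \<open>Three times \<open>dbits d w\<close> plus 2: the number of bits of a rank in
  \<open>rank_less\<close>.\<close>

definition "Bd = 6 * d * w + (6 * (d * d) + 3 * d + 2)"
definition "kN = d * k1 + d * d * k2"
definition "kB = kN - kt"
definition "kM = kN - 2 - 2 * kt"
text \<open>As (1 - 1 / (8 * t)) ^ l is at most exp (- (kN + g * k1)), this number of tables leaves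
  a failure probability of 2 ^ (- g * k1) after the union bound over \<open>2 ^ kN\<close> codes.
  With n \<le> 2 ^ k1 this is at most n ^ (- g).\<close>

definition "l = 8 * 2 ^ kt * (kN + g * k1)"
definition "kl = kt + 3 + (kN + g * k1)"
definition "Kb = (w + 1) * (d * d) + (1 + (Bd + kN))"
definition "P0 = \<beta> + 3 + d * n"
definition "P1 = P0 + 2 * (l * 2 ^ kt)"
definition "P2 = P1 + 2 ^ kB"
definition "P3 = P2 + l * 2 ^ kM"

definition par_vals :: "nat list" where
  "par_vals = [
n, w, d * w + 3, k1, k2, kt, 2 ^ kt, kN, 2 ^ kN, kB, kM, 2 ^ kM, l, l * 2 ^ kM, l * 2 ^ kt, 2 * (l * 2 ^ kt), Bd, Bd + kN, Kb, d * d, (k2 + 1) * (d * d), 2 ^ ((k2 + 1) * (d * d)), P0, P1, P2, P3, kl, kl + kB + kM, kl + kM, 2 ^ kB, kN + 1, w + 1, P3 + 2 ^ kN, P3 + 2 ^ kN + 2 ^ kN, P3 + l * 2 ^ kM]"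

definition pv :: "nat \<Rightarrow> nat" where
  "pv j = (if j < 35 then par_vals ! j else 0)"

text \<open>A generous sum of all exponents that occur, linear in w and log n for fixed d, g and
  \<open>\<beta>\<close>.\<close>

definition word_bound :: nat where
  "word_bound = Kb + kl + kB + kM + kN + 5 * k1 + (k2 + 1) * (d * d) + \<beta> + 2 * d + g + 20"

lemma k1_facts: "4 * n \<le> 2 ^ k1" "2 ^ k1 < 8 * n" "k1 \<le> d * w + 2" "2 \<le> k1"
proof -
  have "(2 :: nat) ^ (d * w + 2) = 4 * 2 ^ (d * w)" by (simp add: power_add)
  then have "\<not> 2 ^ (d * w + 2) < 4 * n" using n(2) by linarith
  note lg = lgc[of "d * w + 2" "d * w + 3" "\<lambda>a. 2 ^ a < 4 * n", OF _ this, folded k1_def]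
  show le: "4 * n \<le> 2 ^ k1" "k1 \<le> d * w + 2" using lg(1,3) by linarith+
  show two: "2 \<le> k1"
  proof (rule ccontr)
    assume "\<not> 2 \<le> k1"
    then have "(2 :: nat) ^ k1 \<le> 2 ^ 1" by (intro power_increasing) simp_all
    then show False using le n(1) by simp
  qed
  then have "2 ^ (k1 - 1) < 4 * n" using lg(2)[of "k1 - 1"] by linarith
  moreover have "(2 :: nat) ^ k1 = 2 * 2 ^ (k1 - 1)" using two by (simp add: power_eq_if)
  ultimately show "2 ^ k1 < 8 * n" by simp
qed

lemma k2_facts: "w + 1 \<le> 2 ^ k2" "2 ^ k2 \<le> 2 * (w + 1)" "k2 \<le> w"
proof -
  have not_lt: "\<not> (2 :: nat) ^ w < w + 1" using less_exp[of w] by linarith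
  have "1 * w \<le> d * w" using d by (intro mult_le_mono1)
  then have le: "w \<le> d * w + 3" by linarith
  note lg = lgc[of w "d * w + 3" "\<lambda>a. 2 ^ a < w + 1", OF le not_lt, folded k2_def]
  show "w + 1 \<le> 2 ^ k2" "k2 \<le> w" using lg(1,3) by linarith+
  show "2 ^ k2 \<le> 2 * (w + 1)"
  proof (cases k2)
    case (Suc a)
    then show ?thesis using lg(2)[of a] by simp
  qed simp
qed

lemma kt_facts: "2 ^ (4 * kt) \<le> u" "u < 2 ^ (4 * (kt + 1))" "4 * kt \<le> k1"
proof -
  have nk: "n < 2 ^ k1" using k1_facts(1) n(1) by linarith
  have "(2 :: nat) ^ k1 \<le> 2 ^ (4 * (k1 + 1))" by (intro power_increasing) simp_all
  then have "\<not> 2 ^ (4 * (k1 + 1)) \<le> u" using nk u(2) by linarith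
  note lg = lgc[of k1 k1 "\<lambda>a. 2 ^ (4 * (a + 1)) \<le> u", OF order_refl this, folded kt_def]
  show "u < 2 ^ (4 * (kt + 1))" using lg(1) by linarith
  show le: "2 ^ (4 * kt) \<le> u"
  proof (cases kt)
    case (Suc a)
    then show ?thesis using lg(2)[of a] by simp
  qed (use u in simp)
  have "(2 :: nat) ^ (4 * kt) < 2 ^ k1" using le u(2) nk by linarith
  then show "4 * kt \<le> k1" by (simp add: less_imp_le)
qed

text \<open>The truncated differences in \<open>kB\<close> and \<open>kM\<close> are exact: for t =
  1 the bound \<open>2 \<le> k1\<close> is enough, otherwise 2 + 2 * kt \<le> 4 * kt \<le>
  k1.\<close>

lemma kN_facts: "k1 \<le> kN" "kN = kB + kt" "kN = kM + 2 + 2 * kt" "2 + 2 * kt \<le> kN"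
proof -
  have "1 * k1 \<le> d * k1" using d by (intro mult_le_mono1)
  then show k1: "k1 \<le> kN" unfolding kN_def by linarith
  have "2 + 2 * kt \<le> k1"
    using kt_facts(3) k1_facts(4) by (cases "kt = 0") linarith+
  then show "kN = kB + kt" "kN = kM + 2 + 2 * kt" "2 + 2 * kt \<le> kN"
    using k1 by (simp_all add: kB_def kM_def)
qed

lemma l_facts: "l \<le> 2 ^ kl" "0 < l"
proof -
  have "kN + g * k1 \<le> 2 ^ (kN + g * k1)" by (rule less_imp_le, rule less_exp)
  then have "8 * 2 ^ kt * (kN + g * k1) \<le> 8 * 2 ^ kt * 2 ^ (kN + g * k1)" by (rule mult_le_mono2)
  then show "l \<le> 2 ^ kl" by (simp add: l_def kl_def power_add)
  show "0 < l" using kN_facts(4) by (simp add: l_def)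
qed

lemma pv_simps:
  "pv 0 = n"
  "pv 1 = w"
  "pv 2 = d * w + 3"
  "pv 3 = k1"
  "pv 4 = k2"
  "pv 5 = kt"
  "pv 6 = 2 ^ kt"
  "pv 7 = kN"
  "pv 8 = 2 ^ kN"
  "pv 9 = kB"
  "pv 10 = kM"
  "pv 11 = 2 ^ kM"
  "pv 12 = l"
  "pv 13 = l * 2 ^ kM"
  "pv 14 = l * 2 ^ kt"
  "pv 15 = 2 * (l * 2 ^ kt)"
  "pv 16 = Bd"
  "pv 17 = Bd + kN"
  "pv 18 = Kb"
  "pv 19 = d * d"
  "pv 20 = (k2 + 1) * (d * d)"
  "pv 21 = 2 ^ ((k2 + 1) * (d * d))"
  "pv 22 = P0"
  "pv 23 = P1"
  "pv 24 = P2"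
  "pv 25 = P3"
  "pv 26 = kl"
  "pv 27 = kl + kB + kM"
  "pv 28 = kl + kM"
  "pv 29 = 2 ^ kB"
  "pv 30 = kN + 1"
  "pv 31 = w + 1"
  "pv 32 = P3 + 2 ^ kN"
  "pv 33 = P3 + 2 ^ kN + 2 ^ kN"
  "pv 34 = P3 + l * 2 ^ kM"
  by (simp_all add: pv_def par_vals_def)

end

locale sized_machine = sizes +
  fixes W :: nat and m :: "nat \<Rightarrow> nat"
  assumes W: "word_bound \<le> W"
    and header: "m \<beta> = n" "m (\<beta> + 1) = w" "m (\<beta> + 2) = u"
begin

lemma lt_pow: "x < W \<Longrightarrow> x < 2 ^ W"
  by (rule less_trans[OF _ less_exp])

lemma pow_lt: "x < W \<Longrightarrow> (2 :: nat) ^ x < 2 ^ W"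
  by simp

lemma exponents: "Kb + 20 \<le> W" "kl + kB + kM + 20 \<le> W" "kl + kM + 20 \<le> W" "(k2 + 1) * (d * d) + 20 \<le> W"
    "\<beta> + 20 \<le> W" "4 * k1 + 20 \<le> W" "g + 20 \<le> W" "2 * d + 20 \<le> W" "0 < W"
    "kl + kt + kN + \<beta> + d + k1 + kM + 20 \<le> W" "2 * kN + 20 \<le> W"
proof -
  have "kt \<le> k1" using kt_facts(3) by simp
  moreover have "kN \<le> Kb" by (simp add: Kb_def)
  ultimately show "Kb + 20 \<le> W" "kl + kB + kM + 20 \<le> W" "kl + kM + 20 \<le> W" "(k2 + 1) * (d * d) + 20 \<le> W"
    "\<beta> + 20 \<le> W" "4 * k1 + 20 \<le> W" "g + 20 \<le> W" "2 * d + 20 \<le> W" "0 < W"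
    "kl + kt + kN + \<beta> + d + k1 + kM + 20 \<le> W" "2 * kN + 20 \<le> W"
    using W unfolding word_bound_def by linarith+
qed

lemma address: "P3 + 2 ^ kN + 2 ^ kN + 1 < 2 ^ W" "P3 + l * 2 ^ kM + 1 < 2 ^ W"
proof -
  \<comment> \<open>Each summand of the addresses is at most \<open>2 ^ E\<close>, and there are
    fewer than 16 of them.\<close>
  define E where "E = kl + kt + kN + \<beta> + d + k1 + kM + 5"
  have "\<beta> + 3 < 2 ^ (\<beta> + 3)" by (rule less_exp)
  moreover have "(2 :: nat) ^ (\<beta> + 3) \<le> 2 ^ E" by (intro power_increasing) (simp_all add: E_def)
  moreover have "d * n \<le> 2 ^ d * 2 ^ k1"
    using less_exp[of d] k1_facts(1) n(1) by (intro mult_le_mono) linarith+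
  moreover have "(2 :: nat) ^ d * 2 ^ k1 \<le> 2 ^ E"
    unfolding power_add[symmetric] by (intro power_increasing) (simp_all add: E_def)
  moreover have "2 * (l * 2 ^ kt) \<le> 2 * (2 ^ kl * 2 ^ kt)"
    using l_facts(1) by (intro mult_le_mono2 mult_le_mono1)
  moreover have "2 * ((2 :: nat) ^ kl * 2 ^ kt) = 2 ^ (kl + kt + 1)" by (simp add: power_add)
  moreover have "(2 :: nat) ^ (kl + kt + 1) \<le> 2 ^ E" by (intro power_increasing) (simp_all add: E_def)
  moreover have "(2 :: nat) ^ kB \<le> 2 ^ E" using kN_facts(2) by (intro power_increasing) (simp_all add: E_def)
  moreover have "l * 2 ^ kM \<le> 2 ^ kl * 2 ^ kM" using l_facts(1) by (intro mult_le_mono1)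
  moreover have "(2 :: nat) ^ kl * 2 ^ kM \<le> 2 ^ E"
    unfolding power_add[symmetric] by (intro power_increasing) (simp_all add: E_def)
  moreover have "(2 :: nat) ^ kN \<le> 2 ^ E" by (intro power_increasing) (simp_all add: E_def)
  moreover have "1 \<le> (2 :: nat) ^ E" by simp
  moreover have "16 * (2 :: nat) ^ E = 2 ^ (E + 4)" by (simp add: power_add)
  moreover have "(2 :: nat) ^ (E + 4) \<le> 2 ^ W"
    using exponents(10) by (intro power_increasing) (simp_all add: E_def)
  ultimately show "P3 + 2 ^ kN + 2 ^ kN + 1 < 2 ^ W" "P3 + l * 2 ^ kM + 1 < 2 ^ W"
    unfolding P3_def P2_def P1_def P0_def by linarith+
qed

lemma bounds: "d < 2 ^ W" "d * d < 2 ^ W" "2 * (d * d) + 1 < 2 ^ W" "w + 1 < W" "g < 2 ^ W"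
    "6 * d < 2 ^ W" "Bd < W" "Kb < W" "d * w + 3 < W" "kl < W" "g * k1 < W" "kN < W"
proof -
  have "1 * w \<le> d * w" using d by (intro mult_le_mono1)
  moreover have "Bd \<le> Kb" by (simp add: Kb_def)
  moreover have "d * w \<le> Bd" "d * d \<le> Bd" "6 * (d * d) + 2 \<le> Bd" "3 * d + 2 \<le> Bd" by (simp_all add: Bd_def)
  moreover have "1 * d \<le> d * d" using d by (intro mult_le_mono1)
  moreover have "g * k1 \<le> kl" by (simp add: kl_def)
  ultimately show "w + 1 < W" "Bd < W" "Kb < W" "d * w + 3 < W" "kl < W" "g * k1 < W" "kN < W"
    "d < 2 ^ W" "d * d < 2 ^ W" "2 * (d * d) + 1 < 2 ^ W" "g < 2 ^ W" "6 * d < 2 ^ W"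
    using exponents lt_pow[of d] lt_pow[of "d * d"] lt_pow[of g] lt_pow[of "6 * d"]
      lt_pow[of "2 * (d * d) + 1"] by linarith+
qed

lemma nums: "(c :: nat) < 20 \<Longrightarrow> c < 2 ^ W"
  using exponents(5) lt_pow[of c] by linarith

lemma eval_lgc:
  assumes "p k = c" "c + 1 < 2 ^ W"
    and "\<And>a i. a < c \<Longrightarrow> eval W p m' e (v(0 := a, 1 := i)) = of_bool (P a)"
  shows "eval W p m' (Iter k 0 1 (Num 0) (Cond e (eAdd (Var 0) (Num 1)) (Var 0))) v = lgc c P"
  unfolding lgc_def
proof (rule eval_iter)
  let ?F = "\<lambda>_ a. if P a then a + 1 else a"
  fix i assume i: "i < c"
  have "itr i ?F 0 \<le> i" by (induction i) auto
  then have lt: "itr i ?F 0 < c" using i by simp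
  have one: "eval W p m' (Num 1) v' = 1" for v' by (intro eval_num nums) simp
  have add: "eval W p m' (eAdd (Var 0) (Num 1)) (v(0 := itr i ?F 0, 1 := i)) = itr i ?F 0 + 1"
    by (intro eval_add one) (use lt assms(2) in simp_all)
  show "eval W p m' (Cond e (eAdd (Var 0) (Num 1)) (Var 0)) (v(0 := itr i ?F 0, 1 := i)) = ?F i (itr i ?F 0)"
    unfolding eval.simps(7) add using assms(3)[OF lt, of i] lt assms(2) by simp
qed (use assms in simp_all)

lemma address_chain:
  "P0 < 2 ^ W" "P1 < 2 ^ W" "P2 < 2 ^ W" "P3 < 2 ^ W" "P3 + 2 ^ kN < 2 ^ W" "P3 + 2 ^ kN + 2 ^ kN < 2 ^ W"
  "P3 + l * 2 ^ kM < 2 ^ W" "l * 2 ^ kM < 2 ^ W" "l * 2 ^ kt < 2 ^ W" "2 * (l * 2 ^ kt) < 2 ^ W"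
  "\<beta> + 3 < 2 ^ W" "d * n < 2 ^ W" "l < 2 ^ W" "n < 2 ^ W"
proof -
  have c: "P0 \<le> P1" "P1 \<le> P2" "P2 \<le> P3" "\<beta> + 3 \<le> P0" "d * n \<le> P0" "2 * (l * 2 ^ kt) \<le> P1" "l * 2 ^ kM \<le> P3"
    by (simp_all add: P3_def P2_def P1_def P0_def)
  have "l * 1 \<le> l * 2 ^ kt" by (intro mult_le_mono2) simp
  moreover have "1 * n \<le> d * n" using d by (intro mult_le_mono1)
  ultimately show "P0 < 2 ^ W" "P1 < 2 ^ W" "P2 < 2 ^ W" "P3 < 2 ^ W" "P3 + 2 ^ kN < 2 ^ W"
    "P3 + 2 ^ kN + 2 ^ kN < 2 ^ W"
    "P3 + l * 2 ^ kM < 2 ^ W" "l * 2 ^ kM < 2 ^ W" "l * 2 ^ kt < 2 ^ W" "2 * (l * 2 ^ kt) < 2 ^ W"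
    "\<beta> + 3 < 2 ^ W" "d * n < 2 ^ W" "l < 2 ^ W" "n < 2 ^ W"
    using address c by linarith+
qed

text \<open>These bounds on the intermediate values of \<open>par_exps\<close> ensure that no
  operation there wraps around.\<close>

lemma sides:
  "d * w < 2 ^ W" "d * w + 3 < 2 ^ W" "4 * n < 2 ^ W" "w + 1 < 2 ^ W" "d * k1 < 2 ^ W" "d * d * k2 < 2 ^ W"
  "d * k1 + d * d * k2 < 2 ^ W" "kN < 2 ^ W" "2 * kt < 2 ^ W" "8 * (2 :: nat) ^ kt < 2 ^ W" "g * k1 < 2 ^ W"
  "kN + g * k1 < 2 ^ W" "8 * 2 ^ kt * (kN + g * k1) < 2 ^ W" "6 * d * w < 2 ^ W" "6 * (d * d) + 3 * d + 2 < 2 ^ W"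
  "6 * d * w + (6 * (d * d) + 3 * d + 2) < 2 ^ W" "Bd + kN < 2 ^ W" "1 + (Bd + kN) < 2 ^ W" "(w + 1) * (d * d) < 2 ^ W"
  "(w + 1) * (d * d) + (1 + (Bd + kN)) < 2 ^ W" "k2 + 1 < 2 ^ W" "(k2 + 1) * (d * d) < 2 ^ W"
  "kt + 3 < 2 ^ W" "kt + 3 + (kN + g * k1) < 2 ^ W" "kl + kB < 2 ^ W" "kl + kB + kM < 2 ^ W" "kl + kM < 2 ^ W"
  "kN + 1 < 2 ^ W" "P0 + 2 * (l * 2 ^ kt) < 2 ^ W" "P1 + 2 ^ kB < 2 ^ W" "P2 + l * 2 ^ kM < 2 ^ W"
  "(2 :: nat) ^ kt < 2 ^ W" "(2 :: nat) ^ kN < 2 ^ W" "(2 :: nat) ^ kB < 2 ^ W" "(2 :: nat) ^ kM < 2 ^ W"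
  "(2 :: nat) ^ ((k2 + 1) * (d * d)) < 2 ^ W" "k1 < 2 ^ W" "kt < 2 ^ W" "\<beta> + 3 + d * n < 2 ^ W"
  "k2 < 2 ^ W" "kB < 2 ^ W" "kM < 2 ^ W" "kl < 2 ^ W" "Bd < 2 ^ W" "Kb < 2 ^ W" "u < 2 ^ W" "w < 2 ^ W"
proof -
  have "1 * 1 \<le> d * d" using d by (intro mult_le_mono)
  then have "1 * (k2 + 1) \<le> d * d * (k2 + 1)" by (intro mult_le_mono1) simp
  then have k2: "k2 + 1 \<le> (k2 + 1) * (d * d)" unfolding mult_1 by (simp only: mult.commute)
  have lk: "8 * 2 ^ kt * 1 \<le> 8 * 2 ^ kt * (kN + g * k1)" using kN_facts(4) by (intro mult_le_mono2) linarith
  have lW: "8 * 2 ^ kt * (kN + g * k1) < 2 ^ W" using address_chain(13) by (simp only: l_def)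
  have "n * 4 \<le> 2 ^ k1" using k1_facts(1) by simp
  moreover have "(2 :: nat) ^ k1 < 2 ^ W" using exponents(6) by (intro pow_lt) linarith
  ultimately show "4 * n < 2 ^ W" by linarith
  show "8 * (2 :: nat) ^ kt < 2 ^ W" "8 * 2 ^ kt * (kN + g * k1) < 2 ^ W" using lk lW by linarith+
  note e = exponents bounds kl_def[symmetric] kN_facts
  have kl: "kt + 3 + (kN + g * k1) = kl" by (simp only: kl_def)
  have Bd: "6 * d * w + (6 * (d * d) + 3 * d + 2) = Bd" by (simp only: Bd_def)
  have Kb: "(w + 1) * (d * d) + (1 + (Bd + kN)) = Kb" by (simp only: Kb_def)
  have kN: "d * k1 + d * d * k2 = kN" by (simp only: kN_def)
  show "d * w < 2 ^ W" "d * w + 3 < 2 ^ W" "w + 1 < 2 ^ W" "d * k1 < 2 ^ W" "d * d * k2 < 2 ^ W"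
    "d * k1 + d * d * k2 < 2 ^ W" "kN < 2 ^ W" "2 * kt < 2 ^ W" "g * k1 < 2 ^ W"
    "kN + g * k1 < 2 ^ W" "6 * d * w < 2 ^ W" "6 * (d * d) + 3 * d + 2 < 2 ^ W"
    "6 * d * w + (6 * (d * d) + 3 * d + 2) < 2 ^ W" "Bd + kN < 2 ^ W" "1 + (Bd + kN) < 2 ^ W" "(w + 1) * (d * d) < 2 ^ W"
    "(w + 1) * (d * d) + (1 + (Bd + kN)) < 2 ^ W" "k2 + 1 < 2 ^ W" "(k2 + 1) * (d * d) < 2 ^ W"
    "kt + 3 < 2 ^ W" "kt + 3 + (kN + g * k1) < 2 ^ W" "kl + kB < 2 ^ W" "kl + kB + kM < 2 ^ W" "kl + kM < 2 ^ W"
    "kN + 1 < 2 ^ W" "k1 < 2 ^ W" "kt < 2 ^ W" "k2 < 2 ^ W" "kB < 2 ^ W" "kM < 2 ^ W" "kl < 2 ^ W" "Bd < 2 ^ W"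
    "Kb < 2 ^ W" "w < 2 ^ W"
    by (rule lt_pow, use e k2 kl Bd Kb kN in linarith)+
  show "(2 :: nat) ^ kt < 2 ^ W" "(2 :: nat) ^ kN < 2 ^ W" "(2 :: nat) ^ kB < 2 ^ W" "(2 :: nat) ^ kM < 2 ^ W"
    "(2 :: nat) ^ ((k2 + 1) * (d * d)) < 2 ^ W"
    by (rule pow_lt, use e k2 kl Bd Kb kN in linarith)+
  show "P0 + 2 * (l * 2 ^ kt) < 2 ^ W" "P1 + 2 ^ kB < 2 ^ W" "P2 + l * 2 ^ kM < 2 ^ W" "\<beta> + 3 + d * n < 2 ^ W"
    using address_chain by (simp_all only: P0_def[symmetric] P1_def[symmetric] P2_def[symmetric] P3_def[symmetric])
  show "u < 2 ^ W" using u(2) address_chain(14) by linarith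
qed

lemma eval_header:
  "eval W p m (Read (Num \<beta>)) v = n" "eval W p m (Read (Num (\<beta> + 1))) v = w"
  "eval W p m (Read (Num (\<beta> + 2))) v = u"
proof -
  have "\<beta> < 2 ^ W" "\<beta> + 1 < 2 ^ W" "\<beta> + 2 < 2 ^ W" using address_chain(11) by linarith+
  then show "eval W p m (Read (Num \<beta>)) v = n" "eval W p m (Read (Num (\<beta> + 1))) v = w"
    "eval W p m (Read (Num (\<beta> + 2))) v = u"
    using header by simp_all
qed

lemma list_all_Nil: "list_all P [] \<longleftrightarrow> True"
  by simp

lemma eval_below: "j < i \<Longrightarrow> pv j = x \<Longrightarrow> eval W (below i pv) m' (Par j) v = x"
  by (simp add: below_def)

lemma below_less: "j < i \<Longrightarrow> pv j = x \<Longrightarrow> below i pv j = x"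
  by (simp add: below_def)

lemma pv_lt: "pv j < 2 ^ W"
proof -
  have eq: "[0..<35] = [0,1,2,3,4,5,6,7,8,9,10,11,12,13,14,15,16,17,18,19,20,21,22,23,24,25,26,27,28,29,30,31,32,33,34]"
    by (simp add: upt_rec)
  have "list_all (\<lambda>j. pv j < 2 ^ W) [0..<35]"
    unfolding eq list.pred_inject(2) list_all_Nil simp_thms pv_simps using sides address_chain bounds by (intro conjI) assumption+
  then show ?thesis
    by (cases "j < 35") (simp_all add: list_all_iff pv_def)
qed

lemma params: "params W (par_exps d g \<beta>) m pv"
proof -
  have ktW: "4 * (a + 1) < W" "4 * (a + 1) < 2 ^ W" if "a < k1" for a
  proof -
    have "4 * (a + 1) \<le> 4 * k1" using that by (intro mult_le_mono2) simp
    then show "4 * (a + 1) < W" using exponents(6) by linarith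
    then show "4 * (a + 1) < 2 ^ W" by (rule lt_pow)
  qed
  have "x + 20 \<le> W \<Longrightarrow> x < W" for x by simp
  note kDW = this[OF exponents(4)]
  have k1_lt: "4 * k1 + 4 < 2 ^ W" using exponents(6) lt_pow[of "4 * k1 + 4"] by linarith
  \<comment> \<open>The list is checked entry by entry; \<open>below\<close> hides all parameters
    that are not computed yet.\<close>
  define ok where "ok i es \<longleftrightarrow> (\<forall>j < length es. eval W (below (i + j) pv) m (es ! j) (\<lambda>_. 0) = pv (i + j))" for i es
  have ok_Nil: "ok i []" for i by (simp add: ok_def)
  have ok_Cons: "ok i (e # es)" if "eval W (below i pv) m e (\<lambda>_. 0) = pv i" "ok (i + 1) es" for i e es
    using that unfolding ok_def by (auto simp: less_Suc_eq_0_disj simp del: eval.simps)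
  note index = add_0 one_add_one numeral_plus_one add_num_simps
  note pv_unfold = pv_simps(1-3) pv_simps(4)[unfolded k1_def] pv_simps(5)[unfolded k2_def] pv_simps(6)[unfolded kt_def]
    pv_simps(7) pv_simps(8)[unfolded kN_def] pv_simps(9) pv_simps(10)[unfolded kB_def] pv_simps(11)[unfolded kM_def]
    pv_simps(12) pv_simps(13)[unfolded l_def] pv_simps(14-16) pv_simps(17)[unfolded Bd_def] pv_simps(18)
    pv_simps(19)[unfolded Kb_def] pv_simps(20-22) pv_simps(23)[unfolded P0_def] pv_simps(24)[unfolded P1_def]
    pv_simps(25)[unfolded P2_def] pv_simps(26)[unfolded P3_def] pv_simps(27)[unfolded kl_def] pv_simps(28-)
  have "ok 0 (par_exps d g \<beta>)"
    unfolding par_exps_def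
    by (intro ok_Cons ok_Nil; (unfold index pv_unfold)?;
        (intro eval_lgc below_less pv_simps eval_less eval_nless eval_header eval_add eval_mul eval_minus
          eval_pow2E eval_below eval_var eval_num)?;
        (rule kDW | (rule ktW, assumption) | (simp; fail)
          | (use sides address_chain bounds kN_facts exponents kt_facts k1_lt
              nums[of 1] nums[of 2] nums[of 3] nums[of 4] nums[of 8] in linarith)))
  moreover have "below 35 pv = pv" by (rule ext) (simp add: below_def pv_def)
  moreover have "length (par_exps d g \<beta>) = 35" by (simp add: par_exps_def)
  ultimately show ?thesis
    using pv_lt unfolding params_def ok_def by simp
qed

end

section \<open>The construction program\<close>

text \<open>The expressions are evaluated in intermediate memories, which differ from the initial
  one only inside the target range.\<close>

lemma fill:
  assumes "p k = n"
    and "\<And>j m'. j < n \<Longrightarrow> (\<forall>x. x \<notin> {a..<a + n} \<longrightarrow> m' x = m x) \<Longrightarrow>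
      eval W p m' A (v(i := j)) = a + j \<and> eval W p m' E (v(i := j)) = f j"
  shows "sem W p (For k i (Write A E)) v m = (\<lambda>x. if a \<le> x \<and> x < a + n then f (x - a) else m x)"
proof -
  define body where "body = (\<lambda>j. sem W p (Write A E) (v(i := j)))"
  have "itr j body m = (\<lambda>x. if a \<le> x \<and> x < a + j then f (x - a) else m x)" if "j \<le> n" for j
    using that
  proof (induction j)
    case (Suc j)
    then have IH: "itr j body m = (\<lambda>x. if a \<le> x \<and> x < a + j then f (x - a) else m x)" by simp
    have "\<forall>x. x \<notin> {a..<a + n} \<longrightarrow> itr j body m x = m x" unfolding IH using Suc(2) by auto
    then have "body j (itr j body m) = (itr j body m)(a + j := f j)"
      using assms(2)[of j "itr j body m"] Suc(2) by (simp add: body_def)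
    then show ?case unfolding itr.simps IH by (auto simp: fun_eq_iff less_Suc_eq)
  qed (simp add: fun_eq_iff)
  from this[of n] show ?thesis by (simp add: body_def assms(1))
qed

text \<open>The full sorted array of N keys lives only in scratch memory from address
  \<open>P3\<close> on; the cells below \<open>P3\<close> become the data structure. After the
  samples have been copied out, the second sort reuses the same scratch area.\<close>

definition build_com :: "exp \<Rightarrow> com" where
  "build_com Ky = Seq (For 8 90 (Write (eAdd (Par 25) (Var 90)) (keyE Ky (Var 90))))
    (Seq (sort_com 18 8 25 32 33)
    (Seq (For 29 90 (Write (eAdd (Par 23) (Var 90)) (Read (eAdd (Par 25) (eMul (Var 90) (Par 6))))))
    (Seq (For 13 90 (Write (eAdd (Par 24) (Var 90))
       (Bind 91 (eDiv (Var 90) (Par 11)) (Bind 92 (eMod (Var 90) (Par 11))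
         (eAdd (eMul (eAdd (eMul (Var 91) (Par 29)) (walkE Ky (Var 91) (Num 0) (Par 6) (Var 92))) (Par 11)) (Var 92))))))
     (sort_com 27 13 24 25 34))))"

text \<open>The key program reads only the input below \<open>P0\<close>, which the construction
  leaves unchanged; so it works in all intermediate memories.\<close>

locale build_code = index +
  fixes p m :: "nat \<Rightarrow> nat" and Ky :: exp and P0 P1 P2 P3 bits :: nat
  assumes par: "p 6 = 2 ^ kt" "p 7 = kN" "p 8 = 2 ^ kN" "p 9 = kB" "p 11 = 2 ^ kM" "p 13 = l * 2 ^ kM"
      "p 18 = Kb" "p 22 = P0" "p 23 = P1" "p 24 = P2" "p 25 = P3" "p 27 = bits" "p 29 = 2 ^ kB"
      "p 32 = P3 + 2 ^ kN" "p 33 = P3 + 2 ^ kN + 2 ^ kN" "p 34 = P3 + l * 2 ^ kM"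
    and P1: "P1 = P0 + 2 * (l * 2 ^ kt)" and P2: "P2 = P1 + 2 ^ kB" and P3: "P3 = P2 + l * 2 ^ kM"
    and space: "P3 + 2 ^ kN + 2 ^ kN + 1 < 2 ^ W" "P3 + l * 2 ^ kM + 1 < 2 ^ W"
    and W: "2 * kN + 2 < W"
    and bits: "l * 2 ^ kB * 2 ^ kM \<le> 2 ^ bits" "bits < W"
    and Ky: "(\<forall>x < P0. m' x = m x) \<Longrightarrow> v 0 < 2 ^ kN \<Longrightarrow> eval W p m' Ky v = key (v 0)"
    and seeds: "q < 2 * (l * 2 ^ kt) \<Longrightarrow> m (P0 + q) = rs ! q"
begin

lemma build_com:
  "(\<forall>x < P1. sem W p (build_com Ky) v m x = m x) \<and>
   (\<forall>c < 2 ^ kB. sem W p (build_com Ky) v m (P1 + c) = A ! (c * 2 ^ kt)) \<and>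
   (\<forall>q < l * 2 ^ kM. sem W p (build_com Ky) v m (P2 + q) = T ! q)"
proof -
  have W1: "1 < W" using W by simp
  define m1 where "m1 = (\<lambda>x. if P3 \<le> x \<and> x < P3 + 2 ^ kN then key (x - P3) else m x)"
  have m1: "sem W p (For 8 90 (Write (eAdd (Par 25) (Var 90)) (keyE Ky (Var 90)))) v m = m1"
    unfolding m1_def
  proof (rule fill)
    fix j :: nat and m' assume j: "j < 2 ^ kN" and m': "\<forall>x. x \<notin> {P3..<P3 + 2 ^ kN} \<longrightarrow> m' x = m x"
    have "\<forall>x < P0. m' x = m x" using m' P1 P2 P3 by simp
    from Ky[OF this] j have "eval W p m' (keyE Ky (Var 90)) (v(90 := j)) = key j"
      by (simp add: keyE_def)
    moreover have "P3 + j < 2 ^ W" using j space(1) by linarith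
    ultimately show "eval W p m' (eAdd (Par 25) (Var 90)) (v(90 := j)) = P3 + j \<and>
      eval W p m' (keyE Ky (Var 90)) (v(90 := j)) = key j"
      by (simp add: par)
  qed (simp add: par)
  define m2 where "m2 = sem W p (sort_com 18 8 25 32 33) v m1"
  interpret S: sorting W p 8 25 32 33 "2 ^ kN" P3 "P3 + 2 ^ kN" "P3 + 2 ^ kN + 2 ^ kN"
    by unfold_locales (use par space in simp_all)
  have arr1: "arr m1 P3 (2 ^ kN) = map key [0..<2 ^ kN]"
    by (intro nth_equalityI) (simp_all add: m1_def)
  have "radix Kb (map key [0..<2 ^ kN]) = A"
    unfolding A_def by (rule radix_sort) (use key_less in auto)
  then have arr2: "arr m2 P3 (2 ^ kN) = A" and low2: "x < P3 \<Longrightarrow> m2 x = m x" for x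
    using S.sort_com[OF W1, of 18 v m1] unfolding m2_def[symmetric] arr1 par by (simp_all add: m1_def)
  define m3 where "m3 = (\<lambda>x. if P1 \<le> x \<and> x < P1 + 2 ^ kB then A ! ((x - P1) * 2 ^ kt) else m2 x)"
  have m3: "sem W p (For 29 90 (Write (eAdd (Par 23) (Var 90)) (Read (eAdd (Par 25) (eMul (Var 90) (Par 6)))))) v m2 = m3"
    unfolding m3_def
  proof (rule fill)
    fix j :: nat and m' assume j: "j < 2 ^ kB" and m': "\<forall>x. x \<notin> {P1..<P1 + 2 ^ kB} \<longrightarrow> m' x = m2 x"
    have jt: "j * 2 ^ kt < 2 ^ kN" using j by (simp add: kN(1) power_add)
    then have "m' (P3 + j * 2 ^ kt) = A ! (j * 2 ^ kt)"
      using m' nth_arr[of "j * 2 ^ kt" "2 ^ kN" m2 P3] P2 P3 unfolding arr2 by simp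
    moreover have "P1 + j < 2 ^ W" "P3 + j * 2 ^ kt < 2 ^ W" "j * 2 ^ kt < 2 ^ W" using j jt space P2 P3 by linarith+
    ultimately show "eval W p m' (eAdd (Par 23) (Var 90)) (v(90 := j)) = P1 + j \<and>
      eval W p m' (Read (eAdd (Par 25) (eMul (Var 90) (Par 6)))) (v(90 := j)) = A ! (j * 2 ^ kt)"
      by (simp add: par)
  qed (simp add: par)
  have low3: "x < P1 \<Longrightarrow> m3 x = m x" for x using low2[of x] P2 P3 by (simp add: m3_def)
  define f where "f = (\<lambda>q. word (q div 2 ^ kM) (walk (q div 2 ^ kM) 0 (2 ^ kt) (q mod 2 ^ kM)) (q mod 2 ^ kM))"
  define m4 where "m4 = (\<lambda>x. if P2 \<le> x \<and> x < P2 + l * 2 ^ kM then f (x - P2) else m3 x)"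
  let ?E = "Bind 91 (eDiv (Var 90) (Par 11)) (Bind 92 (eMod (Var 90) (Par 11))
         (eAdd (eMul (eAdd (eMul (Var 91) (Par 29)) (walkE Ky (Var 91) (Num 0) (Par 6) (Var 92))) (Par 11)) (Var 92)))"
  have fT: "T = sort (map f [0..<l * 2 ^ kM])" by (simp add: T_def f_def)
  have m4: "sem W p (For 13 90 (Write (eAdd (Par 24) (Var 90)) ?E)) v m3 = m4"
    unfolding m4_def
  proof (rule fill)
    fix j :: nat and m' assume j: "j < l * 2 ^ kM" and m': "\<forall>x. x \<notin> {P2..<P2 + l * 2 ^ kM} \<longrightarrow> m' x = m3 x"
    \<comment> \<open>Seeds and samples are in place now, which is all that walking along chains
      demands.\<close>
    interpret I: index_code kN kt kB kM Kb l key W rs p m' Ky P0 P1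
    proof unfold_locales
      show "eval W p m' Ky v = key (v 0)" if "v 0 < 2 ^ kN" for v
        by (rule Ky[of m' v, OF _ that]) (use m' low3 P1 P2 in simp)
      show "m' (P0 + q) = rs ! q" if "q < 2 * (l * 2 ^ kt)" for q
        using seeds[OF that] m' low3[of "P0 + q"] that P1 P2 by simp
      show "m' (P1 + c) = A ! (c * 2 ^ kt)" if "c < 2 ^ kB" for c
        using m' that P2 by (simp add: m3_def)
      show "P1 + 2 ^ kB < 2 ^ W" using space P2 P3 by linarith
    qed (use par P1 W in simp_all)
    let ?s = "j div 2 ^ kM" and ?c = "j mod 2 ^ kM"
    let ?v = "v(90 := j, 91 := ?s, 92 := ?c)"
    have s: "?s < l" using j by (rule less_mult_imp_div_less)
    have c: "?c < 2 ^ kM" by simp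
    have W0: "0 < (2 :: nat) ^ W" by simp
    have walk: "eval W p m' (walkE Ky (Var 91) (Num 0) (Par 6) (Var 92)) ?v = walk ?s 0 (2 ^ kt) ?c"
      by (rule I.eval_walkE) (use s M_le_N c in \<open>simp_all add: par less_le_trans[OF c M_le_N]\<close>)
    have "f j \<in> set T" using j unfolding fT by simp
    then have "f j < l * 2 ^ kB * 2 ^ kM" by (metis T_less in_set_conv_nth length_T)
    also have "\<dots> < 2 ^ W" by (rule le_less_trans[OF bits(1)]) (use bits(2) in simp)
    finally have fW: "(?s * 2 ^ kB + walk ?s 0 (2 ^ kt) ?c) * 2 ^ kM + ?c < 2 ^ W"
      by (simp add: f_def word_def)
    then have 1: "(?s * 2 ^ kB + walk ?s 0 (2 ^ kt) ?c) * 2 ^ kM < 2 ^ W" by linarith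
    have "x \<le> x * 2 ^ kM" for x :: nat by simp
    from le_less_trans[OF this 1] have 2: "?s * 2 ^ kB + walk ?s 0 (2 ^ kt) ?c < 2 ^ W" .
    then have 3: "?s * 2 ^ kB < 2 ^ W" by linarith
    have "eval W p m' (eAdd (eMul (eAdd (eMul (Var 91) (Par 29)) (walkE Ky (Var 91) (Num 0) (Par 6) (Var 92))) (Par 11)) (Var 92)) ?v = f j"
      unfolding f_def word_def
      by (intro eval_add eval_mul eval_var eval_par walk fW 1 2 3 par) simp_all
    note body = this
    have "eval W p m' ?E (v(90 := j)) = f j"
      by (rule eval_bind[OF _ eval_bind[OF _ body]]; intro eval_div eval_mod eval_var eval_par par; simp)
    moreover have "eval W p m' (eAdd (Par 24) (Var 90)) (v(90 := j)) = P2 + j"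
      by (intro eval_add eval_par eval_var par) (use j space P3 in auto)
    ultimately show "eval W p m' (eAdd (Par 24) (Var 90)) (v(90 := j)) = P2 + j \<and> eval W p m' ?E (v(90 := j)) = f j"
      by (rule conjI[rotated])
  qed (simp add: par)
  define m5 where "m5 = sem W p (sort_com 27 13 24 25 34) v m4"
  interpret S2: sorting W p 13 24 25 34 "l * 2 ^ kM" P2 P3 "P3 + l * 2 ^ kM"
    by unfold_locales (use par space P3 in simp_all)
  have arr4: "arr m4 P2 (l * 2 ^ kM) = map f [0..<l * 2 ^ kM]"
    by (intro nth_equalityI) (simp_all add: m4_def)
  have "radix bits (map f [0..<l * 2 ^ kM]) = T"
    unfolding fT
  proof (rule radix_sort, rule ballI)
    fix x assume "x \<in> set (map f [0..<l * 2 ^ kM])"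
    then have "x \<in> set T" unfolding fT by simp
    then obtain q where "q < l * 2 ^ kM" "T ! q = x" unfolding in_set_conv_nth length_T by blast
    then have "x < l * 2 ^ kB * 2 ^ kM" using T_less by blast
    then show "x < 2 ^ bits" using bits(1) by (rule less_le_trans)
  qed
  then have arr5: "arr m5 P2 (l * 2 ^ kM) = T" and low5: "x < P2 \<Longrightarrow> m5 x = m3 x" for x
    using S2.sort_com[OF W1, of 27 v m4] P3 unfolding m5_def[symmetric] arr4 par by (simp_all add: m4_def)
  have "sem W p (build_com Ky) v m = m5"
    unfolding build_com_def sem.simps(2) m1 m2_def[symmetric] m3 m4 m5_def[symmetric] ..
  moreover have "\<forall>x < P1. m5 x = m x" using low5 low3 P2 by simp
  moreover have "\<forall>c < 2 ^ kB. m5 (P1 + c) = A ! (c * 2 ^ kt)" using low5 P2 by (simp add: m3_def)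
  moreover have "\<forall>q < l * 2 ^ kM. m5 (P2 + q) = T ! q" using nth_arr[of _ "l * 2 ^ kM" m5 P2] unfolding arr5 by simp
  ultimately show ?thesis by simp
qed

end

section \<open>Probability that every element is covered\<close>

context index
begin

lemma prob_good:
  assumes "l = 8 * 2 ^ kt * (kN + a)"
  shows "1 - (1 / 2) ^ a \<le> measure_pmf.prob (rwords W (2 * (l * 2 ^ kt)))
    {rs'. \<forall>X < 2 ^ kN. \<exists>s < l. covered (2 ^ kM) (block s rs') X}"
proof -
  let ?bad = "\<lambda>rs' X. \<forall>s < l. \<not> covered (2 ^ kM) (block s rs') X"
  let ?m = "2 * 2 ^ kt * l"
  have t: "1 \<le> real (2 ^ kt)" by simp
  have "(1 - 1 / (8 * real (2 ^ kt))) ^ l \<le> exp (- (1 / (8 * real (2 ^ kt)))) ^ l"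
  proof (rule power_mono)
    have "1 / (8 * real (2 ^ kt)) \<le> 1" unfolding divide_le_eq_1 using t by linarith
    then show "0 \<le> 1 - 1 / (8 * real (2 ^ kt))" by simp
    show "1 - 1 / (8 * real (2 ^ kt)) \<le> exp (- (1 / (8 * real (2 ^ kt))))"
      using exp_ge_add_one_self[of "- (1 / (8 * real (2 ^ kt)))"] by simp
  qed
  also have "\<dots> = exp (- real (kN + a))"
    unfolding exp_of_nat_mult[symmetric] assms by (simp add: field_simps)
  also have "\<dots> = inverse (exp 1 ^ (kN + a))"
    by (simp only: exp_minus exp_of_nat_mult[symmetric] mult_1_right)
  \<comment> \<open>Passing from e to 2 lets the \<open>2 ^ kN\<close> terms of the union bound
    cancel.\<close>
  also have "\<dots> \<le> inverse (2 ^ (kN + a))"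
    using exp_ge_add_one_self[of 1] by (intro le_imp_inverse_le power_mono) simp_all
  finally have small: "(1 - 1 / (8 * real (2 ^ kt))) ^ l \<le> inverse (2 ^ (kN + a))" .
  have "1 - (1 / 2) ^ a = 1 - (\<Sum>X<2 ^ kN :: nat. inverse (2 ^ (kN + a)) :: real)"
    by (simp add: power_add power_one_over field_simps)
  also have "\<dots> \<le> 1 - (\<Sum>X<2 ^ kN. avg (2 ^ W) ?m (\<lambda>rs'. of_bool (?bad rs' X)))"
    using prob_uncovered[OF N_eq'] by (intro diff_mono sum_mono order_refl order_trans[OF _ small]) simp
  also have "\<dots> = avg (2 ^ W) ?m (\<lambda>rs'. 1 - (\<Sum>X<2 ^ kN. of_bool (?bad rs' X)))"
    unfolding avg_diff avg_sum by (simp add: avg_const)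
  also have "\<dots> \<le> avg (2 ^ W) ?m (\<lambda>rs'. of_bool (\<forall>X < 2 ^ kN. \<exists>s < l. covered (2 ^ kM) (block s rs') X))"
  proof (rule avg_mono)
    fix rs' :: "nat list"
    show "1 - (\<Sum>X<2 ^ kN. of_bool (?bad rs' X)) \<le>
      (of_bool (\<forall>X < 2 ^ kN. \<exists>s < l. covered (2 ^ kM) (block s rs') X) :: real)"
    proof (cases "\<exists>X < 2 ^ kN. ?bad rs' X")
      case True
      then obtain X where X: "X < 2 ^ kN" "?bad rs' X" by blast
      then have "(1 :: real) = (\<Sum>Y\<in>{X}. of_bool (?bad rs' Y))" by simp
      also have "\<dots> \<le> (\<Sum>X<2 ^ kN. of_bool (?bad rs' X))" using X(1) by (intro sum_mono2) auto
      finally show ?thesis by (simp add: of_bool_def)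
    next
      case False
      then have "\<forall>X < 2 ^ kN. \<exists>s < l. covered (2 ^ kM) (block s rs') X" by blast
      then have "of_bool (\<forall>X < 2 ^ kN. \<exists>s < l. covered (2 ^ kM) (block s rs') X) = (1 :: real)" by simp
      then show ?thesis by (simp add: sum_nonneg)
    qed
  qed
  also have "\<dots> = measure_pmf.prob (rwords W (2 * (l * 2 ^ kt)))
    {rs'. \<forall>X < 2 ^ kN. \<exists>s < l. covered (2 ^ kM) (block s rs') X}"
    unfolding prob_rwords by (simp add: mult.commute mult.left_commute)
  finally show ?thesis .
qed

end

section \<open>Hyperplanes through grid points\<close>

text \<open>By Cramer's rule, a hyperplane through the rows of \<open>P\<close> has the equation
  \<open>normal P\<close> times x = \<open>det P\<close>. Replacing columns by ones keeps everything
  integral and also covers the case \<open>det P = 0\<close>, a hyperplane through the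
  origin.\<close>

definition normal :: "'a::comm_ring_1 ^ 'n ^ 'n \<Rightarrow> 'a ^ 'n" where
  "normal P = (\<chi> j. det (\<chi> i k. if k = j then 1 else P $ i $ k))"

text \<open>Component j of \<open>normal P\<close> is the sum over k of the cofactors of the entries
  (k, j). The product of row i with the cofactors of row k is the determinant with row k replaced by
  row i: \<open>det P\<close> for k = i, and 0 otherwise because of two equal rows.\<close>

lemma matrix_normal: "P *v normal P = (\<chi> _. det P)"
  for P :: "'a::comm_ring_1 ^ 'n ^ 'n"
proof -
  let ?Q = "{q. q permutes (UNIV :: 'n set)}"
  have normal: "normal P $ j = (\<Sum>k\<in>UNIV. \<Sum>q\<in>?Q. of_int (sign q) *
      (if q k = j then \<Prod>i\<in>UNIV - {k}. P $ i $ q i else 0))" for j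
  proof -
    have "(\<Prod>i\<in>UNIV. if q i = j then 1 else P $ i $ q i) =
        (\<Sum>k\<in>UNIV. if q k = j then \<Prod>i\<in>UNIV - {k}. P $ i $ q i else 0)" if q: "q \<in> ?Q" for q
    proof -
      have bij: "q k = j \<longleftrightarrow> k = inv q j" for k
        using q by (metis mem_Collect_eq permutes_inverses)
      have "(\<Prod>i\<in>UNIV. if q i = j then 1 else P $ i $ q i) =
          (\<Prod>i\<in>UNIV - {inv q j}. if q i = j then 1 else P $ i $ q i)"
        by (subst prod.remove[of _ "inv q j"]) (use bij in auto)
      also have "\<dots> = (\<Prod>i\<in>UNIV - {inv q j}. P $ i $ q i)"
        by (rule prod.cong) (use bij in auto)
      finally show ?thesis unfolding bij by simp
    qed
    then have "normal P $ j = (\<Sum>q\<in>?Q. \<Sum>k\<in>UNIV. of_int (sign q) *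
      (if q k = j then \<Prod>i\<in>UNIV - {k}. P $ i $ q i else 0))"
      unfolding normal_def det_def by (simp add: sum_distrib_left)
    then show ?thesis by (subst (asm) sum.swap)
  qed
  have "(P *v normal P) $ i = det P" for i
  proof -
    have expand: "(\<Sum>j\<in>UNIV. P $ i $ j * (\<Sum>q\<in>?Q. of_int (sign q) *
        (if q k = j then \<Prod>i'\<in>UNIV - {k}. P $ i' $ q i' else 0))) =
      det (\<chi> i'. if i' = k then P $ i else P $ i')" for k
    proof -
      have "(\<Sum>j\<in>UNIV. P $ i $ j * (\<Sum>q\<in>?Q. of_int (sign q) *
        (if q k = j then \<Prod>i'\<in>UNIV - {k}. P $ i' $ q i' else 0))) =
        (\<Sum>q\<in>?Q. \<Sum>j\<in>UNIV. if q k = j then of_int (sign q) * (P $ i $ j * (\<Prod>i'\<in>UNIV - {k}. P $ i' $ q i')) else 0)"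
        unfolding sum_distrib_left by (subst sum.swap) (auto intro!: sum.cong simp: ac_simps)
      also have "\<dots> = (\<Sum>q\<in>?Q. of_int (sign q) * (P $ i $ q k * (\<Prod>i'\<in>UNIV - {k}. P $ i' $ q i')))"
        by simp
      also have "\<dots> = det (\<chi> i'. if i' = k then P $ i else P $ i')"
        unfolding det_def
      proof (rule sum.cong, rule refl)
        fix q
        have "(\<Prod>i'\<in>UNIV. (if i' = k then P $ i else P $ i') $ q i') =
          P $ i $ q k * (\<Prod>i'\<in>UNIV - {k}. P $ i' $ q i')"
          by (subst prod.remove[of _ k]) (auto intro!: prod.cong)
        then show "of_int (sign q) * (P $ i $ q k * (\<Prod>i'\<in>UNIV - {k}. P $ i' $ q i')) =
          of_int (sign q) * (\<Prod>i'\<in>UNIV. (\<chi> i'. if i' = k then P $ i else P $ i') $ i' $ q i')"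
          by simp
      qed
      finally show ?thesis .
    qed
    have rows: "det (\<chi> i'. if i' = k then P $ i else P $ i') = (if k = i then det P else 0)" for k
    proof (cases "k = i")
      case True
      have "(\<chi> i'. if i' = i then P $ i else P $ i') = P" by (auto simp: vec_eq_iff)
      then show ?thesis using True by simp
    next
      case False
      then show ?thesis
        by (simp add: det_identical_rows[of k i] row_def)
    qed
    have "(P *v normal P) $ i = (\<Sum>k\<in>UNIV. \<Sum>j\<in>UNIV. P $ i $ j * (\<Sum>q\<in>?Q. of_int (sign q) *
        (if q k = j then \<Prod>i'\<in>UNIV - {k}. P $ i' $ q i' else 0)))"
      unfolding matrix_vector_mult_def normal by (simp add: sum_distrib_left) (rule sum.swap)
    also have "\<dots> = det P" unfolding expand rows by simp
    finally show ?thesis .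
  qed
  then show ?thesis by (simp add: vec_eq_iff)
qed

text \<open>The foot of the perpendicular is the multiple \<open>?x\<close> of the normal vector;
  the lower bound is the Cauchy-Schwarz inequality.\<close>

lemma infdist_hyperplane:
  fixes a :: "'a::euclidean_space"
  assumes "a \<noteq> 0"
  shows "infdist 0 {x. a \<bullet> x = b} = \<bar>b\<bar> / norm a"
proof (rule antisym)
  let ?x = "(b / (a \<bullet> a)) *\<^sub>R a"
  have "?x \<in> {x. a \<bullet> x = b}" using assms by simp
  then have "infdist 0 {x. a \<bullet> x = b} \<le> dist 0 ?x" by (rule infdist_le)
  also have "\<dots> = \<bar>b\<bar> / norm a"
    using assms by (simp add: dot_square_norm power2_eq_square)
  finally show "infdist 0 {x. a \<bullet> x = b} \<le> \<bar>b\<bar> / norm a" .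
  have ne: "{x. a \<bullet> x = b} \<noteq> {}" using \<open>?x \<in> _\<close> by blast
  show "\<bar>b\<bar> / norm a \<le> infdist 0 {x. a \<bullet> x = b}"
    unfolding infdist_notempty[OF ne]
  proof (rule cINF_greatest[OF ne])
    fix x assume "x \<in> {x. a \<bullet> x = b}"
    then have "\<bar>b\<bar> \<le> norm a * norm x" using Cauchy_Schwarz_ineq2[of a x] by simp
    then show "\<bar>b\<bar> / norm a \<le> dist 0 x" using assms by (simp add: divide_le_eq mult.commute)
  qed
qed

definition pmat :: "('d \<Rightarrow> nat ^ 'd::finite) \<Rightarrow> real ^ 'd ^ 'd" where
  "pmat p = (\<chi> i. real_point (p i))"

lemma flat_hyperplane:
  fixes p :: "'d \<Rightarrow> nat ^ 'd::finite"
  shows "flat p \<subseteq> {x. normal (pmat p) \<bullet> x = det (pmat p)}"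
  unfolding flat_def
proof (rule hull_minimal)
  have "normal (pmat p) \<bullet> real_point (p i) = det (pmat p)" for i
    using matrix_normal[of "pmat p"]
    by (simp add: vec_eq_iff matrix_vector_mult_def inner_vec_def pmat_def mult.commute)
  then show "range (\<lambda>i. real_point (p i)) \<subseteq> {x. normal (pmat p) \<bullet> x = det (pmat p)}" by auto
qed (rule affine_hyperplane)

text \<open>Component j of the normal vector is the determinant of the points with coordinate j
  replaced by 1. If it is nonzero, there is no affine dependence of the points, as this would be a
  linear dependence of the rows. Conversely, if the points span a hyperplane with a normal vector
  whose component j is nonzero, a dependence in the other coordinates extends to coordinate
  j.\<close>

lemma spans_iff:
  fixes p :: "'d \<Rightarrow> nat ^ 'd::finite"
  shows "spans_hyperplane p \<longleftrightarrow> normal (pmat p) \<noteq> 0"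
proof
  let ?r = "\<lambda>i. real_point (p i)"
  assume N: "normal (pmat p) \<noteq> 0"
  then obtain j where "normal (pmat p) $ j \<noteq> 0" by (auto simp: vec_eq_iff)
  then have det: "det (\<chi> i k. if k = j then 1 else pmat p $ i $ k) \<noteq> 0" by (simp add: normal_def)
  then have inv: "invertible (transpose (\<chi> i k. if k = j then 1 else pmat p $ i $ k))"
    by (simp add: invertible_det_nz)
  have indep: "c = 0" if c: "(\<Sum>i\<in>UNIV. c $ i) = 0" "(\<Sum>i\<in>UNIV. c $ i *\<^sub>R ?r i) = 0" for c :: "real ^ 'd"
  proof -
    have "(\<Sum>i\<in>UNIV. c $ i * ?r i $ k) = 0" for k
      using arg_cong[OF c(2), of "\<lambda>x. x $ k"] by simp
    then have "(\<Sum>i\<in>UNIV. c $ i * (if k = j then 1 else pmat p $ i $ k)) = 0" for k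
      using c(1) by (cases "k = j") (simp_all add: pmat_def)
    then have "c v* (\<chi> i k. if k = j then 1 else pmat p $ i $ k) = 0"
      by (simp add: vec_eq_iff vector_matrix_mult_def)
    then have "transpose (\<chi> i k. if k = j then 1 else pmat p $ i $ k) *v c = 0"
      by (simp add: transpose_matrix_vector)
    then show ?thesis
      using inv matrix_left_invertible_ker unfolding invertible_def by blast
  qed
  have inj: "inj ?r"
  proof (rule injI, rule ccontr)
    fix a b assume ab: "?r a = ?r b" "a \<noteq> b"
    define c :: "real ^ 'd" where "c = (\<chi> i. if i = a then 1 else if i = b then - 1 else 0)"
    have eq: "(\<Sum>i\<in>UNIV. c $ i) = (\<Sum>i\<in>{a, b}. c $ i)"
      "(\<Sum>i\<in>UNIV. c $ i *\<^sub>R ?r i) = (\<Sum>i\<in>{a, b}. c $ i *\<^sub>R ?r i)"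
      by (rule sum.mono_neutral_right; auto simp: c_def)+
    have sums: "(\<Sum>i\<in>{a, b}. c $ i) = 0" "(\<Sum>i\<in>{a, b}. c $ i *\<^sub>R ?r i) = 0"
      using ab by (simp_all add: c_def)
    have "c = 0" by (rule indep[OF trans[OF eq(1) sums(1)] trans[OF eq(2) sums(2)]])
    then have "c $ a = 0" by simp
    then show False by (simp add: c_def)
  qed
  have "\<not> affine_dependent (range ?r)"
  proof
    assume "affine_dependent (range ?r)"
    then obtain U where U: "sum U (range ?r) = 0" "\<exists>v\<in>range ?r. U v \<noteq> 0" "(\<Sum>v\<in>range ?r. U v *\<^sub>R v) = 0"
      by (auto simp: affine_dependent_explicit_finite)
    have "(\<chi> i. U (?r i)) = 0"
      by (rule indep) (use U(1,3) in \<open>simp_all add: sum.reindex[OF inj] o_def\<close>)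
    then show False using U(2) by (auto simp: vec_eq_iff)
  qed
  then have "aff_dim (range ?r) = int (card (range ?r)) - 1" using affine_independent_iff_card[of "range ?r"] by simp
  then show "spans_hyperplane p"
    using inj by (simp add: spans_hyperplane_def flat_def card_image)
next
  let ?r = "\<lambda>i. real_point (p i)"
  assume "spans_hyperplane p"
  then have dim: "aff_dim (range ?r) = int CARD('d) - 1" by (simp add: spans_hyperplane_def flat_def)
  then have "aff_dim (range ?r) = DIM(real ^ 'd) - 1" by (simp add: of_nat_diff Suc_leI)
  then have "\<exists>a b. a \<noteq> 0 \<and> affine hull (range ?r) = {x. a \<bullet> x = b}"
    by (rule aff_dim_eq_hyperplane[THEN iffD1])
  then obtain a b where ab: "a \<noteq> 0" "affine hull (range ?r) = {x. a \<bullet> x = b}" by blast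
  from ab(1) obtain j where j: "a $ j \<noteq> 0" by (auto simp: vec_eq_iff)
  have on: "a \<bullet> ?r i = b" for i using ab(2) hull_inc[of "?r i" "range ?r" affine] by auto
  have card: "card (range ?r) = CARD('d)"
    using aff_dim_le_card[of "range ?r"] card_image_le[of UNIV ?r] dim by simp
  have ind: "\<not> affine_dependent (range ?r)"
    using affine_independent_iff_card[of "range ?r"] card dim by simp
  have inj: "inj ?r" using card by (simp add: eq_card_imp_inj_on)
  show "normal (pmat p) \<noteq> 0"
  proof
    assume "normal (pmat p) = 0"
    then have "normal (pmat p) $ j = 0" by simp
    then have det: "det (\<chi> i k. if k = j then 1 else pmat p $ i $ k) = 0" by (simp add: normal_def)
    define Q where "Q = transpose (\<chi> i k. if k = j then 1 else pmat p $ i $ k)"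
    have "\<not> invertible Q" using det by (simp add: invertible_det_nz Q_def)
    then have "\<not> (\<forall>c. Q *v c = 0 \<longrightarrow> c = 0)"
      unfolding matrix_left_invertible_ker[symmetric] invertible_left_inverse .
    then obtain c where c: "c \<noteq> 0" "Q *v c = 0" by blast
    then have k: "(\<Sum>i\<in>UNIV. c $ i * (if k = j then 1 else ?r i $ k)) = 0" for k
      unfolding Q_def transpose_matrix_vector
      by (simp add: vec_eq_iff vector_matrix_mult_def pmat_def mult.commute cong: if_cong)
    have sum0: "(\<Sum>i\<in>UNIV. c $ i) = 0" using k[of j] by simp
    \<comment> \<open>All coordinates of \<open>s\<close> except the j-th vanish by the choice of
      \<open>c\<close>, and the j-th vanishes because \<open>a\<close> is orthogonal to
      \<open>s\<close> and has a nonzero component j. So \<open>c\<close> is an affine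
      dependence.\<close>
    define s where "s = (\<Sum>i\<in>UNIV. c $ i *\<^sub>R ?r i)"
    have s: "s $ k = 0" if "k \<noteq> j" for k using k[of k] that by (simp add: s_def)
    have "a \<bullet> s = 0"
      using sum0 on by (simp add: s_def inner_sum_right sum_distrib_right[symmetric])
    moreover have "a \<bullet> s = a $ j * s $ j"
      unfolding inner_vec_def by (subst sum.remove[of _ j]) (use s in auto)
    ultimately have "s $ j = 0" using j by simp
    then have "s = 0" using s by (metis vec_eq_iff zero_index)
    define U where "U v = c $ inv ?r v" for v
    have U: "U (?r i) = c $ i" for i using inv_f_f[OF inj, of i] by (simp add: U_def)
    obtain i where "c $ i \<noteq> 0" using c(1) by (auto simp: vec_eq_iff)
    then have "affine_dependent (range ?r)"
      unfolding affine_dependent_explicit_finite[OF finite_imageI[OF finite]]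
      using sum0 \<open>s = 0\<close> U by (intro exI[of _ U]) (auto simp: sum.reindex[OF inj] o_def s_def)
    then show False using ind by contradiction
  qed
qed

text \<open>The span lies in the hyperplane of \<open>flat_hyperplane\<close> and has the same
  dimension, so the two are equal.\<close>

lemma origin_dist_eq:
  fixes p :: "'d \<Rightarrow> nat ^ 'd::finite"
  assumes "spans_hyperplane p"
  shows "origin_dist p = \<bar>det (pmat p)\<bar> / norm (normal (pmat p))"
proof -
  have N: "normal (pmat p) \<noteq> 0" using assms by (simp add: spans_iff)
  have "aff_dim (flat p) = aff_dim {x. normal (pmat p) \<bullet> x = det (pmat p)}"
    using assms N by (simp add: spans_hyperplane_def)
  then have "flat p = {x. normal (pmat p) \<bullet> x = det (pmat p)}"
  proof (intro affine_dim_equal)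
    show "flat p \<noteq> {}" unfolding flat_def by simp
  qed (use flat_hyperplane in \<open>auto simp: flat_def affine_affine_hull affine_hyperplane\<close>)
  then show ?thesis unfolding origin_dist_def using infdist_hyperplane[OF N] by simp
qed

section \<open>Numbering of the coordinates\<close>

lemma length_indices [simp]: "length (indices :: 'd::{finite,linorder} list) = CARD('d)"
  by (simp add: indices_def)

lemma set_indices [simp]: "set (indices :: 'd::{finite,linorder} list) = UNIV"
  by (simp add: indices_def)

lemma distinct_indices [simp]: "distinct (indices :: 'd::{finite,linorder} list)"
  by (simp add: indices_def)

definition pos :: "'d::{finite,linorder} \<Rightarrow> nat" where
  "pos i = inv_into {..<CARD('d)} ((!) indices) i"

lemma bij_indices: "bij_betw ((!) (indices :: 'd list)) {..<CARD('d)} (UNIV :: 'd::{finite,linorder} set)"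
  by (rule bij_betw_nth) simp_all

lemma pos_less: "pos (i :: 'd) < CARD('d::{finite,linorder})"
  using inv_into_into[of i "(!) indices" "{..<CARD('d)}"] bij_indices[where 'd = 'd]
  by (auto simp: pos_def bij_betw_def)

lemma indices_pos [simp]: "indices ! pos i = i"
  using f_inv_into_f[of i "(!) indices" "{..<CARD('a)}"] bij_indices[where 'd = 'a]
  by (auto simp: pos_def bij_betw_def)

lemma pos_indices: "k < CARD('d) \<Longrightarrow> pos (indices ! k :: 'd::{finite,linorder}) = k"
  using inv_into_f_f[of "(!) (indices :: 'd list)" "{..<CARD('d)}" k] bij_indices[where 'd = 'd]
  by (auto simp: pos_def bij_betw_def)

section \<open>Integer determinants and ranks of distances\<close>

lemma det_of_int: "det (\<chi> i k. of_int (f i k) :: 'a::comm_ring_1 ^ 'n ^ 'n) = of_int (det (\<chi> i k. f i k))"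
  by (simp add: det_def)

lemma fact_le: "fact d \<le> (2 :: nat) ^ (d * d)"
proof -
  have "fact d \<le> d ^ d" using fact_le_power[of d, where 'a = nat] by simp
  also have "\<dots> \<le> (2 ^ d) ^ d" by (rule power_mono[OF less_imp_le[OF less_exp]]) simp
  finally show ?thesis by (simp add: power_mult)
qed

lemma det_bound:
  fixes M :: "int ^ 'n ^ 'n"
  assumes "\<And>i k. \<bar>M $ i $ k\<bar> \<le> 2 ^ w"
  shows "\<bar>det M\<bar> \<le> 2 ^ (CARD('n) * w + CARD('n) * CARD('n))"
proof -
  let ?Q = "{q. q permutes (UNIV :: 'n set)}"
  have "\<bar>det M\<bar> \<le> (\<Sum>q\<in>?Q. \<bar>of_int (sign q) * (\<Prod>i\<in>UNIV. M $ i $ q i)\<bar>)"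
    unfolding det_def by (rule sum_abs)
  also have "\<dots> = (\<Sum>q\<in>?Q. \<Prod>i\<in>UNIV. \<bar>M $ i $ q i\<bar>)"
    by (intro sum.cong) (simp_all add: abs_mult abs_prod sign_def)
  also have "\<dots> \<le> (\<Sum>q\<in>?Q. \<Prod>i\<in>(UNIV :: 'n set). 2 ^ w)"
    by (intro sum_mono prod_mono conjI assms) simp
  also have "\<dots> = int (fact CARD('n)) * 2 ^ (CARD('n) * w)"
    by (simp add: card_permutations power_mult[symmetric] mult.commute)
  also have "\<dots> \<le> 2 ^ (CARD('n) * CARD('n)) * 2 ^ (CARD('n) * w)"
  proof (rule mult_right_mono)
    have "int (fact CARD('n)) \<le> int (2 ^ (CARD('n) * CARD('n)))"
      using fact_le by (rule of_nat_mono)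
    then show "int (fact CARD('n)) \<le> 2 ^ (CARD('n) * CARD('n))" by simp
  qed simp
  finally show ?thesis by (simp add: power_add mult.commute)
qed

definition det2 :: "int ^ 'd ^ 'd::finite \<Rightarrow> nat" where
  "det2 M = nat ((det M)\<^sup>2)"

definition nrm2 :: "int ^ 'd ^ 'd::finite \<Rightarrow> nat" where
  "nrm2 M = nat (\<Sum>j\<in>UNIV. (normal M $ j)\<^sup>2)"

text \<open>Determinants are at most 2 ^ (d * w + d * d), where d * d bits pay for the factorial.
  Squaring doubles the exponent, and a sum of d squares takes d more bits.\<close>

definition dbits :: "nat \<Rightarrow> nat \<Rightarrow> nat" where
  "dbits d w = 2 * d * w + (2 * (d * d) + d)"

lemma det2_nrm2_less:
  fixes M :: "int ^ 'd ^ 'd::finite"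
  assumes "\<And>i k. 0 \<le> M $ i $ k" "\<And>i k. M $ i $ k \<le> 2 ^ w"
  shows "det2 M < 2 ^ dbits CARD('d) w" "nrm2 M < 2 ^ dbits CARD('d) w"
proof -
  let ?d = "CARD('d)"
  let ?e = "?d * w + ?d * ?d"
  have square: "x\<^sup>2 \<le> 2 ^ (2 * ?e)" if "\<bar>x\<bar> \<le> 2 ^ ?e" for x :: int
    using power_mono[OF that, of 2] by (simp add: power_mult[symmetric] mult.commute)
  have e: "dbits ?d w = ?d + 2 * ?e" by (simp add: dbits_def algebra_simps)
  have d: "int ?d < 2 ^ ?d" using less_exp[of ?d] by (metis of_nat_less_iff of_nat_numeral of_nat_power)
  have p: "(0 :: int) < 2 ^ (2 * ?e)" by simp
  have one: "1 \<le> int ?d" by (simp add: Suc_leI)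
  have step: "int ?d * 2 ^ (2 * ?e) < 2 ^ dbits ?d w"
    unfolding e power_add using d p by (intro mult_strict_right_mono)
  have abs: "\<bar>M $ i $ k\<bar> \<le> 2 ^ w" for i k using assms[of i k] by simp
  then have "(det M)\<^sup>2 \<le> 2 ^ (2 * ?e)" by (intro square det_bound)
  also have "\<dots> \<le> int ?d * 2 ^ (2 * ?e)" using one p by (simp add: mult_le_cancel_right1)
  finally have "(det M)\<^sup>2 < 2 ^ dbits ?d w" using step by linarith
  then show "det2 M < 2 ^ dbits ?d w" by (simp add: det2_def nat_less_iff)
  have "(normal M $ j)\<^sup>2 \<le> 2 ^ (2 * ?e)" for j
    unfolding normal_def vec_lambda_beta
    by (intro square det_bound) (simp add: abs)
  then have "(\<Sum>j\<in>UNIV. (normal M $ j)\<^sup>2) \<le> (\<Sum>j\<in>(UNIV :: 'd set). 2 ^ (2 * ?e))"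
    by (intro sum_mono)
  then have "(\<Sum>j\<in>UNIV. (normal M $ j)\<^sup>2) \<le> int ?d * 2 ^ (2 * ?e)" by simp
  also note step
  finally show "nrm2 M < 2 ^ dbits ?d w" by (simp add: nrm2_def nat_less_iff)
qed

text \<open>The squared distance is the fraction \<open>det2\<close> / \<open>nrm2\<close>.
  Multiplied by the square of a strict bound on the denominators and rounded down, it still
  separates different fractions. The shift by 1 reserves 0 for tuples that span no
  hyperplane.\<close>

definition drank :: "nat \<Rightarrow> int ^ 'd ^ 'd::finite \<Rightarrow> nat" where
  "drank w M = (if nrm2 M = 0 then 0 else 1 + det2 M * 2 ^ (2 * dbits CARD('d) w) div nrm2 M)"

lemma rank_less:
  fixes M :: "int ^ 'd ^ 'd::finite"
  assumes "\<And>i k. 0 \<le> M $ i $ k" "\<And>i k. M $ i $ k \<le> 2 ^ w"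
  shows "drank w M < 2 ^ (3 * dbits CARD('d) w + 2)"
proof -
  let ?e = "dbits CARD('d) w"
  have "drank w M \<le> 1 + det2 M * 2 ^ (2 * ?e)" by (simp add: drank_def)
  moreover have "det2 M * 2 ^ (2 * ?e) < 2 ^ ?e * 2 ^ (2 * ?e)"
    using det2_nrm2_less(1)[OF assms] by (intro mult_strict_right_mono) simp_all
  moreover have "(2 :: nat) ^ ?e * 2 ^ (2 * ?e) = 2 ^ (3 * ?e)" by (simp add: power_add[symmetric])
  moreover have "(2 :: nat) ^ (3 * ?e + 2) = 4 * 2 ^ (3 * ?e)" by (simp add: power_add)
  ultimately show ?thesis by linarith
qed

text \<open>
  Distinct fractions with denominators below \<open>s\<close> differ by more than \<open>1 / s\<^sup>2\<close>, hence they
  remain distinct when scaled by \<open>s\<^sup>2\<close> and rounded down.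
\<close>

lemma scaled_less:
  fixes a b a' b' :: nat
  assumes "0 < b" "0 < b'" "b < s" "b' < s" "a * b' < a' * b"
  shows "a * (s * s) div b < a' * (s * s) div b'"
proof -
  have "a * b' + 1 \<le> a' * b" using assms(5) by simp
  then have "(a * b' + 1) * (s * s) \<le> a' * b * (s * s)" by (rule mult_le_mono1)
  moreover have "b * b' \<le> s * s" using assms by (intro mult_le_mono) simp_all
  ultimately have "a * (s * s) * b' + b * b' \<le> a' * (s * s) * b" by (simp add: algebra_simps)
  then have le: "(a * (s * s) + b) * b' \<le> a' * (s * s) * b" by (simp add: algebra_simps)
  have "(a * (s * s) div b + 1) * b \<le> a * (s * s) + b" by (simp add: add_mult_distrib)
  then have "(a * (s * s) div b + 1) * b * b' \<le> a' * (s * s) * b" using le by (meson mult_le_mono1 order_trans)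
  then have "(a * (s * s) div b + 1) * b' * b \<le> a' * (s * s) * b" by (simp only: ac_simps)
  then have "(a * (s * s) div b + 1) * b' \<le> a' * (s * s)" using assms(1) by simp
  then show ?thesis using assms(2) by (simp add: less_eq_div_iff_mult_less_eq Suc_le_eq[symmetric])
qed

text \<open>Equal distances must get equal ranks although the fractions are not reduced.\<close>

lemma scaled_eq:
  fixes a b a' b' :: nat
  assumes "0 < b" "0 < b'" "a * b' = a' * b"
  shows "a * c div b = a' * c div b'"
proof -
  have "a * c div b = (a * c * b') div (b * b')" using assms(2) by simp
  also have "a * c * b' = a' * c * b" using assms(3) by (simp add: ac_simps)
  also have "\<dots> div (b * b') = a' * c div b'" using assms(1) by (simp add: mult.commute[of b])
  finally show ?thesis .
qed

definition imat :: "('d \<Rightarrow> nat ^ 'd::finite) \<Rightarrow> int ^ 'd ^ 'd" where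
  "imat p = (\<chi> i a. int (p i $ a))"

lemma det_pmat: "det (pmat p) = real_of_int (det (imat p))"
  unfolding imat_def det_of_int[symmetric] by (simp add: pmat_def real_point_def)

lemma normal_pmat: "normal (pmat p) $ j = real_of_int (normal (imat p) $ j)"
proof -
  have "normal (pmat p) $ j = det (\<chi> i k. of_int (if k = j then 1 else int (p i $ k)))"
    unfolding normal_def vec_lambda_beta
    by (intro arg_cong[of _ _ det]) (simp add: pmat_def real_point_def vec_eq_iff)
  also have "\<dots> = real_of_int (normal (imat p) $ j)"
    unfolding det_of_int by (simp add: normal_def imat_def cong: if_cong)
  finally show ?thesis .
qed

lemma norm_normal_pmat: "(norm (normal (pmat p)))\<^sup>2 = real (nrm2 (imat p))"
  unfolding power2_norm_eq_inner inner_vec_def normal_pmat nrm2_def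
  by (simp add: power2_eq_square sum_nonneg)

lemma spans_iff_nrm2: "spans_hyperplane p \<longleftrightarrow> nrm2 (imat p) \<noteq> 0"
proof -
  have "normal (pmat p) = 0 \<longleftrightarrow> (norm (normal (pmat p)))\<^sup>2 = 0" by simp
  also have "\<dots> \<longleftrightarrow> nrm2 (imat p) = 0" unfolding norm_normal_pmat by simp
  finally show ?thesis by (simp add: spans_iff)
qed

lemma origin_dist_square:
  assumes "spans_hyperplane p"
  shows "(origin_dist p)\<^sup>2 = real (det2 (imat p)) / real (nrm2 (imat p))"
  unfolding origin_dist_eq[OF assms] power_divide norm_normal_pmat det2_def det_pmat by simp

text \<open>Distances are compared through their squares by cross-multiplication; unequal fractions
  are handled by \<open>scaled_less\<close>, equal ones by \<open>scaled_eq\<close>.\<close>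

lemma rank_less_iff:
  fixes p q :: "'d \<Rightarrow> nat ^ 'd::finite"
  assumes "spans_hyperplane p" "spans_hyperplane q"
    and "\<And>i a. p i $ a < 2 ^ w" "\<And>i a. q i $ a < 2 ^ w"
  shows "drank w (imat p) < drank w (imat q) \<longleftrightarrow> origin_dist p < origin_dist q"
proof -
  let ?A = "\<lambda>p. det2 (imat p)" and ?B = "\<lambda>p. nrm2 (imat p)"
  have mono: "drank w (imat p) < drank w (imat q) \<and> \<not> drank w (imat q) < drank w (imat p)"
    if "spans_hyperplane p" "spans_hyperplane q" "?A p * ?B q < ?A q * ?B p"
      "\<And>i a. p i $ a < 2 ^ w" "\<And>i a. q i $ a < 2 ^ w" for p q :: "'d \<Rightarrow> nat ^ 'd::finite"
  proof -
    have le: "imat p $ i $ k \<le> 2 ^ w" "imat q $ i $ k \<le> 2 ^ w" for i k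
      using that(4,5)[of i k] by (simp_all add: imat_def order.strict_implies_order)
    have ge: "0 \<le> imat p $ i $ k" "0 \<le> imat q $ i $ k" for i k by (simp_all add: imat_def)
    have "drank w (imat p) < drank w (imat q)"
      using scaled_less[OF _ _ det2_nrm2_less(2)[OF ge(1) le(1)] det2_nrm2_less(2)[OF ge(2) le(2)] that(3)] that(1,2)
      by (simp add: drank_def spans_iff_nrm2 mult_2 power_add)
    then show ?thesis by simp
  qed
  have pos: "0 < ?B p" "0 < ?B q" using assms(1,2) by (simp_all add: spans_iff_nrm2)
  have "origin_dist p < origin_dist q \<longleftrightarrow> (origin_dist p)\<^sup>2 < (origin_dist q)\<^sup>2"
    unfolding not_le[symmetric] by (simp add: origin_dist_def infdist_nonneg)
  also have "\<dots> \<longleftrightarrow> real (?A p * ?B q) < real (?A q * ?B p)"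
    unfolding origin_dist_square[OF assms(1)] origin_dist_square[OF assms(2)] using pos
    by (simp add: divide_simps)
  finally have iff: "origin_dist p < origin_dist q \<longleftrightarrow> ?A p * ?B q < ?A q * ?B p"
    unfolding of_nat_less_iff .
  show ?thesis
  proof (cases "?A p * ?B q" "?A q * ?B p" rule: linorder_cases)
    case less
    then show ?thesis using mono[OF assms(1,2) less assms(3,4)] iff by simp
  next
    case equal
    then have "drank w (imat p) = drank w (imat q)"
      using scaled_eq[OF pos equal] pos by (simp add: drank_def)
    then show ?thesis using iff equal by simp
  next
    case greater
    then show ?thesis using mono[OF assms(2,1) greater assms(4,3)] iff by simp
  qed
qed


section \<open>Computing the distance\<close>

text \<open>
  Intermediate results may be negative or exceed the word size. They are computed modulo
  \<open>2 ^ W\<close>; only the squares at the end are small.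
\<close>

definition repr :: "nat \<Rightarrow> nat \<Rightarrow> int \<Rightarrow> bool" where
  "repr W x z \<longleftrightarrow> x < 2 ^ W \<and> int x mod 2 ^ W = z mod 2 ^ W"

lemma repr_exact: "repr W x (int y) \<Longrightarrow> y < 2 ^ W \<Longrightarrow> x = y"
proof -
  assume r: "repr W x (int y)" and y: "y < 2 ^ W"
  have "int z mod 2 ^ W = int z" if "z < 2 ^ W" for z
    using of_nat_mod[of z "2 ^ W", where 'a = int] mod_less[OF that] by simp
  from this[OF y] this[of x] show ?thesis using r unfolding repr_def by simp
qed

lemma reprI: "int x mod 2 ^ W = z mod 2 ^ W \<Longrightarrow> repr W (x mod 2 ^ W) z"
proof -
  assume "int x mod 2 ^ W = z mod 2 ^ W"
  moreover have "int (x mod 2 ^ W) mod 2 ^ W = int x mod 2 ^ W"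
    unfolding zmod_int of_nat_power of_nat_numeral by (rule mod_mod_trivial)
  moreover have "x mod 2 ^ W < 2 ^ W" by (rule mod_less_divisor) simp
  ultimately show ?thesis unfolding repr_def by metis
qed

lemma repr_eAdd:
  "repr W (eval W p m a v) x \<Longrightarrow> repr W (eval W p m b v) y \<Longrightarrow> repr W (eval W p m (eAdd a b) v) (x + y)"
  unfolding eval.simps binop_val.simps
  by (rule reprI, unfold of_nat_add, rule mod_add_cong) (simp_all only: repr_def)

lemma repr_eMul:
  "repr W (eval W p m a v) x \<Longrightarrow> repr W (eval W p m b v) y \<Longrightarrow> repr W (eval W p m (eMul a b) v) (x * y)"
  unfolding eval.simps binop_val.simps
  by (rule reprI, unfold of_nat_mult, rule mod_mult_cong) (simp_all only: repr_def)

lemma repr_minus: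
  assumes "repr W a x" "repr W b y"
  shows "repr W ((a + 2 ^ W - b) mod 2 ^ W) (x - y)"
proof -
  define P :: nat where "P = 2 ^ W"
  have P: "(2 :: int) ^ W = int P" by (simp add: P_def)
  have ab: "b < P" "int a mod int P = x mod int P" "int b mod int P = y mod int P"
    using assms unfolding repr_def P P_def[symmetric] by blast+
  have "int (a + P - b) = int a - int b + int P" using ab(1) by simp
  also have "\<dots> mod int P = (int a - int b) mod int P" by (rule mod_add_self2)
  also have "\<dots> = (x - y) mod int P" by (rule mod_diff_cong[OF ab(2,3)])
  finally have "int (a + P - b) mod 2 ^ W = (x - y) mod 2 ^ W" unfolding P .
  then show ?thesis unfolding P_def by (rule reprI)
qed

lemma repr_eSub:
  "repr W (eval W p m a v) x \<Longrightarrow> repr W (eval W p m b v) y \<Longrightarrow> repr W (eval W p m (eSub a b) v) (x - y)"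
  unfolding eval.simps binop_val.simps by (rule repr_minus)

lemma repr_Num: "repr W (eval W p m (Num c) v) (int c)"
  unfolding eval.simps by (rule reprI) (rule refl)

definition sumE :: "exp list \<Rightarrow> exp" where
  "sumE es = foldr (\<lambda>a b. eAdd a b) es (Num 0)"

definition prodE :: "exp list \<Rightarrow> exp" where
  "prodE es = foldr (\<lambda>a b. eMul a b) es (Num 1)"

lemma repr_sumE:
  "(\<And>x. x \<in> set xs \<Longrightarrow> repr W (eval W p m (e x) v) (z x)) \<Longrightarrow>
    repr W (eval W p m (sumE (map e xs)) v) (\<Sum>x\<leftarrow>xs. z x)"
proof (induction xs)
  case (Cons x xs)
  then show ?case unfolding sumE_def list.map foldr.simps o_apply sum_list.Cons
    by (intro repr_eAdd) simp_all
qed (use repr_Num[of W p m 0 v] in \<open>simp only: sumE_def list.map foldr.simps id_apply sum_list.Nil of_nat_0\<close>)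

lemma repr_prodE:
  "(\<And>x. x \<in> set xs \<Longrightarrow> repr W (eval W p m (e x) v) (z x)) \<Longrightarrow>
    repr W (eval W p m (prodE (map e xs)) v) (\<Prod>x\<leftarrow>xs. z x)"
proof (induction xs)
  case (Cons x xs)
  then show ?case unfolding prodE_def list.map foldr.simps o_apply prod_list.Cons
    by (intro repr_eMul) simp_all
qed (use repr_Num[of W p m 1 v] in \<open>simp only: prodE_def list.map foldr.simps id_apply prod_list.Nil of_nat_1\<close>)

text \<open>For a fixed dimension the Leibniz formula is written out term by term in the program,
  for which any enumeration of the permutations will do.\<close>

definition perms :: "('d::finite \<Rightarrow> 'd) list" where
  "perms = (SOME qs. set qs = {q. q permutes UNIV} \<and> distinct qs)"

lemma perms: "set perms = {q. q permutes (UNIV :: 'd::finite set)}" "distinct (perms :: ('d \<Rightarrow> 'd) list)"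
proof -
  have "finite {q. q permutes (UNIV :: 'd set)}" by (rule finite_permutations) simp
  then have "\<exists>qs. set qs = {q. q permutes (UNIV :: 'd set)} \<and> distinct qs" by (rule finite_distinct_list)
  from someI_ex[OF this] show "set perms = {q. q permutes (UNIV :: 'd set)}" "distinct (perms :: ('d \<Rightarrow> 'd) list)"
    unfolding perms_def by blast+
qed

definition detE :: "('d::{finite,linorder} \<Rightarrow> 'd \<Rightarrow> exp) \<Rightarrow> exp" where
  "detE f = sumE (map (\<lambda>q. eMul (if sign q = 1 then Num 1 else eSub (Num 0) (Num 1))
     (prodE (map (\<lambda>i. f i (q i)) indices))) perms)"

lemma repr_detE:
  fixes f :: "'d::{finite,linorder} \<Rightarrow> 'd \<Rightarrow> exp"
  assumes "\<And>i k. repr W (eval W p m (f i k) v) (M $ i $ k)"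
  shows "repr W (eval W p m (detE f) v) (det M)"
proof -
  have sgn: "repr W (eval W p m (if sign q = 1 then Num 1 else eSub (Num 0) (Num 1)) v) (sign q)"
    for q :: "'d \<Rightarrow> 'd"
  proof -
    have "repr W (eval W p m (Num 1) v) (int 1)" by (rule repr_Num)
    moreover have "repr W (eval W p m (eSub (Num 0) (Num 1)) v) (int 0 - int 1)"
      by (intro repr_eSub repr_Num)
    moreover have "sign q = 1 \<or> sign q = - 1" by (simp add: sign_def)
    ultimately show ?thesis by (auto simp del: eval.simps)
  qed
  have "repr W (eval W p m (detE f) v) (\<Sum>q\<leftarrow>perms. sign q * (\<Prod>i\<leftarrow>indices. M $ i $ q i))"
    unfolding detE_def by (intro repr_sumE repr_eMul sgn repr_prodE assms)
  also have "(\<Sum>q\<leftarrow>perms. sign q * (\<Prod>i\<leftarrow>indices. M $ i $ q i)) = det M"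
    by (simp add: det_def sum_list_distinct_conv_sum_set perms prod.distinct_set_conv_list[symmetric])
  finally show ?thesis .
qed

definition sqE :: "exp \<Rightarrow> exp" where
  "sqE e = Bind 112 e (eMul (Var 112) (Var 112))"

lemma repr_sqE: "repr W (eval W p m e v) x \<Longrightarrow> repr W (eval W p m (sqE e) v) (x\<^sup>2)"
  unfolding sqE_def eval.simps(6) power2_eq_square by (intro repr_eMul) simp_all

definition entryE :: "nat \<Rightarrow> 'd::{finite,linorder} \<Rightarrow> 'd \<Rightarrow> exp" where
  "entryE \<beta> i a = crdE CARD('d) \<beta> (Var 0) (Num (pos i * CARD('d) + pos a))"

text \<open>Parameter 16 is three times \<open>dbits\<close> plus 2, and the scaling exponent is
  recovered from it.\<close>

definition rankE :: "('d::{finite,linorder} \<Rightarrow> 'd \<Rightarrow> exp) \<Rightarrow> exp" where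
  "rankE f = Bind 110 (sqE (detE f))
    (Bind 111 (sumE (map (\<lambda>j. sqE (detE (\<lambda>i k. if k = j then Num 1 else f i k))) indices))
      (Cond (Var 111) (eAdd (Num 1) (eDiv (eMul (Var 110)
         (pow2E (eMul (Num 2) (eDiv (eSub (Par 16) (Num 2)) (Num 3))))) (Var 111))) (Num 0)))"

lemma eval_rankE:
  fixes f :: "'d::{finite,linorder} \<Rightarrow> 'd \<Rightarrow> exp"
  assumes f: "\<And>i k v'. v' 0 = v 0 \<Longrightarrow> eval W p m (f i k) v' = x i k" "\<And>i k. x i k < 2 ^ w"
    and p: "p 16 = 3 * dbits CARD('d) w + 2" and W: "3 * dbits CARD('d) w + 2 < W"
  shows "eval W p m (rankE f) v = drank w (\<chi> i k. int (x i k))"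
proof -
  let ?M = "\<chi> i k. int (x i k)" and ?e = "dbits CARD('d) w"
  have le: "?M $ i $ k \<le> 2 ^ w" and ge: "0 \<le> ?M $ i $ k" for i k
    using f(2)[of i k] by (simp_all add: order.strict_implies_order)
  note less = det2_nrm2_less[OF ge le]
  have eW: "(2 :: nat) ^ ?e < 2 ^ W" using W by (intro power_strict_increasing) simp_all
  have rank_W: "drank w ?M < 2 ^ W"
    by (rule less_trans[OF rank_less[OF ge le] power_strict_increasing[OF W]]) simp
  have "x i k < 2 ^ W" for i k
  proof -
    have "1 * w \<le> CARD('d) * w" by (intro mult_le_mono1) (simp add: Suc_leI)
    then have "w \<le> ?e" unfolding dbits_def mult.assoc by linarith
    then have "(2 :: nat) ^ w \<le> 2 ^ ?e" by (intro power_increasing) simp_all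
    then show ?thesis using f(2)[of i k] eW by linarith
  qed
  then have rep: "repr W (eval W p m (f i k) v') (int (x i k))" if "v' 0 = v 0" for i k v'
    using f(1)[of v' i k, OF that] by (simp add: repr_def)
  have "repr W (eval W p m (sqE (detE f)) v) ((det ?M)\<^sup>2)"
    by (intro repr_sqE repr_detE) (simp add: rep)
  also have "(det ?M)\<^sup>2 = int (det2 ?M)" by (simp add: det2_def)
  \<comment> \<open>The residue modulo \<open>2 ^ W\<close> determines a value that is known to be
    below \<open>2 ^ W\<close>.\<close>
  finally have det: "eval W p m (sqE (detE f)) v = det2 ?M"
    by (rule repr_exact) (rule less_trans[OF less(1) eW])
  have "repr W (eval W p m (sumE (map (\<lambda>j. sqE (detE (\<lambda>i k. if k = j then Num 1 else f i k))) indices)) (v(110 := det2 ?M)))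
      (\<Sum>j\<leftarrow>indices. (normal ?M $ j)\<^sup>2)"
    unfolding normal_def vec_lambda_beta
    by (intro repr_sumE repr_sqE repr_detE) (use repr_Num[of W p m 1] in \<open>simp add: rep\<close>)
  also have "(\<Sum>j\<leftarrow>indices. (normal ?M $ j)\<^sup>2) = int (nrm2 ?M)"
    by (simp add: sum_list_distinct_conv_sum_set nrm2_def sum_nonneg)
  finally have nrm: "eval W p m (sumE (map (\<lambda>j. sqE (detE (\<lambda>i k. if k = j then Num 1 else f i k))) indices))
      (v(110 := det2 ?M)) = nrm2 ?M"
    by (rule repr_exact) (rule less_trans[OF less(2) eW])
  have lt: "c < W \<Longrightarrow> c < 2 ^ W" for c by (rule less_trans[OF _ less_exp])
  have "1 \<le> CARD('d)" by (simp add: Suc_leI)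
  then have "1 \<le> ?e" unfolding dbits_def by linarith
  then have num: "c < 2 ^ W" if "c \<le> 3" for c :: nat using lt[of c] W that by linarith
  have "det2 ?M * 2 ^ (2 * ?e) < 2 ^ ?e * 2 ^ (2 * ?e)"
    using less(1) by (intro mult_strict_right_mono) simp_all
  also have "\<dots> = 2 ^ (3 * ?e)" by (simp add: power_add[symmetric])
  also have "\<dots> \<le> 2 ^ W" using W by (intro power_increasing) simp_all
  finally have mul: "det2 ?M * 2 ^ (2 * ?e) < 2 ^ W" .
  have "eval W p m (Cond (Var 111) (eAdd (Num 1) (eDiv (eMul (Var 110)
         (pow2E (eMul (Num 2) (eDiv (eSub (Par 16) (Num 2)) (Num 3))))) (Var 111))) (Num 0))
         (v(110 := det2 ?M, 111 := nrm2 ?M)) = drank w ?M"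
  proof (rule eval_cond[where x = "nrm2 ?M"])
    assume "nrm2 ?M \<noteq> 0"
    then have r: "drank w ?M = 1 + det2 ?M * 2 ^ (2 * ?e) div nrm2 ?M" by (simp add: drank_def)
    have "eval W p m (eDiv (eSub (Par 16) (Num 2)) (Num 3)) v' = (3 * ?e + 2 - 2) div 3" for v'
      by (intro eval_div eval_minus eval_num eval_par p; use W lt num in simp)
    then have e: "eval W p m (eMul (Num 2) (eDiv (eSub (Par 16) (Num 2)) (Num 3))) v' = 2 * ?e" for v'
      by (intro eval_mul eval_num; use W lt num in simp)
    show "eval W p m (eAdd (Num 1) (eDiv (eMul (Var 110)
         (pow2E (eMul (Num 2) (eDiv (eSub (Par 16) (Num 2)) (Num 3))))) (Var 111)))
         (v(110 := det2 ?M, 111 := nrm2 ?M)) = drank w ?M"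
      unfolding r
      by (intro eval_add eval_div eval_mul[OF _ _ mul] eval_num eval_pow2E e eval_var)
        (use W lt num rank_W r in simp_all)
  next
    show "eval W p m (Num 0) (v(110 := det2 ?M, 111 := nrm2 ?M)) = drank w ?M" if "nrm2 ?M = 0"
      using that by (simp add: drank_def)
  qed (use rank_W in simp_all)
  then show ?thesis
    unfolding rankE_def eval.simps(6) det nrm .
qed

section \<open>Tuples of points and their canonical codes\<close>

context tuples
begin

lemma pix_dig: "pix X j = dig k1 X (j div d)"
  by (simp add: pix_def dig_def)

lemma lev_dig: "lev X j = dig k2 (X div 2 ^ (k1 * d)) j"
  by (simp add: lev_def dig_def div_mult2_eq power_add mult.commute)

lemma canonical_bounds:
  assumes "X \<in> canonical lo hi" "j < D"
  shows "lo j \<le> crd X j" "crd X j \<le> hi j"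
proof -
  obtain e where e: "taken w (lo j) (hi j) e" "e div 2 = lev X j" "node X j = tnode w (lo j) (hi j) e"
    using assms by (auto simp: canonical_def)
  then have "inside w (lo j) (hi j) (crd X j) (e div 2)"
    by (intro taken_match) (simp_all add: node_def)
  then have "inside w (lo j) (hi j) (crd X j) 0" by (rule inside_mono) simp
  then show "lo j \<le> crd X j" "crd X j \<le> hi j" by (simp_all add: inside_0)
qed

text \<open>The indices of the points determine the coordinates, and above each coordinate there is
  only one taken node, so the levels are determined as well.\<close>

lemma canonical_unique:
  assumes "X \<in> canonical lo hi" "Y \<in> canonical lo hi" "\<And>j. j < D \<Longrightarrow> hi j < 2 ^ w"
    and pix: "\<And>i. i < d \<Longrightarrow> pix X (d * i) = pix Y (d * i)"
  shows "X = Y"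
proof -
  have dig: "dig k1 X i = dig k1 Y i" if "i < d" for i
    using pix[OF that] d by (simp add: pix_dig)
  have crd: "crd X j = crd Y j" if "j < D" for j
    using dig[of "j div d"] that by (simp add: crd_def pix_dig less_mult_imp_div_less)
  have lev: "lev X j = lev Y j" if j: "j < D" for j
  proof -
    obtain e where e: "taken w (lo j) (hi j) e" "e div 2 = lev X j" "node X j = tnode w (lo j) (hi j) e"
      using assms(1) j unfolding canonical_def by blast
    moreover obtain e' where e': "taken w (lo j) (hi j) e'" "e' div 2 = lev Y j" "node Y j = tnode w (lo j) (hi j) e'"
      using assms(2) j unfolding canonical_def by blast
    ultimately have "e = e'"
      using crd[OF j] by (intro taken_unique[OF _ _ _ _ assms(3)[OF j], of "lo j" e "crd X j"]) (simp_all add: node_def)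
    then show ?thesis using e e' by simp
  qed
  have less: "X < 2 ^ (k1 * d + k2 * D)" "Y < 2 ^ (k1 * d + k2 * D)"
    using assms(1,2) by (simp_all add: canonical_def kN_def mult.commute)
  have "X mod 2 ^ (k1 * d) = Y mod 2 ^ (k1 * d)"
    by (rule dig_eqI[where D = d and c = k1]) (simp_all add: dig dig_mod)
  moreover have "X div 2 ^ (k1 * d) = Y div 2 ^ (k1 * d)"
  proof (rule dig_eqI[where D = D and c = k2])
    show "X div 2 ^ (k1 * d) < 2 ^ (k2 * D)" "Y div 2 ^ (k1 * d) < 2 ^ (k2 * D)"
      using less by (simp_all add: div_less_iff_less_mult power_add mult.commute)
  qed (use lev in \<open>simp add: lev_dig\<close>)
  ultimately show ?thesis by (metis div_mult_mod_eq)
qed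

text \<open>The code is assembled from the given indices and the levels of the taken nodes that
  \<open>ex_taken\<close> supplies.\<close>

lemma ex_canonical:
  assumes "\<And>i. i < d \<Longrightarrow> c i < n"
    and "\<And>j. j < D \<Longrightarrow> lo j \<le> cf (c (j div d)) (j mod d)" "\<And>j. j < D \<Longrightarrow> cf (c (j div d)) (j mod d) \<le> hi j"
  shows "\<exists>X \<in> canonical lo hi. \<forall>j<D. pix X j = c (j div d)"
proof -
  have c: "c i < 2 ^ k1" if "i < d" for i using assms(1)[OF that] k1 by linarith
  have jd: "j div d < d" "j mod d < d" if "j < D" for j
    using that d by (simp_all add: less_mult_imp_div_less)
  have "\<exists>e. taken w (lo j) (hi j) e \<and> anc w (cf (c (j div d)) (j mod d)) (e div 2) = tnode w (lo j) (hi j) e"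
    if "j < D" for j
    using ex_taken[OF assms(2,3)[OF that] cf[OF assms(1)[OF jd(1)[OF that]] jd(2)[OF that]]] .
  then obtain e where e: "\<And>j. j < D \<Longrightarrow> taken w (lo j) (hi j) (e j)"
      "\<And>j. j < D \<Longrightarrow> anc w (cf (c (j div d)) (j mod d)) (e j div 2) = tnode w (lo j) (hi j) (e j)"
    by metis
  have lw: "e j div 2 \<le> w" if "j < D" for j using e(1)[OF that] by (simp add: taken_def)
  then have "e j div 2 < 2 ^ k2" if "j < D" for j using lw[OF that] k2 by linarith
  then obtain b where b: "b < 2 ^ (k2 * D)" "\<forall>j<D. dig k2 b j = e j div 2"
    using ex_dig[of D "\<lambda>j. e j div 2" k2] by blast
  obtain a where a: "a < 2 ^ (k1 * d)" "\<forall>i<d. dig k1 a i = c i" using ex_dig[of d c k1] c by blast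
  define X where "X = b * 2 ^ (k1 * d) + a"
  have X: "X div 2 ^ (k1 * d) = b" "X mod 2 ^ (k1 * d) = a" using a(1) by (simp_all add: X_def)
  have pix: "pix X j = c (j div d)" if "j < D" for j
    using a(2) jd(1)[OF that] dig_mod[of "j div d" d k1 X] X(2) by (simp add: pix_dig)
  have lev: "lev X j = e j div 2" if "j < D" for j using b(2) that by (simp add: lev_dig X(1))
  have "X < Suc b * 2 ^ (k1 * d)" using a(1) by (simp add: X_def)
  also have "\<dots> \<le> 2 ^ (k2 * D) * 2 ^ (k1 * d)" using b(1) by (intro mult_le_mono1) simp
  also have "\<dots> = 2 ^ kN" by (simp add: kN_def power_add mult.commute)
  finally have "X < 2 ^ kN" .
  moreover have "valid X" using pix lev lw assms(1) jd(1) by (simp add: valid_def)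
  moreover have "\<forall>j<D. \<exists>e. taken w (lo j) (hi j) e \<and> e div 2 = lev X j \<and> node X j = tnode w (lo j) (hi j) e"
    using e pix lev by (auto simp: node_def crd_def)
  ultimately have "X \<in> canonical lo hi" by (simp add: canonical_def)
  then show ?thesis using pix by blast
qed

end

section \<open>Points and data structure in memory\<close>

lemma nth_concat_uniform:
  assumes "\<forall>xs \<in> set xss. length xs = c" "i < length xss" "a < c"
  shows "concat xss ! (c * i + a) = xss ! i ! a"
  using assms
proof (induction xss arbitrary: i)
  case (Cons xs xss)
  then show ?case by (cases i) (simp_all add: nth_append)
qed simp

lemma length_concat_uniform: "\<forall>xs \<in> set xss. length xs = c \<Longrightarrow> length (concat xss) = c * length xss"
  by (induction xss) simp_all

definition coord :: "(nat ^ 'd::{finite,linorder}) list \<Rightarrow> nat \<Rightarrow> nat \<Rightarrow> nat" where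
  "coord ps i a = ps ! i $ (indices ! a)"

text \<open>The reduction modulo \<open>2 ^ w\<close> changes no actual coordinate; it makes the
  rank bounded for arbitrary arguments, as \<open>dk_less\<close> demands.\<close>

definition dk :: "'d::{finite,linorder} itself \<Rightarrow> nat \<Rightarrow> (nat \<Rightarrow> nat) \<Rightarrow> nat" where
  "dk _ w z = drank w (\<chi> i a. int (z (pos i * CARD('d) + pos (a :: 'd)) mod 2 ^ w))"

lemma pos_less_square: "pos i * CARD('d) + pos a < CARD('d) * CARD('d)" for i a :: "'d::{finite,linorder}"
proof -
  have "pos i * CARD('d) + pos a < Suc (pos i) * CARD('d)" using pos_less[of a] by simp
  also have "\<dots> \<le> CARD('d) * CARD('d)" using pos_less[of i] by (intro mult_le_mono1) simp
  finally show ?thesis .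
qed

definition distE :: "'d::{finite,linorder} itself \<Rightarrow> nat \<Rightarrow> exp" where
  "distE _ \<beta> = rankE (entryE \<beta> :: 'd \<Rightarrow> 'd \<Rightarrow> exp)"

locale points = sizes +
  fixes ps :: "(nat ^ 'd::{finite,linorder}) list" and W :: nat
  assumes dim: "CARD('d) = d"
    and ps: "length ps = n" "i < n \<Longrightarrow> ps ! i $ a < 2 ^ w"
    and W: "word_bound \<le> W"
begin

sublocale T: tuples d n w k1 k2 Bd "coord ps" "dk TYPE('d) w"
proof unfold_locales
  show "dk TYPE('d) w z < 2 ^ Bd" for z
  proof -
    have "Bd = 3 * dbits d w + 2" by (simp add: Bd_def dbits_def)
    then show ?thesis unfolding dk_def using rank_less[where w = w and 'd = 'd]
      by (simp add: dim order.strict_implies_order)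
  qed
  show "dk TYPE('d) w z = dk TYPE('d) w z'" if "\<And>j. j < d * d \<Longrightarrow> z j = z' j" for z z'
    unfolding dk_def using that pos_less_square[where 'd = 'd] by (simp add: dim)
qed (use ps d k1_facts(1) k2_facts(1) in \<open>simp_all add: coord_def\<close>)

lemma T_simps: "T.kN = kN" "T.kD = Bd + kN" "T.Kb = Kb"
  by (simp_all add: T.kN_def T.kD_def T.Kb_def kN_def Kb_def)

definition good_memory :: "(nat \<Rightarrow> nat) \<Rightarrow> bool" where
  "good_memory m \<longleftrightarrow> m \<beta> = n \<and> m (\<beta> + 1) = w \<and> m (\<beta> + 2) = u \<and>
     (\<forall>i<n. \<forall>a<d. m (\<beta> + 3 + d * i + a) = coord ps i a)"

lemma pos_less_D: "pos i * d + pos a < d * d" for i a :: 'd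
  using pos_less_square[of i a] by (simp add: dim)

lemma good_memory_cong:
  assumes "good_memory m" "\<And>x. x < P0 \<Longrightarrow> m' x = m x"
  shows "good_memory m'"
proof -
  have "\<beta> + 3 + d * i + a < P0" if "i < n" "a < d" for i a
  proof -
    have "d * i + a < d * Suc i" using that by simp
    also have "\<dots> \<le> d * n" using that by (intro mult_le_mono2) simp
    finally show ?thesis by (simp add: P0_def)
  qed
  then show ?thesis using assms by (simp add: good_memory_def P0_def)
qed

lemma sized_machine: "good_memory m \<Longrightarrow> sized_machine d g n w u \<beta> W m"
  by unfold_locales (simp_all add: good_memory_def W)

lemma key_code:
  assumes m: "good_memory m"
  shows "key_code d n w k1 k2 Bd (coord ps) (dk TYPE('d) w) W pv m \<beta> (distE TYPE('d) \<beta>)"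
proof -
  interpret S: sized_machine d g n w u \<beta> W m by (rule sized_machine[OF m])
  have num: "2 * d < 2 ^ W" using S.exponents(8) by (intro S.lt_pow) linarith
  have Kb: "T.Kb + 2 < W" using S.exponents(1) unfolding T_simps by linarith
  have P0: "\<beta> + 3 + d * n < 2 ^ W" using S.address_chain(1) by (simp add: P0_def)
  have points: "i < n \<Longrightarrow> a < d \<Longrightarrow> m (\<beta> + 3 + d * i + a) = coord ps i a" for i a
    using m by (simp add: good_memory_def)
  \<comment> \<open>The lemma on evaluating coordinates belongs to \<open>key_code\<close>, which
    presupposes a correct program for the rank. A dummy instance with constant rank 0 gives access
    to this lemma, and the actual rank program is verified with it.\<close>
  have z: "tuples d n w k1 k2 Bd (coord ps) (\<lambda>_. 0)"
    by (unfold_locales, rule T.d, rule T.k1, rule T.k2, rule T.cf) simp_all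
  have base: "key_code_axioms d n w k1 k2 Bd (coord ps) (\<lambda>_. 0) W pv m \<beta> (Num 0)"
    by (rule key_code_axioms.intro)
      (use points num Kb P0 in \<open>simp_all add: pv_simps pv_simps(2)[unfolded One_nat_def] T_simps\<close>)
  interpret K0: key_code d n w k1 k2 Bd "coord ps" "\<lambda>_. 0" W pv m \<beta> "Num 0"
    by (rule key_code.intro[OF z base])
  show ?thesis
  proof (rule key_code.intro[OF T.tuples_axioms], unfold_locales)
    fix v :: "nat \<Rightarrow> nat" assume v: "v 0 < 2 ^ T.kN" "T.valid (v 0)"
    have pix: "T.pix (v 0) (pos i * d + pos a) < n" for i a :: 'd
      using v(2) pos_less_D[of i a] by (simp add: T.valid_def)
    have "eval W pv m (rankE (entryE \<beta> :: 'd \<Rightarrow> 'd \<Rightarrow> exp)) v =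
      drank w (\<chi> i a. int (T.crd (v 0) (pos i * d + pos (a :: 'd))))"
    proof (rule eval_rankE)
      fix i k :: 'd and v' :: "nat \<Rightarrow> nat" assume v': "v' 0 = v 0"
      have "pos i * d + pos k < 2 ^ W" using pos_less_D[of i k] S.bounds(2) by linarith
      then show "eval W pv m (entryE \<beta> i k) v' = T.crd (v 0) (pos i * d + pos k)"
        unfolding entryE_def dim using m v'
        by (intro K0.eval_crdE pix pos_less_D) (simp_all add: good_memory_def)
    next
      show "T.crd (v 0) (pos i * d + pos k) < 2 ^ w" for i k :: 'd
        by (rule T.crd_less[OF v(2) pos_less_D])
      show "pv 16 = 3 * dbits CARD('d) w + 2" "3 * dbits CARD('d) w + 2 < W"
        unfolding dim using S.bounds(7) by (simp_all add: pv_simps Bd_def dbits_def)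
    qed
    also have "\<dots> = dk TYPE('d) w (T.crd (v 0))"
      unfolding dk_def dim using T.crd_less[OF v(2) pos_less_D] by simp
    finally show "eval W pv m (distE TYPE('d) \<beta>) v = dk TYPE('d) w (T.crd (v 0))" by (simp add: distE_def)
  qed (use points num Kb P0 in \<open>simp_all add: pv_simps pv_simps(2)[unfolded One_nat_def] T_simps\<close>)
qed

end

locale seeded = points d g n w u \<beta> ps W
  for d g n w u \<beta> and ps :: "(nat ^ 'd::{finite,linorder}) list" and W +
  fixes rs :: "nat list"
  assumes rs: "length rs = 2 * (l * 2 ^ kt)"
begin

lemma W_facts: "2 * kN + 20 \<le> W" "Kb + 20 \<le> W" "kl + kB + kM + 20 \<le> W"
    "(k2 + 1) * (d * d) + 20 \<le> W" "2 * (d * d) + 1 < 2 ^ W"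
    "P3 + 2 ^ kN + 2 ^ kN + 1 < 2 ^ W" "P3 + l * 2 ^ kM + 1 < 2 ^ W"
proof -
  \<comment> \<open>The arithmetic facts are the same for all memories, so any memory with the right
    header serves.\<close>
  interpret S: sized_machine d g n w u \<beta> W "\<lambda>x. if x = \<beta> then n else if x = \<beta> + 1 then w else u"
    by unfold_locales (use W in simp_all)
  show "2 * kN + 20 \<le> W" "Kb + 20 \<le> W" "kl + kB + kM + 20 \<le> W"
    "(k2 + 1) * (d * d) + 20 \<le> W" "2 * (d * d) + 1 < 2 ^ W"
    "P3 + 2 ^ kN + 2 ^ kN + 1 < 2 ^ W" "P3 + l * 2 ^ kM + 1 < 2 ^ W"
    by (rule S.exponents S.bounds S.address)+
qed

sublocale I: index kN kt kB kM Kb l T.key W rs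
proof unfold_locales
  show "inj_on T.key {..<2 ^ kN}" using T.key_inj unfolding T_simps .
  show "T.key X < 2 ^ Kb" if "X < 2 ^ kN" for X using T.key_less[unfolded T_simps, OF that] .
  show "2 * kN \<le> W" using W_facts(1) by linarith
qed (rule kN_facts rs)+

definition data :: "(nat \<Rightarrow> nat) \<Rightarrow> bool" where
  "data m \<longleftrightarrow> good_memory m \<and> (\<forall>q < 2 * (l * 2 ^ kt). m (P0 + q) = rs ! q) \<and>
     (\<forall>c < 2 ^ kB. m (P1 + c) = I.A ! (c * 2 ^ kt)) \<and> (\<forall>q < l * 2 ^ kM. m (P2 + q) = I.T ! q)"

lemma bits_bound: "l * 2 ^ kB * 2 ^ kM \<le> 2 ^ (kl + kB + kM)"
  using l_facts(1) by (simp add: power_add)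

lemma build_data:
  assumes m: "good_memory m"
  shows "data (sem W pv (build_com (KE d \<beta> (distE TYPE('d) \<beta>))) v (put P0 rs m))"
proof -
  let ?m = "put P0 rs m"
  have low: "x < P0 \<Longrightarrow> ?m x = m x" for x by (simp add: put_def)
  have W2: "2 * kN + 2 < W" "kl + kB + kM < W" using W_facts by linarith+
  interpret B: build_code kN kt kB kM Kb l T.key W rs pv ?m "KE d \<beta> (distE TYPE('d) \<beta>)" P0 P1 P2 P3 "kl + kB + kM"
  proof unfold_locales
    show "P1 = P0 + 2 * (l * 2 ^ kt)" "P2 = P1 + 2 ^ kB" "P3 = P2 + l * 2 ^ kM" by (rule P1_def P2_def P3_def)+
    show "eval W pv m' (KE d \<beta> (distE TYPE('d) \<beta>)) v = T.key (v 0)"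
      if m': "\<forall>x < P0. m' x = ?m x" and v: "v 0 < 2 ^ kN" for m' v
    proof -
      have "good_memory m'" by (rule good_memory_cong[OF m]) (use m' low in simp)
      then interpret K: key_code d n w k1 k2 Bd "coord ps" "dk TYPE('d) w" W pv m' \<beta> "distE TYPE('d) \<beta>"
        by (rule key_code)
      show ?thesis by (rule K.eval_KE) (use v in \<open>simp add: T_simps\<close>)
    qed
    show "?m (P0 + q) = rs ! q" if "q < 2 * (l * 2 ^ kt)" for q using that by (simp add: put_def rs)
  qed (use W2 W_facts(6,7) bits_bound in \<open>simp_all add: pv_simps\<close>)
  let ?F = "sem W pv (build_com (KE d \<beta> (distE TYPE('d) \<beta>))) v ?m"
  note B.build_com[of v]
  then have F: "\<And>x. x < P1 \<Longrightarrow> ?F x = ?m x" "\<forall>c < 2 ^ kB. ?F (P1 + c) = I.A ! (c * 2 ^ kt)"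
    "\<forall>q < l * 2 ^ kM. ?F (P2 + q) = I.T ! q" by blast+
  have "P0 \<le> P1" by (simp add: P1_def)
  then have "good_memory ?F" using F(1) low by (intro good_memory_cong[OF m]) simp
  moreover have "\<forall>q < 2 * (l * 2 ^ kt). ?F (P0 + q) = rs ! q"
    using F(1) by (simp add: P1_def put_def rs)
  ultimately show ?thesis using F(2,3) by (simp add: data_def)
qed

text \<open>This refers to points and seeds but not to an address, so it carries over from the
  construction to the query, where the data structure lies elsewhere.\<close>

definition good :: bool where
  "good \<longleftrightarrow> good_index_axioms kN kt kM l T.key rs (kl + kM)"

lemma query:
  assumes m: "data m" and good: good and \<beta>: "d * d \<le> \<beta>"
    and lo: "\<And>j. j < d * d \<Longrightarrow> m (1 + 2 * d * (j div d) + j mod d) = lo j"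
      "\<And>j. j < d * d \<Longrightarrow> lo j < 2 ^ w"
    and hi: "\<And>j. j < d * d \<Longrightarrow> m (1 + d + 2 * d * (j div d) + j mod d) = hi j"
      "\<And>j. j < d * d \<Longrightarrow> hi j < 2 ^ w"
    and k: "1 \<le> m 0" "m 0 \<le> card {X \<in> T.canonical lo hi. 1 \<le> dk TYPE('d) w (T.crd X)}"
  shows "\<forall>j < d * d. sem W pv (query_com d \<beta> (distE TYPE('d) \<beta>)) v m j = T.crd (T.answer lo hi (m 0)) j"
proof -
  have gm: "good_memory m" using m by (simp add: data_def)
  interpret K: key_code d n w k1 k2 Bd "coord ps" "dk TYPE('d) w" W pv m \<beta> "distE TYPE('d) \<beta>"
    by (rule key_code[OF gm])
  have W2: "2 * kN + 2 < W" "Kb + 1 < W" "kl + kM < W" "P2 + l * 2 ^ kM < 2 ^ W" "P1 + 2 ^ kB < 2 ^ W"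
    "(k2 + 1) * (d * d) < W"
    using W_facts unfolding P3_def P2_def by linarith+
  have "(2 :: nat) ^ (kl + kB + kM) < 2 ^ W" using W_facts(3) by (intro power_strict_increasing) simp_all
  then have W3: "l * 2 ^ kB * 2 ^ kM < 2 ^ W" by (rule le_less_trans[OF bits_bound])
  interpret G: full_index_code kN kt kB kM Kb l T.key W rs pv m "KE d \<beta> (distE TYPE('d) \<beta>)" P0 P1 "kl + kM" P2
  proof (intro full_index_code.intro index_code.intro good_index.intro I.index_axioms)
    show "index_code_axioms kN kt kB l T.key W rs pv m (KE d \<beta> (distE TYPE('d) \<beta>)) P0 P1"
    proof (rule index_code_axioms.intro)
      show "eval W pv m (KE d \<beta> (distE TYPE('d) \<beta>)) v = T.key (v 0)" if "v 0 < 2 ^ kN" for v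
        by (rule K.eval_KE) (use that in \<open>simp add: T_simps\<close>)
    qed (use m W2 in \<open>simp_all add: pv_simps data_def P1_def\<close>)
    show "good_index_axioms kN kt kM l T.key rs (kl + kM)" using good by (simp add: good_def)
    show "full_index_code_axioms kN kt kB kM Kb l T.key W rs pv m (kl + kM) P2"
      by (rule full_index_code_axioms.intro) (use m W2 W3 in \<open>simp_all add: pv_simps data_def\<close>)
  qed
  have "query_code d n w k1 k2 Bd (coord ps) (dk TYPE('d) w) W pv m \<beta> (distE TYPE('d) \<beta>) kt kB kM l rs P0 P1 (kl + kM) P2 lo hi"
  proof (intro query_code.intro K.key_code_axioms)
    show "full_index_code T.kN kt kB kM T.Kb l T.key W rs pv m (KE d \<beta> (distE TYPE('d) \<beta>)) P0 P1 (kl + kM) P2"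
      unfolding T_simps by (rule G.full_index_code_axioms)
    show "query_code_axioms d w k1 k2 Bd W pv m lo hi"
      by (rule query_code_axioms.intro)
        (use lo hi W2 W_facts(5) in \<open>simp_all add: pv_simps T_simps\<close>)
  qed
  then interpret Q: query_code d n w k1 k2 Bd "coord ps" "dk TYPE('d) w" W pv m \<beta> "distE TYPE('d) \<beta>"
    kt kB kM l rs P0 P1 "kl + kM" P2 lo hi .
  have "T.answer lo hi (m 0) \<in> T.canonical lo hi" by (rule T.answer_correct[OF hi(2) k])
  then show ?thesis by (intro Q.query_com \<beta>) (simp add: T.canonical_def T.valid_def)
qed

end

section \<open>Boxes and the tuples in them\<close>

definition box_lo :: "('d::{finite,linorder}) boxes \<Rightarrow> nat \<Rightarrow> nat" where
  "box_lo B j = fst (B (indices ! (j div CARD('d)))) $ (indices ! (j mod CARD('d)))"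

definition box_hi :: "('d::{finite,linorder}) boxes \<Rightarrow> nat \<Rightarrow> nat" where
  "box_hi B j = snd (B (indices ! (j div CARD('d)))) $ (indices ! (j mod CARD('d)))"

lemma box_at:
  fixes B :: "('d::{finite,linorder}) boxes"
  shows "box_lo B (pos i * CARD('d) + pos a) = fst (B i) $ a" "box_hi B (pos i * CARD('d) + pos a) = snd (B i) $ a"
  using pos_less[of a] by (simp_all add: box_lo_def box_hi_def)

lemma in_box_set: "real_point p \<in> box_set b \<longleftrightarrow> (\<forall>a. fst b $ a \<le> p $ a \<and> p $ a \<le> snd b $ a)"
  by (simp add: box_set_def mem_box_cart real_point_def)

context points
begin

definition tuple_of :: "nat \<Rightarrow> 'd \<Rightarrow> (nat, 'd) vec" where
  "tuple_of X i = ps ! T.pix X (d * pos i)"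

lemma pos_dim: "pos i < d" for i :: 'd
  using pos_less[of i] by (simp add: dim)

lemma pix_pos: "T.pix X (pos i * d + pos a) = T.pix X (d * pos i)" for i a :: 'd
  using pos_dim[of a] pos_dim[of i] by (simp add: T.pix_dig mult.commute[of d])

lemma crd_tuple: "T.crd X (pos i * d + pos a) = tuple_of X i $ a"
  using pos_dim[of a] unfolding T.crd_def pix_pos by (simp add: tuple_of_def coord_def)

lemma flat_index:
  assumes "j < d * d"
  obtains i a :: 'd where "j = pos i * d + pos a"
proof
  have "j div d < CARD('d)" "j mod d < CARD('d)" using assms d by (simp_all add: dim less_mult_imp_div_less)
  then show "j = pos (indices ! (j div d) :: 'd) * d + pos (indices ! (j mod d) :: 'd)"
    by (simp add: pos_indices)
qed

lemma pix_less:
  fixes i :: 'd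
  assumes "T.valid X"
  shows "T.pix X (d * pos i) < n"
  using pix_pos[of X i i] pos_less_D[of i i] assms by (metis T.valid_def)

lemma tuple_less: "T.valid X \<Longrightarrow> tuple_of X i $ a < 2 ^ w"
  unfolding tuple_of_def by (rule ps(2)[OF pix_less])

lemma dk_tuple:
  assumes "T.valid X"
  shows "dk TYPE('d) w (T.crd X) = drank w (imat (tuple_of X))"
  unfolding dk_def dim crd_tuple imat_def using tuple_less[OF assms] by simp

text \<open>Indices and points correspond because \<open>ps\<close> is distinct, and the boxes
  determine the levels of a canonical code.\<close>

lemma bij_tuples:
  assumes "distinct ps"
    and B: "\<And>i. snd (B i) \<in> grid (2 ^ w)"
  shows "bij_betw tuple_of (T.canonical (box_lo B) (box_hi B))
    {p. \<forall>i. p i \<in> set ps \<and> real_point (p i) \<in> box_set (B i)}"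
proof -
  let ?C = "T.canonical (box_lo B) (box_hi B)"
  note box = box_at[where B = B, unfolded dim]
  have hi: "box_hi B j < 2 ^ w" if "j < d * d" for j
    using that B by (elim flat_index) (simp add: box grid_def)
  have valid: "T.valid X" if "X \<in> ?C" for X using that by (simp add: T.canonical_def)
  have inj: "inj_on tuple_of ?C"
  proof (rule inj_onI)
    fix X Y assume XY: "X \<in> ?C" "Y \<in> ?C" "tuple_of X = tuple_of Y"
    show "X = Y"
    proof (rule T.canonical_unique[OF XY(1,2) hi])
      fix k assume "k < d"
      then have k: "k = pos (indices ! k :: 'd)" by (simp add: pos_indices dim)
      have "tuple_of X (indices ! k) = tuple_of Y (indices ! k)" using XY(3) by simp
      then show "T.pix X (d * k) = T.pix Y (d * k)"
        using nth_eq_iff_index_eq[OF assms(1)] pix_less[OF valid[OF XY(1)], of "indices ! k"]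
          pix_less[OF valid[OF XY(2)], of "indices ! k"] k ps(1)
        by (simp add: tuple_of_def)
    qed
  qed
  have "tuple_of X i \<in> set ps \<and> real_point (tuple_of X i) \<in> box_set (B i)" if X: "X \<in> ?C" for X i
  proof -
    have "tuple_of X i \<in> set ps"
      unfolding tuple_of_def using pix_less[OF valid[OF X]] ps(1) by simp
    moreover have "fst (B i) $ a \<le> tuple_of X i $ a \<and> tuple_of X i $ a \<le> snd (B i) $ a" for a
      using T.canonical_bounds[OF X pos_less_D[of i a]] by (simp add: box crd_tuple)
    ultimately show ?thesis by (simp add: in_box_set)
  qed
  moreover have "\<exists>X \<in> ?C. p = tuple_of X"
    if p: "\<forall>i. p i \<in> set ps \<and> real_point (p i) \<in> box_set (B i)" for p
  proof -
    have "\<forall>i. \<exists>k<n. ps ! k = p i" using p ps(1) by (auto simp: in_set_conv_nth)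
    then obtain c where c: "\<And>i. c i < n" "\<And>i. ps ! c i = p i" by metis
    let ?c = "\<lambda>k. c (indices ! k)"
    have at: "coord ps (?c (j div d)) (j mod d) = p i $ a" "j div d = pos i" if "j = pos i * d + pos a" for i a j
      using pos_dim[of a] c(2) that by (simp_all add: coord_def)
    have b: "box_lo B j \<le> coord ps (?c (j div d)) (j mod d) \<and> coord ps (?c (j div d)) (j mod d) \<le> box_hi B j"
      if "j < d * d" for j
    proof -
      obtain i a :: 'd where j: "j = pos i * d + pos a" using flat_index[OF \<open>j < d * d\<close>] by blast
      have "real_point (p i) \<in> box_set (B i)" using p by blast
      then show ?thesis using at(1)[OF j] unfolding j by (simp add: box in_box_set)
    qed
    obtain X where X: "X \<in> ?C" "\<forall>j < d * d. T.pix X j = ?c (j div d)"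
      using T.ex_canonical[of ?c "box_lo B" "box_hi B"] c(1) b by blast
    have "tuple_of X i = p i" for i
    proof -
      have "T.pix X (d * pos i) = T.pix X (pos i * d + pos i)" by (simp add: pix_pos)
      also have "\<dots> = ?c (pos i)" using X(2) pos_less_D[of i i] pos_dim[of i] by simp
      finally show ?thesis unfolding tuple_of_def using c(2) by simp
    qed
    then show ?thesis using X(1) by (metis ext)
  qed
  ultimately have "tuple_of ` ?C = {p. \<forall>i. p i \<in> set ps \<and> real_point (p i) \<in> box_set (B i)}" by blast
  then show ?thesis using inj by (simp add: bij_betw_def)
qed

lemma answer_kth_largest:
  assumes "distinct ps"
    and B: "\<And>i. fst (B i) \<in> grid (2 ^ w)" "\<And>i. snd (B i) \<in> grid (2 ^ w)"
    and k: "k \<in> {1..card (spanning_tuples (set ps) B)}"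
  defines "X \<equiv> T.answer (box_lo B) (box_hi B) k"
  shows "k \<le> card {X \<in> T.canonical (box_lo B) (box_hi B). 1 \<le> dk TYPE('d) w (T.crd X)}"
    and "T.valid X" and "kth_largest origin_dist (spanning_tuples (set ps) B) k (tuple_of X)"
proof -
  let ?C = "T.canonical (box_lo B) (box_hi B)" and ?f = "\<lambda>X. dk TYPE('d) w (T.crd X)"
  let ?S = "spanning_tuples (set ps) B"
  have bij: "bij_betw tuple_of ?C {p. \<forall>i. p i \<in> set ps \<and> real_point (p i) \<in> box_set (B i)}"
    by (rule bij_tuples[OF assms(1) B(2)])
  have valid: "T.valid X" if "X \<in> ?C" for X using that by (simp add: T.canonical_def)
  have span: "1 \<le> ?f X \<longleftrightarrow> tuple_of X \<in> ?S" if X: "X \<in> ?C" for X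
  proof -
    have "tuple_of X \<in> {p. \<forall>i. p i \<in> set ps \<and> real_point (p i) \<in> box_set (B i)}"
      using bij X by (auto simp: bij_betw_def)
    then have "tuple_of X \<in> ?S \<longleftrightarrow> spans_hyperplane (tuple_of X)" by (simp add: spanning_tuples_def)
    then show ?thesis
      by (simp add: dk_tuple[OF valid[OF X]] spans_iff_nrm2 drank_def)
  qed
  \<comment> \<open>Counts of codes with positive rank become counts of spanning tuples, for any
    property that the bijection respects.\<close>
  have card: "card {Y \<in> ?C. 1 \<le> ?f Y \<and> P Y} = card {y \<in> ?S. Q y}"
    if PQ: "\<And>Y. Y \<in> ?C \<Longrightarrow> tuple_of Y \<in> ?S \<Longrightarrow> P Y \<longleftrightarrow> Q (tuple_of Y)" for P Q
  proof -
    have "tuple_of ` {Y \<in> ?C. 1 \<le> ?f Y \<and> P Y} = {y \<in> ?S. Q y}"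
    proof (intro equalityI subsetI)
      fix y assume y: "y \<in> {y \<in> ?S. Q y}"
      then have "y \<in> tuple_of ` ?C" using bij by (auto simp: bij_betw_def spanning_tuples_def)
      then obtain Y where "Y \<in> ?C" "y = tuple_of Y" by blast
      then show "y \<in> tuple_of ` {Y \<in> ?C. 1 \<le> ?f Y \<and> P Y}" using y PQ span by blast
    qed (use PQ span in blast)
    moreover have "inj_on tuple_of {Y \<in> ?C. 1 \<le> ?f Y \<and> P Y}"
      by (rule inj_on_subset[OF bij_betw_imp_inj_on[OF bij]]) blast
    then have "card (tuple_of ` {Y \<in> ?C. 1 \<le> ?f Y \<and> P Y}) = card {Y \<in> ?C. 1 \<le> ?f Y \<and> P Y}"
      by (rule card_image)
    ultimately show ?thesis by simp
  qed
  have "card {Y \<in> ?C. 1 \<le> ?f Y} = card ?S" using card[of "\<lambda>_. True" "\<lambda>_. True"] by simp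
  then show le: "k \<le> card {X \<in> ?C. 1 \<le> ?f X}" using k by simp
  have hi: "box_hi B j < 2 ^ w" if "j < d * d" for j
    using that B by (elim flat_index) (simp add: box_at[where B = B, unfolded dim] grid_def)
  have "1 \<le> k" using k by simp
  note ans = T.answer_correct[of "box_hi B" k "box_lo B", OF hi this le, folded X_def]
  show "T.valid X" by (rule valid[OF ans(1)])
  have X: "tuple_of X \<in> ?S" using span[OF ans(1)] ans(2) by simp
  have less: "?f Y < ?f Z \<longleftrightarrow> origin_dist (tuple_of Y) < origin_dist (tuple_of Z)"
    if "Y \<in> ?C" "Z \<in> ?C" "tuple_of Y \<in> ?S" "tuple_of Z \<in> ?S" for Y Z
    unfolding dk_tuple[OF valid[OF that(1)]] dk_tuple[OF valid[OF that(2)]]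
    using that tuple_less[OF valid] by (intro rank_less_iff) (simp_all add: spanning_tuples_def)
  have "card {y \<in> ?S. origin_dist (tuple_of X) < origin_dist y} = card {Y \<in> ?C. 1 \<le> ?f Y \<and> ?f X < ?f Y}"
    by (rule card[symmetric]) (use less ans(1) X in blast)
  also have "{Y \<in> ?C. 1 \<le> ?f Y \<and> ?f X < ?f Y} = {Y \<in> ?C. ?f X < ?f Y}" by auto
  finally have 1: "card {y \<in> ?S. origin_dist y > origin_dist (tuple_of X)} < k" using ans(3) by simp
  have "card {y \<in> ?S. origin_dist (tuple_of X) \<le> origin_dist y} = card {Y \<in> ?C. 1 \<le> ?f Y \<and> ?f X \<le> ?f Y}"
    by (rule card[symmetric]) (use less ans(1) X in \<open>meson not_le\<close>)
  also have "{Y \<in> ?C. 1 \<le> ?f Y \<and> ?f X \<le> ?f Y} = {Y \<in> ?C. ?f X \<le> ?f Y}" using ans(2) by auto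
  finally have 2: "k \<le> card {y \<in> ?S. origin_dist y \<ge> origin_dist (tuple_of X)}" using ans(4) by simp
  show "kth_largest origin_dist ?S k (tuple_of X)"
    unfolding kth_largest_def using X 1 2 by blast
qed

end

section \<open>Encodings and correctness of the two programs\<close>

lemma length_enc_point [simp]: "length (enc_point (p :: nat ^ 'd::{finite,linorder})) = CARD('d)"
  by (simp add: enc_point_def)

lemma nth_enc_point: "a < CARD('d) \<Longrightarrow> enc_point (p :: nat ^ 'd::{finite,linorder}) ! a = p $ (indices ! a)"
  by (simp add: enc_point_def)

lemma length_enc_query: "length (enc_query k (B :: ('d::{finite,linorder}) boxes)) = 1 + 2 * (CARD('d) * CARD('d))"
  by (simp add: enc_query_def length_concat_uniform[where c = "2 * CARD('d)"])

lemma nth_enc_query: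
  fixes B :: "('d::{finite,linorder}) boxes"
  assumes "j < CARD('d) * CARD('d)"
  shows "enc_query k B ! (1 + 2 * CARD('d) * (j div CARD('d)) + j mod CARD('d)) = box_lo B j"
    "enc_query k B ! (1 + CARD('d) + 2 * CARD('d) * (j div CARD('d)) + j mod CARD('d)) = box_hi B j"
proof -
  let ?d = "CARD('d)" and ?xss = "map (\<lambda>i. enc_point (fst (B i)) @ enc_point (snd (B i))) indices"
  have jd: "j div ?d < ?d" "j mod ?d < ?d" using assms by (simp_all add: less_mult_imp_div_less)
  note concat = nth_concat_uniform[of ?xss "2 * ?d" "j div ?d"]
  have jd2: "j mod ?d < 2 * ?d" "?d + j mod ?d < 2 * ?d" using jd(2) by linarith+
  have "concat ?xss ! (2 * ?d * (j div ?d) + j mod ?d) = ?xss ! (j div ?d) ! (j mod ?d)"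
    by (rule concat; (rule jd2)?) (simp_all add: jd)
  then show "enc_query k B ! (1 + 2 * ?d * (j div ?d) + j mod ?d) = box_lo B j"
    using jd by (simp add: enc_query_def box_lo_def nth_append nth_enc_point)
  have "concat ?xss ! (2 * ?d * (j div ?d) + (?d + j mod ?d)) = ?xss ! (j div ?d) ! (?d + j mod ?d)"
    by (rule concat; (rule jd2)?) (simp_all add: jd)
  then show "enc_query k B ! (1 + ?d + 2 * ?d * (j div ?d) + j mod ?d) = box_hi B j"
    using jd by (simp add: enc_query_def box_hi_def nth_append nth_enc_point ac_simps)
qed

text \<open>The stored words are the input, seeds, keys and packed chains but no addresses, so the
  block may be moved from address 0 to the place behind the query.\<close>

lemma data_shift:
  assumes "seeded d g n w u 0 ps W rs" "seeded d g n w u \<beta> ps W rs"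
    and data: "seeded.data d g n w u 0 ps rs F"
    and m: "\<And>x. x < sizes.P3 d g n w u 0 \<Longrightarrow> m (\<beta> + x) = F x"
  shows "seeded.data d g n w u \<beta> ps rs m"
proof -
  interpret A: seeded d g n w u 0 ps W rs by fact
  interpret B: seeded d g n w u \<beta> ps W rs by fact
  have shift: "B.P0 = \<beta> + A.P0" "B.P1 = \<beta> + A.P1" "B.P2 = \<beta> + A.P2"
    by (simp_all add: A.P0_def A.P1_def A.P2_def B.P0_def B.P1_def B.P2_def)
  have le: "3 + d * n = A.P0" "A.P0 + 2 * (A.l * 2 ^ A.kt) = A.P1" "A.P1 + 2 ^ A.kB = A.P2" "A.P2 + A.l * 2 ^ A.kM = A.P3"
    by (simp_all add: A.P0_def A.P1_def A.P2_def A.P3_def)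
  have m0: "m (\<beta> + x) = F x" if "x < A.P3" for x using m[OF that] .
  have pt: "d * i + a < d * n" if "i < n" "a < d" for i a
  proof -
    have "d * i + a < d * Suc i" using that by simp
    also have "\<dots> \<le> d * n" using that by (intro mult_le_mono2) simp
    finally show ?thesis .
  qed
  have header: "m \<beta> = F 0" "m (\<beta> + 1) = F 1" "m (\<beta> + 2) = F (Suc (Suc 0))"
    using m0[of 0] m0[of 1] m0[of 2] le by (simp_all add: numeral_2_eq_2)
  have points: "m (\<beta> + 3 + d * i + a) = F (3 + d * i + a)" if "i < n" "a < d" for i a
    using m0[of "3 + d * i + a"] pt[OF that] le by (simp add: add.assoc)
  have seeds: "m (\<beta> + A.P0 + q) = F (A.P0 + q)" if "q < 2 * (A.l * 2 ^ A.kt)" for q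
    using m0[of "A.P0 + q"] that le by (simp add: add.assoc)
  have samples: "m (\<beta> + A.P1 + q) = F (A.P1 + q)" if "q < 2 ^ A.kB" for q
    using m0[of "A.P1 + q"] that le by (simp add: add.assoc)
  have tables: "m (\<beta> + A.P2 + q) = F (A.P2 + q)" if "q < A.l * 2 ^ A.kM" for q
    using m0[of "A.P2 + q"] that le by (simp add: add.assoc)
  show ?thesis
    using data seeds samples tables header points
    unfolding A.data_def B.data_def A.good_memory_def B.good_memory_def shift
    by simp
qed

definition query_prog :: "'d::{finite,linorder} itself \<Rightarrow> nat \<Rightarrow> instr list" where
  "query_prog _ g = det_prog (par_exps CARD('d) g (1 + 2 * (CARD('d) * CARD('d))))
     (query_com CARD('d) (1 + 2 * (CARD('d) * CARD('d))) (distE TYPE('d) (1 + 2 * (CARD('d) * CARD('d)))))"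

definition build_prog :: "'d::{finite,linorder} itself \<Rightarrow> nat \<Rightarrow> instr list" where
  "build_prog _ g = rand_prog (par_exps CARD('d) g 0) 15 (Par 22)
     (build_com (KE CARD('d) 0 (distE TYPE('d) 0)))"

definition query_time :: "'d::{finite,linorder} itself \<Rightarrow> nat \<Rightarrow> (nat \<Rightarrow> nat) \<Rightarrow> nat" where
  "query_time _ g p = tpars (par_exps CARD('d) g (1 + 2 * (CARD('d) * CARD('d)))) p +
     tcom p (query_com CARD('d) (1 + 2 * (CARD('d) * CARD('d))) (distE TYPE('d) (1 + 2 * (CARD('d) * CARD('d)))))"

definition build_time :: "'d::{finite,linorder} itself \<Rightarrow> nat \<Rightarrow> (nat \<Rightarrow> nat) \<Rightarrow> nat" where
  "build_time _ g p = tpars (par_exps CARD('d) g 0) p + (texp p (Par 22) + 1 + p 15 * 9 + 2) +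
     tcom p (build_com (KE CARD('d) 0 (distE TYPE('d) 0)))"

lemma mem_init_append:
  "x < length xs \<Longrightarrow> mem (init (xs @ ys)) x = xs ! x"
  "y < length ys \<Longrightarrow> mem (init (xs @ ys)) (length xs + y) = ys ! y"
  by (simp_all add: init_def nth_append)

lemma enc_tuple_eq:
  fixes q :: "'d::{finite,linorder} \<Rightarrow> nat ^ 'd::{finite,linorder}"
  assumes "\<And>i a. c (pos i * CARD('d) + pos a) = q i $ a"
  shows "map c [0..<CARD('d) * CARD('d)] = enc_tuple q"
proof (rule nth_equalityI)
  show "length (map c [0..<CARD('d) * CARD('d)]) = length (enc_tuple q)"
    by (simp add: enc_tuple_def length_concat_uniform[where c = "CARD('d)"])
  fix j assume "j < length (map c [0..<CARD('d) * CARD('d)])"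
  then have j: "j < CARD('d) * CARD('d)" by simp
  have jd: "j div CARD('d) < CARD('d)" "j mod CARD('d) < CARD('d)" using j by (simp_all add: less_mult_imp_div_less)
  have "concat (map (\<lambda>i. enc_point (q i)) indices) ! (CARD('d) * (j div CARD('d)) + j mod CARD('d)) =
      map (\<lambda>i. enc_point (q i)) indices ! (j div CARD('d)) ! (j mod CARD('d))"
    by (rule nth_concat_uniform) (use jd in auto)
  then have "enc_tuple q ! j = q (indices ! (j div CARD('d))) $ (indices ! (j mod CARD('d)))"
    using jd by (simp add: enc_tuple_def nth_enc_point)
  also have "\<dots> = c j"
    using assms[of "indices ! (j div CARD('d))" "indices ! (j mod CARD('d))"] jd by (simp add: pos_indices)
  finally show "map c [0..<CARD('d) * CARD('d)] ! j = enc_tuple q ! j" using j by simp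
qed

lemma answers:
  fixes ps :: "(nat ^ 'd::{finite,linorder}) list" and d :: nat
  defines "\<beta> \<equiv> 1 + 2 * (CARD('d) * CARD('d))"
  assumes 0: "seeded d g n w u 0 ps W rs" and \<beta>: "seeded d g n w u \<beta> ps W rs"
    and distinct: "distinct ps"
    and data: "seeded.data d g n w u 0 ps rs F" and good: "seeded.good d g n w u ps rs"
    and t: "query_time TYPE('d) g (sizes.pv d g n w u \<beta>) \<le> t"
  shows "answers_queries W (query_prog TYPE('d) g) t w (set ps) (map F [0..<sizes.P3 d g n w u 0])"
  unfolding answers_queries_def
proof (intro allI impI ballI)
  fix k :: nat and B :: "'d boxes" and c :: config
  assume kW: "k < 2 ^ W" and B: "\<forall>i. fst (B i) \<in> grid (2 ^ w) \<and> snd (B i) \<in> grid (2 ^ w)"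
  interpret A: seeded d g n w u 0 ps W rs by fact
  interpret S: seeded d g n w u \<beta> ps W rs by fact
  have dim: "CARD('d) = d" by (rule A.dim)
  define ds where "ds = map F [0..<A.P3]"
  define m where "m = mem (init (enc_query k B @ ds))"
  assume "c \<in> set_pmf (run W (query_prog TYPE('d) g) t (init (enc_query k B @ map F [0..<A.P3])))"
  moreover have "init (enc_query k B @ ds) = cfg 0 (\<lambda>_. 0) m" by (simp add: m_def init_def)
  ultimately have c: "c \<in> set_pmf (run W (query_prog TYPE('d) g) t (cfg 0 (\<lambda>_. 0) m))"
    unfolding ds_def by simp
  have len: "length (enc_query k B) = \<beta>" unfolding \<beta>_def by (rule length_enc_query)
  have m\<beta>: "m (\<beta> + x) = F x" if "x < A.P3" for x
    using mem_init_append(2)[of x ds "enc_query k B"] that by (simp add: m_def len ds_def)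
  have mq: "m x = enc_query k B ! x" if "x < \<beta>" for x
    using mem_init_append(1)[of x "enc_query k B" ds] that by (simp add: m_def len)
  have dm: "S.data m" by (rule data_shift[OF 0 \<beta> data m\<beta>])
  then have "S.good_memory m" by (simp add: S.data_def)
  then interpret M: sized_machine d g n w u \<beta> W m by (rule S.sized_machine)
  have time: "tpars (par_exps d g \<beta>) S.pv + tcom S.pv (query_com d \<beta> (distE TYPE('d) \<beta>)) \<le> t"
    using t by (simp add: query_time_def dim \<beta>_def)
  have prog: "query_prog TYPE('d) g = det_prog (par_exps d g \<beta>) (query_com d \<beta> (distE TYPE('d) \<beta>))"
    by (simp add: query_prog_def dim \<beta>_def)
  \<comment> \<open>The query program draws no random words, so this configuration is its only
    outcome.\<close>
  obtain r where "run W (query_prog TYPE('d) g) t (cfg 0 (\<lambda>_. 0) m) =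
      return_pmf (cfg (length (query_prog TYPE('d) g)) r (sem W S.pv (query_com d \<beta> (distE TYPE('d) \<beta>)) (\<lambda>_. 0) m))"
    using det_prog_correct[OF M.params time] unfolding prog by blast
  then have c: "c = cfg (length (query_prog TYPE('d) g)) r (sem W S.pv (query_com d \<beta> (distE TYPE('d) \<beta>)) (\<lambda>_. 0) m)"
    using c by simp
  have halted: "halted (query_prog TYPE('d) g) c" by (simp add: c halted_def)
  have "\<exists>q :: 'd \<Rightarrow> (nat, 'd) vec. mem_block (CARD('d) * CARD('d)) c = enc_tuple q \<and> kth_hyperplane (set ps) B k (flat q)"
    if k: "k \<in> {1..card (spanning_tuples (set ps) B)}"
  proof -
    have m0: "m 0 = k" using mq[of 0] by (simp add: \<beta>_def enc_query_def)
    have B': "\<And>i. fst (B i) \<in> grid (2 ^ w)" "\<And>i. snd (B i) \<in> grid (2 ^ w)" using B by blast+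
    note ans = S.answer_kth_largest[OF distinct B' k]
    have address: "1 + 2 * d * (j div d) + j mod d < \<beta>" "1 + d + 2 * d * (j div d) + j mod d < \<beta>" if "j < d * d" for j
    proof -
      have "j div d < d" using that by (rule less_mult_imp_div_less)
      then have "Suc (j div d) \<le> d" by simp
      then have "2 * d * Suc (j div d) \<le> 2 * d * d" by (intro mult_le_mono2)
      moreover have "j mod d < d" using A.d by simp
      ultimately show "1 + 2 * d * (j div d) + j mod d < \<beta>" "1 + d + 2 * d * (j div d) + j mod d < \<beta>"
        by (simp_all add: \<beta>_def dim mult.assoc)
    qed
    have box_less: "box_lo B j < 2 ^ w" "box_hi B j < 2 ^ w" for j
      using B by (simp_all add: box_lo_def box_hi_def grid_def)
    have out: "\<forall>j < d * d. sem W S.pv (query_com d \<beta> (distE TYPE('d) \<beta>)) (\<lambda>_. 0) m j =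
        A.T.crd (A.T.answer (box_lo B) (box_hi B) (m 0)) j"
    proof (rule S.query)
      show "S.data m" by (rule dm)
      show "S.good" by (rule good)
      show "d * d \<le> \<beta>" by (simp add: \<beta>_def dim)
      show "m (1 + 2 * d * (j div d) + j mod d) = box_lo B j"
        "m (1 + d + 2 * d * (j div d) + j mod d) = box_hi B j" if "j < d * d" for j
        unfolding mq[OF address(1)[OF that]] mq[OF address(2)[OF that]]
        using nth_enc_query[of j k B, unfolded dim, OF that] .
      show "1 \<le> m 0" "m 0 \<le> card {X \<in> A.T.canonical (box_lo B) (box_hi B). 1 \<le> dk TYPE('d) w (A.T.crd X)}"
        unfolding m0 using k ans(1) by simp_all
    qed (rule box_less)+
    let ?q = "S.tuple_of (A.T.answer (box_lo B) (box_hi B) k)"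
    have "mem_block (CARD('d) * CARD('d)) c = enc_tuple ?q"
      unfolding mem_block_def
    proof (rule enc_tuple_eq)
      fix i a :: 'd
      show "mem c (pos i * CARD('d) + pos a) = ?q i $ a"
        using out S.pos_less_D[of i a] unfolding c dim m0 S.crd_tuple[symmetric] by simp
    qed
    moreover have "kth_hyperplane (set ps) B k (flat ?q)"
      unfolding kth_hyperplane_def using ans(3) by blast
    ultimately show ?thesis by blast
  qed
  then show "halted (query_prog TYPE('d) g) c \<and> (k \<in> {1..card (spanning_tuples (set ps) B)} \<longrightarrow>
      (\<exists>q :: 'd \<Rightarrow> (nat, 'd) vec. mem_block (CARD('d) * CARD('d)) c = enc_tuple q \<and> kth_hyperplane (set ps) B k (flat q)))"
    using halted by blast
qed

lemma length_enc_input: "length (enc_input \<alpha> w (ps :: (nat ^ 'd::{finite,linorder}) list)) = 3 + CARD('d) * length ps"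
  by (simp add: enc_input_def length_concat_uniform[where c = "CARD('d)"])

lemma nth_enc_input:
  fixes ps :: "(nat ^ 'd::{finite,linorder}) list"
  assumes "i < length ps" "a < CARD('d)"
  shows "enc_input \<alpha> w ps ! (3 + CARD('d) * i + a) = coord ps i a"
proof -
  have "concat (map enc_point ps) ! (CARD('d) * i + a) = map enc_point ps ! i ! a"
    by (rule nth_concat_uniform) (use assms in auto)
  then show ?thesis using assms by (simp add: enc_input_def coord_def nth_enc_point add.assoc)
qed

lemma length_rwords: "xs \<in> set_pmf (rwords W n) \<Longrightarrow> length xs = n"
  by (induction n arbitrary: xs) auto

text \<open>The event that all codes are covered depends on the seeds alone and implies that all
  queries are answered correctly, so its probability is a lower bound for the probability of
  success.\<close>

lemma construction:
  fixes ps :: "(nat ^ 'd::{finite,linorder}) list" and \<alpha> :: real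
  defines "\<beta> \<equiv> 1 + 2 * (CARD('d) * CARD('d))"
  assumes u: "u = nat \<lfloor>real n powr \<alpha>\<rfloor>"
    and 0: "points d g n w u 0 ps W" and \<beta>: "points d g n w u \<beta> ps W"
    and distinct: "distinct ps"
    and t: "query_time TYPE('d) g (sizes.pv d g n w u \<beta>) \<le> t"
    and s: "build_time TYPE('d) g (sizes.pv d g n w u 0) \<le> s"
  shows "1 - (1 / 2) ^ (g * sizes.k1 d n w) \<le>
    measure_pmf.prob (run W (build_prog TYPE('d) g) s (init (enc_input \<alpha> w ps)))
      {f. halted (build_prog TYPE('d) g) f \<and>
        answers_queries W (query_prog TYPE('d) g) t w (set ps) (mem_block (sizes.P3 d g n w u 0) f)}"
proof -
  interpret A: points d g n w u 0 ps W by fact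
  interpret S: points d g n w u \<beta> ps W by fact
  have dim: "CARD('d) = d" by (rule A.dim)
  define m where "m = mem (init (enc_input \<alpha> w ps))"
  have m: "m x = enc_input \<alpha> w ps ! x" if "x < 3 + d * n" for x
    using that by (simp add: m_def init_def length_enc_input dim A.ps(1))
  have pt: "3 + d * i + a < 3 + d * n" if "i < n" "a < d" for i a
  proof -
    have "d * i + a < d * Suc i" using that by simp
    also have "\<dots> \<le> d * n" using that by (intro mult_le_mono2) simp
    finally show ?thesis by simp
  qed
  have gm: "A.good_memory m"
    unfolding A.good_memory_def
  proof (intro conjI allI impI)
    show "m 0 = n" "m (0 + 1) = w" "m (0 + 2) = u"
      using m[of 0] m[of 1] m[of 2] by (simp_all add: enc_input_def A.ps(1) u numeral_2_eq_2)
    show "m (0 + 3 + d * i + a) = coord ps i a" if "i < n" "a < d" for i a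
      using m[OF pt[OF that]] nth_enc_input[of i ps a \<alpha> w, unfolded dim A.ps(1), OF that] by simp
  qed
  interpret M: sized_machine d g n w u 0 W m by (rule A.sized_machine[OF gm])
  let ?L = "2 * (A.l * 2 ^ A.kt)"
  let ?Q = "build_prog TYPE('d) g"
  let ?K = "KE d 0 (distE TYPE('d) 0)"
  let ?F = "\<lambda>xs. sem W A.pv (build_com ?K) (\<lambda>_. 0) (put A.P0 xs m)"
  have P0: "eval W A.pv m (Par 22) (\<lambda>_. 0) = A.P0" by (simp add: A.pv_simps)
  have L: "A.pv 15 = ?L" by (simp add: A.pv_simps)
  have "A.P0 + ?L < 2 ^ W" using M.address_chain(2) by (simp add: A.P1_def)
  then have fits: "eval W A.pv m (Par 22) (\<lambda>_. 0) + A.pv 15 < 2 ^ W" unfolding P0 L .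
  have time: "tpars (par_exps d g 0) A.pv + (texp A.pv (Par 22) + 1 + A.pv 15 * 9 + 2) + tcom A.pv (build_com ?K) \<le> s"
    using s unfolding build_time_def dim .
  have prog: "?Q = rand_prog (par_exps d g 0) 15 (Par 22) (build_com ?K)"
    by (simp add: build_prog_def dim)
  have "init (enc_input \<alpha> w ps) = cfg 0 (\<lambda>_. 0) m" by (simp add: m_def init_def)
  then obtain R where run: "run W ?Q s (init (enc_input \<alpha> w ps)) =
      map_pmf (\<lambda>xs. cfg (length ?Q) (R xs) (?F xs)) (rwords W ?L)"
    using rand_prog_correct[OF M.params fits time] unfolding prog P0 L by auto
  have seeded: "seeded d g n w u 0 ps W rs" "seeded d g n w u \<beta> ps W rs" if "length rs = ?L" for rs
    by (intro seeded.intro seeded_axioms.intro 0 \<beta> that)+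
  let ?good = "\<lambda>rs. \<forall>X<2 ^ A.kN. \<exists>s<A.l. rainbow.covered (2 ^ A.kt) (mshash A.kN)
    (index.bucket_of A.kN A.kt A.T.key) (2 ^ A.kM) (rainbow.block (2 ^ A.kt) s rs) X"
  \<comment> \<open>A sample list of the right length opens the locale; the event bounded by
    \<open>prob_good\<close> ranges over its own lists of seeds.\<close>
  interpret R: seeded d g n w u 0 ps W "replicate ?L 0" by (rule seeded(1)) simp
  have "1 - (1 / 2) ^ (g * A.k1) \<le> measure_pmf.prob (rwords W ?L) {rs. ?good rs}"
    by (rule R.I.prob_good) (rule A.l_def)
  also have "\<dots> \<le> measure_pmf.prob (rwords W ?L) {rs. halted ?Q (cfg (length ?Q) (R rs) (?F rs)) \<and>
        answers_queries W (query_prog TYPE('d) g) t w (set ps) (mem_block A.P3 (cfg (length ?Q) (R rs) (?F rs)))}"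
  proof (rule measure_pmf.finite_measure_mono_AE)
    show "AE rs in rwords W ?L. rs \<in> {rs. ?good rs} \<longrightarrow>
      rs \<in> {rs. halted ?Q (cfg (length ?Q) (R rs) (?F rs)) \<and>
        answers_queries W (query_prog TYPE('d) g) t w (set ps) (mem_block A.P3 (cfg (length ?Q) (R rs) (?F rs)))}"
      unfolding AE_measure_pmf_iff mem_Collect_eq
    proof (intro ballI impI conjI)
      fix rs assume rs: "rs \<in> set_pmf (rwords W ?L)" and good: "?good rs"
      have len: "length rs = ?L" using rs by (rule length_rwords)
      interpret B: seeded d g n w u 0 ps W rs by (rule seeded(1)[OF len])
      have "A.l * 2 ^ A.kM \<le> 2 ^ (A.kl + A.kM)" using A.l_facts(1) by (simp add: power_add)
      then have "B.good" unfolding B.good_def good_index_axioms_def using good by blast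
      moreover have "B.data (?F rs)" by (rule B.build_data[OF gm])
      ultimately show "answers_queries W (query_prog TYPE('d) g) t w (set ps)
          (mem_block A.P3 (cfg (length ?Q) (R rs) (?F rs)))"
        unfolding mem_block_def config.simps
        using answers[OF seeded(1)[OF len] seeded(2)[OF len, unfolded \<beta>_def] distinct _ _ t[unfolded \<beta>_def]]
        by blast
    qed (simp add: halted_def)
  qed simp
  also have "\<dots> = measure_pmf.prob (run W ?Q s (init (enc_input \<alpha> w ps)))
      {f. halted ?Q f \<and> answers_queries W (query_prog TYPE('d) g) t w (set ps) (mem_block A.P3 f)}"
    unfolding run measure_map_pmf by (simp add: vimage_def)
  finally show ?thesis .
qed

section \<open>Growth rates\<close>

text \<open>Soft O with a power of n as the main term. The real exponent is carried along, so that
  products of bounds become sums of exponents; exponent 0 means polylogarithmic.\<close>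

definition grows :: "real \<Rightarrow> (nat \<Rightarrow> nat) \<Rightarrow> bool" where
  "grows a f \<longleftrightarrow> (\<exists>C e. 0 \<le> C \<and> (\<forall>\<^sub>F n in sequentially. real (f n) \<le> C * real n powr a * ln (real n) ^ e))"

lemma ln_ge_1: "3 \<le> n \<Longrightarrow> 1 \<le> ln (real n)"
proof -
  assume "3 \<le> n"
  then have "exp 1 \<le> real n" using e_less_272 by simp
  then show ?thesis using \<open>3 \<le> n\<close> by (subst ln_ge_iff) auto
qed

lemma growsI:
  "0 \<le> C \<Longrightarrow> (\<And>n. 3 \<le> n \<Longrightarrow> real (f n) \<le> C * real n powr a * ln (real n) ^ e) \<Longrightarrow> grows a f"
  unfolding grows_def eventually_sequentially by blast

lemma growsD:
  assumes "grows a f"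
  shows "\<exists>C N e. 0 \<le> C \<and> 3 \<le> N \<and> (\<forall>n\<ge>N. real (f n) \<le> C * real n powr a * ln (real n) ^ e)"
proof -
  obtain C e N where *: "0 \<le> C" "\<forall>n\<ge>N. real (f n) \<le> C * real n powr a * ln (real n) ^ e"
    using assms unfolding grows_def eventually_sequentially by blast
  then show ?thesis by (intro exI[of _ C] exI[of _ "max N 3"] exI[of _ e]) simp
qed

lemma grows_eventually: "0 \<le> C \<Longrightarrow> (\<And>n. N \<le> n \<Longrightarrow> real (f n) \<le> C * real n powr a * ln (real n) ^ e) \<Longrightarrow> grows a f"
  unfolding grows_def eventually_sequentially by blast

lemma grows_soft_O: "grows a f \<Longrightarrow> f \<in> soft_O (\<lambda>n. real n powr a)"
proof -
  assume "grows a f"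
  then obtain C N e where *: "0 \<le> C" "3 \<le> N" "\<And>n. N \<le> n \<Longrightarrow> real (f n) \<le> C * real n powr a * ln (real n) ^ e"
    using growsD by blast
  have "(\<lambda>n. real (f n)) \<in> O(\<lambda>n. real n powr a * ln (real n) ^ e)"
  proof (rule bigoI[of _ C])
    show "\<forall>\<^sub>F n in sequentially. norm (real (f n)) \<le> C * norm (real n powr a * ln (real n) ^ e)"
      unfolding eventually_sequentially
    proof (intro exI[of _ N] allI impI)
      fix n assume "N \<le> n"
      then show "norm (real (f n)) \<le> C * norm (real n powr a * ln (real n) ^ e)"
        using *(3)[of n] ln_ge_1[of n] *(2) by (simp add: abs_mult mult.assoc)
    qed
  qed
  then show ?thesis unfolding soft_O_def by blast
qed

lemma polylog_grows: "polylog f \<Longrightarrow> grows 0 f"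
proof -
  assume "polylog f"
  then obtain e where "(\<lambda>n. real (f n)) \<in> O(\<lambda>n. ln (real n) ^ e)" unfolding polylog_def by blast
  then obtain C where C: "C > 0" "\<forall>\<^sub>F n in sequentially. norm (real (f n)) \<le> C * norm (ln (real n) ^ e)"
    by (elim landau_o.bigE)
  obtain N where N: "\<And>n. N \<le> n \<Longrightarrow> real (f n) \<le> C * norm (ln (real n) ^ e)"
    using C(2) unfolding eventually_sequentially by auto
  show ?thesis
  proof (rule grows_eventually[of C "max N 3"])
    fix n assume "max N 3 \<le> n"
    then show "real (f n) \<le> C * real n powr 0 * ln (real n) ^ e"
      using N[of n] ln_ge_1[of n] by simp
  qed (use C in simp)
qed

lemma grows_add:
  assumes "grows a f" "grows a g"
  shows "grows a (\<lambda>n. f n + g n)"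
proof -
  obtain C N e where 1: "0 \<le> C" "3 \<le> N" "\<And>n. N \<le> n \<Longrightarrow> real (f n) \<le> C * real n powr a * ln (real n) ^ e"
    using growsD[OF assms(1)] by blast
  obtain C' N' e' where 2: "0 \<le> C'" "3 \<le> N'" "\<And>n. N' \<le> n \<Longrightarrow> real (g n) \<le> C' * real n powr a * ln (real n) ^ e'"
    using growsD[OF assms(2)] by blast
  show ?thesis
  proof (rule grows_eventually[of "C + C'" "max N N'" _ _ "max e e'"])
    fix n assume n: "max N N' \<le> n"
    then have l: "1 \<le> ln (real n)" using 1(2) by (intro ln_ge_1) simp
    have "real (f n) \<le> C * real n powr a * ln (real n) ^ e" using 1(3) n by simp
    also have "\<dots> \<le> C * real n powr a * ln (real n) ^ max e e'"
      using 1(1) l by (intro mult_left_mono power_increasing) simp_all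
    finally have f: "real (f n) \<le> C * real n powr a * ln (real n) ^ max e e'" .
    have "real (g n) \<le> C' * real n powr a * ln (real n) ^ e'" using 2(3) n by simp
    also have "\<dots> \<le> C' * real n powr a * ln (real n) ^ max e e'"
      using 2(1) l by (intro mult_left_mono power_increasing) simp_all
    finally show "real (f n + g n) \<le> (C + C') * real n powr a * ln (real n) ^ max e e'"
      using f by (simp add: algebra_simps)
  qed (use 1 2 in simp)
qed

lemma grows_mult:
  assumes "grows a f" "grows b g"
  shows "grows (a + b) (\<lambda>n. f n * g n)"
proof -
  obtain C N e where 1: "0 \<le> C" "3 \<le> N" "\<And>n. N \<le> n \<Longrightarrow> real (f n) \<le> C * real n powr a * ln (real n) ^ e"
    using growsD[OF assms(1)] by blast
  obtain C' N' e' where 2: "0 \<le> C'" "3 \<le> N'" "\<And>n. N' \<le> n \<Longrightarrow> real (g n) \<le> C' * real n powr b * ln (real n) ^ e'"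
    using growsD[OF assms(2)] by blast
  show ?thesis
  proof (rule grows_eventually[of "C * C'" "max N N'" _ _ "e + e'"])
    fix n assume n: "max N N' \<le> n"
    then have l: "1 \<le> ln (real n)" using 1(2) by (intro ln_ge_1) simp
    have "real (f n) * real (g n) \<le> (C * real n powr a * ln (real n) ^ e) * (C' * real n powr b * ln (real n) ^ e')"
      using 1 2 n l by (intro mult_mono) simp_all
    then show "real (f n * g n) \<le> C * C' * real n powr (a + b) * ln (real n) ^ (e + e')"
      by (simp add: powr_add power_add ac_simps)
  qed (use 1 2 in simp)
qed

lemma grows_le: "grows a g \<Longrightarrow> (\<And>n. 3 \<le> n \<Longrightarrow> real (f n) \<le> real (g n)) \<Longrightarrow> grows a f"
proof -
  assume "grows a g" and le: "\<And>n. 3 \<le> n \<Longrightarrow> real (f n) \<le> real (g n)"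
  then obtain C N e where 1: "0 \<le> C" "3 \<le> N" "\<And>n. N \<le> n \<Longrightarrow> real (g n) \<le> C * real n powr a * ln (real n) ^ e"
    using growsD by blast
  show ?thesis by (rule grows_eventually[OF 1(1)], rule order_trans[OF le 1(3)]) (use 1(2) in auto)
qed

lemma grows_mono: "grows a f \<Longrightarrow> a \<le> b \<Longrightarrow> grows b f"
proof -
  assume ab: "a \<le> b" and "grows a f"
  then obtain C N e where 1: "0 \<le> C" "3 \<le> N" "\<And>n. N \<le> n \<Longrightarrow> real (f n) \<le> C * real n powr a * ln (real n) ^ e"
    using growsD by blast
  show ?thesis
  proof (rule grows_eventually[of C N _ _ e])
    fix n assume n: "N \<le> n"
    then have "C * real n powr a * ln (real n) ^ e \<le> C * real n powr b * ln (real n) ^ e"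
      using 1(1,2) ab ln_ge_1[of n] by (intro mult_right_mono mult_left_mono powr_mono) simp_all
    then show "real (f n) \<le> C * real n powr b * ln (real n) ^ e" using 1(3)[OF n] by simp
  qed (rule 1)
qed

lemma grows_const: "0 \<le> a \<Longrightarrow> grows a (\<lambda>_. c)"
proof (rule growsI[of c _ _ 0])
  fix n :: nat assume "0 \<le> a" "3 \<le> n"
  then have "1 \<le> real n powr a" by (intro ge_one_powr_ge_zero) simp_all
  then show "real c \<le> real c * real n powr a * ln (real n) ^ 0" by (simp add: mult_le_cancel_left1)
qed simp

lemma grows_mult0: "grows a f \<Longrightarrow> grows 0 g \<Longrightarrow> grows a (\<lambda>n. g n * f n)"
  using grows_mult[of 0 g a f] by simp

lemma grows_power: "grows a f \<Longrightarrow> grows (real k * a) (\<lambda>n. f n ^ k)"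
proof (induction k)
  case 0
  then show ?case using grows_const[of 0 1] by simp
next
  case (Suc k)
  then show ?case using grows_mult[of a f "real k * a" "\<lambda>n. f n ^ k"] by (simp add: algebra_simps)
qed

lemma grows_sum: "finite I \<Longrightarrow> 0 \<le> a \<Longrightarrow> (\<And>i. i \<in> I \<Longrightarrow> grows a (f i)) \<Longrightarrow> grows a (\<lambda>n. \<Sum>i\<in>I. f i n)"
proof (induction I rule: finite_induct)
  case empty
  then show ?case using grows_const[of a 0] by simp
qed (simp add: grows_add)

text \<open>This is meant for sizes of the order N / t, which are known only through a
  product.\<close>

lemma grows_quotient:
  assumes "grows a g" "\<And>n. 3 \<le> n \<Longrightarrow> real (f n) * real n powr b \<le> real (g n)"
  shows "grows (a - b) f"
proof -
  obtain C N e where 1: "0 \<le> C" "3 \<le> N" "\<And>n. N \<le> n \<Longrightarrow> real (g n) \<le> C * real n powr a * ln (real n) ^ e"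
    using growsD[OF assms(1)] by blast
  show ?thesis
  proof (rule grows_eventually[of C N _ _ e])
    fix n assume n: "N \<le> n"
    then have pos: "0 < real n powr b" using 1(2) by simp
    have "real (f n) * real n powr b \<le> C * real n powr a * ln (real n) ^ e"
      using assms(2)[of n] 1(2) 1(3)[OF n] n by linarith
    then show "real (f n) \<le> C * real n powr (a - b) * ln (real n) ^ e"
      using pos by (simp add: powr_diff field_simps)
  qed (rule 1)
qed

section \<open>Running times\<close>

definition costs :: "(nat \<Rightarrow> nat \<Rightarrow> nat) \<Rightarrow> real \<Rightarrow> exp \<Rightarrow> bool" where
  "costs p a e \<longleftrightarrow> grows a (\<lambda>n. texp (p n) e)"

definition costs_com :: "(nat \<Rightarrow> nat \<Rightarrow> nat) \<Rightarrow> real \<Rightarrow> com \<Rightarrow> bool" where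
  "costs_com p a c \<longleftrightarrow> grows a (\<lambda>n. tcom (p n) c)"

lemma costs_leaf: "0 \<le> a \<Longrightarrow> costs p a (Num c)" "0 \<le> a \<Longrightarrow> costs p a (Par j)" "0 \<le> a \<Longrightarrow> costs p a (Var x)"
  unfolding costs_def texp.simps by (rule grows_const, assumption)+

lemma costs_step:
  "0 \<le> a \<Longrightarrow> costs p a x \<Longrightarrow> costs p a y \<Longrightarrow> costs p a (Op f x y)"
  "0 \<le> a \<Longrightarrow> costs p a x \<Longrightarrow> costs p a (Read x)"
  "0 \<le> a \<Longrightarrow> costs p a x \<Longrightarrow> costs p a y \<Longrightarrow> costs p a (Bind i x y)"
  "0 \<le> a \<Longrightarrow> costs p a z \<Longrightarrow> costs p a x \<Longrightarrow> costs p a y \<Longrightarrow> costs p a (Cond z x y)"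
  unfolding costs_def texp.simps by (intro grows_add grows_const; assumption)+

text \<open>The exponent of the loop bound is added to that of the body; the start value is
  evaluated once and may cost as much as the whole loop.\<close>

lemma costs_loop:
  assumes "grows b (\<lambda>n. p n j)" "0 \<le> b" "0 \<le> a" "costs p (a + b) x" "costs p a y"
  shows "costs p (a + b) (Iter j i k x y)"
proof -
  have "grows (b + a) (\<lambda>n. p n j * (texp (p n) y + 7))"
    using assms by (intro grows_mult grows_add grows_const) (simp_all add: costs_def)
  then show ?thesis
    using assms unfolding costs_def texp.simps
    by (intro grows_add grows_const) (simp_all add: add.commute)
qed

lemma costs_loop0:
  "grows 0 (\<lambda>n. p n j) \<Longrightarrow> 0 \<le> a \<Longrightarrow> costs p a x \<Longrightarrow> costs p a y \<Longrightarrow> costs p a (Iter j i k x y)"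
  using costs_loop[of 0 p j a] by simp

lemma costs_mono: "costs p a e \<Longrightarrow> a \<le> b \<Longrightarrow> costs p b e"
  unfolding costs_def by (rule grows_mono)

lemma costs_com_step:
  "0 \<le> a \<Longrightarrow> costs p a x \<Longrightarrow> costs p a y \<Longrightarrow> costs_com p a (Write x y)"
  "costs_com p a c \<Longrightarrow> costs_com p a c' \<Longrightarrow> costs_com p a (Seq c c')"
  "costs p a x \<Longrightarrow> costs_com p a c \<Longrightarrow> costs_com p a (Local i x c)"
  unfolding costs_def costs_com_def tcom.simps by (intro grows_add grows_const; assumption)+

lemma costs_com_loop:
  assumes "grows b (\<lambda>n. p n j)" "0 \<le> b" "0 \<le> a" "costs_com p a c"
  shows "costs_com p (a + b) (For j i c)"
proof -
  have "grows (b + a) (\<lambda>n. p n j * (tcom (p n) c + 6))"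
    using assms by (intro grows_mult grows_add grows_const) (simp_all add: costs_com_def)
  then show ?thesis
    using assms unfolding costs_com_def tcom.simps
    by (intro grows_add grows_const) (simp_all add: add.commute)
qed

lemma costs_com_mono: "costs_com p a e \<Longrightarrow> a \<le> b \<Longrightarrow> costs_com p b e"
  unfolding costs_com_def by (rule grows_mono)

lemma costs_com_loop0: "grows 0 (\<lambda>n. p n j) \<Longrightarrow> 0 \<le> a \<Longrightarrow> costs_com p a c \<Longrightarrow> costs_com p a (For j i c)"
  using costs_com_loop[of 0 p j a] by simp

lemma costs_com_loop1: "grows a (\<lambda>n. p n j) \<Longrightarrow> 0 \<le> a \<Longrightarrow> costs_com p 0 c \<Longrightarrow> costs_com p a (For j i c)"
  using costs_com_loop[of a p j 0] by simp

lemma texp_mono: "(\<And>j. p j \<le> q j) \<Longrightarrow> texp p e \<le> texp q e"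
  by (induction e) (simp_all add: add_mono mult_le_mono)

text \<open>Hiding later parameters by \<open>below\<close> can only shorten loops, so the times
  under all parameters are upper bounds.\<close>

lemma grows_tpars:
  assumes "0 \<le> a" "\<And>e. e \<in> set es \<Longrightarrow> costs p a e"
  shows "grows a (\<lambda>n. tpars es (p n))"
proof (rule grows_le)
  show "grows a (\<lambda>n. \<Sum>i<length es. texp (p n) (es ! i) + 1)"
    using assms by (intro grows_sum grows_add grows_const) (simp_all add: costs_def)
  show "real (tpars es (p n)) \<le> real (\<Sum>i<length es. texp (p n) (es ! i) + 1)" for n
    unfolding tpars_def of_nat_le_iff
    by (intro sum_mono add_mono texp_mono) (simp_all add: below_def)
qed

lemma costs_sumE: "0 \<le> a \<Longrightarrow> (\<And>e. e \<in> set es \<Longrightarrow> costs p a e) \<Longrightarrow> costs p a (sumE es)"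
  by (induction es) (simp_all add: sumE_def costs_leaf costs_step)

lemma costs_prodE: "0 \<le> a \<Longrightarrow> (\<And>e. e \<in> set es \<Longrightarrow> costs p a e) \<Longrightarrow> costs p a (prodE es)"
  by (induction es) (simp_all add: prodE_def costs_leaf costs_step)

lemma costs_detE: "0 \<le> a \<Longrightarrow> (\<And>i k. costs p a (f i k)) \<Longrightarrow> costs p a (detE f)"
  unfolding detE_def by (intro costs_sumE) (auto intro!: costs_prodE costs_step costs_leaf)

lemma costs_distE: "costs p 0 (distE TYPE('d::{finite,linorder}) \<beta>)"
proof -
  have "costs p 0 (entryE \<beta> i a)" for i a :: 'd
    unfolding entryE_def crdE_def pixE_def pow2E_def by (intro costs_step costs_leaf order_refl)
  then show ?thesis
    unfolding distE_def rankE_def sqE_def pow2E_def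
    by (auto intro!: costs_step costs_leaf costs_detE costs_sumE)
qed

text \<open>The parameters in \<open>small\<close> are polylogarithmic. Of the others, 6 is t, 14
  and 15 count columns and seeds, about t^2, parameter 8 is N, and 13 and 29 are the numbers of
  chains and samples, about N / t.\<close>

locale growth =
  fixes p :: "nat \<Rightarrow> nat \<Rightarrow> nat" and d :: nat and \<alpha> :: real
  assumes \<alpha>: "0 < \<alpha>" "\<alpha> < 1" and d: "1 \<le> d"
    and small: "j \<in> {2, 3, 9, 17, 18, 19, 21, 27, 28, 30} \<Longrightarrow> grows 0 (\<lambda>n. p n j)"
    and p6: "grows (\<alpha> / 4) (\<lambda>n. p n 6)"
    and p14: "grows (\<alpha> / 2) (\<lambda>n. p n 14)" and p15: "grows (\<alpha> / 2) (\<lambda>n. p n 15)"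
    and p8: "grows (real d) (\<lambda>n. p n 8)"
    and p13: "grows (real d - \<alpha> / 4) (\<lambda>n. p n 13)" and p29: "grows (real d - \<alpha> / 4) (\<lambda>n. p n 29)"
begin

lemmas steps = costs_step costs_leaf costs_loop0

lemma costs_KE: "costs p 0 (KE d \<beta> (distE TYPE('d::{finite,linorder}) \<beta>))"
  unfolding KE_def validE_def codeE_def crdE_def levE_def pixE_def pow2E_def nlessE_def
  by (intro steps costs_distE order_refl small) simp_all

context
  fixes K :: exp
  assumes K: "costs p 0 K"
begin

lemma costs_keyE: "0 \<le> a \<Longrightarrow> costs p a x \<Longrightarrow> costs p a (keyE K x)"
  unfolding keyE_def by (intro steps) (auto intro: costs_mono[OF K])

lemma costs_fE: "0 \<le> a \<Longrightarrow> costs p a x \<Longrightarrow> costs p a (fE K x)"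
  unfolding fE_def bsE_def nlessE_def by (intro steps costs_keyE small) simp_all

lemma costs_hE: "0 \<le> a \<Longrightarrow> costs p a x \<Longrightarrow> costs p a y \<Longrightarrow> costs p a (hE x y)"
  unfolding hE_def by (intro steps) simp_all

lemma costs_walkE:
  assumes "costs p (\<alpha> / 4) s" "costs p (\<alpha> / 4) lo" "costs p (\<alpha> / 4) hi" "costs p (\<alpha> / 4) b"
  shows "costs p (\<alpha> / 4) (walkE K s lo hi b)"
proof -
  have "costs p (0 + \<alpha> / 4) (Iter 6 10 11 b
     (Cond (eAnd (nlessE (Var 11) (Var 8)) (eLess (Var 11) (Var 9)))
       (fE K (hE (eAdd (eMul (Var 7) (Par 6)) (Var 11)) (Var 10))) (Var 10)))"
    unfolding nlessE_def
    by (intro costs_loop p6 steps costs_fE costs_hE) (use assms \<alpha> in simp_all)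
  then show ?thesis
    unfolding walkE_def using assms \<alpha> by (intro costs_step) simp_all
qed

lemma costs_candE: "costs p (\<alpha> / 4) (candE K (Var i) (Var j))"
  unfolding candE_def bsE_def by (intro steps costs_walkE costs_hE small) (use \<alpha> in simp_all)

lemma costs_nextE:
  assumes "costs p (\<alpha> / 4 + \<alpha> / 2) x" "costs p (\<alpha> / 4 + \<alpha> / 2) y"
  shows "costs p (\<alpha> / 4 + \<alpha> / 2) (nextE K x y)"
  unfolding nextE_def nlessE_def
  by (intro costs_step assms costs_loop p14 costs_leaf costs_candE costs_keyE costs_fE) (use \<alpha> in simp_all)

lemma costs_accessE: "costs p \<alpha> x \<Longrightarrow> costs p \<alpha> (accessE K x)"
proof -
  assume x: "costs p \<alpha> x"
  have "costs p (\<alpha> / 4 + \<alpha> / 2 + \<alpha> / 4) (Iter 6 30 31 (Num 0)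
     (Cond (eLess (eMod (Var 29) (Par 6)) (Var 31)) (Var 30)
       (eAdd (nextE K (eDiv (Var 29) (Par 6)) (Var 30)) (Num 1))))"
    by (intro costs_step costs_loop p6 costs_leaf costs_nextE) (use \<alpha> in simp_all)
  also have "\<alpha> / 4 + \<alpha> / 2 + \<alpha> / 4 = \<alpha>" by simp
  finally show ?thesis
    unfolding accessE_def using x \<alpha> by (intro costs_step costs_leaf) simp_all
qed

lemma costs_lbE: "costs p \<alpha> z \<Longrightarrow> costs p \<alpha> (lbE K z)"
  unfolding lbE_def bsE_def nlessE_def by (intro steps costs_accessE small) (use \<alpha> in simp_all)

lemma costs_answerE: "costs p \<alpha> (answerE d K)"
  unfolding answerE_def bsE_def nlessE_def cntE_def qtakenE_def qcodeE_def takenE_def tnodeE_def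
    lowE_def highE_def halfE_def sideE_def digE_def loE_def hiE_def pow2E_def
  by (intro steps costs_lbE small) (use \<alpha> in simp_all)

end

lemma costs_query_com: "costs_com p \<alpha> (query_com d \<beta> (distE TYPE('d::{finite,linorder}) \<beta>))"
  unfolding query_com_def crdE_def pixE_def pow2E_def
  by (intro costs_com_step costs_answerE costs_KE costs_com_loop0 small steps) (use \<alpha> in simp_all)

lemma costs_sort_com:
  assumes "grows 0 (\<lambda>n. p n k)" "grows a (\<lambda>n. p n s)" "0 \<le> a"
  shows "costs_com p a (sort_com k s x y z)"
  unfolding sort_com_def half_com_def copy_com_def
  by (intro costs_com_step costs_com_loop0[of p k, OF assms(1)] costs_com_loop1[of a p s, OF assms(2)] assms(3) steps) simp_all

text \<open>Computing and sorting the keys takes about N steps. There are only about N / t chains,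
  but each takes about t steps, so they cost about N as well.\<close>

lemma costs_build_com: "costs_com p (real d) (build_com (KE d \<beta> (distE TYPE('d::{finite,linorder}) \<beta>)))"
proof -
  let ?K = "KE d \<beta> (distE TYPE('d) \<beta>)"
  have d': "1 \<le> real d" using d by simp
  have "costs_com p (real d) (For 8 90 (Write (eAdd (Par 25) (Var 90)) (keyE ?K (Var 90))))"
    by (intro costs_com_loop1 p8 costs_com_step steps costs_keyE costs_KE) simp_all
  moreover have "costs_com p (real d) (sort_com 18 8 25 32 33)"
    by (intro costs_sort_com small p8) simp_all
  moreover have "costs_com p (real d - \<alpha> / 4) (For 29 90 (Write (eAdd (Par 23) (Var 90))
      (Read (eAdd (Par 25) (eMul (Var 90) (Par 6))))))"
    by (intro costs_com_loop1 p29 costs_com_step steps) (use \<alpha> d' in simp_all)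
  then have "costs_com p (real d) (For 29 90 (Write (eAdd (Par 23) (Var 90))
      (Read (eAdd (Par 25) (eMul (Var 90) (Par 6))))))"
    by (rule costs_com_mono) (use \<alpha> in simp)
  moreover have "costs_com p (\<alpha> / 4 + (real d - \<alpha> / 4)) (For 13 90 (Write (eAdd (Par 24) (Var 90))
       (Bind 91 (eDiv (Var 90) (Par 11)) (Bind 92 (eMod (Var 90) (Par 11))
         (eAdd (eMul (eAdd (eMul (Var 91) (Par 29)) (walkE ?K (Var 91) (Num 0) (Par 6) (Var 92))) (Par 11)) (Var 92))))))"
    by (intro costs_com_loop p13 costs_com_step steps costs_walkE costs_KE) (use \<alpha> d' in simp_all)
  moreover have "costs_com p (real d - \<alpha> / 4) (sort_com 27 13 24 25 34)"
    by (intro costs_sort_com small p13) (use \<alpha> d' in simp_all)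
  then have "costs_com p (real d) (sort_com 27 13 24 25 34)"
    by (rule costs_com_mono) (use \<alpha> in simp)
  ultimately show ?thesis
    unfolding build_com_def by (intro costs_com_step) simp_all
qed

lemma costs_par_exps: "e \<in> set (par_exps d g \<beta>) \<Longrightarrow> costs p 0 e"
  unfolding par_exps_def pow2E_def nlessE_def
  by (auto intro!: steps small)

end

section \<open>Word size and growth of the parameters\<close>

definition word_factor :: "nat \<Rightarrow> nat \<Rightarrow> nat \<Rightarrow> nat" where
  "word_factor d g \<beta> = (1 + 1) * (d * d) + (1 + (6 * d * 1 + (6 * (d * d) + 3 * d + 2) + (d * 3 + d * d * 1))) +
     (3 + 3 + (d * 3 + d * d * 1 + g * 3)) + (d * 3 + d * d * 1) + (d * 3 + d * d * 1) + (d * 3 + d * d * 1) +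
     5 * 3 + (1 + 1) * (d * d) + \<beta> + 2 * d + g + 20"

text \<open>\<open>word_factor\<close> arises from \<open>word_bound\<close> by substituting 1 for w
  and \<open>k2\<close> and 3 for \<open>k1\<close> and \<open>kt\<close>, their bounds as multiples
  of f = w + floorlog 2 n. Constants are absorbed since f is at least 1.\<close>

lemma (in sizes) word_bound_le: "word_bound \<le> word_factor d g \<beta> * (w + floorlog 2 n)"
proof -
  define f where "f = w + floorlog 2 n"
  have fl: "1 \<le> floorlog 2 n" "n < 2 ^ floorlog 2 n"
    using n(1) floorlog_leD[of 2 n "floorlog 2 n"] by (simp_all add: floorlog_def)
  then have f: "1 \<le> f" by (simp add: f_def)
  have "2 ^ k1 < 8 * (2 :: nat) ^ floorlog 2 n" using k1_facts(2) fl(2) by linarith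
  also have "\<dots> = 2 ^ (floorlog 2 n + 3)" by (simp add: power_add)
  finally have "k1 < floorlog 2 n + 3" by (rule power_less_imp_less_exp[rotated]) simp
  then have k1: "k1 \<le> 3 * f" using fl f_def by linarith
  have w: "w \<le> 1 * f" by (simp add: f_def)
  have k2: "k2 \<le> 1 * f" using k2_facts(3) w by linarith
  have kt: "kt \<le> 3 * f" using kt_facts(3) k1 by linarith
  have add: "a \<le> c * f \<Longrightarrow> b \<le> c' * f \<Longrightarrow> a + b \<le> (c + c') * f" for a b c c'
    unfolding add_mult_distrib by (rule add_mono)
  have mul: "a \<le> c * f \<Longrightarrow> k * a \<le> k * c * f" "a \<le> c * f \<Longrightarrow> a * k \<le> c * k * f" for a c k
    using mult_le_mono2[of a "c * f" k] by (simp_all add: ac_simps)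
  have const: "k \<le> k * f" for k using f by simp
  have kN: "kN \<le> (d * 3 + d * d * 1) * f"
    unfolding kN_def by (intro add mul k1 k2)
  then have "kB \<le> (d * 3 + d * d * 1) * f" "kM \<le> (d * 3 + d * d * 1) * f" by (simp_all add: kB_def kM_def)
  then show ?thesis
    unfolding word_bound_def Kb_def kl_def Bd_def word_factor_def f_def[symmetric]
    by (intro add mul(1)[OF k1] mul(1)[OF w] mul(2) k1 k2 kN kt w const)
qed

definition usable :: "nat \<Rightarrow> (nat \<Rightarrow> nat) \<Rightarrow> nat \<Rightarrow> bool" where
  "usable d w n \<longleftrightarrow> 1 \<le> n \<and> n \<le> 2 ^ (d * w n)"

text \<open>If the grid has no room for n points, there is no input of that size and the values are
  set to 0; so growth can be stated for all n.\<close>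

definition vals :: "nat \<Rightarrow> nat \<Rightarrow> nat \<Rightarrow> (nat \<Rightarrow> nat) \<Rightarrow> real \<Rightarrow> nat \<Rightarrow> nat \<Rightarrow> nat" where
  "vals d g \<beta> w \<alpha> n j = (if usable d w n then sizes.pv d g n (w n) (nat \<lfloor>real n powr \<alpha>\<rfloor>) \<beta> j else 0)"

lemma root_bounds:
  assumes "0 < \<alpha>" "\<alpha> < 1" "1 \<le> n"
  shows "1 \<le> nat \<lfloor>real n powr \<alpha>\<rfloor>" "nat \<lfloor>real n powr \<alpha>\<rfloor> \<le> n"
    "real (nat \<lfloor>real n powr \<alpha>\<rfloor>) \<le> real n powr \<alpha>" "real n powr \<alpha> \<le> 2 * real (nat \<lfloor>real n powr \<alpha>\<rfloor>)"
proof -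
  have 1: "1 \<le> real n powr \<alpha>" using assms by (intro ge_one_powr_ge_zero) simp_all
  then have fl: "1 \<le> \<lfloor>real n powr \<alpha>\<rfloor>" by (simp add: le_floor_iff)
  then show "1 \<le> nat \<lfloor>real n powr \<alpha>\<rfloor>" by linarith
  have "real n powr \<alpha> \<le> real n powr 1" using assms by (intro powr_mono) simp_all
  then show "nat \<lfloor>real n powr \<alpha>\<rfloor> \<le> n" using assms by (simp add: nat_le_iff floor_le_iff)
  have eq: "real (nat \<lfloor>real n powr \<alpha>\<rfloor>) = real_of_int \<lfloor>real n powr \<alpha>\<rfloor>" using fl by simp
  show "real (nat \<lfloor>real n powr \<alpha>\<rfloor>) \<le> real n powr \<alpha>" unfolding eq by (rule of_int_floor_le)
  have "real n powr \<alpha> < real_of_int \<lfloor>real n powr \<alpha>\<rfloor> + 1" by simp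
  moreover have "1 \<le> real_of_int \<lfloor>real n powr \<alpha>\<rfloor>" using fl by simp
  ultimately show "real n powr \<alpha> \<le> 2 * real (nat \<lfloor>real n powr \<alpha>\<rfloor>)" unfolding eq by linarith
qed

locale scaling =
  fixes d g \<beta> :: nat and w :: "nat \<Rightarrow> nat" and \<alpha> :: real
  assumes d: "1 \<le> d" and \<alpha>: "0 < \<alpha>" "\<alpha> < 1" and w: "grows 0 w"
begin

abbreviation "U n \<equiv> nat \<lfloor>real n powr \<alpha>\<rfloor>"

lemma sizes: "usable d w n \<Longrightarrow> sizes d n (w n) (U n)"
  using root_bounds[OF \<alpha>, of n] d by (simp add: sizes_def usable_def)

definition guard :: "(nat \<Rightarrow> nat) \<Rightarrow> nat \<Rightarrow> nat" where
  "guard F n = (if usable d w n then F n else 0)"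

lemma grows_guard:
  assumes "grows a h" "\<And>n. 3 \<le> n \<Longrightarrow> usable d w n \<Longrightarrow> F n \<le> h n"
  shows "grows a (guard F)"
  by (rule grows_le[OF assms(1)]) (use assms(2) in \<open>simp add: guard_def\<close>)

abbreviation "K1 n \<equiv> sizes.k1 d n (w n)"
abbreviation "K2 n \<equiv> sizes.k2 d (w n)"
abbreviation "Kt n \<equiv> sizes.kt d n (w n) (U n)"
abbreviation "KN n \<equiv> sizes.kN d n (w n)"
abbreviation "KB n \<equiv> sizes.kB d n (w n) (U n)"
abbreviation "KM n \<equiv> sizes.kM d n (w n) (U n)"
abbreviation "L n \<equiv> sizes.l d g n (w n) (U n)"

lemma grows_k1: "grows 0 (guard K1)"
proof (rule growsI[of "(ln 8 + 1) / ln 2" _ _ 1])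
  fix n :: nat assume n: "3 \<le> n"
  have l: "1 \<le> ln (real n)" by (rule ln_ge_1[OF n])
  show "real (guard K1 n) \<le> (ln 8 + 1) / ln 2 * real n powr 0 * ln (real n) ^ 1"
  proof (cases "usable d w n")
    case True
    interpret S: sizes d g n "w n" "U n" 0 by (rule sizes[OF True])
    have "real (2 ^ S.k1) < real (8 * n)" using S.k1_facts(2) by (rule of_nat_less_iff[THEN iffD2])
    then have "ln (2 ^ S.k1) < ln (8 * real n)" using n by (subst ln_less_cancel_iff) simp_all
    then have "real S.k1 * ln 2 < ln 8 + ln (real n)" using n by (simp add: ln_mult ln_realpow)
    also have "\<dots> \<le> (ln 8 + 1) * ln (real n)"
      using mult_left_mono[OF l, of "ln 8"] by (simp add: algebra_simps)
    finally show ?thesis using True n by (simp add: guard_def field_simps)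
  qed (use l n in \<open>simp add: guard_def\<close>)
qed simp

lemma grows_pow_k1: "grows 1 (guard (\<lambda>n. 2 ^ K1 n))"
proof (rule grows_guard)
  show "grows 1 (\<lambda>n. 8 * n)" by (rule growsI[of 8 _ _ 0]) simp_all
  fix n assume "usable d w n"
  then interpret S: sizes d g n "w n" "U n" 0 by (rule sizes)
  show "2 ^ S.k1 \<le> 8 * n" using S.k1_facts(2) by simp
qed

lemma grows_k2: "grows 0 (guard K2)"
proof (rule grows_guard[OF w])
  fix n assume "usable d w n"
  then interpret S: sizes d g n "w n" "U n" 0 by (rule sizes)
  show "S.k2 \<le> w n" by (rule S.k2_facts)
qed

lemma grows_pow_k2: "grows 0 (guard (\<lambda>n. 2 ^ K2 n))"
proof (rule grows_guard)
  show "grows 0 (\<lambda>n. 2 * (w n + 1))" by (intro grows_mult0 grows_add grows_const w order_refl)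
  fix n assume "usable d w n"
  then interpret S: sizes d g n "w n" "U n" 0 by (rule sizes)
  show "2 ^ S.k2 \<le> 2 * (w n + 1)" by (rule S.k2_facts)
qed

lemma grows_kN: "grows 0 (guard KN)"
proof (rule grows_guard)
  show "grows 0 (\<lambda>n. d * guard K1 n + d * d * guard K2 n)"
    by (intro grows_add grows_mult0 grows_const grows_k1 grows_k2 order_refl)
  fix n assume u: "usable d w n"
  then interpret S: sizes d g n "w n" "U n" 0 by (rule sizes)
  show "S.kN \<le> d * guard K1 n + d * d * guard K2 n" using u by (simp add: guard_def S.kN_def)
qed

lemma grows_kt: "grows 0 (guard Kt)"
proof (rule grows_guard[OF grows_k1])
  fix n assume u: "usable d w n"
  then interpret S: sizes d g n "w n" "U n" 0 by (rule sizes)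
  show "S.kt \<le> guard K1 n" using u S.kt_facts(3) by (simp add: guard_def)
qed

lemma grows_kB: "grows 0 (guard KB)" and grows_kM: "grows 0 (guard KM)"
proof -
  have "KB n \<le> guard KN n \<and> KM n \<le> guard KN n" if u: "usable d w n" for n
  proof -
    interpret S: sizes d g n "w n" "U n" 0 by (rule sizes[OF u])
    show ?thesis using u by (simp add: guard_def S.kB_def S.kM_def)
  qed
  then show "grows 0 (guard KB)" "grows 0 (guard KM)" by (auto intro!: grows_guard[OF grows_kN])
qed

lemma powr_quarter: "(real n powr (\<alpha> / 4)) ^ 4 = real n powr \<alpha>"
proof -
  have "real n powr (\<alpha> / 4 + \<alpha> / 4 + \<alpha> / 4 + \<alpha> / 4) = (real n powr (\<alpha> / 4)) ^ 4"
    unfolding powr_add power4_eq_xxxx by (rule refl)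
  then show ?thesis by simp
qed

lemma pow_quarter: "(2 ^ k) ^ 4 = (2 :: 'a::comm_semiring_1) ^ (4 * k)"
  by (simp only: power_mult[symmetric] mult.commute)

lemma grows_t: "grows (\<alpha> / 4) (guard (\<lambda>n. 2 ^ Kt n))"
proof (rule growsI[of 1 _ _ 0])
  fix n :: nat assume n: "3 \<le> n"
  show "real (guard (\<lambda>n. 2 ^ Kt n) n) \<le> 1 * real n powr (\<alpha> / 4) * ln (real n) ^ 0"
  proof (cases "usable d w n")
    case True
    interpret S: sizes d g n "w n" "U n" 0 by (rule sizes[OF True])
    have "real (2 ^ (4 * S.kt)) \<le> real (U n)" using S.kt_facts(1) by (rule of_nat_mono)
    also have "\<dots> \<le> real n powr \<alpha>" using n by (intro root_bounds \<alpha>) simp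
    finally have "(2 ^ S.kt :: real) ^ 4 \<le> (real n powr (\<alpha> / 4)) ^ 4"
      unfolding powr_quarter pow_quarter by simp
    then have "(2 ^ S.kt :: real) \<le> real n powr (\<alpha> / 4)" by (subst (asm) power_mono_iff) simp_all
    then show ?thesis using True by (simp add: guard_def)
  qed (simp add: guard_def)
qed simp

text \<open>Rounding loses at most a factor 2 in u and at most 16 in t^4, so n^\<alpha> is at most
  32 * t^4, which is below (3 * t)^4.\<close>

lemma root_le_t:
  assumes "3 \<le> n" "usable d w n"
  shows "real n powr (\<alpha> / 4) \<le> 3 * 2 ^ Kt n"
proof -
  interpret S: sizes d g n "w n" "U n" 0 by (rule sizes[OF assms(2)])
  have "real (U n) \<le> real (2 ^ (4 * (S.kt + 1)))"
    using S.kt_facts(2) by (intro of_nat_mono) simp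
  also have "\<dots> = 16 * (2 ^ S.kt) ^ 4" unfolding pow_quarter by (simp add: power_add)
  finally have U: "real (U n) \<le> 16 * (2 ^ S.kt) ^ 4" .
  have "(real n powr (\<alpha> / 4)) ^ 4 \<le> 2 * real (U n)"
    unfolding powr_quarter using assms(1) by (intro root_bounds \<alpha>) simp
  also have "\<dots> \<le> 32 * (2 ^ S.kt) ^ 4" using U by linarith
  also have "\<dots> \<le> 81 * (2 ^ S.kt) ^ 4" by (intro mult_right_mono) simp_all
  also have "\<dots> = (3 * 2 ^ S.kt) ^ 4" unfolding power_mult_distrib by simp
  finally show ?thesis by (subst (asm) power_mono_iff) simp_all
qed

text \<open>The factor \<open>2 ^ k1\<close> is linear in n and occurs d times; the factors
  \<open>2 ^ k2\<close> for the levels are polylogarithmic.\<close>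

lemma grows_N: "grows (real d) (guard (\<lambda>n. 2 ^ KN n))"
proof (rule grows_guard)
  have "grows (real d * 1 + real (d * d) * 0) (\<lambda>n. guard (\<lambda>n. 2 ^ K1 n) n ^ d * guard (\<lambda>n. 2 ^ K2 n) n ^ (d * d))"
    by (intro grows_mult grows_power grows_pow_k1 grows_pow_k2)
  then show "grows (real d) (\<lambda>n. guard (\<lambda>n. 2 ^ K1 n) n ^ d * guard (\<lambda>n. 2 ^ K2 n) n ^ (d * d))" by simp
  fix n assume u: "usable d w n"
  then interpret S: sizes d g n "w n" "U n" 0 by (rule sizes)
  show "2 ^ S.kN \<le> guard (\<lambda>n. 2 ^ K1 n) n ^ d * guard (\<lambda>n. 2 ^ K2 n) n ^ (d * d)"
    using u unfolding guard_def S.kN_def power_add by (simp only: if_True power_mult[symmetric] mult.commute order_refl)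
qed

lemma grows_kNk1: "grows 0 (\<lambda>n. guard KN n + g * guard K1 n)"
  by (intro grows_add grows_mult0 grows_const grows_k1 grows_kN order_refl)

lemma grows_l: "grows (\<alpha> / 4) (guard L)"
proof (rule grows_guard)
  show "grows (\<alpha> / 4) (\<lambda>n. (guard KN n + g * guard K1 n) * (8 * guard (\<lambda>n. 2 ^ Kt n) n))"
    by (intro grows_mult0[OF grows_mult0[OF grows_t] grows_kNk1] grows_const order_refl)
  fix n assume u: "usable d w n"
  then interpret S: sizes d g n "w n" "U n" 0 by (rule sizes)
  show "S.l \<le> (guard KN n + g * guard K1 n) * (8 * guard (\<lambda>n. 2 ^ Kt n) n)"
    using u by (simp add: guard_def S.l_def)
qed

lemma grows_lt: "grows (\<alpha> / 2) (guard (\<lambda>n. L n * 2 ^ Kt n))"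
proof (rule grows_guard)
  have "grows (\<alpha> / 4 + \<alpha> / 4) (\<lambda>n. guard L n * guard (\<lambda>n. 2 ^ Kt n) n)"
    by (intro grows_mult grows_l grows_t)
  then show "grows (\<alpha> / 2) (\<lambda>n. guard L n * guard (\<lambda>n. 2 ^ Kt n) n)" by simp
qed (simp add: guard_def)

lemma grows_2lt: "grows (\<alpha> / 2) (guard (\<lambda>n. 2 * (L n * 2 ^ Kt n)))"
proof (rule grows_guard)
  show "grows (\<alpha> / 2) (\<lambda>n. 2 * guard (\<lambda>n. L n * 2 ^ Kt n) n)"
    by (intro grows_mult0[OF grows_lt] grows_const order_refl)
qed (simp add: guard_def)

lemma grows_B: "grows (real d - \<alpha> / 4) (guard (\<lambda>n. 2 ^ KB n))"
proof (rule grows_quotient)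
  show "grows (real d) (\<lambda>n. 3 * guard (\<lambda>n. 2 ^ KN n) n)"
    by (intro grows_mult0[OF grows_N] grows_const order_refl)
  fix n :: nat assume n: "3 \<le> n"
  show "real (guard (\<lambda>n. 2 ^ KB n) n) * real n powr (\<alpha> / 4) \<le> real (3 * guard (\<lambda>n. 2 ^ KN n) n)"
  proof (cases "usable d w n")
    case True
    interpret S: sizes d g n "w n" "U n" 0 by (rule sizes[OF True])
    have "2 ^ S.kB * real n powr (\<alpha> / 4) \<le> 2 ^ S.kB * (3 * 2 ^ S.kt)"
      by (intro mult_left_mono root_le_t n True) simp
    also have "\<dots> = 3 * 2 ^ S.kN" by (simp add: S.kN_facts(2) power_add)
    finally show ?thesis using True by (simp add: guard_def)
  qed (simp add: guard_def)
qed

text \<open>As N = 4 * M * t^2, the product l * M * t is 2 * N times a polylogarithmic factor.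
  Dividing by t, which is at least a third of n^(\<alpha> / 4), gives the exponent.\<close>

lemma grows_lM: "grows (real d - \<alpha> / 4) (guard (\<lambda>n. L n * 2 ^ KM n))"
proof (rule grows_quotient)
  show "grows (real d) (\<lambda>n. (guard KN n + g * guard K1 n) * (6 * guard (\<lambda>n. 2 ^ KN n) n))"
    by (intro grows_mult0[OF grows_mult0[OF grows_N] grows_kNk1] grows_const order_refl)
  fix n :: nat assume n: "3 \<le> n"
  show "real (guard (\<lambda>n. L n * 2 ^ KM n) n) * real n powr (\<alpha> / 4) \<le>
    real ((guard KN n + g * guard K1 n) * (6 * guard (\<lambda>n. 2 ^ KN n) n))"
  proof (cases "usable d w n")
    case True
    interpret S: sizes d g n "w n" "U n" 0 by (rule sizes[OF True])
    have N: "(2 :: real) ^ S.kN = 4 * (2 ^ S.kM * (2 ^ S.kt * 2 ^ S.kt))"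
      unfolding S.kN_facts(3) power_add mult_2[of S.kt] by simp
    have "real (S.l * 2 ^ S.kM) * real n powr (\<alpha> / 4) \<le> real (S.l * 2 ^ S.kM) * (3 * 2 ^ S.kt)"
      by (intro mult_left_mono root_le_t n True) simp
    also have "\<dots> = real (S.kN + g * S.k1) * (6 * 2 ^ S.kN)"
      unfolding N S.l_def by (simp only: of_nat_mult of_nat_power of_nat_numeral) (simp add: ac_simps)
    finally show ?thesis using True by (simp add: guard_def)
  qed (simp add: guard_def)
qed

lemma vals_grow: "growth (vals d g \<beta> w \<alpha>) d \<alpha>"
proof
  have eq: "vals d g \<beta> w \<alpha> n j = guard (\<lambda>n. sizes.pv d g n (w n) (U n) \<beta> j) n" for n j
    by (simp add: vals_def guard_def)
  note simps = sizes.pv_simps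
  show "grows (\<alpha> / 4) (\<lambda>n. vals d g \<beta> w \<alpha> n 6)"
    by (rule grows_le[OF grows_t]) (simp add: eq guard_def simps[OF sizes])
  show "grows (\<alpha> / 2) (\<lambda>n. vals d g \<beta> w \<alpha> n 14)"
    by (rule grows_le[OF grows_lt]) (simp add: eq guard_def simps[OF sizes])
  show "grows (\<alpha> / 2) (\<lambda>n. vals d g \<beta> w \<alpha> n 15)"
    by (rule grows_le[OF grows_2lt]) (simp add: eq guard_def simps[OF sizes])
  show "grows (real d) (\<lambda>n. vals d g \<beta> w \<alpha> n 8)"
    by (rule grows_le[OF grows_N]) (simp add: eq guard_def simps[OF sizes])
  show "grows (real d - \<alpha> / 4) (\<lambda>n. vals d g \<beta> w \<alpha> n 13)"
    by (rule grows_le[OF grows_lM]) (simp add: eq guard_def simps[OF sizes])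
  show "grows (real d - \<alpha> / 4) (\<lambda>n. vals d g \<beta> w \<alpha> n 29)"
    by (rule grows_le[OF grows_B]) (simp add: eq guard_def simps[OF sizes])
  note zero = grows_add grows_mult0 grows_const w grows_k1 grows_k2 grows_kN grows_kt grows_kB grows_kM order_refl
  have Bd: "grows 0 (\<lambda>n. 6 * d * w n + (6 * (d * d) + 3 * d + 2) + guard KN n)" by (intro zero)
  have kl: "grows 0 (\<lambda>n. guard Kt n + 3 + (guard KN n + g * guard K1 n))" by (intro zero)
  have pow: "grows 0 (\<lambda>n. (2 * guard (\<lambda>n. 2 ^ K2 n) n) ^ (d * d))"
    using grows_power[OF grows_mult0[OF grows_pow_k2 grows_const[of 0 2]], of "d * d"] by simp
  have Kb: "grows 0 (\<lambda>n. d * d * (w n + 1) + (1 + (6 * d * w n + (6 * (d * d) + 3 * d + 2) + guard KN n)))"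
    by (intro zero)
  have "grows 0 (\<lambda>n. d * w n + 3)" by (intro zero)
  then have "grows 0 (\<lambda>n. vals d g \<beta> w \<alpha> n 2)"
    by (rule grows_le) (simp add: eq guard_def simps[OF sizes])
  moreover have "grows 0 (\<lambda>n. vals d g \<beta> w \<alpha> n 3)"
    by (rule grows_le[OF grows_k1]) (simp add: eq guard_def simps[OF sizes])
  moreover have "grows 0 (\<lambda>n. vals d g \<beta> w \<alpha> n 9)"
    by (rule grows_le[OF grows_kB]) (simp add: eq guard_def simps[OF sizes])
  moreover have "grows 0 (\<lambda>n. vals d g \<beta> w \<alpha> n 17)"
    by (rule grows_le[OF Bd]) (simp add: eq guard_def simps[OF sizes] sizes.Bd_def[OF sizes])
  moreover have "grows 0 (\<lambda>n. vals d g \<beta> w \<alpha> n 18)"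
    by (rule grows_le[OF Kb]) (simp add: eq guard_def simps[OF sizes] sizes.Bd_def[OF sizes] sizes.Kb_def[OF sizes])
  moreover have "grows 0 (\<lambda>n. vals d g \<beta> w \<alpha> n 19)"
    by (rule grows_le[OF grows_const[of 0 "d * d"]]) (simp_all add: eq guard_def simps[OF sizes])
  moreover have "grows 0 (\<lambda>n. vals d g \<beta> w \<alpha> n 21)"
  proof (rule grows_le[OF pow])
    fix n
    have "2 ^ ((K2 n + 1) * (d * d)) = (2 * 2 ^ K2 n :: nat) ^ (d * d)"
      unfolding power_mult power_add power_one_right mult.commute[of _ "2 :: nat"] by (rule refl)
    then show "real (vals d g \<beta> w \<alpha> n 21) \<le> real ((2 * guard (\<lambda>n. 2 ^ K2 n) n) ^ (d * d))"
      by (cases "usable d w n") (simp_all only: eq guard_def simps(22)[OF sizes] if_True if_False order_refl of_nat_0 of_nat_0_le_iff)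
  qed
  moreover have "grows 0 (\<lambda>n. guard Kt n + 3 + (guard KN n + g * guard K1 n) + guard KB n + guard KM n)"
    by (intro zero)
  then have "grows 0 (\<lambda>n. vals d g \<beta> w \<alpha> n 27)"
    by (rule grows_le) (simp add: eq guard_def simps[OF sizes] sizes.kl_def[OF sizes])
  moreover have "grows 0 (\<lambda>n. guard Kt n + 3 + (guard KN n + g * guard K1 n) + guard KM n)"
    by (intro zero)
  then have "grows 0 (\<lambda>n. vals d g \<beta> w \<alpha> n 28)"
    by (rule grows_le) (simp add: eq guard_def simps[OF sizes] sizes.kl_def[OF sizes])
  moreover have "grows 0 (\<lambda>n. guard KN n + 1)" by (intro zero)
  then have "grows 0 (\<lambda>n. vals d g \<beta> w \<alpha> n 30)"
    by (rule grows_le) (simp add: eq guard_def simps[OF sizes])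
  ultimately show "grows 0 (\<lambda>n. vals d g \<beta> w \<alpha> n j)" if "j \<in> {2, 3, 9, 17, 18, 19, 21, 27, 28, 30}" for j
    using that by auto
qed (use \<alpha> d in simp_all)

end

context scaling
begin

text \<open>The free words are subtracted here and added again in the theorem; by
  \<open>space_free\<close> the truncated subtraction is exact.\<close>

definition space :: "nat \<Rightarrow> nat" where
  "space n = guard (\<lambda>n. sizes.P3 d g n (w n) (U n) 0) n - free_words d n"

lemma space_free: "usable d w n \<Longrightarrow> space n + free_words d n = sizes.P3 d g n (w n) (U n) 0"
proof -
  assume u: "usable d w n"
  interpret S: sizes d g n "w n" "U n" 0 by (rule sizes[OF u])
  have "free_words d n \<le> S.P3" by (simp add: free_words_def S.P3_def S.P2_def S.P1_def S.P0_def)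
  then show ?thesis using u by (simp add: space_def guard_def)
qed

text \<open>For d = 1 the words of the points are the free ones; for larger d they are dominated
  because 1 \<le> d - \<alpha> / 4.\<close>

lemma grows_space: "grows (real d - \<alpha> / 4) space"
proof (rule grows_le)
  have le: "\<alpha> / 2 \<le> real d - \<alpha> / 4" "0 \<le> real d - \<alpha> / 4" using \<alpha> d by simp_all
  have pts: "grows (real d - \<alpha> / 4) (\<lambda>n. if d = 1 then 0 else d * n)"
  proof (cases "d = 1")
    case False
    then have "1 \<le> real d - \<alpha> / 4" using d \<alpha> by simp
    moreover have "grows 1 (\<lambda>n. n)" by (rule growsI[of 1 _ _ 0]) simp_all
    ultimately have "grows (real d - \<alpha> / 4) (\<lambda>n. n)" by (rule grows_mono[rotated])
    from grows_mult0[OF this grows_const[of 0 d]] show ?thesis using False by simp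
  qed (use le grows_const[of "real d - \<alpha> / 4" 0] in simp)
  show "grows (real d - \<alpha> / 4) (\<lambda>n. 3 + (if d = 1 then 0 else d * n) + guard (\<lambda>n. 2 * (L n * 2 ^ Kt n)) n
      + guard (\<lambda>n. 2 ^ KB n) n + guard (\<lambda>n. L n * 2 ^ KM n) n)"
    by (rule grows_add[OF grows_add[OF grows_add[OF grows_add[OF grows_const[OF le(2)] pts]
      grows_mono[OF grows_2lt le(1)]] grows_B] grows_lM])
  fix n :: nat
  show "real (space n) \<le> real (3 + (if d = 1 then 0 else d * n) + guard (\<lambda>n. 2 * (L n * 2 ^ Kt n)) n
      + guard (\<lambda>n. 2 ^ KB n) n + guard (\<lambda>n. L n * 2 ^ KM n) n)"
  proof (cases "usable d w n")
    case True
    interpret S: sizes d g n "w n" "U n" 0 by (rule sizes[OF True])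
    show ?thesis
      unfolding of_nat_le_iff using True
      by (simp add: space_def guard_def free_words_def S.P3_def S.P2_def S.P1_def S.P0_def)
  qed (simp add: space_def guard_def)
qed

end

section \<open>Total running times and the theorem\<close>

lemma grows_query_time:
  assumes "growth p CARD('d::{finite,linorder}) \<alpha>"
  shows "grows \<alpha> (\<lambda>n. query_time TYPE('d) g (p n))"
proof -
  interpret growth p "CARD('d)" \<alpha> by fact
  have "costs p \<alpha> e" if "e \<in> set (par_exps CARD('d) g \<beta>)" for e \<beta>
    using costs_mono[OF costs_par_exps[OF that]] \<alpha> by simp
  then show ?thesis
    unfolding query_time_def using \<alpha> costs_query_com
    by (intro grows_add grows_tpars) (simp_all add: costs_com_def)
qed

lemma grows_build_time:
  assumes "growth p CARD('d::{finite,linorder}) \<alpha>"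
  shows "grows (real CARD('d)) (\<lambda>n. build_time TYPE('d) g (p n))"
proof -
  interpret growth p "CARD('d)" \<alpha> by fact
  have "1 \<le> real CARD('d)" by (simp add: Suc_leI)
  then have le: "\<alpha> / 2 \<le> real CARD('d)" "0 \<le> real CARD('d)" using \<alpha> by linarith+
  have e: "costs p (real CARD('d)) e" if "e \<in> set (par_exps CARD('d) g 0)" for e
    using costs_mono[OF costs_par_exps[OF that]] by simp
  have "grows (real CARD('d)) (\<lambda>n. 9 * p n 15)"
    by (intro grows_mono[OF grows_mult0[OF p15 grows_const] le(1)]) simp
  then show ?thesis
    unfolding build_time_def texp.simps using costs_build_com
    by (intro grows_add grows_tpars e grows_const le) (simp_all add: costs_com_def mult.commute)
qed

text \<open>It yields n \<le> 2 ^ (d * w), so every n that occurs is \<open>usable\<close>.\<close>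

lemma finite_card_grid: "finite (grid M :: (nat ^ 'd::finite) set) \<and> card (grid M :: (nat ^ 'd) set) \<le> M ^ CARD('d)"
proof -
  have inj: "inj_on vec_nth (grid M :: (nat ^ 'd) set)" by (simp add: inj_on_def vec_nth_inject)
  have sub: "vec_nth ` (grid M :: (nat ^ 'd) set) \<subseteq> PiE UNIV (\<lambda>_. {..<M})"
    by (auto simp: grid_def PiE_def)
  have fin: "finite (PiE (UNIV :: 'd set) (\<lambda>_. {..<M}))" by (intro finite_PiE) simp_all
  have "card (grid M :: (nat ^ 'd) set) = card (vec_nth ` (grid M :: (nat ^ 'd) set))"
    using inj by (simp add: card_image)
  also have "\<dots> \<le> card (PiE (UNIV :: 'd set) (\<lambda>_. {..<M}))" by (rule card_mono[OF fin sub])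
  also have "\<dots> = M ^ CARD('d)" by (simp add: card_PiE)
  finally have "card (grid M :: (nat ^ 'd) set) \<le> M ^ CARD('d)" .
  moreover have "finite (grid M :: (nat ^ 'd) set)"
    using finite_subset[OF sub fin] inj by (rule finite_imageD)
  ultimately show ?thesis by blast
qed

theorem mainTheorem14:
  fixes w :: "nat \<Rightarrow> nat" and \<alpha> \<gamma> :: real
  assumes "polylog w"
    and "0 < \<alpha>" and "\<alpha> < 1"
    and "0 < \<gamma>"
  shows "\<exists>(build :: instr list) (query :: instr list) (c :: nat)
          (t_build :: nat \<Rightarrow> nat) (t_query :: nat \<Rightarrow> nat) (space :: nat \<Rightarrow> nat).
      t_build \<in> soft_O (\<lambda>n. real n ^ CARD('d)) \<and>
      t_query \<in> soft_O (\<lambda>n. real n powr \<alpha>) \<and>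
      space \<in> soft_O (\<lambda>n. real n powr (real CARD('d) - \<alpha> / 4)) \<and>
      (\<forall>n > 0. \<forall>W \<ge> c * (w n + floorlog 2 n).
        \<forall>S :: (nat ^ 'd::{finite,linorder}) set. S \<subseteq> grid (2 ^ w n) \<and> card S = n \<longrightarrow>
          (\<forall>ps. distinct ps \<and> set ps = S \<longrightarrow>
            measure_pmf.prob (run W build (t_build n) (init (enc_input \<alpha> (w n) ps)))
              {f. halted build f \<and>
                  answers_queries W query (t_query n) (w n) S
                    (mem_block (space n + free_words CARD('d) n) f)}
            \<ge> 1 - real n powr (- \<gamma>)))"
proof -
  \<comment> \<open>The failure probability 2 ^ (- g * k1) is at most n ^ (- g), because n \<le> 2 ^
    k1.\<close>
  define g where "g = nat \<lceil>\<gamma>\<rceil>"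
  define \<beta> where "\<beta> = 1 + 2 * (CARD('d) * CARD('d))"
  have d: "1 \<le> CARD('d)" by (simp add: Suc_leI)
  interpret A: scaling "CARD('d)" g 0 w \<alpha>
    by unfold_locales (use assms d polylog_grows in auto)
  interpret B: scaling "CARD('d)" g \<beta> w \<alpha>
    by unfold_locales (use assms d polylog_grows in auto)
  let ?t_build = "\<lambda>n. build_time TYPE('d) g (vals CARD('d) g 0 w \<alpha> n)"
  let ?t_query = "\<lambda>n. query_time TYPE('d) g (vals CARD('d) g \<beta> w \<alpha> n)"
  \<comment> \<open>The construction has its input at address 0, the query program at
    \<open>\<beta>\<close>; the sum of the two factors is sufficient for both.\<close>
  define c where "c = word_factor CARD('d) g 0 + word_factor CARD('d) g \<beta>"
  show ?thesis
  proof (rule exI[of _ "build_prog TYPE('d) g"], rule exI[of _ "query_prog TYPE('d) g"], rule exI[of _ c],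
      rule exI[of _ ?t_build], rule exI[of _ ?t_query], rule exI[of _ A.space], intro conjI allI impI)
    have "?t_build \<in> soft_O (\<lambda>n. real n powr real CARD('d))"
      by (intro grows_soft_O grows_build_time[OF A.vals_grow])
    also have "(\<lambda>n. real n powr real CARD('d)) = (\<lambda>n. real n ^ CARD('d))"
    proof
      show "real n powr real CARD('d) = real n ^ CARD('d)" for n
        using d by (cases "n = 0") (simp_all add: powr_realpow)
    qed
    finally show "?t_build \<in> soft_O (\<lambda>n. real n ^ CARD('d))" .
    show "?t_query \<in> soft_O (\<lambda>n. real n powr \<alpha>)"
      by (intro grows_soft_O grows_query_time[OF B.vals_grow])
    show "A.space \<in> soft_O (\<lambda>n. real n powr (real CARD('d) - \<alpha> / 4))"
      by (intro grows_soft_O A.grows_space)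
    fix n W :: nat and S :: "(nat, 'd) vec set" and ps
    assume n: "0 < n" and W: "c * (w n + floorlog 2 n) \<le> W"
      and S: "S \<subseteq> grid (2 ^ w n) \<and> card S = n" and ps: "distinct ps \<and> set ps = S"
    have "card S \<le> card (grid (2 ^ w n) :: (nat, 'd) vec set)"
      using S finite_card_grid by (intro card_mono) auto
    also have "\<dots> \<le> (2 ^ w n) ^ CARD('d)" using finite_card_grid by blast
    finally have "n \<le> 2 ^ (CARD('d) * w n)" using S by (simp add: power_mult[symmetric] mult.commute)
    then have use: "usable CARD('d) w n" using n by (simp add: usable_def)
    let ?u = "nat \<lfloor>real n powr \<alpha>\<rfloor>"
    have sizes: "sizes CARD('d) n (w n) ?u" by (rule A.sizes[OF use])
    have len: "length ps = n" using S ps distinct_card[of ps] by simp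
    have crd: "ps ! i $ a < 2 ^ w n" if "i < n" for i a
      using S ps len that nth_mem[of i ps] by (auto simp: grid_def)
    have "sizes.word_bound CARD('d) g n (w n) ?u \<beta>' \<le> W" if "word_factor CARD('d) g \<beta>' \<le> c" for \<beta>'
      using sizes.word_bound_le[OF sizes, of g \<beta>'] mult_le_mono1[OF that, of "w n + floorlog 2 n"] W
      by linarith
    then have points: "points CARD('d) g n (w n) ?u \<beta>' ps W" if "word_factor CARD('d) g \<beta>' \<le> c" for \<beta>'
      using that len crd by (intro points.intro sizes points_axioms.intro) simp_all
    have P: "points CARD('d) g n (w n) ?u 0 ps W" "points CARD('d) g n (w n) ?u \<beta> ps W"
      by (rule points, simp add: c_def)+
    interpret P: points "CARD('d)" g n "w n" ?u 0 ps W by (rule P)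
    have vals: "vals CARD('d) g \<beta>' w \<alpha> n = sizes.pv CARD('d) g n (w n) ?u \<beta>'" for \<beta>'
      using use by (simp add: vals_def fun_eq_iff)
    have "1 - real n powr (- \<gamma>) \<le> 1 - (1 / 2) ^ (g * P.k1)"
    proof -
      have "\<gamma> \<le> real g" unfolding g_def by linarith
      have "(1 / 2 :: real) ^ (g * P.k1) = inverse (2 ^ P.k1) ^ g"
        by (simp add: power_mult[symmetric] power_one_over inverse_eq_divide power_divide mult.commute)
      also have "\<dots> \<le> inverse (real n) ^ g"
      proof (intro power_mono le_imp_inverse_le)
        have "n \<le> 2 ^ P.k1" using P.k1_facts(1) by linarith
        then have "real n \<le> real (2 ^ P.k1)" by (rule of_nat_mono)
        then show "real n \<le> 2 ^ P.k1" by simp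
      qed (use n in simp_all)
      also have "\<dots> = real n powr (- real g)"
        using n by (simp add: powr_minus powr_realpow power_inverse)
      also have "\<dots> \<le> real n powr (- \<gamma>)" using n \<open>\<gamma> \<le> real g\<close> by (intro powr_mono) simp_all
      finally show ?thesis by simp
    qed
    also have "\<dots> \<le> measure_pmf.prob (run W (build_prog TYPE('d) g) (?t_build n) (init (enc_input \<alpha> (w n) ps)))
              {f. halted (build_prog TYPE('d) g) f \<and>
                  answers_queries W (query_prog TYPE('d) g) (?t_query n) (w n) (set ps) (mem_block P.P3 f)}"
      by (rule construction[OF refl P(1) P(2)[unfolded \<beta>_def]])
        (use ps in \<open>simp_all add: vals \<beta>_def\<close>)
    finally show "1 - real n powr (- \<gamma>) \<le>
        measure_pmf.prob (run W (build_prog TYPE('d) g) (?t_build n) (init (enc_input \<alpha> (w n) ps)))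
              {f. halted (build_prog TYPE('d) g) f \<and>
                  answers_queries W (query_prog TYPE('d) g) (?t_query n) (w n) S
                    (mem_block (A.space n + free_words CARD('d) n) f)}"
      unfolding A.space_free[OF use] using ps by simp
  qed
qed

end
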